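(* Let $\alpha\in(1,2)$, $T>0$, $u_0\in H^1_0(\Omega)$ and $u_1\in H^{-1}(\Omega)$. Then the function $$u(t,x)=\sum_{n=1}^\infty\big[\langle u_0,e_n\rangle E_{\alpha}(-\lambda_nt^\alpha)+\langle u_1,e_n\rangle_{H^{-1}}\, t\, E_{\alpha,2}(-\lambda_nt^\alpha)\big]e_n(x)$$ is the $H^1$-solution of $$\partial_t^{\alpha}u+\Delta^2 u=0\ \text{ in }(0,T)\times\Omega,\qquad u=\Delta u=0\ \text{ on }(0,T)\times\partial\Omega,$$ satisfying the initial conditions $u(0,\cdot)=u_0$, $u_t(0,\cdot)=u_1$.
   Context: Domain and operator. $\Omega\subset\mathbb{R}^N$, $N\ge1$, is a bounded open set with sufficiently smooth boundary $\partial\Omega$; $\langle\cdot,\cdot\rangle$ is the inner product of $L^2(\Omega)$. $A$ is the positive self-adjoint operator in $L^2(\Omega)$ with $Au=\Delta^2u$ and $D(A)=H^4(\Omega)\cap\{u\in H^3(\Omega): u=\Delta u=0 \text{ on }\partial\Omega\}$. Its eigenvalues $\lambda_n$ form a sequence tending to $+\infty$ and are assumed all distinct, with one-dimensional eigenspaces; $e_n$ are eigenfunctions, $Ae_n=\lambda_ne_n$, forming an orthonormal basis of $L^2(\Omega)$. Fractional powers. For $\theta>0$, $D(A^\theta)=\{u\in L^2(\Omega):\sum_n\lambda_n^{2\theta}|\langle u,e_n\rangle|^2<\infty\}$, $A^\theta u=\sum_n\lambda_n^\theta\langle u,e_n\rangle e_n$, $\|u\|_{D(A^\theta)}=\|A^\theta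 u\|_{L^2(\Omega)}$; $D(A^{-\theta})$ is the dual of $D(A^\theta)$ ($L^2(\Omega)$ being identified with its dual), with duality pairing $\langle\cdot,\cdot\rangle_{-\theta,\theta}$, and $A^{-\theta}u=\sum_n\lambda_n^{-\theta}\langle u,e_n\rangle_{-\theta,\theta}e_n$. In particular $D(A^{1/2})=H^2(\Omega)\cap H^1_0(\Omega)$, $D(A^{1/4})=H^1_0(\Omega)$, $D(A^{-1/4})=H^{-1}(\Omega)$, $D(A^{3/4})=\{u\in H^3(\Omega):u=\Delta u=0\text{ on }\partial\Omega\}$ (with norm $\|\nabla\Delta u\|_{L^2(\Omega)}$), and $A^{1/2}=-\Delta$ with Dirichlet boundary condition, so $(-\Delta)^{-1}=A^{-1/2}$. The symbol $\langle u_1,e_n\rangle_{H^{-1}}$ denotes the duality pairing $\langle u_1,e_n\rangle_{-\frac14,\frac14}$ between $H^{-1}(\Omega)$ and $H^1_0(\Omega)$. Fractional calculus. For $\beta>0$, $I^\beta f(t)=\frac1{\Gamma(\beta)}\int_0^t(t-\tau)^{\beta-1}f(\tau)\,d\tau$. The Caputo derivative of order $\alpha\in(1,2)$ is $\partial_t^\alpha f=I^{2-\alpha}(f'')$, which equals $\frac{d}{dt}I^{2-\alpha}(f'-f'(0))$ when $f'$ is absolutely continuous. Mittag-Leffler functions: $E_{\alpha,\beta}(z)=\sum_{k\ge0}\frac{z^k}{\Gamma(\alpha k+\beta)}$, $E_\alpha=E_{\alpha,1}$. $H^1$-solution. A function $u\in C([0,T];H^1_0(\Omega))$ is an $H^1$-solution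 of the boundary value problem if, setting $w=(-\Delta)^{-1}u=A^{-1/2}u$, one has $w\in C([0,T];D(A^{3/4}))$, $w_t\in L^2(0,T;H^1(\Omega))\cap C([0,T];H^{-1}(\Omega))$, $\partial_t^\alpha w\in L^2(0,T;L^2(\Omega))$ and $$\int_\Omega\partial_t^\alpha w(t,x)v(x)\,dx-\int_\Omega\nabla\Delta w(t,x)\cdot\nabla v(x)\,dx=0\qquad \forall v\in H^1_0(\Omega),\ t\in(0,T).$$ *)

theory Defs
  imports "HOL-Analysis.Analysis"
begin

section \<open>Classical smoothness\<close>

definition pderiv_dir :: "'a::euclidean_space \<Rightarrow> ('a \<Rightarrow> real) \<Rightarrow> 'a \<Rightarrow> real" where
  "pderiv_dir b f x = frechet_derivative f (at x) b"

primrec C_k :: "nat \<Rightarrow> 'a::euclidean_space set \<Rightarrow> ('a \<Rightarrow> real) \<Rightarrow> bool" where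
  "C_k 0 U f \<longleftrightarrow> continuous_on U f"
| "C_k (Suc k) U f \<longleftrightarrow>
     (\<forall>x\<in>U. f differentiable (at x)) \<and> (\<forall>b\<in>Basis. C_k k U (pderiv_dir b f))"

text \<open>Boundary of class \<open>C\<^sup>k\<close>, by local defining functions; the set lies locally on one side
  of its boundary.\<close>

definition C_k_boundary :: "nat \<Rightarrow> 'a::euclidean_space set \<Rightarrow> bool" where
  "C_k_boundary k \<Omega> \<longleftrightarrow>
     (\<forall>p\<in>frontier \<Omega>. \<exists>U \<phi>. open U \<and> p \<in> U \<and> C_k k U \<phi> \<and>
        (\<forall>x\<in>U. \<exists>b\<in>Basis. pderiv_dir b \<phi> x \<noteq> 0) \<and> \<Omega> \<inter> U = {x\<in>U. \<phi> x < 0})"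

definition test_functions :: "'a::euclidean_space set \<Rightarrow> ('a \<Rightarrow> real) set" where
  "test_functions \<Omega> = {\<phi>. (\<forall>k. C_k k UNIV \<phi>) \<and>
     compact (closure {x. \<phi> x \<noteq> 0}) \<and> closure {x. \<phi> x \<noteq> 0} \<subseteq> \<Omega>}"


section \<open>Lebesgue and Sobolev spaces\<close>

text \<open>Elements of function spaces over \<open>\<Omega>\<close> are represented by functions on the whole type; only
  their values almost everywhere on \<open>\<Omega>\<close> matter, and equality is \<open>eq_ae\<close>.\<close>

definition eq_ae :: "'a::euclidean_space set \<Rightarrow> ('a \<Rightarrow> real) \<Rightarrow> ('a \<Rightarrow> real) \<Rightarrow> bool" where
  "eq_ae \<Omega> f g \<longleftrightarrow> (AE x in lebesgue_on \<Omega>. f x = g x)"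

definition L2 :: "'a::euclidean_space set \<Rightarrow> ('a \<Rightarrow> real) set" where
  "L2 \<Omega> = {f. f \<in> borel_measurable (lebesgue_on \<Omega>) \<and> integrable (lebesgue_on \<Omega>) (\<lambda>x. (f x)\<^sup>2)}"

definition L2_inner :: "'a::euclidean_space set \<Rightarrow> ('a \<Rightarrow> real) \<Rightarrow> ('a \<Rightarrow> real) \<Rightarrow> real" where
  "L2_inner \<Omega> f g = (LINT x|lebesgue_on \<Omega>. f x * g x)"

definition L2_norm :: "'a::euclidean_space set \<Rightarrow> ('a \<Rightarrow> real) \<Rightarrow> real" where
  "L2_norm \<Omega> f = sqrt (L2_inner \<Omega> f f)"

definition L2_sums :: "'a::euclidean_space set \<Rightarrow> (nat \<Rightarrow> 'a \<Rightarrow> real) \<Rightarrow> ('a \<Rightarrow> real) \<Rightarrow> bool" where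
  "L2_sums \<Omega> f s \<longleftrightarrow> s \<in> L2 \<Omega> \<and> (\<forall>n. f n \<in> L2 \<Omega>) \<and>
     (\<lambda>N. L2_norm \<Omega> (\<lambda>x. (\<Sum>n<N. f n x) - s x)) \<longlonglongrightarrow> 0"

definition has_weak_pderiv ::
  "'a::euclidean_space set \<Rightarrow> 'a \<Rightarrow> ('a \<Rightarrow> real) \<Rightarrow> ('a \<Rightarrow> real) \<Rightarrow> bool" where
  "has_weak_pderiv \<Omega> b u g \<longleftrightarrow>
     (\<forall>\<phi>\<in>test_functions \<Omega>. L2_inner \<Omega> u (pderiv_dir b \<phi>) = - L2_inner \<Omega> g \<phi>)"

text \<open>Weak derivatives are unique almost everywhere on \<open>\<Omega>\<close>, so the choices below only pick
  representatives.\<close>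

definition weak_pderiv :: "'a::euclidean_space set \<Rightarrow> 'a \<Rightarrow> ('a \<Rightarrow> real) \<Rightarrow> 'a \<Rightarrow> real" where
  "weak_pderiv \<Omega> b u = (SOME g. g \<in> L2 \<Omega> \<and> has_weak_pderiv \<Omega> b u g)"

definition has_weak_laplacian ::
  "'a::euclidean_space set \<Rightarrow> ('a \<Rightarrow> real) \<Rightarrow> ('a \<Rightarrow> real) \<Rightarrow> bool" where
  "has_weak_laplacian \<Omega> u f \<longleftrightarrow>
     (\<forall>\<phi>\<in>test_functions \<Omega>.
        L2_inner \<Omega> u (\<lambda>x. \<Sum>b\<in>Basis. pderiv_dir b (pderiv_dir b \<phi>) x) = L2_inner \<Omega> f \<phi>)"

definition laplacian :: "'a::euclidean_space set \<Rightarrow> ('a \<Rightarrow> real) \<Rightarrow> 'a \<Rightarrow> real" where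
  "laplacian \<Omega> u = (SOME f. f \<in> L2 \<Omega> \<and> has_weak_laplacian \<Omega> u f)"

primrec sobolev :: "nat \<Rightarrow> 'a::euclidean_space set \<Rightarrow> ('a \<Rightarrow> real) set" where
  "sobolev 0 \<Omega> = L2 \<Omega>"
| "sobolev (Suc k) \<Omega> =
     {u \<in> L2 \<Omega>. \<forall>b\<in>Basis. \<exists>g\<in>sobolev k \<Omega>. has_weak_pderiv \<Omega> b u g}"

definition grad_inner :: "'a::euclidean_space set \<Rightarrow> ('a \<Rightarrow> real) \<Rightarrow> ('a \<Rightarrow> real) \<Rightarrow> real" where
  "grad_inner \<Omega> u v =
     (LINT x|lebesgue_on \<Omega>. (\<Sum>b\<in>Basis. weak_pderiv \<Omega> b u x * weak_pderiv \<Omega> b v x))"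

definition H1_norm :: "'a::euclidean_space set \<Rightarrow> ('a \<Rightarrow> real) \<Rightarrow> real" where
  "H1_norm \<Omega> u = sqrt (L2_inner \<Omega> u u + grad_inner \<Omega> u u)"

text \<open>\<open>H\<^sup>1\<^sub>0(\<Omega>)\<close> is the closure of the test functions in \<open>H\<^sup>1(\<Omega>)\<close>.
  Vanishing of an \<open>H\<^sup>1\<close>-function on \<open>\<partial>\<Omega>\<close> always means membership in this space.\<close>

definition H10 :: "'a::euclidean_space set \<Rightarrow> ('a \<Rightarrow> real) set" where
  "H10 \<Omega> = {u \<in> sobolev 1 \<Omega>.
     \<forall>\<epsilon>>0. \<exists>\<phi>\<in>test_functions \<Omega>. H1_norm \<Omega> (\<lambda>x. u x - \<phi> x) < \<epsilon>}"


section \<open>Dual spaces\<close>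

text \<open>The dual of a space \<open>Y\<close> of functions normed by \<open>N\<close>. Functionals are total functions of which
  only the values on \<open>Y\<close> matter.\<close>

definition dual :: "('a \<Rightarrow> real) set \<Rightarrow> (('a \<Rightarrow> real) \<Rightarrow> real) \<Rightarrow> (('a \<Rightarrow> real) \<Rightarrow> real) set" where
  "dual Y N = {L.
     (\<forall>f\<in>Y. \<forall>g\<in>Y. L (\<lambda>x. f x + g x) = L f + L g) \<and>
     (\<forall>f\<in>Y. \<forall>c. L (\<lambda>x. c * f x) = c * L f) \<and>
     (\<exists>C. \<forall>f\<in>Y. \<bar>L f\<bar> \<le> C * N f)}"

definition dual_norm ::
  "('a \<Rightarrow> real) set \<Rightarrow> (('a \<Rightarrow> real) \<Rightarrow> real) \<Rightarrow> (('a \<Rightarrow> real) \<Rightarrow> real) \<Rightarrow> real" where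
  "dual_norm Y N L = (SUP f\<in>{f\<in>Y. N f \<le> 1}. \<bar>L f\<bar>)"

definition Hm1 :: "'a::euclidean_space set \<Rightarrow> (('a \<Rightarrow> real) \<Rightarrow> real) set" where
  "Hm1 \<Omega> = dual (H10 \<Omega>) (H1_norm \<Omega>)"

definition Hm1_norm :: "'a::euclidean_space set \<Rightarrow> (('a \<Rightarrow> real) \<Rightarrow> real) \<Rightarrow> real" where
  "Hm1_norm \<Omega> = dual_norm (H10 \<Omega>) (H1_norm \<Omega>)"

text \<open>The identification of \<open>L\<^sup>2(\<Omega>)\<close> with its dual embeds a function \<open>f\<close> of \<open>L\<^sup>2(\<Omega>)\<close> into the
  dual spaces as the functional \<open>L2_inner \<Omega> f\<close>.\<close>


section \<open>The operator and its fractional powers\<close>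

definition bilaplacian :: "'a::euclidean_space set \<Rightarrow> ('a \<Rightarrow> real) \<Rightarrow> 'a \<Rightarrow> real" where
  "bilaplacian \<Omega> u = laplacian \<Omega> (laplacian \<Omega> u)"

definition dom_A :: "'a::euclidean_space set \<Rightarrow> ('a \<Rightarrow> real) set" where
  "dom_A \<Omega> = sobolev 4 \<Omega> \<inter> {u \<in> sobolev 3 \<Omega>. u \<in> H10 \<Omega> \<and> laplacian \<Omega> u \<in> H10 \<Omega>}"

definition positive_selfadjoint ::
  "'a::euclidean_space set \<Rightarrow> ('a \<Rightarrow> real) set \<Rightarrow> (('a \<Rightarrow> real) \<Rightarrow> 'a \<Rightarrow> real) \<Rightarrow> bool" where
  "positive_selfadjoint \<Omega> D A \<longleftrightarrow>
     D \<subseteq> L2 \<Omega> \<and> (\<forall>u\<in>D. A u \<in> L2 \<Omega>) \<and>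
     (\<forall>f\<in>L2 \<Omega>. \<forall>\<epsilon>>0. \<exists>u\<in>D. L2_norm \<Omega> (\<lambda>x. f x - u x) < \<epsilon>) \<and>
     (\<forall>u\<in>D. \<forall>v\<in>D. L2_inner \<Omega> (A u) v = L2_inner \<Omega> u (A v)) \<and>
     (\<forall>v\<in>L2 \<Omega>. \<forall>h\<in>L2 \<Omega>. (\<forall>u\<in>D. L2_inner \<Omega> (A u) v = L2_inner \<Omega> u h) \<longrightarrow>
        v \<in> D \<and> eq_ae \<Omega> (A v) h) \<and>
     (\<forall>u\<in>D. \<not> eq_ae \<Omega> u (\<lambda>_. 0) \<longrightarrow> L2_inner \<Omega> (A u) u > 0)"

text \<open>\<open>lam\<close> lists all eigenvalues of \<open>A\<close>, pairwise distinct, tending to infinity and with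
  one-dimensional eigenspaces, and the \<open>e n\<close> are corresponding eigenfunctions forming an
  orthonormal basis. Indices start at 0.\<close>

definition eigensystem ::
  "'a::euclidean_space set \<Rightarrow> ('a \<Rightarrow> real) set \<Rightarrow> (('a \<Rightarrow> real) \<Rightarrow> 'a \<Rightarrow> real) \<Rightarrow>
    (nat \<Rightarrow> real) \<Rightarrow> (nat \<Rightarrow> 'a \<Rightarrow> real) \<Rightarrow> bool" where
  "eigensystem \<Omega> D A lam e \<longleftrightarrow>
     (\<forall>n. e n \<in> D \<and> eq_ae \<Omega> (A (e n)) (\<lambda>x. lam n * e n x)) \<and>
     inj lam \<and> filterlim lam at_top sequentially \<and>
     (\<forall>\<mu>. \<forall>f\<in>D. eq_ae \<Omega> (A f) (\<lambda>x. \<mu> * f x) \<and> \<not> eq_ae \<Omega> f (\<lambda>_. 0) \<longrightarrow>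
        (\<exists>n c. \<mu> = lam n \<and> eq_ae \<Omega> f (\<lambda>x. c * e n x))) \<and>
     (\<forall>m n. L2_inner \<Omega> (e m) (e n) = (if m = n then 1 else 0)) \<and>
     (\<forall>f\<in>L2 \<Omega>. L2_sums \<Omega> (\<lambda>n x. L2_inner \<Omega> f (e n) * e n x) f)"

text \<open>\<open>D(A\<^sup>\<theta>)\<close> for positive \<open>\<theta>\<close>.\<close>

definition dom_frac ::
  "'a::euclidean_space set \<Rightarrow> (nat \<Rightarrow> real) \<Rightarrow> (nat \<Rightarrow> 'a \<Rightarrow> real) \<Rightarrow> real \<Rightarrow> ('a \<Rightarrow> real) set" where
  "dom_frac \<Omega> lam e \<theta> =
     {u \<in> L2 \<Omega>. summable (\<lambda>n. lam n powr (2 * \<theta>) * (L2_inner \<Omega> u (e n))\<^sup>2)}"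

text \<open>\<open>A\<^sup>\<theta> u\<close> for positive \<open>\<theta>\<close> and \<open>u \<in> D(A\<^sup>\<theta>)\<close>, or for negative \<open>\<theta>\<close> and \<open>u \<in> L\<^sup>2(\<Omega>)\<close>.\<close>

definition frac_power ::
  "'a::euclidean_space set \<Rightarrow> (nat \<Rightarrow> real) \<Rightarrow> (nat \<Rightarrow> 'a \<Rightarrow> real) \<Rightarrow> real \<Rightarrow> ('a \<Rightarrow> real) \<Rightarrow>
    'a \<Rightarrow> real" where
  "frac_power \<Omega> lam e \<theta> u =
     (SOME v. L2_sums \<Omega> (\<lambda>n x. lam n powr \<theta> * L2_inner \<Omega> u (e n) * e n x) v)"

definition frac_norm ::
  "'a::euclidean_space set \<Rightarrow> (nat \<Rightarrow> real) \<Rightarrow> (nat \<Rightarrow> 'a \<Rightarrow> real) \<Rightarrow> real \<Rightarrow> ('a \<Rightarrow> real) \<Rightarrow> real" where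
  "frac_norm \<Omega> lam e \<theta> u = L2_norm \<Omega> (frac_power \<Omega> lam e \<theta> u)"


section \<open>Functions of time with values in a normed space\<close>

text \<open>The space is given by its carrier \<open>X\<close>, consisting of real-valued functions or functionals,
  and its norm \<open>N\<close>.\<close>

definition cont_into ::
  "real set \<Rightarrow> ('b \<Rightarrow> real) set \<Rightarrow> (('b \<Rightarrow> real) \<Rightarrow> real) \<Rightarrow> (real \<Rightarrow> 'b \<Rightarrow> real) \<Rightarrow> bool" where
  "cont_into I X N f \<longleftrightarrow>
     (\<forall>t\<in>I. f t \<in> X \<and> ((\<lambda>s. N (\<lambda>x. f s x - f t x)) \<longlongrightarrow> 0) (at t within I))"

definition has_time_deriv ::
  "(('b \<Rightarrow> real) \<Rightarrow> real) \<Rightarrow> (real \<Rightarrow> 'b \<Rightarrow> real) \<Rightarrow> ('b \<Rightarrow> real) \<Rightarrow> real \<Rightarrow> real set \<Rightarrow> bool" where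
  "has_time_deriv N f f' t I \<longleftrightarrow>
     ((\<lambda>s. N (\<lambda>x. (f s x - f t x) / (s - t) - f' x)) \<longlongrightarrow> 0) (at t within I)"

text \<open>Strong (Bochner) measurability: almost everywhere limits of simple functions.\<close>

definition strongly_measurable ::
  "real set \<Rightarrow> ('b \<Rightarrow> real) set \<Rightarrow> (('b \<Rightarrow> real) \<Rightarrow> real) \<Rightarrow> (real \<Rightarrow> 'b \<Rightarrow> real) \<Rightarrow> bool" where
  "strongly_measurable I X N f \<longleftrightarrow>
     (AE t in lebesgue_on I. f t \<in> X) \<and>
     (\<exists>s::nat \<Rightarrow> real \<Rightarrow> 'b \<Rightarrow> real.
        (\<forall>k. finite (s k ` I) \<and> s k ` I \<subseteq> X \<and> (\<forall>y. {t\<in>I. s k t = y} \<in> sets lebesgue)) \<and>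
        (AE t in lebesgue_on I. (\<lambda>k. N (\<lambda>x. s k t x - f t x)) \<longlonglongrightarrow> 0))"

definition bochner_integrable ::
  "real set \<Rightarrow> ('b \<Rightarrow> real) set \<Rightarrow> (('b \<Rightarrow> real) \<Rightarrow> real) \<Rightarrow> (real \<Rightarrow> 'b \<Rightarrow> real) \<Rightarrow> bool" where
  "bochner_integrable I X N f \<longleftrightarrow>
     strongly_measurable I X N f \<and> integrable (lebesgue_on I) (\<lambda>t. N (f t))"

definition L2_into ::
  "real set \<Rightarrow> ('b \<Rightarrow> real) set \<Rightarrow> (('b \<Rightarrow> real) \<Rightarrow> real) \<Rightarrow> (real \<Rightarrow> 'b \<Rightarrow> real) \<Rightarrow> bool" where
  "L2_into I X N f \<longleftrightarrow>
     strongly_measurable I X N f \<and> integrable (lebesgue_on I) (\<lambda>t. (N (f t))\<^sup>2)"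


section \<open>Fractional calculus\<close>

definition frac_integral :: "real \<Rightarrow> (real \<Rightarrow> real) \<Rightarrow> real \<Rightarrow> real" where
  "frac_integral \<beta> f t =
     1 / Gamma \<beta> * (LINT \<tau>|lebesgue_on {0<..<t}. (t - \<tau>) powr (\<beta> - 1) * f \<tau>)"

text \<open>\<open>g\<close> is the Caputo derivative \<open>I\<^bsup>2 - \<alpha>\<^esup> f''\<close> on \<open>{0<..<T}\<close> of \<open>f\<close>, taking values in the dual of the
  space \<open>Y\<close> with norm \<open>N\<close>, where \<open>1 < \<alpha> < 2\<close>. Here \<open>f'\<close> is absolutely continuous with
  density \<open>f''\<close>. The Bochner integral of an integrable function with values in a dual space is the
  functional obtained by integrating the values at each \<open>v \<in> Y\<close>.\<close>

definition has_caputo_deriv ::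
  "('a \<Rightarrow> real) set \<Rightarrow> (('a \<Rightarrow> real) \<Rightarrow> real) \<Rightarrow> real \<Rightarrow> real \<Rightarrow>
    (real \<Rightarrow> ('a \<Rightarrow> real) \<Rightarrow> real) \<Rightarrow> (real \<Rightarrow> ('a \<Rightarrow> real) \<Rightarrow> real) \<Rightarrow> bool" where
  "has_caputo_deriv Y N T \<alpha> f g \<longleftrightarrow>
     (\<forall>t\<in>{0..T}. f t \<in> dual Y N) \<and>
     (\<exists>f' f''.
        (\<forall>t\<in>{0..T}. f' t \<in> dual Y N \<and> has_time_deriv (dual_norm Y N) f (f' t) t {0..T}) \<and>
        bochner_integrable {0..T} (dual Y N) (dual_norm Y N) f'' \<and>
        (\<forall>t\<in>{0..T}. \<forall>v\<in>Y. f' t v = f' 0 v + (LINT \<tau>|lebesgue_on {0..t}. f'' \<tau> v)) \<and>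
        (\<forall>t\<in>{0<..<T}.
           bochner_integrable {0<..<t} (dual Y N) (dual_norm Y N)
             (\<lambda>\<tau> v. (t - \<tau>) powr (1 - \<alpha>) * f'' \<tau> v) \<and>
           (\<forall>v\<in>Y. g t v = frac_integral (2 - \<alpha>) (\<lambda>\<tau>. f'' \<tau> v) t)))"

definition mittag_leffler :: "real \<Rightarrow> real \<Rightarrow> real \<Rightarrow> real" where
  "mittag_leffler \<alpha> \<beta> z = (\<Sum>k. z ^ k / Gamma (\<alpha> * real k + \<beta>))"


section \<open>Solutions\<close>

text \<open>\<open>w_t\<close> is the derivative of \<open>w\<close> in \<open>H\<^sup>-\<^sup>1(\<Omega>)\<close>; that it belongs to \<open>L\<^sup>2(0,T;H\<^sup>1(\<Omega>))\<close> means that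
  it is represented by the function \<open>p t\<close> for almost every \<open>t\<close>. The Caputo derivative of \<open>w\<close> is
  taken in \<open>H\<^sup>-\<^sup>1(\<Omega>)\<close> and is represented by \<open>g t\<close>.\<close>

definition H1_solution ::
  "'a::euclidean_space set \<Rightarrow> (nat \<Rightarrow> real) \<Rightarrow> (nat \<Rightarrow> 'a \<Rightarrow> real) \<Rightarrow> real \<Rightarrow> real \<Rightarrow>
    (real \<Rightarrow> 'a \<Rightarrow> real) \<Rightarrow> bool" where
  "H1_solution \<Omega> lam e \<alpha> T u \<longleftrightarrow>
     cont_into {0..T} (H10 \<Omega>) (H1_norm \<Omega>) u \<and>
     (let w = (\<lambda>t. frac_power \<Omega> lam e (-1/2) (u t)) in
        cont_into {0..T} (dom_frac \<Omega> lam e (3/4)) (frac_norm \<Omega> lam e (3/4)) w \<and>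
        (\<exists>w_t.
           (\<forall>t\<in>{0..T}. has_time_deriv (Hm1_norm \<Omega>) (\<lambda>s. L2_inner \<Omega> (w s)) (w_t t) t {0..T}) \<and>
           cont_into {0..T} (Hm1 \<Omega>) (Hm1_norm \<Omega>) w_t \<and>
           (\<exists>p. L2_into {0<..<T} (sobolev 1 \<Omega>) (H1_norm \<Omega>) p \<and>
              (AE t in lebesgue_on {0<..<T}. \<forall>v\<in>H10 \<Omega>. w_t t v = L2_inner \<Omega> (p t) v))) \<and>
        (\<exists>g. has_caputo_deriv (H10 \<Omega>) (H1_norm \<Omega>) T \<alpha>
                (\<lambda>t. L2_inner \<Omega> (w t)) (\<lambda>t. L2_inner \<Omega> (g t)) \<and>
           (\<forall>t\<in>{0<..<T}. g t \<in> L2 \<Omega>) \<and>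
           L2_into {0<..<T} (L2 \<Omega>) (L2_norm \<Omega>) g \<and>
           (\<forall>v\<in>H10 \<Omega>. \<forall>t\<in>{0<..<T}.
              L2_inner \<Omega> (g t) v - grad_inner \<Omega> (laplacian \<Omega> (w t)) v = 0)))"

text \<open>An \<open>H\<^sup>1\<close>-solution \<open>u = A\<^bsup>1/2\<^esup> w\<close> has \<open>w_t\<close> continuous into \<open>H\<^sup>-\<^sup>1(\<Omega>) = D(A\<^bsup>-1/4\<^esup>)\<close>, hence \<open>u_t\<close>
  continuous into \<open>D(A\<^bsup>-3/4\<^esup>)\<close>, the dual of \<open>D(A\<^bsup>3/4\<^esup>)\<close>. The second initial condition is an identity
  in that space; in general \<open>u\<close> is not differentiable at \<open>0\<close> with values in \<open>H\<^sup>-\<^sup>1(\<Omega>)\<close>.\<close>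

definition initial_conditions ::
  "'a::euclidean_space set \<Rightarrow> (nat \<Rightarrow> real) \<Rightarrow> (nat \<Rightarrow> 'a \<Rightarrow> real) \<Rightarrow> real \<Rightarrow>
    ('a \<Rightarrow> real) \<Rightarrow> (('a \<Rightarrow> real) \<Rightarrow> real) \<Rightarrow> (real \<Rightarrow> 'a \<Rightarrow> real) \<Rightarrow> bool" where
  "initial_conditions \<Omega> lam e T u0 u1 u \<longleftrightarrow>
     eq_ae \<Omega> (u 0) u0 \<and>
     has_time_deriv (dual_norm (dom_frac \<Omega> lam e (3/4)) (frac_norm \<Omega> lam e (3/4)))
       (\<lambda>t. L2_inner \<Omega> (u t)) u1 0 {0..T}"

definition solution_series ::
  "'a::euclidean_space set \<Rightarrow> (nat \<Rightarrow> real) \<Rightarrow> (nat \<Rightarrow> 'a \<Rightarrow> real) \<Rightarrow> real \<Rightarrow> real \<Rightarrow>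
    ('a \<Rightarrow> real) \<Rightarrow> (('a \<Rightarrow> real) \<Rightarrow> real) \<Rightarrow> (real \<Rightarrow> 'a \<Rightarrow> real) \<Rightarrow> bool" where
  "solution_series \<Omega> lam e \<alpha> T u0 u1 u \<longleftrightarrow>
     (\<forall>t\<in>{0..T}. L2_sums \<Omega>
        (\<lambda>n x. (L2_inner \<Omega> u0 (e n) * mittag_leffler \<alpha> 1 (- lam n * t powr \<alpha>)
                + u1 (e n) * t * mittag_leffler \<alpha> 2 (- lam n * t powr \<alpha>)) * e n x)
        (u t))"

end

theory Submission
  imports Defs "HOL-Complex_Analysis.Complex_Analysis"
begin

text \<open>The operator \<open>A\<close> is diagonal in the basis \<open>e n\<close>, so the boundary value problem is a family of scalar
problems. With \<open>w = A\<^sup>-\<^sup>1\<^sup>/\<^sup>2 u\<close> and \<open>w\<^sub>n\<close> the \<open>n\<close>-th coefficient of \<open>w\<close>, the equation says that the Caputo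
derivative of \<open>w\<^sub>n\<close> is \<open>- \<lambda>\<^sub>n w\<^sub>n\<close>, and its solutions are combinations of \<open>E\<^sub>\<alpha>(- \<lambda>\<^sub>n t\<^sup>\<alpha>)\<close> and
\<open>t E\<^sub>\<alpha>\<^sub>,\<^sub>2(- \<lambda>\<^sub>n t\<^sup>\<alpha>)\<close>. Three things have to be supplied to make this rigorous.

First, the series must converge in all the spaces that occur. Everything follows from the estimate
\<open>|E\<^sub>\<alpha>\<^sub>,\<^sub>\<beta>(-x)| \<le> C / (1 + x)\<close> (\<open>mittag_leffler_decay\<close>), obtained by summing the series under Hankel's
contour integral for the reciprocal Gamma function (\<open>hankel_rGamma\<close>, \<open>mittag_leffler_contour\<close>). Interpolated, it
gives \<open>\<lambda>\<^sup>\<gamma> |t\<^sup>\<beta>\<^sup>-\<^sup>1 E\<^sub>\<alpha>\<^sub>,\<^sub>\<beta>(- \<lambda> t\<^sup>\<alpha>)| \<le> C t\<^sup>\<beta>\<^sup>-\<^sup>1\<^sup>-\<^sup>\<alpha>\<^sup>\<gamma>\<close> for \<open>0 \<le> \<gamma> \<le> 1\<close>: powers of the eigenvalue are traded for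
singular powers of \<open>t\<close>, which remain integrable because \<open>1 < \<alpha> < 2\<close>.

Second, the function spaces must be read off from coefficients. Applying Green's formula to
\<open>\<Delta>e + \<lambda>\<^sup>1\<^sup>/\<^sup>2e\<close> shows \<open>\<Delta>e = - \<lambda>\<^sup>1\<^sup>/\<^sup>2 e\<close> for an eigenfunction \<open>e\<close> of \<open>A\<close> (\<open>eigenfunction_laplacian\<close>). Hence
\<open>H\<^sup>1\<^sub>0\<close> consists of the \<open>v\<close> with \<open>\<Sum> \<lambda>\<^sub>n\<^sup>1\<^sup>/\<^sup>2 v\<^sub>n\<^sup>2 < \<infinity>\<close>, and its inner products are the corresponding weighted sums
(\<open>H10_spectral\<close>, \<open>grad_inner_spectral\<close>). It and the spaces \<open>L\<^sup>2\<close> and \<open>D(A\<^sup>3\<^sup>/\<^sup>4)\<close> are instances of a single locale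
\<open>hilbert_scale\<close>, whose dual spaces are weighted sequence spaces with reciprocal weights. Continuity,
differentiability and Bochner integrability in time then reduce, by dominated convergence of series, to the same
properties of each coefficient and a summable majorant (locale \<open>coord_space\<close>). All majorants come from one sequence,
\<open>mode_size\<close>, which measures the data. This gives \<open>solution_series_H1_solution\<close> and
\<open>solution_series_initial_conditions\<close>.

Third, uniqueness. Testing two solutions with \<open>e n\<close> shows that the coefficients of \<open>w\<close> solve the same scalar problem
(\<open>solution_modes\<close>). Abel's inversion turns the homogeneous scalar problem into a Volterra equation, whose only solution
is zero by an exponentially weighted maximum estimate (\<open>fractional_ode_zero\<close>).\<close>

section \<open>Integrals along rays\<close>

lemma exp_decay_integral:
  assumes "\<delta> > (0::real)"
  shows "set_integrable lborel {0..} (\<lambda>r. exp (- \<delta> * r))"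
    and "(LBINT r:{0..}. exp (- \<delta> * r)) = 1 / \<delta>"
proof -
  have h: "((\<lambda>r. exp (- \<delta> * r)) has_integral 1 / \<delta>) {0..}"
    using has_integral_exp_minus_to_infinity[of \<delta> 0] assms by simp
  have "(\<lambda>r. exp (- \<delta> * r)) absolutely_integrable_on {0..}"
    by (intro nonnegative_absolutely_integrable_1) (use h in auto)
  then show 1: "set_integrable lborel {0..} (\<lambda>r. exp (- \<delta> * r))"
    unfolding set_integrable_def by (subst (asm) integrable_completion) auto
  from set_borel_integral_eq_integral(2)[OF this] h
  show "(LBINT r:{0..}. exp (- \<delta> * r)) = 1 / \<delta>" by (simp add: integral_unique)
qed

text \<open>The half of Hankel's contour above the real axis is a ray with direction \<open>cis \<theta>\<close> in the left half plane, where \<open>exp\<close>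
decays. All integrands used below are real on the positive axis, so that the other half contributes the complex
conjugate and the imaginary part of the integral over the upper ray carries the whole contour integral.
\<open>half_plane\<close> is the side of the line through \<open>0\<close> with direction \<open>w\<close> on which the rays starting at
positive points lie; it misses the branch cut of complex powers.\<close>

locale ray =
  fixes \<theta> :: real
  assumes theta: "pi / 2 < \<theta>" "\<theta> < pi"
begin

definition w :: complex where "w = cis \<theta>"
definition half_plane :: "complex set" where "half_plane = {z. Im (z * cnj w) < 0}"
definition ray :: "real \<Rightarrow> real \<Rightarrow> complex" where "ray c r = of_real c + of_real r * w"
definition ray_integral :: "(complex \<Rightarrow> complex) \<Rightarrow> real \<Rightarrow> complex" where
  "ray_integral f c = (LBINT r:{0..}. f (ray c r) * w)"
definition \<delta> :: real where "\<delta> = - cos \<theta> / 2"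

lemma cos_neg: "cos \<theta> < 0" and sin_pos: "sin \<theta> > 0" and delta_pos: "\<delta> > 0"
proof -
  show "cos \<theta> < 0" using cos_monotone_0_pi[of "pi/2" \<theta>] theta by simp
  then show "\<delta> > 0" by (simp add: \<delta>_def)
  show "sin \<theta> > 0" by (intro sin_gt_zero) (use theta in auto)
qed

lemma norm_w [simp]: "norm w = 1" by (simp add: w_def)

lemma Re_ray: "Re (ray c r) = c + r * cos \<theta>" and Im_ray: "Im (ray c r) = r * sin \<theta>"
  by (simp_all add: ray_def w_def)

lemma ray_mult_cnj: "Im (ray c r * cnj w) = - c * sin \<theta>"
  by (simp add: ray_def w_def algebra_simps)

lemma ray_in_half_plane: "c > 0 \<Longrightarrow> ray c r \<in> half_plane"
  using sin_pos by (simp add: half_plane_def ray_mult_cnj del: times_complex.sel)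

lemma real_in_half_plane: "c > 0 \<Longrightarrow> of_real c \<in> half_plane"
  using ray_in_half_plane[of c 0] by (simp add: ray_def)

lemma norm_ray_ge: assumes "c > 0" "r \<ge> 0"
  shows "c * sin \<theta> \<le> norm (ray c r)" "r * sin \<theta> \<le> norm (ray c r)"
proof -
  have "\<bar>Im (ray c r * cnj w)\<bar> \<le> norm (ray c r * cnj w)" by (rule abs_Im_le_cmod)
  then show "c * sin \<theta> \<le> norm (ray c r)"
    using assms sin_pos by (simp add: ray_mult_cnj norm_mult abs_mult del: times_complex.sel)
  have "\<bar>Im (ray c r)\<bar> \<le> norm (ray c r)" by (rule abs_Im_le_cmod)
  then show "r * sin \<theta> \<le> norm (ray c r)" using assms sin_pos by (simp add: Im_ray abs_mult)
qed

lemma norm_ray_le: assumes "c > 0" "r \<ge> 0" shows "norm (ray c r) \<le> c + r"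
  using norm_triangle_ineq[of "of_real c" "of_real r * w"] assms by (simp add: ray_def norm_mult)

lemma open_half_plane: "open half_plane" and convex_half_plane: "convex half_plane"
proof -
  have eq: "half_plane = {z. w \<bullet> (\<i> * z) > 0}"
    by (auto simp: half_plane_def inner_complex_def algebra_simps)
  have lin: "bounded_linear (\<lambda>z. Im (z * cnj w))"
    by (intro bounded_linear_compose[OF bounded_linear_Im] bounded_linear_mult_left)
  have "half_plane = (\<lambda>z. Im (z * cnj w)) -` {..<0}" by (auto simp: half_plane_def)
  then show "open half_plane" 
    by (metis continuous_on_eq_continuous_within lin linear_continuous_at open_lessThan open_vimage linear_continuous_on)
  show "convex half_plane" unfolding convex_def half_plane_def
  proof (safe)
    fix x y :: complex and u v :: real
    assume *: "Im (x * cnj w) < 0" "Im (y * cnj w) < 0" "0 \<le> u" "0 \<le> v" "u + v = 1"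
    have "Im ((u *\<^sub>R x + v *\<^sub>R y) * cnj w) = u * Im (x * cnj w) + v * Im (y * cnj w)"
      by (simp add: algebra_simps)
    also have "\<dots> < 0"
    proof (cases "u = 0")
      case True then show ?thesis using * by simp
    next
      case False
      then have "u * Im (x * cnj w) < 0" using * by (simp add: mult_less_0_iff)
      moreover have "v * Im (y * cnj w) \<le> 0" using * by (simp add: mult_le_0_iff)
      ultimately show ?thesis by simp
    qed
    finally show "Im ((u *\<^sub>R x + v *\<^sub>R y) * cnj w) < 0" .
  qed
qed

lemma Arg_half_plane: assumes "z \<in> half_plane" shows "z \<noteq> 0" "\<bar>Arg z\<bar> < \<theta>" "z \<notin> \<real>\<^sub>\<le>\<^sub>0"
proof -
  show z0: "z \<noteq> 0" using assms by (auto simp: half_plane_def)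
  define a where "a = Arg z"
  have a: "-pi < a" "a \<le> pi" using mpi_less_Arg Arg_le_pi by (auto simp: a_def)
  have "z = of_real (norm z) * cis a"
    by (metis a_def rcis_cmod_Arg rcis_def)
  then have "Im (z * cnj w) = Im (of_real (norm z) * (cis a * cnj w))" by (metis mult.assoc)
  also have "\<dots> = norm z * sin (a - \<theta>)"
    by (simp add: w_def sin_diff algebra_simps)
  finally have s: "sin (a - \<theta>) < 0" using assms z0 by (simp add: half_plane_def mult_less_0_iff del: times_complex.sel)
  have "a < \<theta>"
  proof (rule ccontr)
    assume "\<not> a < \<theta>"
    then have "sin (a - \<theta>) \<ge> 0" by (intro sin_ge_zero) (use a theta in auto)
    with s show False by simp
  qed
  moreover have "-\<theta> < a"
  proof (rule ccontr)
    assume "\<not> -\<theta> < a"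
    then have "sin (a - \<theta> + 2 * pi) \<ge> 0" by (intro sin_ge_zero) (use a theta in auto)
    with s show False by simp
  qed
  ultimately show "\<bar>Arg z\<bar> < \<theta>" by (auto simp: a_def)
  then show "z \<notin> \<real>\<^sub>\<le>\<^sub>0"
    using theta z0 Arg_eq_pi by (auto simp: complex_nonpos_Reals_iff complex_eq_iff)
      (smt (verit) Arg_eq_pi)
qed

text \<open>On the ray \<open>exp\<close> decays at the rate \<open>- cos \<theta> = 2 * \<delta>\<close>. Half of it is spent on absorbing the power, which leaves the rate \<open>\<delta>\<close>.\<close>

lemma exp_ray_decay:
  assumes "0 < c1"
  shows "\<exists>C\<ge>0. \<forall>c\<in>{c1..c2}. \<forall>r\<ge>0. norm (exp (ray c r)) * norm (ray c r) powr \<gamma> \<le> C * exp (- \<delta> * r)"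
proof (cases "\<gamma> \<le> 0")
  case True
  show ?thesis
  proof (intro exI[of _ "exp c2 * (c1 * sin \<theta>) powr \<gamma>"] conjI ballI allI impI)
    fix c r :: real assume c: "c \<in> {c1..c2}" and r: "r \<ge> 0"
    have "norm (ray c r) powr \<gamma> \<le> (c1 * sin \<theta>) powr \<gamma>"
    proof (rule powr_mono2')
      show "c1 * sin \<theta> \<le> norm (ray c r)"
        using norm_ray_ge(1)[of c r] c r assms sin_pos
        by (smt (verit, best) atLeastAtMost_iff mult_right_mono)
    qed (use True assms sin_pos in auto)
    moreover have "norm (exp (ray c r)) \<le> exp c2 * exp (- \<delta> * r)"
    proof -
      have "r * cos \<theta> \<le> r * cos \<theta> / 2" using r cos_neg by (simp add: mult_nonneg_nonpos)
      then have "c + r * cos \<theta> \<le> c2 + - \<delta> * r" using c by (simp add: \<delta>_def field_simps)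
      then show ?thesis by (simp add: Re_ray mult_exp_exp)
    qed
    ultimately have "norm (exp (ray c r)) * norm (ray c r) powr \<gamma> \<le> (exp c2 * exp (- \<delta> * r)) * (c1 * sin \<theta>) powr \<gamma>"
      by (intro mult_mono) auto
    then show "norm (exp (ray c r)) * norm (ray c r) powr \<gamma> \<le> exp c2 * (c1 * sin \<theta>) powr \<gamma> * exp (- \<delta> * r)"
      by (simp add: mult_ac)
  qed simp
next
  case False
  \<comment> \<open>A positive power is absorbed by means of \<open>ln y \<le> y - 1\<close> at \<open>y = \<eta> * (c2 + r)\<close>, with \<open>\<eta>\<close> chosen so that \<open>\<gamma> * \<eta> = \<delta>\<close>.\<close>
  define \<eta> where "\<eta> = \<delta> / \<gamma>"
  have \<eta>: "\<eta> > 0" using False delta_pos by (simp add: \<eta>_def)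
  define K where "K = exp (c2 + \<delta> * c2 + \<gamma> * (- 1 - ln \<eta>))"
  show ?thesis
  proof (intro exI[of _ K] conjI ballI allI impI)
    fix c r :: real assume c: "c \<in> {c1..c2}" and r: "r \<ge> 0"
    have pos: "c > 0" using c assms by auto
    have "ln (\<eta> * (c2 + r)) \<le> \<eta> * (c2 + r) - 1"
      by (intro ln_le_minus_one) (use \<eta> c r pos in auto)
    moreover have "ln (\<eta> * (c2 + r)) = ln \<eta> + ln (c2 + r)"
      by (intro ln_mult_pos) (use \<eta> c r pos in auto)
    ultimately have "ln (c2 + r) \<le> \<eta> * (c2 + r) - 1 - ln \<eta>" by simp
    then have "\<gamma> * ln (c2 + r) \<le> \<gamma> * (\<eta> * (c2 + r) - 1 - ln \<eta>)" using False by simp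
    also have "\<dots> = \<delta> * (c2 + r) + \<gamma> * (- 1 - ln \<eta>)" using False by (simp add: \<eta>_def field_simps)
    finally have l: "\<gamma> * ln (c2 + r) \<le> \<delta> * (c2 + r) + \<gamma> * (- 1 - ln \<eta>)" .
    have "norm (ray c r) powr \<gamma> \<le> (c2 + r) powr \<gamma>"
      by (intro powr_mono2) (use False norm_ray_le[OF pos r] c in auto)
    also have "\<dots> = exp (\<gamma> * ln (c2 + r))" using c r pos by (simp add: powr_def)
    also have "\<dots> \<le> exp (\<delta> * (c2 + r) + \<gamma> * (- 1 - ln \<eta>))" using l by simp
    finally have "norm (exp (ray c r)) * norm (ray c r) powr \<gamma> \<le> 
       exp (c + r * cos \<theta>) * exp (\<delta> * (c2 + r) + \<gamma> * (- 1 - ln \<eta>))"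
      by (intro mult_mono) (auto simp: Re_ray)
    also have "\<dots> = exp (c + r * cos \<theta> + (\<delta> * (c2 + r) + \<gamma> * (- 1 - ln \<eta>)))" by (simp add: exp_add)
    also have "\<dots> \<le> exp (c2 + \<delta> * c2 + \<gamma> * (- 1 - ln \<eta>) + - \<delta> * r)"
      using c by (simp add: \<delta>_def field_simps)
    also have "\<dots> = K * exp (- \<delta> * r)" by (simp add: K_def flip: exp_add)
    finally show "norm (exp (ray c r)) * norm (ray c r) powr \<gamma> \<le> K * exp (- \<delta> * r)" .
  qed (simp add: K_def)
qed

lemma continuous_ray: "continuous_on S (ray c)"
  unfolding ray_def by (intro continuous_intros)

lemma ray_continuous_comp:
  assumes "f holomorphic_on half_plane" "c > 0"
  shows "continuous_on S (\<lambda>r. f (ray c r) * w)"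
proof -
  have "continuous_on S (f \<circ> ray c)"
    by (rule continuous_on_compose[OF continuous_ray])
       (use holomorphic_on_imp_continuous_on[OF assms(1)] ray_in_half_plane[OF assms(2)] in \<open>auto intro: continuous_on_subset\<close>)
  then show ?thesis by (auto intro!: continuous_intros simp: o_def)
qed

lemma ray_integral_integrable:
  assumes "f holomorphic_on half_plane" "c > 0" 
    and "\<And>r. r \<ge> 0 \<Longrightarrow> norm (f (ray c r)) \<le> C * exp (- \<delta> * r)"
  shows "set_integrable lborel {0..} (\<lambda>r. f (ray c r) * w)" and "norm (ray_integral f c) \<le> C / \<delta>"
proof -
  have i: "set_integrable lborel {0..} (\<lambda>r. C * exp (- \<delta> * r))"
    using exp_decay_integral(1)[OF delta_pos] by (rule set_integrable_mult_right)
  show 1: "set_integrable lborel {0..} (\<lambda>r. f (ray c r) * w)"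
  proof (rule set_integrable_bound[OF i])
    show "set_borel_measurable lborel {0..} (\<lambda>r. f (ray c r) * w)"
      unfolding set_borel_measurable_def using ray_continuous_comp[OF assms(1,2)]
      by (simp add: borel_measurable_continuous_on_indicator)
    show "AE x in lborel. x \<in> {0..} \<longrightarrow> norm (f (ray c x) * w) \<le> norm (C * exp (- \<delta> * x))"
      using assms(3) by (auto simp: norm_mult intro!: AE_I2 order_trans[OF assms(3)])
  qed
  have "norm (ray_integral f c) \<le> (LBINT r:{0..}. norm (f (ray c r) * w))"
    unfolding ray_integral_def by (rule set_integral_norm_bound[OF 1])
  also have "\<dots> \<le> (LBINT r:{0..}. C * exp (- \<delta> * r))"
    by (rule set_integral_mono) (use set_integrable_norm[OF 1] i assms(3) in \<open>auto simp: norm_mult\<close>)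
  also have "\<dots> = C / \<delta>" using exp_decay_integral(2)[OF delta_pos] by simp
  finally show "norm (ray_integral f c) \<le> C / \<delta>" .
qed

text \<open>With a primitive \<open>F\<close> of \<open>f\<close>, the difference of the two integrals is the difference of the values of \<open>F\<close> at the far end points
minus that at the starting points. The latter is real, since \<open>f\<close> is real on the positive axis; the former is at most the
length of the connecting segment times the bound of \<open>f\<close> there.\<close>

lemma Im_partial_shift:
  assumes hol: "f holomorphic_on half_plane" and real: "\<And>x. x > 0 \<Longrightarrow> f (of_real x) \<in> \<real>"
    and c: "0 < c1" "c1 \<le> c2" and R: "R \<ge> 0"
    and B: "\<And>c. c \<in> {c1..c2} \<Longrightarrow> norm (f (ray c R)) \<le> B"
  shows "\<bar>Im (LBINT r:{0..R}. f (ray c1 r) * w) - Im (LBINT r:{0..R}. f (ray c2 r) * w)\<bar> \<le> B * (c2 - c1)"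
proof -
  obtain F where F0: "\<And>z. z \<in> half_plane \<Longrightarrow> (F has_field_derivative f z) (at z within half_plane)"
    using holomorphic_convex_primitive'[OF convex_half_plane open_half_plane hol] by blast
  then have F: "\<And>z. z \<in> half_plane \<Longrightarrow> (F has_field_derivative f z) (at z)"
    using open_half_plane by (metis at_within_open)
  have int: "(LBINT r:{0..R}. f (ray c r) * w) = F (ray c R) - F (of_real c)" if "c > 0" for c
  proof -
    have "(LINT r|lborel. indicator {0..R} r *\<^sub>R (f (ray c r) * w)) = F (ray c R) - F (ray c 0)"
    proof (rule integral_FTC_atLeastAtMost[OF R, where F = "\<lambda>r. F (ray c r)"])
      fix r :: real assume "0 \<le> r" "r \<le> R"
      have "(ray c has_vector_derivative w) (at r within {0..R})"
        unfolding ray_def by (auto intro!: derivative_eq_intros simp: has_vector_derivative_def scaleR_conv_of_real)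
      from field_vector_diff_chain_within[OF this has_field_derivative_at_within[OF F[OF ray_in_half_plane[OF that]]]]
      have "((\<lambda>r. F (ray c r)) has_vector_derivative (w * f (ray c r))) (at r within {0..R})"
        by (simp add: o_def)
      then show "((\<lambda>r. F (ray c r)) has_vector_derivative f (ray c r) * w) (at r within {0..R})"
        by (simp add: mult.commute)
    qed (rule ray_continuous_comp[OF hol that])
    moreover have "ray c 0 = of_real c" by (simp add: ray_def)
    ultimately show ?thesis by (simp only: set_lebesgue_integral_def)
  qed
  have "Im (F (of_real c1)) = Im (F (of_real c2))"
  proof (cases "c1 = c2")
    case False
    have "((\<lambda>x. Im (F (of_real x))) has_field_derivative 0) (at x)" if "x > 0" for x
    proof -
      have "((\<lambda>x. F (of_real x)) has_vector_derivative f (of_real x)) (at x)"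
      proof -
        have "(complex_of_real has_vector_derivative 1) (at x)"
          by (auto simp: has_vector_derivative_def scaleR_conv_of_real[abs_def] intro!: bounded_linear_imp_has_derivative bounded_linear_of_real)
        from field_vector_diff_chain_at[OF this F[OF real_in_half_plane[OF that]]] show ?thesis
          by (simp add: o_def)
      qed
      then have "((\<lambda>x. Im (F (of_real x))) has_vector_derivative Im (f (of_real x))) (at x)"
        using bounded_linear.has_vector_derivative[OF bounded_linear_Im] by blast
      moreover have "Im (f (of_real x)) = 0" using real[OF that] by (auto simp: complex_is_Real_iff)
      ultimately show ?thesis by (simp add: has_real_derivative_iff_has_vector_derivative)
    qed
    then have "\<And>x. c1 \<le> x \<Longrightarrow> x \<le> c2 \<Longrightarrow> ((\<lambda>x. Im (F (of_real x))) has_field_derivative 0) (at x)"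
      using c by force
    from DERIV_isconst_end[of c1 c2, OF _ _ ] show ?thesis
      by (smt (verit) False DERIV_isCont DERIV_isconst2 c(2) \<open>\<And>x. \<lbrakk>c1 \<le> x; x \<le> c2\<rbrakk> \<Longrightarrow> ((\<lambda>x. Im (F (complex_of_real x))) has_real_derivative 0) (at x)\<close> continuous_at_imp_continuous_on atLeastAtMost_iff)
  qed simp
  moreover have "norm (F (ray c1 R) - F (ray c2 R)) \<le> B * norm (ray c1 R - ray c2 R)"
  proof (rule field_differentiable_bound[where S = "closed_segment (ray c1 R) (ray c2 R)" and f' = f])
    have seg: "closed_segment (ray c1 R) (ray c2 R) = (\<lambda>c. ray c R) ` {c1..c2}"
    proof -
      have "(\<lambda>c. ray c R) ` {c1..c2} = (\<lambda>z. of_real R * w + z) ` of_real ` closed_segment c1 c2"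
        using c by (auto simp: ray_def closed_segment_eq_real_ivl image_image algebra_simps)
      also have "of_real ` closed_segment c1 c2 = closed_segment (complex_of_real c1) (of_real c2)"
        by (metis closed_segment_of_real)
      also have "(\<lambda>z. of_real R * w + z) ` \<dots> = closed_segment (ray c1 R) (ray c2 R)"
        using closed_segment_translation[of "of_real R * w" "of_real c1" "of_real c2"] by (simp add: ray_def add.commute)
      finally show ?thesis ..
    qed
    show "(F has_field_derivative f z) (at z within closed_segment (ray c1 R) (ray c2 R))"
      if "z \<in> closed_segment (ray c1 R) (ray c2 R)" for z
      using that c ray_in_half_plane unfolding seg by (intro has_field_derivative_at_within[OF F]) auto
    show "norm (f z) \<le> B" if "z \<in> closed_segment (ray c1 R) (ray c2 R)" for z
      using that B unfolding seg by auto
  qed auto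
  moreover have "norm (ray c1 R - ray c2 R) = c2 - c1"
    using c by (simp add: ray_def flip: of_real_diff)
  moreover have "c2 > 0" using c by simp
  ultimately show ?thesis
    using int[OF c(1)] int[of c2] abs_Im_le_cmod[of "F (ray c1 R) - F (ray c2 R)"] by simp
qed

text \<open>The contour may be moved: only the imaginary part is kept, because the segment between the two starting points
contributes a real number.\<close>

lemma Im_ray_integral_shift:
  assumes hol: "f holomorphic_on half_plane" and real: "\<And>x. x > 0 \<Longrightarrow> f (of_real x) \<in> \<real>"
    and c: "0 < c1" "c1 \<le> c2"
    and B: "\<And>c r. c \<in> {c1..c2} \<Longrightarrow> r \<ge> 0 \<Longrightarrow> norm (f (ray c r)) \<le> C * exp (- \<delta> * r)"
  shows "Im (ray_integral f c1) = Im (ray_integral f c2)"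
proof -
  define I where "I = (\<lambda>c R. LBINT r:{0..R}. f (ray c r) * w)"
  have lim: "((\<lambda>R. Im (I c R)) \<longlongrightarrow> Im (ray_integral f c)) at_top" if "c \<in> {c1..c2}" for c
    unfolding I_def ray_integral_def
    by (intro tendsto_Im tendsto_set_lebesgue_integral_at_top ray_integral_integrable(1)[OF hol, of c C])
       (use that c B in auto)
  have "((\<lambda>R. Im (I c1 R) - Im (I c2 R)) \<longlongrightarrow> Im (ray_integral f c1) - Im (ray_integral f c2)) at_top"
    by (intro tendsto_diff lim) (use c in auto)
  moreover have "((\<lambda>R. Im (I c1 R) - Im (I c2 R)) \<longlongrightarrow> 0) at_top"
  proof (rule Lim_null_comparison)
    show "\<forall>\<^sub>F R in at_top. norm (Im (I c1 R) - Im (I c2 R)) \<le> C * exp (- \<delta> * R) * (c2 - c1)"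
      using eventually_ge_at_top[of 0]
    proof eventually_elim
      case (elim R)
      show ?case unfolding I_def real_norm_def
        by (rule Im_partial_shift[OF hol real c elim]) (use B elim in auto)
    qed
    have "((\<lambda>R. exp (- \<delta> * R)) \<longlongrightarrow> 0) at_top"
      by (rule filterlim_compose[OF exp_at_bot filterlim_tendsto_neg_mult_at_bot[OF tendsto_const]])
        (use delta_pos in \<open>auto simp: filterlim_ident\<close>)
    then show "((\<lambda>R. C * exp (- \<delta> * R) * (c2 - c1)) \<longlongrightarrow> 0) at_top"
      by (intro tendsto_mult_left_zero tendsto_mult_right_zero)
  qed
  ultimately have "Im (ray_integral f c1) - Im (ray_integral f c2) = 0"
    using tendsto_unique trivial_limit_at_top_linorder by blast
  then show ?thesis by simp
qed

end

section \<open>Hankel's formula for the reciprocal Gamma function\<close>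

lemma complex_exp_integral:
  assumes "Re a > 0"
  shows "set_integrable lborel {0..} (\<lambda>t. exp (- (of_real t * a)))"
    and "(LBINT t:{0..}. exp (- (of_real t * a))) = 1 / a"
proof -
  have cont: "continuous_on S (\<lambda>t. exp (- (of_real t * a)))" for S by (intro continuous_intros)
  show 1: "set_integrable lborel {0..} (\<lambda>t. exp (- (of_real t * a)))"
  proof (rule set_integrable_bound[OF exp_decay_integral(1)[OF assms]])
    show "set_borel_measurable lborel {0..} (\<lambda>t. exp (- (of_real t * a)))"
      unfolding set_borel_measurable_def using cont by (simp add: borel_measurable_continuous_on_indicator)
  qed (auto simp: mult.commute)
  have a0: "a \<noteq> 0" using assms by auto
  have fin: "(LBINT t:{0..R}. exp (- (of_real t * a))) = 1 / a - exp (- (of_real R * a)) / a" if "R \<ge> 0" for R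
  proof -
    have "(LINT t|lborel. indicator {0..R} t *\<^sub>R exp (- (of_real t * a))) 
        = (- exp (- (of_real R * a)) / a) - (- exp (- (of_real 0 * a)) / a)"
    proof (rule integral_FTC_atLeastAtMost[OF that, where F = "\<lambda>t. - exp (- (of_real t * a)) / a"])
      fix x :: real
      have "((\<lambda>z. - exp (- (z * a)) / a) has_field_derivative exp (- (of_real x * a))) (at (of_real x))"
        using a0 by (auto intro!: derivative_eq_intros)
      then show "((\<lambda>t. - exp (- (of_real t * a)) / a) has_vector_derivative exp (- (of_real x * a))) (at x within {0..R})"
        by (rule has_vector_derivative_real_field[where f = "\<lambda>z. - exp (- (z * a)) / a"])
    qed (rule cont)
    then show ?thesis by (simp add: set_lebesgue_integral_def)
  qed
  have "((\<lambda>R. LBINT t:{0..R}. exp (- (of_real t * a))) \<longlongrightarrow> 1 / a - 0) at_top"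
  proof (rule Lim_transform_eventually)
    show "\<forall>\<^sub>F R in at_top. 1 / a - exp (- (of_real R * a)) / a = (LBINT t:{0..R}. exp (- (of_real t * a)))"
      using eventually_ge_at_top[of 0] by eventually_elim (simp add: fin)
    have "((\<lambda>R. exp (- Re a * R)) \<longlongrightarrow> 0) at_top"
      by (rule filterlim_compose[OF exp_at_bot filterlim_tendsto_neg_mult_at_bot[OF tendsto_const]])
        (use assms in \<open>auto simp: filterlim_ident\<close>)
    then have "((\<lambda>R. exp (- (of_real R * a))) \<longlongrightarrow> 0) at_top"
      by (intro tendsto_norm_zero_cancel[of "\<lambda>R. exp (- (of_real R * a))"]) (simp add: mult.commute)
    then show "((\<lambda>R. 1 / a - exp (- (of_real R * a)) / a) \<longlongrightarrow> 1 / a - 0) at_top"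
      by (intro tendsto_intros tendsto_divide_zero)
  qed
  moreover have "((\<lambda>R. LBINT t:{0..R}. exp (- (of_real t * a))) \<longlongrightarrow> (LBINT t:{0..}. exp (- (of_real t * a)))) at_top"
    by (intro tendsto_set_lebesgue_integral_at_top 1) auto
  ultimately show "(LBINT t:{0..}. exp (- (of_real t * a))) = 1 / a"
    using tendsto_unique trivial_limit_at_top_linorder by fastforce
qed

lemma powr_decay_integrable:
  assumes "e < (-1::real)"
  shows "set_integrable lborel {0..} (\<lambda>r. (1 + r) powr e)"
proof -
  have "(\<lambda>r. r powr e) absolutely_integrable_on {1..}"
    by (intro nonnegative_absolutely_integrable_1) (use has_integral_powr_to_inf[OF assms, of 1] in auto)
  then have "integrable lborel (\<lambda>r. indicator {1..} r *\<^sub>R r powr e)"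
    unfolding set_integrable_def by (subst (asm) integrable_completion) auto
  from lborel_integrable_real_affine[OF this, of 1 1]
  show ?thesis unfolding set_integrable_def
    by (rule Bochner_Integration.integrable_cong[THEN iffD1, rotated -1]) (auto simp: indicator_def)
qed

context ray
begin

lemma holomorphic_powr_half_plane [holomorphic_intros]: "(\<lambda>z. z powr s) holomorphic_on half_plane"
  using Arg_half_plane(3) by (intro holomorphic_intros) auto

lemma norm_powr_ray: "norm ((z::complex) powr of_real s) = norm z powr s"
  by (simp add: norm_powr_real_powr')

definition hankel_kernel :: "real \<Rightarrow> complex \<Rightarrow> complex" where "hankel_kernel s z = exp z * z powr of_real (- s)"

text \<open>By Hankel's formula this is \<open>pi / Gamma s\<close>; the proof of that is the purpose of this section.\<close>

definition hankel :: "real \<Rightarrow> real" where "hankel s = Im (ray_integral (hankel_kernel s) 1)"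

lemma hankel_kernel_holo: "hankel_kernel s holomorphic_on half_plane" and hankel_kernel_real: "x > 0 \<Longrightarrow> hankel_kernel s (of_real x) \<in> \<real>"
proof -
  show "hankel_kernel s holomorphic_on half_plane" unfolding hankel_kernel_def by (intro holomorphic_intros)
  show "hankel_kernel s (of_real x) \<in> \<real>" if "x > 0"
    using that powr_of_real[of x "-s"] by (auto simp: hankel_kernel_def exp_of_real simp flip: of_real_mult)
qed

lemma hankel_kernel_decay:
  assumes "0 < c1"
  obtains C where "C \<ge> 0" "\<And>c r. c \<in> {c1..c2} \<Longrightarrow> r \<ge> 0 \<Longrightarrow> norm (hankel_kernel s (ray c r)) \<le> C * exp (- \<delta> * r)"
proof -
  obtain C where "C \<ge> 0" "\<And>c r. c \<in> {c1..c2} \<Longrightarrow> r \<ge> 0 \<Longrightarrow> norm (exp (ray c r)) * norm (ray c r) powr (-s) \<le> C * exp (- \<delta> * r)"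
    using exp_ray_decay[OF assms, of c2 "-s"] by blast
  then show ?thesis using that[of C] by (simp only: hankel_kernel_def norm_mult norm_powr_ray) 
qed

lemma hankel_eq: assumes "c > 0" shows "Im (ray_integral (hankel_kernel s) c) = hankel s"
proof -
  have "Im (ray_integral (hankel_kernel s) a) = Im (ray_integral (hankel_kernel s) b)" if "0 < a" "a \<le> b" for a b
    by (rule hankel_kernel_decay[OF that(1), of b s]) (rule Im_ray_integral_shift[OF hankel_kernel_holo hankel_kernel_real that], auto)
  then show ?thesis unfolding hankel_def using assms by (metis le_cases zero_less_one)
qed

text \<open>Substitution of \<open>z / t\<close> for \<open>z\<close>.\<close>

lemma ray_integral_scale:
  assumes "t > 0" "c > 0"
  shows "ray_integral (\<lambda>z. exp (of_real t * z) * z powr of_real (- s)) c = of_real (t powr (s - 1)) * ray_integral (hankel_kernel s) (t * c)"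
proof -
  define F where "F = (\<lambda>r. indicator {0..} r *\<^sub>R (exp (of_real t * ray c r) * ray c r powr of_real (- s) * w))"
  have "ray_integral (\<lambda>z. exp (of_real t * z) * z powr of_real (- s)) c = integral\<^sup>L lborel F"
    by (simp only: ray_integral_def set_lebesgue_integral_def F_def)
  also have "\<dots> = (1 / t) *\<^sub>R (LINT r|lborel. F (0 + (1 / t) * r))"
    by (subst lborel_integral_real_affine[of "1 / t" F 0]) (use assms in auto)
  also have "(\<lambda>r. F (0 + (1 / t) * r)) = (\<lambda>r. of_real (t powr s) * (indicator {0..} r *\<^sub>R (hankel_kernel s (ray (t * c) r) * w)))"
  proof
    fix r
    have ind: "indicator {0..} (r / t) = (indicator {0..} r :: real)"
      using assms by (auto simp: indicator_def zero_le_divide_iff)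
    have ry: "ray c (r / t) = of_real (1 / t) * ray (t * c) r" using assms by (simp add: ray_def field_simps)
    have nz: "ray (t * c) r \<noteq> 0" using Arg_half_plane(1)[OF ray_in_half_plane[of "t * c" r]] assms by auto
    have "Ln (ray c (r / t)) = of_real (ln (1 / t)) + Ln (ray (t * c) r)"
      unfolding ry using nz assms Ln_times_of_real[of "1 / t" "ray (t * c) r"] by (simp add: Ln_of_real del: of_real_divide)
    also have "ln (1 / t) = - ln t" using assms by (simp add: ln_div)
    finally have Ln: "Ln (ray c (r / t)) = - of_real (ln t) + Ln (ray (t * c) r)" by simp
    have "ray c (r / t) \<noteq> 0" unfolding ry using nz assms by simp
    then have "ray c (r / t) powr of_real (- s) = exp (of_real (- s) * (- of_real (ln t) + Ln (ray (t * c) r)))"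
      by (simp only: powr_def Ln if_False)
    also have "of_real (- s) * (- of_real (ln t) + Ln (ray (t * c) r)) = of_real (s * ln t) + of_real (- s) * Ln (ray (t * c) r)"
      by (simp add: algebra_simps)
    also have "exp \<dots> = of_real (exp (s * ln t)) * exp (of_real (- s) * Ln (ray (t * c) r))"
      by (simp only: exp_add exp_of_real)
    also have "\<dots> = of_real (t powr s) * ray (t * c) r powr of_real (- s)"
      using nz assms by (simp add: powr_def)
    finally show "F (0 + (1 / t) * r) = of_real (t powr s) * (indicator {0..} r *\<^sub>R (hankel_kernel s (ray (t * c) r) * w))"
      using assms ind by (simp add: F_def hankel_kernel_def ry mult_ac)
  qed
  also have "(1 / t) *\<^sub>R (LINT r|lborel. of_real (t powr s) * (indicator {0..} r *\<^sub>R (hankel_kernel s (ray (t * c) r) * w)))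
      = of_real (t powr (s - 1)) * ray_integral (hankel_kernel s) (t * c)"
    unfolding ray_integral_def set_lebesgue_integral_def using assms
    by (subst integral_mult_right_zero) (simp add: scaleR_conv_of_real powr_diff)
  finally show ?thesis .
qed

lemma norm_ray_ge': assumes "c \<ge> 1/2" "r \<ge> 0" shows "norm (ray c r) \<ge> sin \<theta> / 4 * (1 + r)"
proof -
  have "1/2 * sin \<theta> \<le> c * sin \<theta>" using assms sin_pos by simp
  then have "2 * norm (ray c r) \<ge> sin \<theta> * (1/2 + r)"
    using norm_ray_ge[of c r] assms by (simp add: algebra_simps)
  moreover have "sin \<theta> * (1/2 + r) \<ge> sin \<theta> * ((1 + r) / 2)"
    by (intro mult_left_mono) (use assms sin_pos in auto)
  ultimately show ?thesis by (simp add: field_simps)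
qed

text \<open>In \<open>Gamma s = \<integral> t\<^sup>s\<^sup>-\<^sup>1 e\<^sup>-\<^sup>t dt\<close> the factor \<open>t\<^sup>s\<^sup>-\<^sup>1 * hankel s\<close> is, by scaling, the imaginary part of the ray integral of \<open>e\<^sup>t\<^sup>z z\<^sup>-\<^sup>s\<close>. Exchanging the
integrals and integrating \<open>e\<^sup>-\<^sup>t\<^sup>(\<^sup>1\<^sup>-\<^sup>z\<^sup>)\<close> over \<open>t\<close> leaves \<open>z\<^sup>-\<^sup>s / (1 - z)\<close>. The ray starts at \<open>1/2\<close>, to the left of the pole
at \<open>1\<close>, so that \<open>1 - z\<close> has positive real part.\<close>

lemma Gamma_hankel:
  assumes "s > 0"
  shows "set_integrable lborel {0..} (\<lambda>r. ray (1/2) r powr of_real (- s) / (1 - ray (1/2) r) * w)"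
    and "Gamma s * hankel s = Im (LBINT r:{0..}. ray (1/2) r powr of_real (- s) / (1 - ray (1/2) r) * w)"
proof -
  define z where "z = ray (1/2)"
  define g :: "real \<Rightarrow> real \<Rightarrow> complex" where 
    "g = (\<lambda>r t. indicator {0..} r *\<^sub>R indicator {0..} t *\<^sub>R (exp (- (of_real t * (1 - z r))) * z r powr of_real (- s) * w))"
  have zP: "z r \<in> half_plane" for r unfolding z_def by (rule ray_in_half_plane) auto
  have Re1: "Re (1 - z r) = 1/2 - r * cos \<theta>" for r by (simp add: z_def Re_ray)
  have Re_pos: "Re (1 - z r) > 0" if "r \<ge> 0" for r
    using that cos_neg mult_nonneg_nonpos[of r "cos \<theta>"] by (simp add: Re1 del: minus_complex.sel one_complex.sel)
  have z1: "1 - z r \<noteq> 0" if "r \<ge> 0" for r using Re_pos[OF that] by auto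
  have contz: "continuous_on S z" for S unfolding z_def by (rule continuous_ray)
  have contzp: "continuous_on S (\<lambda>r. z r powr of_real (- s))" for S
    by (rule continuous_on_compose2[OF holomorphic_on_imp_continuous_on[OF holomorphic_powr_half_plane] contz]) (use zP in auto)
  have gmeas: "case_prod g \<in> borel_measurable (lborel \<Otimes>\<^sub>M lborel)"
  proof -
    have "(\<lambda>p. indicator ({0..} \<times> {0..}) p *\<^sub>R (exp (- (of_real (snd p) * (1 - z (fst p)))) * z (fst p) powr of_real (- s) * w)) \<in> borel_measurable borel"
    proof (rule borel_measurable_continuous_on_indicator)
      show "({0..} \<times> {0..} :: (real \<times> real) set) \<in> sets borel" by (intro borel_closed closed_Times) auto
      show "continuous_on ({0..} \<times> {0..}) (\<lambda>p. exp (- (of_real (snd p) * (1 - z (fst p)))) * z (fst p) powr of_real (- s) * w)"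
        by (intro continuous_intros continuous_on_compose2[OF contz[of UNIV]] continuous_on_compose2[OF contzp[of UNIV]]) auto
    qed
    also have "(\<lambda>p. indicator ({0..} \<times> {0..}) p *\<^sub>R (exp (- (of_real (snd p) * (1 - z (fst p)))) * z (fst p) powr of_real (- s) * w)) = case_prod g"
      by (auto simp: g_def indicator_def)
    finally show ?thesis by (simp add: borel_prod[symmetric] measurable_lborel1 cong: measurable_cong_sets)
  qed
  have tint: "set_integrable lborel {0..} (\<lambda>t. exp (- (of_real t * (1 - z r))))"
     "(LBINT t:{0..}. exp (- (of_real t * (1 - z r)))) = 1 / (1 - z r)" if "r \<ge> 0" for r
    using complex_exp_integral[OF Re_pos[OF that]] by auto
  have g_int_t: "integrable lborel (g r)" for r
  proof (cases "r \<ge> 0")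
    case True
    from tint(1)[OF True] have "integrable lborel (\<lambda>t. (indicator {0..} t *\<^sub>R exp (- (of_real t * (1 - z r)))) * (z r powr of_real (- s) * w))"
      unfolding set_integrable_def by (rule integrable_mult_left)
    then show ?thesis by (simp add: g_def True mult.assoc)
  qed (simp add: g_def)
  have g_t: "(LINT t|lborel. g r t) = indicator {0..} r *\<^sub>R (z r powr of_real (- s) / (1 - z r) * w)" for r
  proof (cases "r \<ge> 0")
    case True
    have "(LINT t|lborel. g r t) = (LINT t|lborel. (indicator {0..} t *\<^sub>R exp (- (of_real t * (1 - z r)))) * (z r powr of_real (- s) * w))"
      by (simp add: g_def True mult.assoc)
    also have "\<dots> = 1 / (1 - z r) * (z r powr of_real (- s) * w)"
      unfolding tint(2)[OF True, symmetric] set_lebesgue_integral_def by (rule integral_mult_left_zero)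
    finally show ?thesis using True by simp
  qed (simp add: g_def)
  have g_nt: "(LINT t|lborel. norm (g r t)) = indicator {0..} r *\<^sub>R (norm (z r) powr (- s) / Re (1 - z r))" for r
  proof (cases "r \<ge> 0")
    case True
    have "(LINT t|lborel. norm (g r t)) = (LINT t|lborel. (indicator {0..} t *\<^sub>R exp (- Re (1 - z r) * t)) * (norm (z r) powr (- s)))"
      using True norm_powr_ray[of "z r" "- s"] by (simp add: g_def norm_mult algebra_simps) 
    also have "\<dots> = 1 / Re (1 - z r) * norm (z r) powr (- s)"
      unfolding exp_decay_integral(2)[OF Re_pos[OF True], symmetric] set_lebesgue_integral_def by (rule integral_mult_left_zero)
    finally show ?thesis using True by simp
  qed (simp add: g_def)
  have g_int_r: "integrable lborel (\<lambda>r. LINT t|lborel. norm (g r t))"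
  proof -
    define \<kappa> where "\<kappa> = - cos \<theta>"
    have kap: "\<kappa> > 0" "\<kappa> \<le> 1" using cos_neg cos_ge_minus_one[of \<theta>] by (auto simp: \<kappa>_def)
    define K where "K = (sin \<theta> / 4) powr (- s) * (2 / \<kappa>)"
    have "set_integrable lborel {0..} (\<lambda>r. K * (1 + r) powr (- s - 1))"
      by (intro set_integrable_mult_right powr_decay_integrable) (use assms in auto)
    then have "integrable lborel (\<lambda>r. indicator {0..} r *\<^sub>R (K * (1 + r) powr (- s - 1)))"
      unfolding set_integrable_def .
    then show ?thesis
    proof (rule Bochner_Integration.integrable_bound)
      show "(\<lambda>r. LINT t|lborel. norm (g r t)) \<in> borel_measurable lborel"
        using gmeas by measurable
      show "AE r in lborel. norm (LINT t|lborel. norm (g r t)) \<le> norm (indicator {0..} r *\<^sub>R (K * (1 + r) powr (- s - 1)))"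
      proof (rule AE_I2)
        fix r :: real
        show "norm (LINT t|lborel. norm (g r t)) \<le> norm (indicator {0..} r *\<^sub>R (K * (1 + r) powr (- s - 1)))"
        proof (cases "r \<ge> 0")
          case True
          have "norm (z r) powr (- s) \<le> (sin \<theta> / 4 * (1 + r)) powr (- s)"
            by (intro powr_mono2') (use norm_ray_ge'[of "1/2" r] True sin_pos assms in \<open>auto simp: z_def\<close>)
          also have "\<dots> = (sin \<theta> / 4) powr (- s) * (1 + r) powr (- s)"
            by (rule powr_mult)
          finally have 1: "norm (z r) powr (- s) \<le> (sin \<theta> / 4) powr (- s) * (1 + r) powr (- s)" .
          have "r * \<kappa> \<ge> 0" using True kap by simp
          then have 3: "\<kappa> / 2 * (1 + r) \<le> Re (1 - z r)"
          proof -
            have "Re (1 - z r) = 1/2 + r * \<kappa>" unfolding Re1 \<kappa>_def by simp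
            moreover have "\<kappa> / 2 * (1 + r) = \<kappa> / 2 + r * \<kappa> / 2" by (simp add: field_simps)
            ultimately show ?thesis using kap \<open>r * \<kappa> \<ge> 0\<close> by linarith
          qed
          then have 2: "1 / Re (1 - z r) \<le> 1 / (\<kappa> / 2 * (1 + r))"
            using kap True Re_pos[OF True] by (intro divide_left_mono mult_pos_pos) auto
          have "norm (z r) powr (- s) * (1 / Re (1 - z r)) \<le> ((sin \<theta> / 4) powr (- s) * (1 + r) powr (- s)) * (1 / (\<kappa> / 2 * (1 + r)))"
            using Re_pos[OF True] by (intro mult_mono 1 2) auto
          also have "\<dots> = K * ((1 + r) powr (- s) / (1 + r))"
            using True kap by (simp add: K_def)
          also have "(1 + r) powr (- s) / (1 + r) = (1 + r) powr (- s - 1)"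
            using True by (simp add: powr_diff)
          finally show ?thesis using True Re_pos[OF True] by (simp add: g_nt del: minus_complex.sel)
        qed (simp add: g_nt)
      qed
    qed
  qed
  have int2: "integrable (lborel \<Otimes>\<^sub>M lborel) (case_prod g)"
    by (rule lborel_pair.Fubini_integrable[OF gmeas]) (use g_int_r g_int_t in auto)
  show "set_integrable lborel {0..} (\<lambda>r. ray (1/2) r powr of_real (- s) / (1 - ray (1/2) r) * w)"
    using lborel_pair.integrable_fst'[OF int2] unfolding set_integrable_def by (simp add: g_t z_def)
  have "Im (LBINT r:{0..}. ray (1/2) r powr of_real (- s) / (1 - ray (1/2) r) * w) = Im (LINT r|lborel. LINT t|lborel. g r t)"
    unfolding set_lebesgue_integral_def by (simp add: g_t z_def)
  also have "(LINT r|lborel. LINT t|lborel. g r t) = (LINT t|lborel. LINT r|lborel. g r t)"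
    by (rule lborel_pair.Fubini_integral[OF int2, symmetric])
  also have "Im \<dots> = (LINT t|lborel. Im (LINT r|lborel. g r t))"
    by (rule integral_Im[symmetric]) (rule lborel_pair.integrable_snd[OF int2])
  also have "\<dots> = (LINT t|lborel. hankel s * (indicator {0..} t *\<^sub>R (t powr (s - 1) / exp t)))"
  proof (rule integral_cong_AE)
    show "AE t in lborel. Im (LINT r|lborel. g r t) = hankel s * (indicator {0..} t *\<^sub>R (t powr (s - 1) / exp t))"
      using AE_lborel_singleton[of 0]
    proof eventually_elim
      case (elim t)
      show ?case
      proof (cases "t > 0")
        case True
        have "(LINT r|lborel. g r t) = (LINT r|lborel. of_real (exp (- t)) * (indicator {0..} r *\<^sub>R (exp (of_real t * z r) * z r powr of_real (- s) * w)))"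
        proof (rule Bochner_Integration.integral_cong[OF refl])
          fix r
          have "- (of_real t * (1 - z r)) = of_real (- t) + of_real t * z r" by (simp add: algebra_simps)
          then have "exp (- (of_real t * (1 - z r))) = of_real (exp (- t)) * exp (of_real t * z r)"
            by (simp only: exp_add exp_of_real)
          then show "g r t = of_real (exp (- t)) * (indicator {0..} r *\<^sub>R (exp (of_real t * z r) * z r powr of_real (- s) * w))"
            using True by (simp add: g_def)
        qed
        also have "\<dots> = of_real (exp (- t)) * ray_integral (\<lambda>z. exp (of_real t * z) * z powr of_real (- s)) (1/2)"
          unfolding ray_integral_def set_lebesgue_integral_def z_def by (rule integral_mult_right_zero)
        also have "\<dots> = of_real (exp (- t) * t powr (s - 1)) * ray_integral (hankel_kernel s) (t * (1/2))"
          using True by (subst ray_integral_scale) auto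
        finally have "Im (LINT r|lborel. g r t) = exp (- t) * t powr (s - 1) * hankel s"
          using hankel_eq[of "t * (1/2)" s] True by simp
        then show ?thesis using True by (simp add: exp_minus divide_inverse mult_ac)
      next
        case False
        then show ?thesis using elim by (simp add: g_def)
      qed
    qed
  qed (use lborel_pair.integrable_snd[OF int2] in auto)
  also have "\<dots> = hankel s * (LINT t|lborel. indicator {0..} t *\<^sub>R (t powr (s - 1) / exp t))" by (rule integral_mult_right_zero)
  also have "(LINT t|lborel. indicator {0..} t *\<^sub>R (t powr (s - 1) / exp t)) = Gamma s"
  proof -
    have "(\<lambda>t. t powr (s - 1) / exp t) absolutely_integrable_on {0..}"
      by (intro nonnegative_absolutely_integrable_1) (use Gamma_integral_real[OF assms] in auto)
    then have "set_integrable lborel {0..} (\<lambda>t. t powr (s - 1) / exp t)"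
      unfolding set_integrable_def by (subst (asm) integrable_completion) auto
    from set_borel_integral_eq_integral(2)[OF this] Gamma_integral_real[OF assms]
    show ?thesis by (simp add: integral_unique set_lebesgue_integral_def)
  qed
  finally show "Gamma s * hankel s = Im (LBINT r:{0..}. ray (1/2) r powr of_real (- s) / (1 - ray (1/2) r) * w)" by simp
qed

end

context ray
begin

lemma ray_ne_1: assumes "c > 0" "c \<noteq> 1" shows "ray c r \<noteq> 1"
proof
  assume "ray c r = 1"
  then have "Re (ray c r) = 1" "Im (ray c r) = 0" by simp_all
  then show False using assms sin_pos by (simp add: Re_ray Im_ray)
qed

lemma Im_Ln_w: "Im (Ln w) = \<theta>" "Im (Ln (- w)) = \<theta> - pi"
proof -
  have "Arg w = \<theta>" unfolding w_def by (rule Arg_cis) (use theta in auto)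
  then show "Im (Ln w) = \<theta>" using Arg_eq_Im_Ln[of w] by (auto simp: w_def)
  have "- w = cis (\<theta> - pi)" by (simp add: w_def complex_eq_iff cos_diff sin_diff)
  moreover have "Arg (cis (\<theta> - pi)) = \<theta> - pi" by (rule Arg_cis) (use theta in auto)
  ultimately show "Im (Ln (- w)) = \<theta> - pi" using Arg_eq_Im_Ln[of "- w"] by (auto simp: w_def)
qed

lemma Im_Ln_line_limit:
  assumes "v = w \<or> v = - w"
  shows "((\<lambda>R. Im (Ln (of_real b + of_real R * v))) \<longlongrightarrow> Im (Ln v)) at_top"
proof (rule Lim_transform_eventually)
  have "Im v \<noteq> 0" using assms sin_pos by (auto simp: w_def)
  then have v: "v \<notin> \<real>\<^sub>\<le>\<^sub>0" "v \<noteq> 0" by (auto simp: complex_nonpos_Reals_iff)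
  have "((\<lambda>R. b / R) \<longlongrightarrow> 0) at_top"
    by (rule tendsto_divide_0[OF tendsto_const]) (simp add: filterlim_at_top_imp_at_infinity filterlim_ident)
  then have "((\<lambda>R. of_real (b / R) + v) \<longlongrightarrow> of_real 0 + v) at_top"
    by (intro tendsto_intros)
  then show "((\<lambda>R. Im (Ln (of_real (b / R) + v))) \<longlongrightarrow> Im (Ln v)) at_top"
    using v by (intro tendsto_Im tendsto_Ln) auto
  show "\<forall>\<^sub>F R in at_top. Im (Ln (of_real (b / R) + v)) = Im (Ln (of_real b + of_real R * v))"
    using eventually_gt_at_top[of 0]
  proof eventually_elim
    case (elim R)
    have eq: "of_real b + of_real R * v = of_real R * (of_real (b / R) + v)"
      using elim by (simp add: field_simps)
    have nz: "of_real (b / R) + v \<noteq> 0" using \<open>Im v \<noteq> 0\<close> by (auto simp: complex_eq_iff)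
    have "Ln (of_real b + of_real R * v) = of_real (ln R) + Ln (of_real (b / R) + v)"
      unfolding eq using Ln_times_of_real[OF elim nz] elim by (simp add: Ln_of_real del: of_real_divide)
    then show ?case by simp
  qed
qed

text \<open>The primitive is a logarithm of \<open>z - 1\<close>. The sign \<open>\<sigma>\<close> is that of \<open>c - 1\<close>: with it the line
\<open>\<sigma> * (ray c r - 1)\<close> starts at a positive number and avoids the cut of \<open>Ln\<close>.\<close>

lemma pole_partial_integral:
  assumes "c = 1/2 \<and> \<sigma> = -1 \<or> c \<ge> 2 \<and> \<sigma> = (1::real)" "R \<ge> 0"
  shows "set_integrable lborel {0..R} (\<lambda>r. w / (ray c r - 1))"
    and "(LBINT r:{0..R}. w / (ray c r - 1)) = Ln (of_real (\<sigma> * (c - 1)) + of_real R * (of_real \<sigma> * w)) - Ln (of_real (\<sigma> * (c - 1)))"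
proof -
  define L where "L = (\<lambda>r. of_real (\<sigma> * (c - 1)) + of_real r * (of_real \<sigma> * w))"
  have L_eq: "L r = of_real \<sigma> * (ray c r - 1)" for r by (simp add: L_def ray_def algebra_simps)
  have ne: "ray c r \<noteq> 1" for r using ray_ne_1[of c r] assms by auto
  have Lnp: "L r \<notin> \<real>\<^sub>\<le>\<^sub>0" for r
  proof
    assume "L r \<in> \<real>\<^sub>\<le>\<^sub>0"
    then have "Im (L r) = 0" "Re (L r) \<le> 0" by (auto simp: complex_nonpos_Reals_iff)
    then have "r = 0" using assms sin_pos by (auto simp: L_eq Im_ray)
    then show False using \<open>Re (L r) \<le> 0\<close> assms by (auto simp: L_def)
  qed
  have cont: "continuous_on {0..R} (\<lambda>r. w / (ray c r - 1))"
    using ne by (intro continuous_intros continuous_ray) auto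
  show "set_integrable lborel {0..R} (\<lambda>r. w / (ray c r - 1))"
    by (rule borel_integrable_atLeastAtMost'[OF cont])
  have "(LINT r|lborel. indicator {0..R} r *\<^sub>R (w / (ray c r - 1))) = Ln (L R) - Ln (L 0)"
  proof (rule integral_FTC_atLeastAtMost[OF assms(2), where F = "\<lambda>r. Ln (L r)"])
    fix r :: real
    have "(L has_vector_derivative (of_real \<sigma> * w)) (at r within {0..R})"
      unfolding L_def by (auto intro!: derivative_eq_intros simp: has_vector_derivative_def scaleR_conv_of_real)
    from field_vector_diff_chain_within[OF this has_field_derivative_at_within[OF has_field_derivative_Ln[OF Lnp]]]
    have "((\<lambda>r. Ln (L r)) has_vector_derivative of_real \<sigma> * w * inverse (L r)) (at r within {0..R})"
      by (simp add: o_def)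
    also have "of_real \<sigma> * w * inverse (L r) = w / (ray c r - 1)"
    proof -
      have "\<sigma> \<noteq> 0" using assms by auto
      then show ?thesis unfolding L_eq by (simp add: divide_inverse)
    qed
    finally show "((\<lambda>r. Ln (L r)) has_vector_derivative w / (ray c r - 1)) (at r within {0..R})" .
  qed (rule cont)
  then show "(LBINT r:{0..R}. w / (ray c r - 1)) = Ln (of_real (\<sigma> * (c - 1)) + of_real R * (of_real \<sigma> * w)) - Ln (of_real (\<sigma> * (c - 1)))"
    unfolding set_lebesgue_integral_def L_def by simp
qed

definition neg_powr :: "real \<Rightarrow> complex \<Rightarrow> complex" where "neg_powr s z = z powr of_real (- s)"

text \<open>The function \<open>(z\<^sup>-\<^sup>s - 1) / (z - 1)\<close> with the removable singularity filled in.\<close>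

definition pole_quotient :: "real \<Rightarrow> complex \<Rightarrow> complex" where
  "pole_quotient s z = (if z = 1 then deriv (neg_powr s) 1 else (neg_powr s z - neg_powr s 1) / (z - 1))"

lemma pole_quotient_holo: "pole_quotient s holomorphic_on half_plane"
proof -
  have "neg_powr s holomorphic_on half_plane" unfolding neg_powr_def by (rule holomorphic_powr_half_plane)
  from pole_lemma_open[OF this open_half_plane, of 1] show ?thesis unfolding pole_quotient_def[abs_def] .
qed

lemma pole_quotient_real: assumes "x > 0" shows "pole_quotient s (of_real x) \<in> \<real>"
proof -
  have q: "neg_powr s (of_real y) = of_real (y powr - s)" if "y > 0" for y
    using powr_of_real[of y "- s"] that by (simp add: neg_powr_def)
  have "(neg_powr s has_field_derivative of_real (- s) * 1 powr (of_real (- s) - 1)) (at 1)"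
    unfolding neg_powr_def[abs_def] by (rule has_field_derivative_powr) auto
  then have "deriv (neg_powr s) 1 = of_real (- s)" by (simp add: DERIV_imp_deriv)
  then have "deriv (neg_powr s) 1 \<in> \<real>" by simp
  moreover have "(of_real (x powr - s) - of_real (1 powr - s)) / (of_real x - 1) \<in> (\<real> :: complex set)"
    by (intro Reals_divide Reals_diff) auto
  ultimately show ?thesis using q[of x] q[of 1] assms by (auto simp: pole_quotient_def)
qed

definition pole_integral :: "real \<Rightarrow> real \<Rightarrow> complex" where "pole_integral s c = (LBINT r:{0..}. neg_powr s (ray c r) / (ray c r - 1) * w)"

lemma norm_ray_sub1: assumes "c \<ge> 2" "r \<ge> 0" shows "norm (ray c r - 1) \<ge> sin \<theta> / 4 * (1 + r)"
proof -
  have "ray c r - 1 = ray (c - 1) r" by (simp add: ray_def)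
  then show ?thesis using norm_ray_ge'[of "c - 1" r] assms by simp
qed

lemma neg_powr_pole_bound:
  assumes "s > 0" "c \<ge> 2" "r \<ge> 0"
  shows "norm (neg_powr s (ray c r) / (ray c r - 1) * w) \<le> (sin \<theta> * c) powr (- s / 2) * ((sin \<theta> / 4) powr (- s / 2 - 1) * (1 + r) powr (- s / 2 - 1))"
proof -
  have n: "norm (neg_powr s (ray c r)) = norm (ray c r) powr (- s / 2) * norm (ray c r) powr (- s / 2)"
    by (simp add: neg_powr_def norm_powr_ray flip: powr_add of_real_minus)
  have a: "norm (ray c r) powr (- s / 2) \<le> (sin \<theta> * c) powr (- s / 2)"
    by (intro powr_mono2') (use assms sin_pos norm_ray_ge[of c r] in \<open>auto simp: mult.commute\<close>)
  have b: "norm (ray c r) powr (- s / 2) \<le> (sin \<theta> / 4 * (1 + r)) powr (- s / 2)"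
    by (intro powr_mono2') (use assms sin_pos norm_ray_ge'[of c r] in auto)
  have d: "1 / norm (ray c r - 1) \<le> 1 / (sin \<theta> / 4 * (1 + r))"
  proof -
    have p: "0 < sin \<theta> / 4 * (1 + r)" using sin_pos assms by (intro mult_pos_pos) auto
    with norm_ray_sub1[OF assms(2,3)] have "0 < norm (ray c r - 1)" by linarith
    with p show ?thesis by (intro divide_left_mono norm_ray_sub1[OF assms(2,3)] mult_pos_pos[OF _ p]) auto
  qed
  have "norm (neg_powr s (ray c r) / (ray c r - 1) * w) = norm (ray c r) powr (- s / 2) * (norm (ray c r) powr (- s / 2) * (1 / norm (ray c r - 1)))"
    by (simp add: norm_mult norm_divide n)
  also have "\<dots> \<le> (sin \<theta> * c) powr (- s / 2) * ((sin \<theta> / 4 * (1 + r)) powr (- s / 2) * (1 / (sin \<theta> / 4 * (1 + r))))"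
    by (intro mult_mono a b d) auto
  also have "(sin \<theta> / 4 * (1 + r)) powr (- s / 2) * (1 / (sin \<theta> / 4 * (1 + r))) = (sin \<theta> / 4 * (1 + r)) powr (- s / 2 - 1)"
    using sin_pos assms by (simp add: powr_diff)
  also have "\<dots> = (sin \<theta> / 4) powr (- s / 2 - 1) * (1 + r) powr (- s / 2 - 1)"
    by (rule powr_mult)
  finally show ?thesis .
qed

lemma cont_neg_powr_pole: assumes "c > 0" "c \<noteq> 1" shows "continuous_on S (\<lambda>r. neg_powr s (ray c r) / (ray c r - 1) * w)"
proof -
  have "continuous_on S (\<lambda>r. neg_powr s (ray c r))" unfolding neg_powr_def
    by (rule continuous_on_compose2[OF holomorphic_on_imp_continuous_on[OF holomorphic_powr_half_plane] continuous_ray]) (use ray_in_half_plane[OF assms(1)] in auto)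
  then show ?thesis using ray_ne_1[OF assms] by (intro continuous_intros continuous_ray) auto
qed

text \<open>As the starting point moves to the right the integral vanishes: half of the decay of \<open>z\<^sup>-\<^sup>s\<close> is used for the factor
depending on \<open>c\<close>, the other half keeps the integral over the ray convergent.\<close>

lemma pole_integral_far:
  assumes "s > 0" "c \<ge> 2"
  shows "set_integrable lborel {0..} (\<lambda>r. neg_powr s (ray c r) / (ray c r - 1) * w)"
    and "norm (pole_integral s c) \<le> (sin \<theta> * c) powr (- s / 2) * (LBINT r:{0..}. (sin \<theta> / 4) powr (- s / 2 - 1) * (1 + r) powr (- s / 2 - 1))"
proof -
  have i0: "set_integrable lborel {0..} (\<lambda>r. (sin \<theta> / 4) powr (- s / 2 - 1) * (1 + r) powr (- s / 2 - 1))"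
    using powr_decay_integrable[of "- s / 2 - 1"] assms by (intro set_integrable_mult_right) auto
  then have i: "set_integrable lborel {0..} (\<lambda>r. (sin \<theta> * c) powr (- s / 2) * ((sin \<theta> / 4) powr (- s / 2 - 1) * (1 + r) powr (- s / 2 - 1)))"
    by (rule set_integrable_mult_right)
  show 1: "set_integrable lborel {0..} (\<lambda>r. neg_powr s (ray c r) / (ray c r - 1) * w)"
  proof (rule set_integrable_bound[OF i])
    show "set_borel_measurable lborel {0..} (\<lambda>r. neg_powr s (ray c r) / (ray c r - 1) * w)"
      unfolding set_borel_measurable_def using cont_neg_powr_pole[of c "{0..}" s] assms
      by (simp add: borel_measurable_continuous_on_indicator)
  qed (use neg_powr_pole_bound[OF assms] in \<open>auto intro!: AE_I2 order_trans[OF neg_powr_pole_bound[OF assms]]\<close>)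
  have "norm (pole_integral s c) \<le> (LBINT r:{0..}. norm (neg_powr s (ray c r) / (ray c r - 1) * w))"
    unfolding pole_integral_def by (rule set_integral_norm_bound[OF 1])
  also have "\<dots> \<le> (LBINT r:{0..}. (sin \<theta> * c) powr (- s / 2) * ((sin \<theta> / 4) powr (- s / 2 - 1) * (1 + r) powr (- s / 2 - 1)))"
    by (rule set_integral_mono[OF set_integrable_norm[OF 1] i]) (use neg_powr_pole_bound[OF assms] in auto)
  also have "\<dots> = (sin \<theta> * c) powr (- s / 2) * (LBINT r:{0..}. (sin \<theta> / 4) powr (- s / 2 - 1) * (1 + r) powr (- s / 2 - 1))"
    by (rule set_integral_mult_right)
  finally show "norm (pole_integral s c) \<le> (sin \<theta> * c) powr (- s / 2) * (LBINT r:{0..}. (sin \<theta> / 4) powr (- s / 2 - 1) * (1 + r) powr (- s / 2 - 1))" .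
qed

lemma pole_integral_near: assumes "s > 0" shows "set_integrable lborel {0..} (\<lambda>r. neg_powr s (ray (1/2) r) / (ray (1/2) r - 1) * w)"
   and "Gamma s * hankel s = - Im (pole_integral s (1/2))"
proof -
  have eq: "neg_powr s z / (z - 1) * w = - (z powr of_real (- s) / (1 - z) * w)" for z
    by (cases "z = 1") (auto simp: neg_powr_def field_simps)
  show "set_integrable lborel {0..} (\<lambda>r. neg_powr s (ray (1/2) r) / (ray (1/2) r - 1) * w)"
    unfolding eq using Gamma_hankel(1)[OF assms] unfolding set_integrable_def by (simp del: of_real_minus)
  have "pole_integral s (1/2) = - (LBINT r:{0..}. ray (1/2) r powr of_real (- s) / (1 - ray (1/2) r) * w)"
    unfolding pole_integral_def eq by (simp add: set_lebesgue_integral_def del: of_real_minus integral_mult_left_zero)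
  then show "Gamma s * hankel s = - Im (pole_integral s (1/2))" using Gamma_hankel(2)[OF assms] by simp
qed

text \<open>Moving the ray from \<open>1/2\<close> to \<open>c\<close> crosses the pole at \<open>1\<close>. Without the pole, that is for \<open>pole_quotient\<close>, the imaginary part does
not change; the pole part is integrated explicitly, and the arguments of \<open>w\<close> and \<open>- w\<close>, the directions in which \<open>\<sigma> * (z - 1)\<close>
tends to infinity on the two rays, differ by \<open>pi\<close>.\<close>

lemma pole_integral_jump:
  assumes s: "s > 0" and c: "c \<ge> 2"
  shows "Im (pole_integral s (1/2)) - Im (pole_integral s c) = - pi"
proof -
  define D where "D = (\<lambda>R. Im (LBINT r:{0..R}. pole_quotient s (ray (1/2) r) * w) - Im (LBINT r:{0..R}. pole_quotient s (ray c r) * w))"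
  have split: "Im (LBINT r:{0..R}. pole_quotient s (ray a r) * w) =
      Im (LBINT r:{0..R}. neg_powr s (ray a r) / (ray a r - 1) * w) - Im (Ln (of_real (\<sigma> * (a - 1)) + of_real R * (of_real \<sigma> * w)))"
    if "a = 1/2 \<and> \<sigma> = -1 \<or> a \<ge> 2 \<and> \<sigma> = (1::real)" "R \<ge> 0" for a \<sigma> R
  proof -
    have i1: "set_integrable lborel {0..R} (\<lambda>r. neg_powr s (ray a r) / (ray a r - 1) * w)"
      by (rule borel_integrable_atLeastAtMost'[OF cont_neg_powr_pole]) (use that in auto)
    have "(LBINT r:{0..R}. pole_quotient s (ray a r) * w) = (LBINT r:{0..R}. neg_powr s (ray a r) / (ray a r - 1) * w - w / (ray a r - 1))"
      by (rule set_lebesgue_integral_cong) (use that ray_ne_1[of a] in \<open>auto simp: pole_quotient_def neg_powr_def diff_divide_distrib left_diff_distrib\<close>)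
    also have "\<dots> = (LBINT r:{0..R}. neg_powr s (ray a r) / (ray a r - 1) * w) - (LBINT r:{0..R}. w / (ray a r - 1))"
      by (rule set_integral_diff(2)[OF i1 pole_partial_integral(1)[OF that]])
    finally have "(LBINT r:{0..R}. pole_quotient s (ray a r) * w) = (LBINT r:{0..R}. neg_powr s (ray a r) / (ray a r - 1) * w) -
        (Ln (of_real (\<sigma> * (a - 1)) + of_real R * (of_real \<sigma> * w)) - Ln (of_real (\<sigma> * (a - 1))))"
      by (simp only: pole_partial_integral(2)[OF that])
    moreover have "Im (Ln (of_real (\<sigma> * (a - 1)))) = 0"
      using that by (intro Im_Ln_of_real) auto
    ultimately show ?thesis by simp
  qed
  have lim1: "((\<lambda>R. Im (LBINT r:{0..R}. neg_powr s (ray a r) / (ray a r - 1) * w)) \<longlongrightarrow> Im (pole_integral s a)) at_top"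
    if "a = 1/2 \<or> a \<ge> 2" for a
  proof -
    have "set_integrable lborel {0..} (\<lambda>r. neg_powr s (ray a r) / (ray a r - 1) * w)"
      using that pole_integral_far(1)[OF s, of a] pole_integral_near(1)[OF s] by metis
    then show ?thesis unfolding pole_integral_def by (intro tendsto_Im tendsto_set_lebesgue_integral_at_top) auto
  qed
  \<comment> \<open>The starting point disappears in the limit; only the direction of the line matters.\<close>
  have lim2: "((\<lambda>R. Im (Ln (of_real (\<sigma> * (a - 1)) + of_real R * (of_real \<sigma> * w)))) \<longlongrightarrow> Im (Ln (of_real \<sigma> * w))) at_top"
    if "a = 1/2 \<and> \<sigma> = -1 \<or> a \<ge> 2 \<and> \<sigma> = (1::real)" for a \<sigma>
    by (rule Im_Ln_line_limit) (use that in auto)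
  have "(D \<longlongrightarrow> (Im (pole_integral s (1/2)) - Im (Ln (of_real (-1) * w))) - (Im (pole_integral s c) - Im (Ln (of_real 1 * w)))) at_top"
  proof (rule Lim_transform_eventually)
    show "((\<lambda>R. (Im (LBINT r:{0..R}. neg_powr s (ray (1/2) r) / (ray (1/2) r - 1) * w) - Im (Ln (of_real (-1 * (1/2 - 1)) + of_real R * (of_real (-1) * w))))
       - (Im (LBINT r:{0..R}. neg_powr s (ray c r) / (ray c r - 1) * w) - Im (Ln (of_real (1 * (c - 1)) + of_real R * (of_real 1 * w)))))
       \<longlongrightarrow> (Im (pole_integral s (1/2)) - Im (Ln (of_real (-1) * w))) - (Im (pole_integral s c) - Im (Ln (of_real 1 * w)))) at_top"
      by (intro tendsto_diff lim1 lim2) (use c in auto)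
    show "\<forall>\<^sub>F R in at_top. (Im (LBINT r:{0..R}. neg_powr s (ray (1/2) r) / (ray (1/2) r - 1) * w) - Im (Ln (of_real (-1 * (1/2 - 1)) + of_real R * (of_real (-1) * w))))
       - (Im (LBINT r:{0..R}. neg_powr s (ray c r) / (ray c r - 1) * w) - Im (Ln (of_real (1 * (c - 1)) + of_real R * (of_real 1 * w)))) = D R"
      using eventually_ge_at_top[of 0]
    proof eventually_elim
      case (elim R)
      show ?case unfolding D_def using split[of "1/2" "-1" R] split[of c 1 R] elim c by simp
    qed
  qed
  moreover have "(D \<longlongrightarrow> 0) at_top"
  proof (rule Lim_null_comparison)
    show "\<forall>\<^sub>F R in at_top. norm (D R) \<le> (2 / sin \<theta> * (c - 1/2)) / R"
      using eventually_gt_at_top[of "1 / sin \<theta>"] eventually_gt_at_top[of 0]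
    proof eventually_elim
      case (elim R)
      have R1: "R * sin \<theta> > 1" using elim sin_pos by (simp add: field_simps)
      have "\<bar>Im (LBINT r:{0..R}. pole_quotient s (ray (1/2) r) * w) - Im (LBINT r:{0..R}. pole_quotient s (ray c r) * w)\<bar> \<le> (2 / (R * sin \<theta>)) * (c - 1/2)"
      proof (rule Im_partial_shift[OF pole_quotient_holo pole_quotient_real])
        fix a assume a: "a \<in> {1/2..c}"
        have n1: "norm (ray a R) \<ge> R * sin \<theta>" using norm_ray_ge(2)[of a R] a elim by auto
        have "\<bar>Im (ray a R - 1)\<bar> \<le> norm (ray a R - 1)" by (rule abs_Im_le_cmod)
        then have n2: "norm (ray a R - 1) \<ge> R * sin \<theta>" using elim sin_pos by (simp add: Im_ray)
        have "norm (neg_powr s (ray a R)) = norm (ray a R) powr (- s)" by (simp add: neg_powr_def norm_powr_ray flip: of_real_minus)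
        also have "\<dots> \<le> 1 powr (- s)" by (rule powr_mono2') (use s n1 R1 in auto)
        finally have "norm (neg_powr s (ray a R) - neg_powr s 1) \<le> 2"
          using norm_triangle_ineq4[of "neg_powr s (ray a R)" "neg_powr s 1"] by (simp add: neg_powr_def)
        then have "norm ((neg_powr s (ray a R) - neg_powr s 1) / (ray a R - 1)) \<le> 2 / (R * sin \<theta>)"
          unfolding norm_divide using n2 R1 by (intro frac_le) auto
        moreover have "ray a R \<noteq> 1" using n2 R1 by auto
        ultimately show "norm (pole_quotient s (ray a R)) \<le> 2 / (R * sin \<theta>)" by (simp add: pole_quotient_def)
      qed (use c elim in auto)
      then show ?case using sin_pos elim by (simp add: D_def field_simps)
    qed
    show "((\<lambda>R. (2 / sin \<theta> * (c - 1/2)) / R) \<longlongrightarrow> 0) at_top"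
      by (rule tendsto_divide_0[OF tendsto_const]) (simp add: filterlim_at_top_imp_at_infinity filterlim_ident)
  qed
  ultimately have "(Im (pole_integral s (1/2)) - Im (Ln (of_real (-1) * w))) - (Im (pole_integral s c) - Im (Ln (of_real 1 * w))) = 0"
    using tendsto_unique trivial_limit_at_top_linorder by blast
  then show ?thesis using Im_Ln_w by simp
qed

text \<open>Moving the ray across the pole and then to infinity shows that the imaginary part of \<open>pole_integral s (1/2)\<close> is \<open>- pi\<close>.\<close>

lemma hankel_rGamma: assumes "s > 0" shows "hankel s = pi / Gamma s"
proof -
  define I where "I = (LBINT r:{0..}. (sin \<theta> / 4) powr (- s / 2 - 1) * (1 + r) powr (- s / 2 - 1))"
  have "((\<lambda>c. Im (pole_integral s c)) \<longlongrightarrow> 0) at_top"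
  proof (rule Lim_null_comparison)
    show "\<forall>\<^sub>F c in at_top. norm (Im (pole_integral s c)) \<le> (sin \<theta> * c) powr (- s / 2) * I"
      using eventually_ge_at_top[of 2]
    proof eventually_elim
      case (elim c)
      show ?case using pole_integral_far(2)[OF assms elim] abs_Im_le_cmod[of "pole_integral s c"] unfolding I_def real_norm_def by linarith
    qed
    have "((\<lambda>c. (sin \<theta> * c) powr (- s / 2)) \<longlongrightarrow> 0) at_top"
      by (rule tendsto_neg_powr) (use assms sin_pos in \<open>auto intro!: filterlim_tendsto_pos_mult_at_top[OF tendsto_const] filterlim_ident\<close>)
    then show "((\<lambda>c. (sin \<theta> * c) powr (- s / 2) * I) \<longlongrightarrow> 0) at_top"
      by (rule tendsto_mult_left_zero)
  qed
  moreover have "\<forall>\<^sub>F c in at_top. Im (pole_integral s c) = Im (pole_integral s (1/2)) + pi"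
    using eventually_ge_at_top[of 2]
  proof eventually_elim
    case (elim c)
    then show ?case using pole_integral_jump[OF assms elim] by simp
  qed
  ultimately have "((\<lambda>c::real. Im (pole_integral s (1/2)) + pi) \<longlongrightarrow> 0) at_top"
    using Lim_transform_eventually by fast
  then have "Im (pole_integral s (1/2)) + pi = 0" by (simp add: tendsto_const_iff)
  then have "Gamma s * hankel s = pi" using pole_integral_near(2)[OF assms] by simp
  then show ?thesis using Gamma_real_pos[OF assms] by (simp add: field_simps)
qed

end

section \<open>Decay of Mittag-Leffler functions on the negative axis\<close>

text \<open>The condition \<open>\<alpha> * \<theta> < pi\<close> keeps \<open>z\<^sup>\<alpha>\<close> away from the negative axis for \<open>z\<close> in the half plane, so that \<open>z\<^sup>\<alpha> + x\<close> has no zero there.\<close>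

locale ml_ray = ray +
  fixes \<alpha> \<beta> x :: real
  assumes alpha: "1 < \<alpha>" "\<alpha> * \<theta> < pi" and beta: "\<beta> > 0" and x: "x \<ge> 0"
begin

definition \<kappa> :: real where "\<kappa> = sin (\<alpha> * \<theta>)"

lemma kappa_pos: "\<kappa> > 0"
  unfolding \<kappa>_def by (rule sin_gt_zero) (use alpha theta in \<open>auto intro!: mult_pos_pos\<close>)

text \<open>If \<open>\<phi>\<close> is the argument and \<open>\<rho>\<close> the modulus of \<open>z\<^sup>\<alpha>\<close>, then \<open>|z\<^sup>\<alpha> + x|\<^sup>2 = \<rho>\<^sup>2 + 2 \<rho> x cos \<phi> + x\<^sup>2\<close>, which is smallest for the extreme
argument \<open>\<alpha> * \<theta>\<close>; completing the square in \<open>x\<close> or in \<open>\<rho>\<close> leaves \<open>\<kappa>\<^sup>2 \<rho>\<^sup>2\<close> or \<open>\<kappa>\<^sup>2 x\<^sup>2\<close>.\<close>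

lemma denominator_bound:
  assumes "z \<in> half_plane"
  shows "\<kappa> * norm z powr \<alpha> \<le> norm (z powr of_real \<alpha> + of_real x)" "\<kappa> * x \<le> norm (z powr of_real \<alpha> + of_real x)"
proof -
  define \<phi> where "\<phi> = \<alpha> * Arg z"
  define \<rho> where "\<rho> = norm z powr \<alpha>"
  have z0: "z \<noteq> 0" using Arg_half_plane[OF assms] by auto
  have "z powr of_real \<alpha> = exp (of_real \<alpha> * Ln z)" using z0 by (simp add: powr_def)
  also have "of_real \<alpha> * Ln z = of_real (\<alpha> * ln (norm z)) + \<i> * of_real \<phi>"
    using z0 Arg_eq_Im_Ln[OF z0] by (simp add: complex_eq_iff \<phi>_def)
  also have "exp \<dots> = of_real \<rho> * cis \<phi>"
    using z0 by (simp add: exp_add \<rho>_def powr_def cis_conv_exp flip: exp_of_real)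
  finally have zp: "z powr of_real \<alpha> = of_real \<rho> * cis \<phi>" .
  have rho: "\<rho> \<ge> 0" by (simp add: \<rho>_def)
  have "\<bar>\<phi>\<bar> \<le> \<alpha> * \<theta>" using Arg_half_plane(2)[OF assms] alpha by (simp add: \<phi>_def abs_mult)
  then have "cos (\<alpha> * \<theta>) \<le> cos \<bar>\<phi>\<bar>" using alpha by (intro cos_monotone_0_pi_le) auto
  then have cosge: "cos (\<alpha> * \<theta>) \<le> cos \<phi>" by simp
  have sc: "\<kappa>\<^sup>2 = 1 - (cos (\<alpha> * \<theta>))\<^sup>2" by (simp add: \<kappa>_def sin_squared_eq)
  have "(norm (z powr of_real \<alpha> + of_real x))\<^sup>2 = (\<rho> * cos \<phi> + x)\<^sup>2 + (\<rho> * sin \<phi>)\<^sup>2"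
    by (simp add: zp cmod_power2)
  also have "\<dots> = \<rho>\<^sup>2 * ((sin \<phi>)\<^sup>2 + (cos \<phi>)\<^sup>2) + 2 * (\<rho> * x) * cos \<phi> + x\<^sup>2" by algebra
  also have "\<dots> = \<rho>\<^sup>2 + 2 * (\<rho> * x) * cos \<phi> + x\<^sup>2" by simp
  finally have eq: "(norm (z powr of_real \<alpha> + of_real x))\<^sup>2 = \<rho>\<^sup>2 + 2 * (\<rho> * x) * cos \<phi> + x\<^sup>2" .
  have "(\<rho> * x) * cos (\<alpha> * \<theta>) \<le> (\<rho> * x) * cos \<phi>" using cosge rho x by (intro mult_left_mono) auto
  then have ge: "\<rho>\<^sup>2 + 2 * (\<rho> * x) * cos (\<alpha> * \<theta>) + x\<^sup>2 \<le> (norm (z powr of_real \<alpha> + of_real x))\<^sup>2"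
    unfolding eq by simp
  have "(\<kappa> * \<rho>)\<^sup>2 + (x + \<rho> * cos (\<alpha> * \<theta>))\<^sup>2 = \<rho>\<^sup>2 + 2 * (\<rho> * x) * cos (\<alpha> * \<theta>) + x\<^sup>2"
    "(\<kappa> * x)\<^sup>2 + (\<rho> + x * cos (\<alpha> * \<theta>))\<^sup>2 = \<rho>\<^sup>2 + 2 * (\<rho> * x) * cos (\<alpha> * \<theta>) + x\<^sup>2"
    unfolding power_mult_distrib sc by algebra+
  then have "(\<kappa> * \<rho>)\<^sup>2 \<le> (norm (z powr of_real \<alpha> + of_real x))\<^sup>2" "(\<kappa> * x)\<^sup>2 \<le> (norm (z powr of_real \<alpha> + of_real x))\<^sup>2"
    using ge zero_le_power2[of "x + \<rho> * cos (\<alpha> * \<theta>)"] zero_le_power2[of "\<rho> + x * cos (\<alpha> * \<theta>)"] by linarith+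
  then show "\<kappa> * norm z powr \<alpha> \<le> norm (z powr of_real \<alpha> + of_real x)" "\<kappa> * x \<le> norm (z powr of_real \<alpha> + of_real x)"
    unfolding \<rho>_def[symmetric] by (auto intro: power2_le_imp_le)
qed

lemma denominator_nonzero: assumes "z \<in> half_plane" shows "z powr of_real \<alpha> + of_real x \<noteq> 0"
proof -
  have "0 < \<kappa> * norm z powr \<alpha>" using kappa_pos Arg_half_plane(1)[OF assms] by simp
  with denominator_bound(1)[OF assms] show ?thesis by auto
qed

text \<open>Expanding \<open>e\<^sup>z z\<^sup>\<alpha>\<^sup>-\<^sup>\<beta> / (z\<^sup>\<alpha> + x)\<close> as a geometric series in \<open>- x z\<^sup>-\<^sup>\<alpha>\<close> gives the Hankel kernels of the Mittag-Leffler series;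
this is what is left after \<open>K\<close> terms.\<close>

definition remainder :: "nat \<Rightarrow> complex \<Rightarrow> complex" where
  "remainder K z = (- of_real x) ^ K * (exp z * (z powr of_real (\<alpha> - \<alpha> * real K - \<beta>) / (z powr of_real \<alpha> + of_real x)))"

lemma remainder_holo: "remainder K holomorphic_on half_plane"
  unfolding remainder_def[abs_def] using denominator_nonzero by (intro holomorphic_intros) auto

lemma remainder_real: assumes "y > 0" shows "remainder K (of_real y) \<in> \<real>"
proof -
  have p: "of_real y powr of_real a = (of_real (y powr a) :: complex)" for a
    by (rule powr_of_real) (use assms in auto)
  have "remainder K (of_real y) = of_real ((- x) ^ K * (exp y * (y powr (\<alpha> - \<alpha> * real K - \<beta>) / (y powr \<alpha> + x))))"
    unfolding remainder_def p by (simp add: exp_of_real)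
  then show ?thesis by simp
qed

lemma remainder_bound: 
  assumes "z \<in> half_plane"
  shows "norm (remainder K z) \<le> x ^ K / \<kappa> * (norm (exp z) * norm z powr (- \<alpha> * real K - \<beta>))"
    and "x > 0 \<Longrightarrow> norm (remainder K z) \<le> x ^ K / (\<kappa> * x) * (norm (exp z) * norm z powr (\<alpha> - \<alpha> * real K - \<beta>))"
proof -
  have z: "norm z > 0" using Arg_half_plane(1)[OF assms] by simp
  let ?d = "norm (z powr of_real \<alpha> + of_real x)"
  have n: "norm (remainder K z) = x ^ K * (norm (exp z) * (norm z powr (\<alpha> - \<alpha> * real K - \<beta>) / ?d))"
    using x by (simp only: remainder_def norm_mult norm_divide norm_powr_ray norm_power) simp
  have "norm z powr (\<alpha> - \<alpha> * real K - \<beta>) / ?d \<le> norm z powr (\<alpha> - \<alpha> * real K - \<beta>) / (\<kappa> * norm z powr \<alpha>)"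
    using denominator_bound(1)[OF assms] kappa_pos z by (intro frac_le) auto
  also have "\<dots> = norm z powr (- \<alpha> * real K - \<beta>) / \<kappa>"
  proof -
    have "norm z powr (\<alpha> - \<alpha> * real K - \<beta>) = norm z powr \<alpha> * norm z powr (- \<alpha> * real K - \<beta>)"
      by (simp add: algebra_simps flip: powr_add)
    then show ?thesis using kappa_pos z by simp
  qed
  finally have "x ^ K * (norm (exp z) * (norm z powr (\<alpha> - \<alpha> * real K - \<beta>) / ?d)) \<le> x ^ K * (norm (exp z) * (norm z powr (- \<alpha> * real K - \<beta>) / \<kappa>))"
    using x by (intro mult_left_mono) auto
  then show "norm (remainder K z) \<le> x ^ K / \<kappa> * (norm (exp z) * norm z powr (- \<alpha> * real K - \<beta>))"
    unfolding n by simp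
  assume xp: "x > 0"
  have "norm z powr (\<alpha> - \<alpha> * real K - \<beta>) / ?d \<le> norm z powr (\<alpha> - \<alpha> * real K - \<beta>) / (\<kappa> * x)"
    using denominator_bound(2)[OF assms] kappa_pos xp by (intro frac_le) auto
  then have "x ^ K * (norm (exp z) * (norm z powr (\<alpha> - \<alpha> * real K - \<beta>) / ?d)) \<le> x ^ K * (norm (exp z) * (norm z powr (\<alpha> - \<alpha> * real K - \<beta>) / (\<kappa> * x)))"
    using x by (intro mult_left_mono) auto
  then show "norm (remainder K z) \<le> x ^ K / (\<kappa> * x) * (norm (exp z) * norm z powr (\<alpha> - \<alpha> * real K - \<beta>))"
    unfolding n by simp
qed

lemma remainder_decay:
  assumes "0 < c1"
  obtains C where "C \<ge> 0" "\<And>c r. c \<in> {c1..c2} \<Longrightarrow> r \<ge> 0 \<Longrightarrow> norm (remainder K (ray c r)) \<le> C * exp (- \<delta> * r)"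
proof -
  obtain C where C: "C \<ge> 0" "\<And>c r. c \<in> {c1..c2} \<Longrightarrow> r \<ge> 0 \<Longrightarrow>
      norm (exp (ray c r)) * norm (ray c r) powr (- \<alpha> * real K - \<beta>) \<le> C * exp (- \<delta> * r)"
    using exp_ray_decay[OF assms, of c2 "- \<alpha> * real K - \<beta>"] by blast
  show thesis
  proof (rule that[of "x ^ K / \<kappa> * C"])
    show "0 \<le> x ^ K / \<kappa> * C" using C(1) x kappa_pos by simp
    fix c r :: real assume cr: "c \<in> {c1..c2}" "r \<ge> 0"
    have "norm (remainder K (ray c r)) \<le> x ^ K / \<kappa> * (norm (exp (ray c r)) * norm (ray c r) powr (- \<alpha> * real K - \<beta>))"
      by (rule remainder_bound(1)[OF ray_in_half_plane]) (use cr assms in auto)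
    also have "\<dots> \<le> x ^ K / \<kappa> * (C * exp (- \<delta> * r))"
      using C(2)[OF cr] x kappa_pos by (intro mult_left_mono) auto
    finally show "norm (remainder K (ray c r)) \<le> x ^ K / \<kappa> * C * exp (- \<delta> * r)" by simp
  qed
qed

lemma remainder_step: assumes "z \<in> half_plane" shows "remainder K z = (- of_real x) ^ K * hankel_kernel (\<alpha> * real K + \<beta>) z + remainder (Suc K) z"
proof -
  define p where "p = z powr of_real \<alpha>"
  define q where "q = exp z * z powr of_real (- (\<alpha> * real K + \<beta>))"
  have z: "z \<noteq> 0" using Arg_half_plane(1)[OF assms] .
  have nz: "p + of_real x \<noteq> 0" using denominator_nonzero[OF assms] by (simp add: p_def)
  have "z powr of_real (\<alpha> - \<alpha> * real K - \<beta>) = z powr (of_real \<alpha> + of_real (- (\<alpha> * real K + \<beta>)))"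
    by (rule arg_cong[where f = "\<lambda>a. z powr a"]) (simp add: algebra_simps)
  also have "\<dots> = p * z powr of_real (- (\<alpha> * real K + \<beta>))"
    unfolding p_def by (rule powr_add)
  finally have 1: "remainder K z = (- of_real x) ^ K * (q * (p / (p + of_real x)))"
    by (simp add: remainder_def q_def p_def)
  have "\<alpha> - \<alpha> * real (Suc K) - \<beta> = - (\<alpha> * real K + \<beta>)" by (simp add: algebra_simps)
  then have 2: "remainder (Suc K) z = (- of_real x) ^ K * (q * (- of_real x / (p + of_real x)))"
    by (simp only: remainder_def q_def p_def) simp
  have "p / (p + of_real x) = 1 + (- of_real x / (p + of_real x))"
    using nz by (simp add: field_simps)
  moreover have "hankel_kernel (\<alpha> * real K + \<beta>) z = q" by (simp only: hankel_kernel_def q_def)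
  ultimately show ?thesis unfolding 1 2 by (simp only: distrib_left mult_1_right)
qed

lemma ray_integral_add_scaled:
  assumes "set_integrable lborel {0..} (\<lambda>r. f (ray c r) * w)" "set_integrable lborel {0..} (\<lambda>r. g (ray c r) * w)"
    "c > 0" "\<And>z. z \<in> half_plane \<Longrightarrow> k z = of_real a * f z + g z"
  shows "ray_integral k c = of_real a * ray_integral f c + ray_integral g c"
proof -
  have "ray_integral k c = (LBINT r:{0..}. of_real a * (f (ray c r) * w) + g (ray c r) * w)"
    unfolding ray_integral_def using assms(4)[OF ray_in_half_plane[OF assms(3)]] by (simp add: algebra_simps)
  also have "\<dots> = (LBINT r:{0..}. of_real a * (f (ray c r) * w)) + (LBINT r:{0..}. g (ray c r) * w)"
    by (rule set_integral_add(2)) (use assms in auto)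
  also have "(LBINT r:{0..}. of_real a * (f (ray c r) * w)) = of_real a * ray_integral f c"
    unfolding ray_integral_def by (rule set_integral_mult_right)
  finally show ?thesis by (simp add: ray_integral_def)
qed

lemma Im_ray_integral_remainder_step: "Im (ray_integral (remainder K) 1) = (- x) ^ K * (pi / Gamma (\<alpha> * real K + \<beta>)) + Im (ray_integral (remainder (Suc K)) 1)"
proof -
  obtain C where "C \<ge> 0" and C: "\<And>c r. c \<in> {1..1} \<Longrightarrow> r \<ge> 0 \<Longrightarrow> norm (hankel_kernel (\<alpha> * real K + \<beta>) (ray c r)) \<le> C * exp (- \<delta> * r)"
    by (rule hankel_kernel_decay[of 1 1 "\<alpha> * real K + \<beta>", OF zero_less_one]) (rule that, assumption, blast)
  obtain C' where "C' \<ge> 0" and C': "\<And>c r. c \<in> {1..1} \<Longrightarrow> r \<ge> 0 \<Longrightarrow> norm (remainder (Suc K) (ray c r)) \<le> C' * exp (- \<delta> * r)"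
    by (rule remainder_decay[of 1 1 "Suc K", OF zero_less_one]) (rule that, assumption, blast)
  have "ray_integral (remainder K) 1 = of_real ((- x) ^ K) * ray_integral (hankel_kernel (\<alpha> * real K + \<beta>)) 1 + ray_integral (remainder (Suc K)) 1"
  proof (rule ray_integral_add_scaled)
    show "set_integrable lborel {0..} (\<lambda>r. hankel_kernel (\<alpha> * real K + \<beta>) (ray 1 r) * w)"
      by (rule ray_integral_integrable(1)[OF hankel_kernel_holo zero_less_one C]) auto
    show "set_integrable lborel {0..} (\<lambda>r. remainder (Suc K) (ray 1 r) * w)"
      by (rule ray_integral_integrable(1)[OF remainder_holo zero_less_one C']) auto
    show "remainder K z = of_real ((- x) ^ K) * hankel_kernel (\<alpha> * real K + \<beta>) z + remainder (Suc K) z" if "z \<in> half_plane" for z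
      using remainder_step[OF that, of K] by (simp only: of_real_power of_real_minus)
  qed simp
  moreover have "Im (ray_integral (hankel_kernel (\<alpha> * real K + \<beta>)) 1) = pi / Gamma (\<alpha> * real K + \<beta>)"
    using hankel_rGamma[of "\<alpha> * real K + \<beta>"] alpha beta by (simp add: hankel_def add_nonneg_pos)
  ultimately show ?thesis by (simp flip: of_real_power)
qed

text \<open>The contour is moved so far to the right that \<open>|x z\<^sup>-\<^sup>\<alpha>| \<le> 1/2\<close> on all of it; there the remainders decay geometrically.\<close>

lemma Im_ray_integral_remainder_tendsto: "(\<lambda>K. Im (ray_integral (remainder K) 1)) \<longlonglongrightarrow> 0"
proof -
  \<comment> \<open>Every point of the ray from \<open>\<sigma>\<close> has modulus at least \<open>\<sigma> * sin \<theta>\<close>, hence \<open>2 * x \<le> |z|\<^sup>\<alpha>\<close>.\<close>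
  define \<sigma> where "\<sigma> = max 1 ((2 * x) powr (1 / \<alpha>) / sin \<theta>)"
  have sg: "1 \<le> \<sigma>" "0 < \<sigma>" by (auto simp: \<sigma>_def)
  obtain C where C: "C \<ge> 0" "\<And>c r. c \<in> {\<sigma>..\<sigma>} \<Longrightarrow> r \<ge> 0 \<Longrightarrow> norm (remainder 0 (ray c r)) \<le> C * exp (- \<delta> * r)"
    using remainder_decay[OF sg(2), of \<sigma> 0] by auto
  have b: "norm (remainder K (ray \<sigma> r)) \<le> C * (1/2) ^ K * exp (- \<delta> * r)" if r: "r \<ge> 0" for K r
  proof -
    define z where "z = ray \<sigma> r"
    have zP: "z \<in> half_plane" unfolding z_def by (rule ray_in_half_plane[OF sg(2)])
    then have z0: "z \<noteq> 0" by (rule Arg_half_plane)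
    have "(2 * x) powr (1 / \<alpha>) \<le> \<sigma> * sin \<theta>"
      using sin_pos by (simp add: \<sigma>_def max_def field_simps)
    also have "\<dots> \<le> norm z" unfolding z_def by (rule norm_ray_ge(1)[OF sg(2) r])
    finally have "((2 * x) powr (1 / \<alpha>)) powr \<alpha> \<le> norm z powr \<alpha>"
      using alpha by (intro powr_mono2) auto
    then have "2 * x \<le> norm z powr \<alpha>" using alpha x by (simp add: powr_powr)
    then have "x * norm z powr (- \<alpha>) \<le> 1 / 2"
      using z0 by (simp add: powr_minus field_simps)
    then have le: "(x * norm z powr (- \<alpha>)) ^ K \<le> (1/2) ^ K" using x by (intro power_mono) auto
    have "z powr of_real (\<alpha> - \<alpha> * real K - \<beta>) = z powr (of_real (\<alpha> - \<beta>) + of_real (- \<alpha> * real K))"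
      by (rule arg_cong[where f = "\<lambda>a. z powr a"]) simp
    also have "\<dots> = z powr of_real (\<alpha> - \<beta>) * z powr of_real (- \<alpha> * real K)" by (rule powr_add)
    finally have "remainder K z = ((- of_real x) ^ K * z powr of_real (- \<alpha> * real K)) * remainder 0 z"
      by (simp add: remainder_def)
    moreover have "norm (z powr of_real (- \<alpha> * real K)) = (norm z powr (- \<alpha>)) ^ K"
      unfolding norm_powr_ray using z0 by (simp add: powr_powr flip: powr_realpow)
    ultimately have "norm (remainder K z) = (x * norm z powr (- \<alpha>)) ^ K * norm (remainder 0 z)"
      using x by (simp add: norm_mult norm_power power_mult_distrib)
    also have "\<dots> \<le> (1/2) ^ K * (C * exp (- \<delta> * r))"
      by (intro mult_mono le) (use C(2)[of \<sigma> r] r x in \<open>auto simp: z_def\<close>)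
    finally show ?thesis by (simp add: z_def mult_ac)
  qed
  have eq: "Im (ray_integral (remainder K) 1) = Im (ray_integral (remainder K) \<sigma>)" for K
  proof (rule remainder_decay[of 1 \<sigma> K, OF zero_less_one])
    fix C assume "\<And>c r. c \<in> {1..\<sigma>} \<Longrightarrow> r \<ge> 0 \<Longrightarrow> norm (remainder K (ray c r)) \<le> C * exp (- \<delta> * r)"
    then show ?thesis by (intro Im_ray_integral_shift[OF remainder_holo remainder_real zero_less_one sg(1)])
  qed
  show ?thesis
  proof (rule Lim_null_comparison)
    show "\<forall>\<^sub>F K in sequentially. norm (Im (ray_integral (remainder K) 1)) \<le> C * (1/2) ^ K / \<delta>"
    proof (rule always_eventually, rule allI)
      fix K
      have "norm (ray_integral (remainder K) \<sigma>) \<le> C * (1/2) ^ K / \<delta>"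
        by (rule ray_integral_integrable(2)[OF remainder_holo sg(2) b])
      then show "norm (Im (ray_integral (remainder K) 1)) \<le> C * (1/2) ^ K / \<delta>"
        unfolding eq using abs_Im_le_cmod[of "ray_integral (remainder K) \<sigma>"] by simp
    qed
    have "(\<lambda>K. C * (1/2::real) ^ K / \<delta>) \<longlonglongrightarrow> C * 0 / \<delta>"
      by (intro tendsto_intros LIMSEQ_power_zero) (use delta_pos in auto)
    then show "(\<lambda>K. C * (1/2::real) ^ K / \<delta>) \<longlonglongrightarrow> 0" by simp
  qed
qed

text \<open>The Mittag-Leffler function as a contour integral, by termwise use of Hankel's formula.\<close>

lemma mittag_leffler_contour:
  "(\<lambda>k. (- x) ^ k / Gamma (\<alpha> * real k + \<beta>)) sums (Im (ray_integral (remainder 0) 1) / pi)"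
proof -
  have "(\<Sum>k<K. (- x) ^ k * (pi / Gamma (\<alpha> * real k + \<beta>))) = Im (ray_integral (remainder 0) 1) - Im (ray_integral (remainder K) 1)" for K
  proof (induction K)
    case (Suc K)
    then show ?case using Im_ray_integral_remainder_step[of K] by simp
  qed simp
  then have "(\<lambda>K. \<Sum>k<K. (- x) ^ k * (pi / Gamma (\<alpha> * real k + \<beta>))) \<longlonglongrightarrow> Im (ray_integral (remainder 0) 1) - 0"
    using tendsto_diff[OF tendsto_const Im_ray_integral_remainder_tendsto, of "Im (ray_integral (remainder 0) 1)"] by simp
  then have "(\<lambda>k. (- x) ^ k * (pi / Gamma (\<alpha> * real k + \<beta>))) sums (Im (ray_integral (remainder 0) 1))"
    by (simp add: sums_def)
  from sums_divide[OF this, of pi] show ?thesis by simp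
qed

end

text \<open>The two lower bounds of the denominator in the contour integral give a bound uniform in \<open>x\<close> and a bound of order \<open>1 / x\<close>.\<close>

lemma mittag_leffler_decay:
  fixes \<alpha> \<beta> :: real
  assumes "1 < \<alpha>" "\<alpha> < 2" "\<beta> > 0"
  shows "\<exists>C>0. \<forall>x\<ge>0. \<bar>mittag_leffler \<alpha> \<beta> (- x)\<bar> \<le> C / (1 + x)"
proof -
  define q where "q = pi / \<alpha>"
  \<comment> \<open>The midpoint of \<open>pi / 2\<close> and \<open>pi / \<alpha>\<close>: the ray points into the left half plane and \<open>\<alpha> * \<theta> < pi\<close>.\<close>
  define \<theta> where "\<theta> = pi / 4 + q / 2"
  have "pi / 2 < pi / \<alpha>" "pi / \<alpha> < pi" using assms by (simp_all add: divide_strict_left_mono field_simps)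
  then have pa: "pi / 2 < q" "q < pi" by (simp_all only: q_def)
  have th: "pi / 2 < \<theta>" using pa unfolding \<theta>_def by linarith
  have th': "\<theta> < pi" using pa unfolding \<theta>_def by linarith
  have th3: "\<theta> < q" using pa unfolding \<theta>_def by linarith
  interpret ray \<theta> by unfold_locales (use th th' in auto)
  have at: "\<alpha> * \<theta> < pi" using th3 assms unfolding q_def by (simp add: field_simps)
  define \<nu> where "\<nu> = sin (\<alpha> * \<theta>)"
  obtain C1 where C1: "C1 \<ge> 0" "\<And>r. r \<ge> 0 \<Longrightarrow> norm (exp (ray 1 r)) * norm (ray 1 r) powr (- \<beta>) \<le> C1 * exp (- \<delta> * r)"
    using exp_ray_decay[of 1 1 "- \<beta>"] by auto
  obtain C2 where C2: "C2 \<ge> 0" "\<And>r. r \<ge> 0 \<Longrightarrow> norm (exp (ray 1 r)) * norm (ray 1 r) powr (\<alpha> - \<beta>) \<le> C2 * exp (- \<delta> * r)"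
    using exp_ray_decay[of 1 1 "\<alpha> - \<beta>"] by auto
  have kp: "\<nu> > 0" unfolding \<nu>_def by (rule sin_gt_zero) (use assms at th th' in \<open>auto intro!: mult_pos_pos\<close>)
  define D where "D = (C1 + C2) / (\<nu> * \<delta> * pi) + 1"
  have "\<bar>mittag_leffler \<alpha> \<beta> (- x)\<bar> \<le> 2 * D / (1 + x)" if x: "x \<ge> 0" for x
  proof -
    interpret ml_ray \<theta> \<alpha> \<beta> x by unfold_locales (use assms at x in auto)
    have k: "\<kappa> = \<nu>" by (simp add: \<kappa>_def \<nu>_def)
    have E: "mittag_leffler \<alpha> \<beta> (- x) = Im (ray_integral (remainder 0) 1) / pi"
      unfolding mittag_leffler_def using mittag_leffler_contour by (simp add: sums_iff)
    have integral_bound: "norm (ray_integral (remainder 0) 1) \<le> (C1 / \<nu>) / \<delta>"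
    proof (rule ray_integral_integrable(2)[OF remainder_holo])
      fix r :: real assume r: "r \<ge> 0"
      have "norm (remainder 0 (ray 1 r)) \<le> 1 / \<nu> * (norm (exp (ray 1 r)) * norm (ray 1 r) powr (- \<beta>))"
        using remainder_bound(1)[of "ray 1 r" 0] ray_in_half_plane[of 1 r] k by simp
      also have "\<dots> \<le> 1 / \<nu> * (C1 * exp (- \<delta> * r))" using C1(2)[OF r] kp by (intro mult_left_mono) auto
      finally show "norm (remainder 0 (ray 1 r)) \<le> C1 / \<nu> * exp (- \<delta> * r)" by simp
    qed simp
    then have "\<bar>mittag_leffler \<alpha> \<beta> (- x)\<bar> \<le> C1 / \<nu> / \<delta> / pi"
    proof -
      have "\<bar>Im (ray_integral (remainder 0) 1)\<bar> \<le> C1 / \<nu> / \<delta>" using abs_Im_le_cmod[of "ray_integral (remainder 0) 1"] integral_bound by linarith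
      then have "\<bar>Im (ray_integral (remainder 0) 1)\<bar> / pi \<le> C1 / \<nu> / \<delta> / pi" by (rule divide_right_mono) simp
      then show ?thesis unfolding E by simp
    qed
    also have "\<dots> = C1 / (\<nu> * \<delta> * pi)" by simp
    also have "\<dots> \<le> D" using C1 C2 kp delta_pos by (simp add: D_def add_divide_distrib)
    finally have b1: "\<bar>mittag_leffler \<alpha> \<beta> (- x)\<bar> \<le> D" .
    show ?thesis
    proof (cases "x \<le> 1")
      case True
      have "D * (1 + x) \<le> D * 2" using True x b1 by (intro mult_left_mono) auto
      then have "D \<le> 2 * D / (1 + x)" using x by (simp add: field_simps)
      then show ?thesis using b1 by simp
    next
      case False
      have integral_bound: "norm (ray_integral (remainder 0) 1) \<le> (C2 / (\<nu> * x)) / \<delta>"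
      proof (rule ray_integral_integrable(2)[OF remainder_holo])
        fix r :: real assume r: "r \<ge> 0"
        have "norm (remainder 0 (ray 1 r)) \<le> 1 / (\<nu> * x) * (norm (exp (ray 1 r)) * norm (ray 1 r) powr (\<alpha> - \<beta>))"
          using remainder_bound(2)[of "ray 1 r" 0] ray_in_half_plane[of 1 r] k False by simp
        also have "\<dots> \<le> 1 / (\<nu> * x) * (C2 * exp (- \<delta> * r))" using C2(2)[OF r] kp False by (intro mult_left_mono) auto
        finally show "norm (remainder 0 (ray 1 r)) \<le> C2 / (\<nu> * x) * exp (- \<delta> * r)" by simp
      qed simp
      then have "\<bar>mittag_leffler \<alpha> \<beta> (- x)\<bar> \<le> C2 / (\<nu> * x) / \<delta> / pi"
      proof -
        have "\<bar>Im (ray_integral (remainder 0) 1)\<bar> \<le> C2 / (\<nu> * x) / \<delta>" using abs_Im_le_cmod[of "ray_integral (remainder 0) 1"] integral_bound by linarith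
        then have "\<bar>Im (ray_integral (remainder 0) 1)\<bar> / pi \<le> C2 / (\<nu> * x) / \<delta> / pi" by (rule divide_right_mono) simp
        then show ?thesis unfolding E by simp
      qed
      also have "\<dots> = (C2 / (\<nu> * \<delta> * pi)) / x" by simp
      also have "\<dots> \<le> D / x" using C1 C2 kp delta_pos False
        by (intro divide_right_mono) (auto simp: D_def add_divide_distrib)
      also have "\<dots> \<le> 2 * D / (1 + x)"
      proof -
        have "D \<ge> 0" using b1 by linarith
        then have "D * (1 + x) \<le> D * (2 * x)" using False by (intro mult_left_mono) auto
        then show ?thesis using False by (simp add: field_simps)
      qed
      finally show ?thesis .
    qed
  qed
  moreover have "2 * D > 0" using C1 C2 kp delta_pos by (simp add: D_def add_nonneg_pos)
  ultimately show ?thesis by blast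
qed

section \<open>Mittag-Leffler kernels\<close>

lemma nonneg_has_integral_lebesgue_on:
  fixes f :: "real \<Rightarrow> real"
  assumes "(f has_integral I) S" "\<And>x. x \<in> S \<Longrightarrow> f x \<ge> 0" "S \<in> sets lebesgue"
  shows "integrable (lebesgue_on S) f" "(LINT x|lebesgue_on S. f x) = I"
proof -
  have "f absolutely_integrable_on S"
    by (rule nonnegative_absolutely_integrable_1) (use assms in auto)
  then show 1: "integrable (lebesgue_on S) f"
    by (rule absolutely_integrable_imp_integrable[OF _ assms(3)])
  show "(LINT x|lebesgue_on S. f x) = I"
    using lebesgue_integral_eq_integral[OF 1 assms(3)] integral_unique[OF assms(1)] by simp
qed

lemma beta_kernel_integral:
  assumes "a > 0" "b > 0" "t > (0::real)"
  shows "integrable (lebesgue_on {0<..<t}) (\<lambda>\<tau>. (t - \<tau>) powr (a - 1) * \<tau> powr (b - 1))"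
    and "(LINT \<tau>|lebesgue_on {0<..<t}. (t - \<tau>) powr (a - 1) * \<tau> powr (b - 1)) = t powr (a + b - 1) * Beta a b"
proof -
  have "((\<lambda>u. u powr (b - 1) * (1 - u) powr (a - 1)) has_integral Beta b a) {0..1}"
    by (rule has_integral_Beta_real[OF assms(2,1)])
  from has_integral_stretch_real[OF this, of "1 / t"] assms(3)
  have 1: "((\<lambda>\<tau>. (\<tau> / t) powr (b - 1) * (1 - \<tau> / t) powr (a - 1)) has_integral t * Beta b a) ((\<lambda>x. x * t) ` {0..1})"
    by simp
  have "(\<lambda>x. x * t) ` {0..1} = {0..t}"
  proof
    show "{0..t} \<subseteq> (\<lambda>x. x * t) ` {0..1}"
    proof
      fix y assume "y \<in> {0..t}"
      then show "y \<in> (\<lambda>x. x * t) ` {0..1}" using assms(3) by (intro image_eqI[of _ _ "y / t"]) auto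
    qed
  qed (use assms(3) in auto)
  with 1 have "((\<lambda>\<tau>. (\<tau> / t) powr (b - 1) * (1 - \<tau> / t) powr (a - 1)) has_integral t * Beta b a) {0<..<t}"
    by (simp add: has_integral_Icc_iff_Ioo)
  from has_integral_mult_right[OF this, of "t powr (a + b - 2)"]
  have "((\<lambda>\<tau>. t powr (a + b - 2) * ((\<tau> / t) powr (b - 1) * (1 - \<tau> / t) powr (a - 1))) has_integral t powr (a + b - 2) * (t * Beta b a)) {0<..<t}" .
  moreover have "t powr (a + b - 2) * (t * Beta b a) = t powr (a + b - 1) * Beta a b"
  proof -
    have "t powr (a + b - 2) * t = t powr (a + b - 2 + 1)" using assms(3) by (subst powr_add) simp
    then show ?thesis by (simp add: Beta_commute mult.assoc[symmetric])
  qed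
  moreover have keq: "t powr (a + b - 2) * ((\<tau> / t) powr (b - 1) * (1 - \<tau> / t) powr (a - 1)) = (t - \<tau>) powr (a - 1) * \<tau> powr (b - 1)"
    if "\<tau> \<in> {0<..<t}" for \<tau>
  proof -
    have "1 - \<tau> / t = (t - \<tau>) / t" using assms(3) by (simp add: field_simps)
    then have "(\<tau> / t) powr (b - 1) * (1 - \<tau> / t) powr (a - 1) = (\<tau> powr (b - 1) / t powr (b - 1)) * ((t - \<tau>) powr (a - 1) / t powr (a - 1))"
      using that assms(3) by (simp add: powr_divide)
    moreover have "t powr (a + b - 2) = t powr (b - 1) * t powr (a - 1)" by (simp add: add.commute flip: powr_add)
    ultimately show ?thesis using assms(3) by simp
  qed
  ultimately have "((\<lambda>\<tau>. (t - \<tau>) powr (a - 1) * \<tau> powr (b - 1)) has_integral t powr (a + b - 1) * Beta a b) {0<..<t}"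
    using has_integral_eq[OF keq] by (simp only:)
  from nonneg_has_integral_lebesgue_on[OF this]
  show "integrable (lebesgue_on {0<..<t}) (\<lambda>\<tau>. (t - \<tau>) powr (a - 1) * \<tau> powr (b - 1))"
    "(LINT \<tau>|lebesgue_on {0<..<t}. (t - \<tau>) powr (a - 1) * \<tau> powr (b - 1)) = t powr (a + b - 1) * Beta a b" by auto
qed

lemma mittag_leffler_summable:
  fixes z :: real
  assumes "1 < \<alpha>" "\<beta> > 0"
  shows "summable (\<lambda>k. \<bar>z ^ k / Gamma (\<alpha> * real k + \<beta>)\<bar>)"
proof (rule summable_comparison_test')
  have "summable (\<lambda>k. \<bar>z\<bar> * (\<bar>z\<bar> ^ k / fact k))"
    using summable_exp[of "\<bar>z\<bar>"] by (intro summable_mult) (simp add: field_simps)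
  then have "summable (\<lambda>k. \<bar>z\<bar> ^ Suc k / fact (Suc k - 1))" by (simp add: field_simps)
  then show "summable (\<lambda>k. \<bar>z\<bar> ^ k / fact (k - 1))" by (subst (asm) summable_Suc_iff)
  fix k :: nat assume k: "2 \<le> k"
  have "real k < \<alpha> * real k + \<beta>" using assms k by (smt (verit) mult_le_cancel_right1 of_nat_0_le_iff)
  then have "Gamma (real k) < Gamma (\<alpha> * real k + \<beta>)" using k by (intro Gamma_real_strict_mono) auto
  moreover have "Gamma (real k) = fact (k - 1)"
    using Gamma_fact[of "k - 1", where ?'a = real] k by (simp add: of_nat_diff)
  moreover have "(fact (k - 1) :: real) > 0" by simp
  ultimately show "norm \<bar>z ^ k / Gamma (\<alpha> * real k + \<beta>)\<bar> \<le> \<bar>z\<bar> ^ k / fact (k - 1)"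
    by (simp add: abs_divide power_abs) (intro frac_le, auto)
qed

lemma mittag_leffler_isCont:
  assumes "1 < \<alpha>" "\<beta> > 0"
  shows "isCont (mittag_leffler \<alpha> \<beta>) z"
proof -
  have "isCont (\<lambda>x. \<Sum>k. (1 / Gamma (\<alpha> * real k + \<beta>)) * x ^ k) z"
    by (rule isCont_powser_converges_everywhere)
      (use summable_rabs_cancel[OF mittag_leffler_summable[OF assms]] in simp)
  then show ?thesis by (simp add: mittag_leffler_def[abs_def])
qed

lemma mittag_leffler_0: assumes "\<beta> > 0" shows "mittag_leffler \<alpha> \<beta> 0 = 1 / Gamma \<beta>"
  unfolding mittag_leffler_def by (subst suminf_finite[of "{0}"]) auto

lemma mittag_leffler_recurrence:
  assumes "1 < \<alpha>" "\<beta> > 0"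
  shows "mittag_leffler \<alpha> \<beta> z = 1 / Gamma \<beta> + z * mittag_leffler \<alpha> (\<alpha> + \<beta>) z"
proof -
  have s: "summable (\<lambda>k. z ^ k / Gamma (\<alpha> * real k + \<beta>))" if "\<beta> > 0" for \<beta>
    by (rule summable_rabs_cancel[OF mittag_leffler_summable[OF assms(1) that]])
  have "mittag_leffler \<alpha> \<beta> z = 1 / Gamma \<beta> + (\<Sum>k. z ^ Suc k / Gamma (\<alpha> * real (Suc k) + \<beta>))"
    unfolding mittag_leffler_def using suminf_split_head[OF s[OF assms(2)]] by simp
  also have "(\<lambda>k. z ^ Suc k / Gamma (\<alpha> * real (Suc k) + \<beta>)) = (\<lambda>k. z * (z ^ k / Gamma (\<alpha> * real k + (\<alpha> + \<beta>))))"
    by (simp add: algebra_simps)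
  also have "suminf \<dots> = z * mittag_leffler \<alpha> (\<alpha> + \<beta>) z"
    unfolding mittag_leffler_def by (rule suminf_mult) (rule s, use assms in auto)
  finally show ?thesis .
qed

text \<open>As functions of \<open>t\<close> these kernels are closed under fractional integration, which raises \<open>\<beta>\<close>. The coefficients of the
solution and of its derivatives are combinations of them.\<close>

definition ml_kernel :: "real \<Rightarrow> real \<Rightarrow> real \<Rightarrow> real \<Rightarrow> real" where
  "ml_kernel \<alpha> lam \<beta> t = t powr (\<beta> - 1) * mittag_leffler \<alpha> \<beta> (- lam * t powr \<alpha>)"

text \<open>Termwise integration of the Mittag-Leffler series; each term is a Beta integral.\<close>

lemma ml_kernel_frac_integral:
  assumes "1 < \<alpha>" "\<beta> > 0" "\<gamma> > 0" "t > 0"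
  shows "integrable (lebesgue_on {0<..<t}) (\<lambda>\<tau>. (t - \<tau>) powr (\<gamma> - 1) * ml_kernel \<alpha> lam \<beta> \<tau>)"
    and "frac_integral \<gamma> (ml_kernel \<alpha> lam \<beta>) t = ml_kernel \<alpha> lam (\<beta> + \<gamma>) t"
proof -
  define M where "M = lebesgue_on {0<..<t}"
  define c where "c = (\<lambda>k. (- lam) ^ k / Gamma (\<alpha> * real k + \<beta>))"
  define f where "f = (\<lambda>k \<tau>. c k * ((t - \<tau>) powr (\<gamma> - 1) * \<tau> powr ((\<alpha> * real k + \<beta>) - 1)))"
  have pos: "\<alpha> * real k + \<beta> > 0" for k using assms by (simp add: add_nonneg_pos)
  have fi: "integrable M (f k)" for k
    unfolding f_def M_def by (intro integrable_mult_right beta_kernel_integral assms pos)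
  have pw: "\<tau> powr ((\<alpha> * real k + \<beta>) - 1) = \<tau> powr (\<beta> - 1) * (\<tau> powr \<alpha>) ^ k" if "\<tau> > 0" for \<tau> k
  proof -
    have "(\<alpha> * real k + \<beta>) - 1 = (\<beta> - 1) + \<alpha> * real k" by simp
    then have "\<tau> powr ((\<alpha> * real k + \<beta>) - 1) = \<tau> powr (\<beta> - 1) * \<tau> powr (\<alpha> * real k)" by (simp only: powr_add)
    also have "\<tau> powr (\<alpha> * real k) = (\<tau> powr \<alpha>) ^ k" using that by (simp add: powr_powr flip: powr_realpow)
    finally show ?thesis .
  qed
  have fk: "f k \<tau> = (t - \<tau>) powr (\<gamma> - 1) * \<tau> powr (\<beta> - 1) * ((- lam * \<tau> powr \<alpha>) ^ k / Gamma (\<alpha> * real k + \<beta>))" if "\<tau> > 0" for k \<tau>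
    unfolding f_def c_def pw[OF that] by (simp flip: power_mult_distrib)
  have fs: "summable (\<lambda>k. norm (f k \<tau>))" if "\<tau> > 0" for \<tau>
  proof -
    have "norm (f k \<tau>) = \<bar>(t - \<tau>) powr (\<gamma> - 1) * \<tau> powr (\<beta> - 1)\<bar> * \<bar>(- lam * \<tau> powr \<alpha>) ^ k / Gamma (\<alpha> * real k + \<beta>)\<bar>" for k
      by (simp only: fk[OF that] real_norm_def abs_mult)
    then show ?thesis by (simp only:) (intro summable_mult mittag_leffler_summable assms)
  qed
  have fsum: "(\<Sum>k. f k \<tau>) = (t - \<tau>) powr (\<gamma> - 1) * ml_kernel \<alpha> lam \<beta> \<tau>" if "\<tau> > 0" for \<tau>
  proof -
    have "(\<Sum>k. f k \<tau>) = (t - \<tau>) powr (\<gamma> - 1) * \<tau> powr (\<beta> - 1) * mittag_leffler \<alpha> \<beta> (- lam * \<tau> powr \<alpha>)"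
      unfolding fk[OF that] mittag_leffler_def
      by (rule suminf_mult) (rule summable_rabs_cancel[OF mittag_leffler_summable[OF assms(1,2)]])
    then show ?thesis by (simp add: ml_kernel_def mult_ac)
  qed
  have tpw: "t powr (\<gamma> + (\<alpha> * real k + \<beta>) - 1) = t powr (\<beta> + \<gamma> - 1) * (t powr \<alpha>) ^ k" for k
  proof -
    have "\<gamma> + (\<alpha> * real k + \<beta>) - 1 = (\<beta> + \<gamma> - 1) + \<alpha> * real k" by simp
    then have "t powr (\<gamma> + (\<alpha> * real k + \<beta>) - 1) = t powr (\<beta> + \<gamma> - 1) * t powr (\<alpha> * real k)" by (simp only: powr_add)
    also have "t powr (\<alpha> * real k) = (t powr \<alpha>) ^ k" using assms by (simp add: powr_powr flip: powr_realpow)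
    finally show ?thesis .
  qed
  have bet: "1 / Gamma (\<alpha> * real k + \<beta>) * Beta \<gamma> (\<alpha> * real k + \<beta>) = Gamma \<gamma> / Gamma (\<alpha> * real k + (\<beta> + \<gamma>))" for k
  proof -
    have "Gamma (\<alpha> * real k + \<beta>) \<noteq> 0" using Gamma_real_pos[OF pos[of k]] by simp
    moreover have "\<gamma> + (\<alpha> * real k + \<beta>) = \<alpha> * real k + (\<beta> + \<gamma>)" by simp
    ultimately show ?thesis by (simp only: Beta_def) simp
  qed
  have fint: "(LINT \<tau>|M. f k \<tau>) = t powr (\<beta> + \<gamma> - 1) * Gamma \<gamma> * ((- lam * t powr \<alpha>) ^ k / Gamma (\<alpha> * real k + (\<beta> + \<gamma>)))" for k
  proof -
    have "(LINT \<tau>|M. f k \<tau>) = c k * (t powr (\<gamma> + (\<alpha> * real k + \<beta>) - 1) * Beta \<gamma> (\<alpha> * real k + \<beta>))"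
      unfolding f_def M_def using beta_kernel_integral(2)[OF assms(3) pos assms(4), of k] by simp
    also have "\<dots> = t powr (\<beta> + \<gamma> - 1) * ((- lam) ^ k * (t powr \<alpha>) ^ k) * (1 / Gamma (\<alpha> * real k + \<beta>) * Beta \<gamma> (\<alpha> * real k + \<beta>))"
      unfolding tpw c_def by simp
    also have "\<dots> = t powr (\<beta> + \<gamma> - 1) * ((- lam) ^ k * (t powr \<alpha>) ^ k) * (Gamma \<gamma> / Gamma (\<alpha> * real k + (\<beta> + \<gamma>)))"
      by (simp only: bet)
    finally show ?thesis by (simp flip: power_mult_distrib)
  qed
  have fnint: "(LINT \<tau>|M. norm (f k \<tau>)) = \<bar>LINT \<tau>|M. f k \<tau>\<bar>" for k
  proof -
    have "(LINT \<tau>|M. norm (f k \<tau>)) = (LINT \<tau>|M. \<bar>c k\<bar> * ((t - \<tau>) powr (\<gamma> - 1) * \<tau> powr ((\<alpha> * real k + \<beta>) - 1)))"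
      by (rule Bochner_Integration.integral_cong) (auto simp: f_def abs_mult)
    also have "\<dots> = \<bar>c k\<bar> * (LINT \<tau>|M. (t - \<tau>) powr (\<gamma> - 1) * \<tau> powr ((\<alpha> * real k + \<beta>) - 1))" by simp
    also have "\<dots> = \<bar>c k * (LINT \<tau>|M. (t - \<tau>) powr (\<gamma> - 1) * \<tau> powr ((\<alpha> * real k + \<beta>) - 1))\<bar>"
      by (simp add: abs_mult)
    also have "c k * (LINT \<tau>|M. (t - \<tau>) powr (\<gamma> - 1) * \<tau> powr ((\<alpha> * real k + \<beta>) - 1)) = (LINT \<tau>|M. f k \<tau>)"
      unfolding f_def by simp
    finally show ?thesis .
  qed
  have sn: "summable (\<lambda>k. LINT \<tau>|M. norm (f k \<tau>))"
    unfolding fnint fint abs_mult[of "t powr (\<beta> + \<gamma> - 1) * Gamma \<gamma>"]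
    by (intro summable_mult mittag_leffler_summable) (use assms in auto)
  have ae: "AE \<tau> in M. summable (\<lambda>k. norm (f k \<tau>))"
    by (rule AE_I2) (use fs in \<open>auto simp: M_def\<close>)
  have eq: "\<tau> \<in> space M \<Longrightarrow> (\<Sum>k. f k \<tau>) = (t - \<tau>) powr (\<gamma> - 1) * ml_kernel \<alpha> lam \<beta> \<tau>" for \<tau>
    using fsum by (auto simp: M_def)
  have "integrable M (\<lambda>\<tau>. \<Sum>k. f k \<tau>)" by (rule integrable_suminf[OF fi ae sn])
  then show "integrable (lebesgue_on {0<..<t}) (\<lambda>\<tau>. (t - \<tau>) powr (\<gamma> - 1) * ml_kernel \<alpha> lam \<beta> \<tau>)"
    unfolding M_def[symmetric] by (subst (asm) Bochner_Integration.integrable_cong[OF refl eq])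
  have "(LINT \<tau>|M. (t - \<tau>) powr (\<gamma> - 1) * ml_kernel \<alpha> lam \<beta> \<tau>) = (LINT \<tau>|M. (\<Sum>k. f k \<tau>))"
    by (rule Bochner_Integration.integral_cong[OF refl eq[symmetric]])
  also have "\<dots> = (\<Sum>k. (LINT \<tau>|M. f k \<tau>))" by (rule integral_suminf[OF fi ae sn])
  also have "\<dots> = t powr (\<beta> + \<gamma> - 1) * Gamma \<gamma> * mittag_leffler \<alpha> (\<beta> + \<gamma>) (- lam * t powr \<alpha>)"
    unfolding fint mittag_leffler_def
    by (rule suminf_mult) (rule summable_rabs_cancel[OF mittag_leffler_summable[OF assms(1)]], use assms in auto)
  finally show "frac_integral \<gamma> (ml_kernel \<alpha> lam \<beta>) t = ml_kernel \<alpha> lam (\<beta> + \<gamma>) t"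
    using Gamma_real_pos[OF assms(3)] by (simp add: frac_integral_def M_def ml_kernel_def)
qed

lemma ml_kernel_integral:
  assumes "1 < \<alpha>" "\<beta> > 0" "t \<ge> 0"
  shows "integrable (lebesgue_on {0..t}) (ml_kernel \<alpha> lam \<beta>)"
    and "(LINT \<tau>|lebesgue_on {0..t}. ml_kernel \<alpha> lam \<beta> \<tau>) = ml_kernel \<alpha> lam (\<beta> + 1) t"
proof -
  have "integrable (lebesgue_on {0..t}) (ml_kernel \<alpha> lam \<beta>) \<and> (LINT \<tau>|lebesgue_on {0..t}. ml_kernel \<alpha> lam \<beta> \<tau>) = ml_kernel \<alpha> lam (\<beta> + 1) t"
  proof (cases "t = 0")
    case True
    have n: "{0::real} \<in> null_sets lebesgue" by simp
    have "integrable (lebesgue_on {0}) (ml_kernel \<alpha> lam \<beta>)"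
      using absolutely_integrable_on_null[of "0::real" 0 "ml_kernel \<alpha> lam \<beta>"]
      by (intro absolutely_integrable_imp_integrable) auto
    moreover have "(LINT \<tau>|lebesgue_on {0}. ml_kernel \<alpha> lam \<beta> \<tau>) = 0"
      by (subst lebesgue_integral_eq_integral[OF calculation]) auto
    ultimately show ?thesis using True assms by (simp add: ml_kernel_def)
  next
    case False
    then have t: "t > 0" using assms by simp
    have eq: "\<tau> \<in> space (lebesgue_on {0<..<t}) \<Longrightarrow> (t - \<tau>) powr (1 - 1) * ml_kernel \<alpha> lam \<beta> \<tau> = ml_kernel \<alpha> lam \<beta> \<tau>" for \<tau>
      by simp
    have i: "integrable (lebesgue_on {0<..<t}) (ml_kernel \<alpha> lam \<beta>)"
      using ml_kernel_frac_integral(1)[OF assms(1,2) zero_less_one t, of lam] by (subst (asm) Bochner_Integration.integrable_cong[OF refl eq])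
    then have "(ml_kernel \<alpha> lam \<beta>) absolutely_integrable_on {0<..<t}"
      by (simp add: set_integrable_def integrable_restrict_space)
    then have ai: "(ml_kernel \<alpha> lam \<beta>) absolutely_integrable_on {0..t}"
      by (simp add: absolutely_integrable_on_Icc_iff_Ioo)
    then have i2: "integrable (lebesgue_on {0..t}) (ml_kernel \<alpha> lam \<beta>)"
      by (rule absolutely_integrable_imp_integrable) simp
    have "(LINT \<tau>|lebesgue_on {0..t}. ml_kernel \<alpha> lam \<beta> \<tau>) = (LINT \<tau>|lebesgue_on {0<..<t}. ml_kernel \<alpha> lam \<beta> \<tau>)"
      by (subst (1 2) lebesgue_integral_eq_integral) (use i i2 in \<open>auto simp: integral_open_interval_real\<close>)
    also have "\<dots> = (LINT \<tau>|lebesgue_on {0<..<t}. (t - \<tau>) powr (1 - 1) * ml_kernel \<alpha> lam \<beta> \<tau>)"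
      by (rule Bochner_Integration.integral_cong[OF refl eq[symmetric]])
    also have "\<dots> = frac_integral 1 (ml_kernel \<alpha> lam \<beta>) t"
      by (simp add: frac_integral_def)
    also have "\<dots> = ml_kernel \<alpha> lam (\<beta> + 1) t" by (rule ml_kernel_frac_integral(2)[OF assms(1,2) zero_less_one t])
    finally show ?thesis using i2 by simp
  qed
  then show "integrable (lebesgue_on {0..t}) (ml_kernel \<alpha> lam \<beta>)" "(LINT \<tau>|lebesgue_on {0..t}. ml_kernel \<alpha> lam \<beta> \<tau>) = ml_kernel \<alpha> lam (\<beta> + 1) t"
    by auto
qed

text \<open>By the decay of the Mittag-Leffler function at \<open>- x\<close>, where \<open>x = lam * t\<^sup>\<alpha>\<close>, this comes down to \<open>x\<^sup>\<gamma> \<le> 1 + x\<close>. The exponent \<open>\<gamma>\<close> is chosen later according to the space in which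
convergence is wanted.\<close>

lemma ml_kernel_bound:
  assumes "1 < \<alpha>" "\<alpha> < 2" "\<beta> > 0"
  shows "\<exists>C>0. \<forall>\<gamma>\<in>{0..1}. \<forall>lam>0. \<forall>t>0. lam powr \<gamma> * \<bar>ml_kernel \<alpha> lam \<beta> t\<bar> \<le> C * t powr (\<beta> - 1 - \<alpha> * \<gamma>)"
proof -
  obtain C where C: "C > 0" "\<And>x. x \<ge> 0 \<Longrightarrow> \<bar>mittag_leffler \<alpha> \<beta> (- x)\<bar> \<le> C / (1 + x)"
    using mittag_leffler_decay[OF assms] by blast
  have "lam powr \<gamma> * \<bar>ml_kernel \<alpha> lam \<beta> t\<bar> \<le> C * t powr (\<beta> - 1 - \<alpha> * \<gamma>)"
    if g: "\<gamma> \<in> {0..1}" and l: "lam > 0" and t: "t > 0" for \<gamma> lam t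
  proof -
    define x where "x = lam * t powr \<alpha>"
    have x: "x > 0" using l t by (simp add: x_def)
    have "x powr \<gamma> \<le> 1 + x"
    proof (cases "x \<le> 1")
      case True
      then have "x powr \<gamma> \<le> 1" using x g by (simp add: powr_le1)
      then show ?thesis using x by simp
    next
      case False
      then have "x powr \<gamma> \<le> x powr 1" using g by (intro powr_mono) auto
      then show ?thesis using x by simp
    qed
    then have le: "x powr \<gamma> * (C / (1 + x)) \<le> C" using C(1) x mult_left_mono[of "x powr \<gamma>" "1 + x" C] by (simp add: field_simps)
    have "lam powr \<gamma> * \<bar>ml_kernel \<alpha> lam \<beta> t\<bar> = lam powr \<gamma> * t powr (\<beta> - 1) * \<bar>mittag_leffler \<alpha> \<beta> (- x)\<bar>"
      by (simp add: ml_kernel_def x_def abs_mult)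
    also have "\<dots> \<le> lam powr \<gamma> * t powr (\<beta> - 1) * (C / (1 + x))"
      using C(2)[of x] x by (intro mult_left_mono) auto
    also have lx: "lam powr \<gamma> = x powr \<gamma> * t powr (- \<alpha> * \<gamma>)"
      using l t by (simp add: x_def powr_mult powr_powr powr_minus)
    also have "x powr \<gamma> * t powr (- \<alpha> * \<gamma>) * t powr (\<beta> - 1) * (C / (1 + x)) = (x powr \<gamma> * (C / (1 + x))) * (t powr (- \<alpha> * \<gamma>) * t powr (\<beta> - 1))"
      by (simp only: mult_ac)
    also have "\<dots> \<le> C * (t powr (- \<alpha> * \<gamma>) * t powr (\<beta> - 1))" by (rule mult_right_mono[OF le]) simp
    also have "t powr (- \<alpha> * \<gamma>) * t powr (\<beta> - 1) = t powr (\<beta> - 1 - \<alpha> * \<gamma>)"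
      by (simp flip: powr_add)
    finally show ?thesis unfolding lx[symmetric] .
  qed
  then show ?thesis using C(1) by blast
qed

lemma ml_kernel_continuous:
  assumes "1 < \<alpha>" "\<beta> > 0"
  shows "continuous_on {0<..} (ml_kernel \<alpha> lam \<beta>)" and "\<beta> > 1 \<Longrightarrow> continuous_on {0..} (ml_kernel \<alpha> lam \<beta>)"
    and "continuous_on {0..} (\<lambda>t. mittag_leffler \<alpha> \<beta> (- lam * t powr \<alpha>))"
proof -
  have ml: "continuous_on UNIV (mittag_leffler \<alpha> \<beta>)"
    using mittag_leffler_isCont[OF assms] by (simp add: continuous_at_imp_continuous_on)
  show 1: "continuous_on {0..} (\<lambda>t. mittag_leffler \<alpha> \<beta> (- lam * t powr \<alpha>))"
    by (rule continuous_on_compose2[OF ml]) (use assms in \<open>auto intro!: continuous_intros continuous_on_powr'\<close>)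
  show "continuous_on {0<..} (ml_kernel \<alpha> lam \<beta>)" unfolding ml_kernel_def[abs_def]
    by (intro continuous_on_mult continuous_on_subset[OF 1]) (auto intro!: continuous_intros)
  show "continuous_on {0..} (ml_kernel \<alpha> lam \<beta>)" if "\<beta> > 1" unfolding ml_kernel_def[abs_def]
    by (intro continuous_on_mult 1 continuous_on_powr') (use that in \<open>auto intro!: continuous_intros\<close>)
qed

lemma ml_kernel_1: "t > 0 \<Longrightarrow> ml_kernel \<alpha> lam 1 t = mittag_leffler \<alpha> 1 (- lam * t powr \<alpha>)"
  and ml_kernel_2: "t \<ge> 0 \<Longrightarrow> ml_kernel \<alpha> lam 2 t = t * mittag_leffler \<alpha> 2 (- lam * t powr \<alpha>)"
  by (auto simp: ml_kernel_def)

lemma integral_has_derivative_lebesgue_on: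
  fixes f g :: "real \<Rightarrow> real"
  assumes cont: "continuous_on {0..T} g" and eq: "\<And>t. t \<in> {0..T} \<Longrightarrow> f t = c + k * (LINT \<tau>|lebesgue_on {0..t}. g \<tau>)" and t: "t \<in> {0..T}"
  shows "(f has_real_derivative k * g t) (at t within {0..T})"
proof -
  have i: "(LINT \<tau>|lebesgue_on {0..t}. g \<tau>) = integral {0..t} g" if "t \<in> {0..T}" for t
  proof -
    have "continuous_on {0..t} g" using cont by (rule continuous_on_subset) (use that in auto)
    then have "integrable (lebesgue_on {0..t}) g"
      by (intro absolutely_integrable_imp_integrable absolutely_integrable_continuous_real) auto
    then show ?thesis by (intro lebesgue_integral_eq_integral) auto
  qed
  have "((\<lambda>t. c + k * integral {0..t} g) has_real_derivative k * g t) (at t within {0..T})"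
    using integral_has_real_derivative[OF cont t] by (auto intro!: derivative_eq_intros)
  then show ?thesis
    by (rule has_field_derivative_transform_within[where d = 1]) (use t eq i in auto)
qed

text \<open>Both functions are integrals of continuous ones. This gives the derivatives on the closed interval, including the end point \<open>0\<close>, without
differentiating the power \<open>t\<^sup>\<alpha>\<close> there.\<close>

lemma ml_kernel_derivs:
  assumes "1 < \<alpha>" "\<alpha> < 2" "t \<in> {0..T}"
  shows "((\<lambda>t. mittag_leffler \<alpha> 1 (- lam * t powr \<alpha>)) has_real_derivative - lam * ml_kernel \<alpha> lam \<alpha> t) (at t within {0..T})"
    and "((\<lambda>t. t * mittag_leffler \<alpha> 2 (- lam * t powr \<alpha>)) has_real_derivative mittag_leffler \<alpha> 1 (- lam * t powr \<alpha>)) (at t within {0..T})"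
proof -
  show "((\<lambda>t. mittag_leffler \<alpha> 1 (- lam * t powr \<alpha>)) has_real_derivative - lam * ml_kernel \<alpha> lam \<alpha> t) (at t within {0..T})"
  proof (rule integral_has_derivative_lebesgue_on[OF _ _ assms(3), where c = 1])
    show "continuous_on {0..T} (ml_kernel \<alpha> lam \<alpha>)"
      by (rule continuous_on_subset[OF ml_kernel_continuous(2)]) (use assms in auto)
    fix t assume "t \<in> {0..T}"
    then have "(LINT \<tau>|lebesgue_on {0..t}. ml_kernel \<alpha> lam \<alpha> \<tau>) = t powr \<alpha> * mittag_leffler \<alpha> (\<alpha> + 1) (- lam * t powr \<alpha>)"
      using ml_kernel_integral(2)[of \<alpha> \<alpha> t lam] assms by (simp add: ml_kernel_def)
    then show "mittag_leffler \<alpha> 1 (- lam * t powr \<alpha>) = 1 + - lam * (LINT \<tau>|lebesgue_on {0..t}. ml_kernel \<alpha> lam \<alpha> \<tau>)"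
      using mittag_leffler_recurrence[OF assms(1), of 1 "- lam * t powr \<alpha>"] by simp
  qed
  have "((\<lambda>t. t * mittag_leffler \<alpha> 2 (- lam * t powr \<alpha>)) has_real_derivative 1 * mittag_leffler \<alpha> 1 (- lam * t powr \<alpha>)) (at t within {0..T})"
  proof (rule integral_has_derivative_lebesgue_on[OF _ _ assms(3), where c = 0])
    show "continuous_on {0..T} (\<lambda>t. mittag_leffler \<alpha> 1 (- lam * t powr \<alpha>))"
      by (rule continuous_on_subset[OF ml_kernel_continuous(3)]) (use assms in auto)
    then have c: "continuous_on {0..t} (\<lambda>t. mittag_leffler \<alpha> 1 (- lam * t powr \<alpha>))" if "t \<in> {0..T}" for t
      by (rule continuous_on_subset) (use that in auto)
    fix t assume t: "t \<in> {0..T}"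
    have "(LINT \<tau>|lebesgue_on {0..t}. mittag_leffler \<alpha> 1 (- lam * \<tau> powr \<alpha>)) = (LINT \<tau>|lebesgue_on {0..t}. ml_kernel \<alpha> lam 1 \<tau>)"
    proof (rule integral_cong_AE)
      have "AE \<tau> in lebesgue. \<tau> \<noteq> 0" by (simp add: AE_iff_null)
      then have "AE \<tau> in lebesgue_on {0..t}. \<tau> \<noteq> 0" by (auto simp: AE_restrict_space_iff elim: eventually_mono)
      moreover have "AE \<tau> in lebesgue_on {0..t}. \<tau> \<in> {0..t}" by (rule AE_I2) auto
      ultimately show "AE \<tau> in lebesgue_on {0..t}. mittag_leffler \<alpha> 1 (- lam * \<tau> powr \<alpha>) = ml_kernel \<alpha> lam 1 \<tau>"
        by eventually_elim (auto simp: ml_kernel_1)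
      show "ml_kernel \<alpha> lam 1 \<in> borel_measurable (lebesgue_on {0..t})"
        by (rule borel_measurable_integrable[OF ml_kernel_integral(1)]) (use assms t in auto)
      show "(\<lambda>\<tau>. mittag_leffler \<alpha> 1 (- lam * \<tau> powr \<alpha>)) \<in> borel_measurable (lebesgue_on {0..t})"
        by (intro borel_measurable_integrable absolutely_integrable_imp_integrable absolutely_integrable_continuous_real c t) auto
    qed
    also have "\<dots> = ml_kernel \<alpha> lam 2 t" using ml_kernel_integral(2)[of \<alpha> 1 t lam] assms t by simp
    finally show "t * mittag_leffler \<alpha> 2 (- lam * t powr \<alpha>) = 0 + 1 * (LINT \<tau>|lebesgue_on {0..t}. mittag_leffler \<alpha> 1 (- lam * \<tau> powr \<alpha>))"
      using t by (simp add: ml_kernel_2)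
  qed
  then show "((\<lambda>t. t * mittag_leffler \<alpha> 2 (- lam * t powr \<alpha>)) has_real_derivative mittag_leffler \<alpha> 1 (- lam * t powr \<alpha>)) (at t within {0..T})"
    by simp
qed

section \<open>The Hilbert space of square integrable functions\<close>

definition L2_sq :: "'a::euclidean_space set \<Rightarrow> ('a \<Rightarrow> real) \<Rightarrow> real" where "L2_sq \<Omega> f = L2_inner \<Omega> f f"

lemma L2_measurable: "f \<in> L2 \<Omega> \<Longrightarrow> f \<in> borel_measurable (lebesgue_on \<Omega>)"
  and L2_sq_integrable: "f \<in> L2 \<Omega> \<Longrightarrow> integrable (lebesgue_on \<Omega>) (\<lambda>x. (f x)\<^sup>2)"
  by (auto simp: L2_def)

lemma L2_mult_integrable:
  assumes "f \<in> L2 \<Omega>" "g \<in> L2 \<Omega>" shows "integrable (lebesgue_on \<Omega>) (\<lambda>x. f x * g x)"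
proof (rule Bochner_Integration.integrable_bound)
  show "integrable (lebesgue_on \<Omega>) (\<lambda>x. (f x)\<^sup>2 + (g x)\<^sup>2)"
    using assms L2_sq_integrable by (intro Bochner_Integration.integrable_add) auto
  show "(\<lambda>x. f x * g x) \<in> borel_measurable (lebesgue_on \<Omega>)"
    using assms L2_measurable by measurable
  have "\<bar>a * b\<bar> \<le> a\<^sup>2 + b\<^sup>2" for a b :: real
  proof -
    have "0 \<le> (\<bar>a\<bar> - \<bar>b\<bar>)\<^sup>2" "0 \<le> a\<^sup>2" "0 \<le> b\<^sup>2" by auto
    then have "2 * (\<bar>a\<bar> * \<bar>b\<bar>) \<le> a\<^sup>2 + b\<^sup>2" by (simp add: power2_diff)
    moreover have "\<bar>a\<bar> * \<bar>b\<bar> \<ge> 0" by simp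
    ultimately show ?thesis unfolding abs_mult by linarith
  qed
  then show "AE x in lebesgue_on \<Omega>. norm (f x * g x) \<le> norm ((f x)\<^sup>2 + (g x)\<^sup>2)" by auto
qed

lemma L2_add: assumes "f \<in> L2 \<Omega>" "g \<in> L2 \<Omega>" shows "(\<lambda>x. f x + g x) \<in> L2 \<Omega>"
proof -
  have "integrable (lebesgue_on \<Omega>) (\<lambda>x. (f x)\<^sup>2 + (g x)\<^sup>2 + 2 * (f x * g x))"
    using assms L2_sq_integrable L2_mult_integrable by (intro Bochner_Integration.integrable_add integrable_mult_right) auto
  then have "integrable (lebesgue_on \<Omega>) (\<lambda>x. (f x + g x)\<^sup>2)" by (simp add: power2_sum mult.assoc)
  moreover have "(\<lambda>x. f x + g x) \<in> borel_measurable (lebesgue_on \<Omega>)" using assms L2_measurable by measurable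
  ultimately show ?thesis by (simp add: L2_def)
qed

lemma L2_scale: assumes "f \<in> L2 \<Omega>" shows "(\<lambda>x. c * f x) \<in> L2 \<Omega>"
  using assms by (auto simp: L2_def power_mult_distrib)

lemma L2_diff: assumes "f \<in> L2 \<Omega>" "g \<in> L2 \<Omega>" shows "(\<lambda>x. f x - g x) \<in> L2 \<Omega>"
  using L2_add[OF assms(1) L2_scale[OF assms(2), of "-1"]] by simp

lemma L2_zero: "(\<lambda>x. 0) \<in> L2 \<Omega>" by (simp add: L2_def)

lemma L2_sum: assumes "\<And>i. i \<in> I \<Longrightarrow> f i \<in> L2 \<Omega>" shows "(\<lambda>x. \<Sum>i\<in>I. f i x) \<in> L2 \<Omega>"
  using assms by (induction I rule: infinite_finite_induct) (auto simp: L2_zero intro: L2_add)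

lemma L2_inner_commute: "L2_inner \<Omega> f g = L2_inner \<Omega> g f"
  by (simp add: L2_inner_def mult.commute)

lemma L2_inner_scale: "L2_inner \<Omega> (\<lambda>x. c * f x) g = c * L2_inner \<Omega> f g"
  "L2_inner \<Omega> f (\<lambda>x. c * g x) = c * L2_inner \<Omega> f g"
  by (simp_all add: L2_inner_def mult.assoc mult.left_commute[of _ c])

lemma L2_inner_add:
  assumes "f \<in> L2 \<Omega>" "g \<in> L2 \<Omega>" "h \<in> L2 \<Omega>"
  shows "L2_inner \<Omega> (\<lambda>x. f x + g x) h = L2_inner \<Omega> f h + L2_inner \<Omega> g h"
    "L2_inner \<Omega> h (\<lambda>x. f x + g x) = L2_inner \<Omega> h f + L2_inner \<Omega> h g"
  using L2_mult_integrable[OF assms(1,3)] L2_mult_integrable[OF assms(2,3)]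
  by (simp_all add: L2_inner_def ring_distribs mult.commute[of "h _"])

lemma L2_inner_diff:
  assumes "f \<in> L2 \<Omega>" "g \<in> L2 \<Omega>" "h \<in> L2 \<Omega>"
  shows "L2_inner \<Omega> (\<lambda>x. f x - g x) h = L2_inner \<Omega> f h - L2_inner \<Omega> g h"
    "L2_inner \<Omega> h (\<lambda>x. f x - g x) = L2_inner \<Omega> h f - L2_inner \<Omega> h g"
  using L2_mult_integrable[OF assms(1,3)] L2_mult_integrable[OF assms(2,3)]
  by (simp_all add: L2_inner_def ring_distribs mult.commute[of "h _"])

lemma L2_inner_sum:
  assumes "\<And>i. i \<in> I \<Longrightarrow> f i \<in> L2 \<Omega>" "h \<in> L2 \<Omega>"
  shows "L2_inner \<Omega> (\<lambda>x. \<Sum>i\<in>I. f i x) h = (\<Sum>i\<in>I. L2_inner \<Omega> (f i) h)"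
    "L2_inner \<Omega> h (\<lambda>x. \<Sum>i\<in>I. f i x) = (\<Sum>i\<in>I. L2_inner \<Omega> h (f i))"
proof -
  show 1: "L2_inner \<Omega> (\<lambda>x. \<Sum>i\<in>I. f i x) h = (\<Sum>i\<in>I. L2_inner \<Omega> (f i) h)"
    using assms
  proof (induction I rule: infinite_finite_induct)
    case (insert i I)
    have "L2_inner \<Omega> (\<lambda>x. f i x + (\<Sum>j\<in>I. f j x)) h = L2_inner \<Omega> (f i) h + L2_inner \<Omega> (\<lambda>x. \<Sum>j\<in>I. f j x) h"
      by (rule L2_inner_add(1)) (use insert in \<open>auto intro!: L2_sum\<close>)
    then show ?case using insert by simp
  qed (auto simp: L2_inner_def)
  show "L2_inner \<Omega> h (\<lambda>x. \<Sum>i\<in>I. f i x) = (\<Sum>i\<in>I. L2_inner \<Omega> h (f i))"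
    using 1 by (simp add: L2_inner_commute[of \<Omega> h])
qed

lemma L2_sq_nonneg: "L2_sq \<Omega> f \<ge> 0"
  unfolding L2_sq_def L2_inner_def by (rule integral_nonneg_AE) simp

lemma L2_norm_sq: "L2_norm \<Omega> f = sqrt (L2_sq \<Omega> f)" by (simp add: L2_norm_def L2_sq_def)

lemma L2_sq_add: assumes "f \<in> L2 \<Omega>" "g \<in> L2 \<Omega>"
  shows "L2_sq \<Omega> (\<lambda>x. f x + g x) = L2_sq \<Omega> f + 2 * L2_inner \<Omega> f g + L2_sq \<Omega> g"
  unfolding L2_sq_def using assms by (simp add: L2_inner_add L2_add L2_inner_commute[of \<Omega> g f])

lemma L2_sq_diff: assumes "f \<in> L2 \<Omega>" "g \<in> L2 \<Omega>"
  shows "L2_sq \<Omega> (\<lambda>x. f x - g x) = L2_sq \<Omega> f - 2 * L2_inner \<Omega> f g + L2_sq \<Omega> g"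
  unfolding L2_sq_def using assms by (simp add: L2_inner_diff L2_diff L2_inner_commute[of \<Omega> g f])

lemma L2_sq_scale: "L2_sq \<Omega> (\<lambda>x. c * f x) = c\<^sup>2 * L2_sq \<Omega> f"
  unfolding L2_sq_def by (simp add: L2_inner_scale power2_eq_square)

lemma L2_sq_add_le: assumes "f \<in> L2 \<Omega>" "g \<in> L2 \<Omega>"
  shows "L2_sq \<Omega> (\<lambda>x. f x + g x) \<le> 2 * L2_sq \<Omega> f + 2 * L2_sq \<Omega> g"
  using L2_sq_add[OF assms] L2_sq_diff[OF assms] L2_sq_nonneg[of \<Omega> "\<lambda>x. f x - g x"] by simp

lemma discriminant_bound:
  fixes a b c :: real
  assumes q: "\<And>t. 0 \<le> a + 2 * t * b + t\<^sup>2 * c" and c: "c \<ge> 0"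
  shows "b\<^sup>2 \<le> a * c"
proof (cases "c = 0")
  case True
  have "b = 0"
  proof (rule ccontr)
    assume "b \<noteq> 0"
    then show False using q[of "- (a + 1) / (2 * b)"] True by (simp add: field_simps)
  qed
  then show ?thesis using True by simp
next
  case False
  then have c: "c > 0" using c by simp
  have "0 \<le> a - b\<^sup>2 / c"
    using q[of "- b / c"] c by (simp add: power2_eq_square)
  then show ?thesis using c by (simp add: field_simps)
qed

lemma L2_Cauchy_Schwarz:
  assumes "f \<in> L2 \<Omega>" "g \<in> L2 \<Omega>"
  shows "(L2_inner \<Omega> f g)\<^sup>2 \<le> L2_sq \<Omega> f * L2_sq \<Omega> g"
proof (rule discriminant_bound[OF _ L2_sq_nonneg])
  fix t
  show "0 \<le> L2_sq \<Omega> f + 2 * t * L2_inner \<Omega> f g + t\<^sup>2 * L2_sq \<Omega> g"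
    using L2_sq_nonneg[of \<Omega> "\<lambda>x. f x + t * g x"] L2_sq_add[OF assms(1) L2_scale[OF assms(2), of t]]
    by (simp add: L2_sq_scale L2_inner_scale)
qed

lemma L2_inner_tendsto:
  assumes "\<And>n. f n \<in> L2 \<Omega>" "g \<in> L2 \<Omega>" "h \<in> L2 \<Omega>" "(\<lambda>n. L2_sq \<Omega> (\<lambda>x. f n x - g x)) \<longlonglongrightarrow> 0"
  shows "(\<lambda>n. L2_inner \<Omega> (f n) h) \<longlonglongrightarrow> L2_inner \<Omega> g h"
proof -
  have "(\<lambda>n. sqrt (L2_sq \<Omega> (\<lambda>x. f n x - g x) * L2_sq \<Omega> h)) \<longlonglongrightarrow> sqrt (0 * L2_sq \<Omega> h)"
    by (intro tendsto_intros assms)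
  then have "(\<lambda>n. L2_inner \<Omega> (\<lambda>x. f n x - g x) h) \<longlonglongrightarrow> 0"
  proof (intro Lim_null_comparison[of "\<lambda>n. L2_inner \<Omega> (\<lambda>x. f n x - g x) h" _ sequentially] always_eventually allI)
    fix n
    have "\<bar>L2_inner \<Omega> (\<lambda>x. f n x - g x) h\<bar> \<le> sqrt (L2_sq \<Omega> (\<lambda>x. f n x - g x) * L2_sq \<Omega> h)"
      using L2_Cauchy_Schwarz[OF L2_diff[OF assms(1,2)] assms(3), of n] by (intro real_le_rsqrt) simp
    then show "norm (L2_inner \<Omega> (\<lambda>x. f n x - g x) h) \<le> sqrt (L2_sq \<Omega> (\<lambda>x. f n x - g x) * L2_sq \<Omega> h)" by simp
  qed simp
  then have "(\<lambda>n. L2_inner \<Omega> (f n) h - L2_inner \<Omega> g h) \<longlonglongrightarrow> 0"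
    using assms by (simp add: L2_inner_diff)
  then show ?thesis by (simp add: LIM_zero_iff)
qed

lemma eq_ae_refl: "eq_ae \<Omega> f f"
  and eq_ae_sym: "eq_ae \<Omega> f g \<Longrightarrow> eq_ae \<Omega> g f"
  unfolding eq_ae_def by (auto elim: eventually_mono)

lemma eq_ae_inner:
  assumes "eq_ae \<Omega> f g" "f \<in> L2 \<Omega>" "g \<in> L2 \<Omega>" "h \<in> L2 \<Omega>"
  shows "L2_inner \<Omega> f h = L2_inner \<Omega> g h"
  unfolding L2_inner_def
  by (rule integral_cong_AE) (use assms L2_measurable in \<open>auto simp: eq_ae_def intro: borel_measurable_times\<close>)

lemma L2_sq_zero_iff: assumes "f \<in> L2 \<Omega>" shows "L2_sq \<Omega> f = 0 \<longleftrightarrow> eq_ae \<Omega> f (\<lambda>_. 0)"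
  unfolding L2_sq_def L2_inner_def eq_ae_def
  by (subst integral_nonneg_eq_0_iff_AE[OF L2_mult_integrable[OF assms assms]]) auto

lemma eq_ae_iff: assumes "f \<in> L2 \<Omega>" "g \<in> L2 \<Omega>" shows "eq_ae \<Omega> f g \<longleftrightarrow> L2_sq \<Omega> (\<lambda>x. f x - g x) = 0"
  using L2_sq_zero_iff[OF L2_diff[OF assms]] by (simp add: eq_ae_def)

text \<open>The usual proof: a subsequence with summable successive distances converges almost everywhere, and Fatou's lemma identifies its limit as
the limit in norm.\<close>

lemma L2_complete:
  assumes F: "\<And>n. F n \<in> L2 \<Omega>"
    and Cauchy: "\<And>\<epsilon>. \<epsilon> > 0 \<Longrightarrow> \<exists>N. \<forall>m\<ge>N. \<forall>n\<ge>N. L2_sq \<Omega> (\<lambda>x. F m x - F n x) < \<epsilon>"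
  obtains g where "g \<in> L2 \<Omega>" "(\<lambda>n. L2_sq \<Omega> (\<lambda>x. F n x - g x)) \<longlonglongrightarrow> 0"
proof -
  define M where "M = lebesgue_on \<Omega>"
  have Fm [measurable]: "F n \<in> borel_measurable M" for n using L2_measurable[OF F] by (simp add: M_def)
  have ennsq: "(\<integral>\<^sup>+ x. ennreal ((F m x - F n x)\<^sup>2) \<partial>M) = ennreal (L2_sq \<Omega> (\<lambda>x. F m x - F n x))" for m n
    unfolding L2_sq_def L2_inner_def power2_eq_square M_def
    by (rule nn_integral_eq_integral) (auto intro!: L2_mult_integrable L2_diff F)
  have "\<forall>k. \<exists>N. \<forall>m\<ge>N. \<forall>n\<ge>N. L2_sq \<Omega> (\<lambda>x. F m x - F n x) < (1/4) ^ k" using Cauchy by simp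
  then obtain N where N: "\<And>k m n. m \<ge> N k \<Longrightarrow> n \<ge> N k \<Longrightarrow> L2_sq \<Omega> (\<lambda>x. F m x - F n x) < (1/4) ^ k" by metis
  define K where "K = (\<lambda>k. k + (\<Sum>j\<le>k. N j))"
  have KN: "N k \<le> K k" for k unfolding K_def by (intro trans_le_add2 member_le_sum) auto
  have Kmono: "j \<le> k \<Longrightarrow> K j \<le> K k" for j k unfolding K_def by (intro add_mono sum_mono2) auto
  define d where "d = (\<lambda>k x. F (K (Suc k)) x - F (K k) x)"
  have dm [measurable]: "d k \<in> borel_measurable M" for k unfolding d_def by measurable
  \<comment> \<open>The weights \<open>2 ^ k\<close> leave a convergent sum, as the squared distances are below \<open>(1/4) ^ k\<close>, and they give
convergence of the differences themselves by \<open>|d| \<le> 2\<^sup>-\<^sup>k + 2\<^sup>k d\<^sup>2\<close>.\<close>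
  have "(\<integral>\<^sup>+ x. (\<Sum>k. ennreal (2 ^ k * (d k x)\<^sup>2)) \<partial>M) = (\<Sum>k. \<integral>\<^sup>+ x. ennreal (2 ^ k * (d k x)\<^sup>2) \<partial>M)"
    by (rule nn_integral_suminf) measurable
  also have "\<dots> \<le> (\<Sum>k. ennreal ((1/2) ^ k))"
  proof (rule suminf_le)
    fix k
    have "(\<integral>\<^sup>+ x. ennreal (2 ^ k * (d k x)\<^sup>2) \<partial>M) = ennreal (2 ^ k) * (\<integral>\<^sup>+ x. ennreal ((d k x)\<^sup>2) \<partial>M)"
      by (subst nn_integral_cmult[symmetric]) (auto simp: ennreal_mult)
    also have "\<dots> = ennreal (2 ^ k * L2_sq \<Omega> (\<lambda>x. F (K (Suc k)) x - F (K k) x))"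
      by (simp add: d_def ennsq ennreal_mult L2_sq_nonneg)
    also have "\<dots> \<le> ennreal (2 ^ k * (1/4) ^ k)"
      using N[of k "K (Suc k)" "K k"] KN[of k] Kmono[of k "Suc k"] by (intro ennreal_leI mult_left_mono) auto
    also have "2 ^ k * (1/4) ^ k = (1/2 :: real) ^ k" by (simp flip: power_mult_distrib)
    finally show "(\<integral>\<^sup>+ x. ennreal (2 ^ k * (d k x)\<^sup>2) \<partial>M) \<le> ennreal ((1/2) ^ k)" .
  qed auto
  also have "\<dots> = ennreal (\<Sum>k. (1/2) ^ k)"
    by (rule suminf_ennreal2) (auto intro: summable_geometric)
  finally have "(\<integral>\<^sup>+ x. (\<Sum>k. ennreal (2 ^ k * (d k x)\<^sup>2)) \<partial>M) < \<infinity>"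
    by (rule order.strict_trans1) simp
  then have "AE x in M. (\<Sum>k. ennreal (2 ^ k * (d k x)\<^sup>2)) \<noteq> \<infinity>"
    by (intro nn_integral_PInf_AE) auto
  then have conv: "AE x in M. convergent (\<lambda>k. F (K k) x)"
  proof eventually_elim
    case (elim x)
    have "summable (\<lambda>k. 2 ^ k * (d k x)\<^sup>2)"
      by (rule summable_suminf_not_top) (use elim in \<open>auto simp: top_ennreal.rep_eq infinity_ennreal_def\<close>)
    moreover have "summable (\<lambda>k. (1/2::real) ^ k)" by (intro summable_geometric) auto
    ultimately have s: "summable (\<lambda>k. (1/2) ^ k + 2 ^ k * (d k x)\<^sup>2)" by (intro summable_add) auto
    have "summable (\<lambda>k. d k x)"
    proof (rule summable_comparison_test'[OF s])
      fix k :: nat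
      define p where "p = (2::real) ^ k"
      have p: "p > 0" "(1/2) ^ k = 1 / p" by (simp_all add: p_def power_one_over)
      have "0 \<le> (p * \<bar>d k x\<bar> - 1)\<^sup>2" by simp
      then have "2 * (p * \<bar>d k x\<bar>) \<le> 1 + p * (p * (d k x)\<^sup>2)"
        by (simp add: power2_diff power_mult_distrib power2_eq_square[of p])
      moreover have "p * \<bar>d k x\<bar> \<ge> 0" using p by simp
      ultimately have "p * \<bar>d k x\<bar> \<le> 1 + p * (p * (d k x)\<^sup>2)" by linarith
      then have "\<bar>d k x\<bar> \<le> (1 + p * (p * (d k x)\<^sup>2)) / p" using p by (simp add: field_simps)
      also have "\<dots> = 1 / p + p * (d k x)\<^sup>2" using p by (simp add: add_divide_distrib)
      finally show "norm (d k x) \<le> (1/2) ^ k + 2 ^ k * (d k x)\<^sup>2" by (simp add: p(2) p_def[symmetric])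
    qed
    then have "convergent (\<lambda>k. \<Sum>j<k. d j x)" by (simp add: summable_iff_convergent)
    moreover have "(\<Sum>j<k. d j x) = F (K k) x - F (K 0) x" for k
      unfolding d_def by (rule sum_lessThan_telescope)
    ultimately have "convergent (\<lambda>k. F (K k) x - F (K 0) x)" by simp
    then have "convergent (\<lambda>k. (F (K k) x - F (K 0) x) + F (K 0) x)" by (intro convergent_add convergent_const)
    then show ?case by simp
  qed
  define g where "g = (\<lambda>x. lim (\<lambda>k. F (K k) x))"
  have gm [measurable]: "g \<in> borel_measurable M" unfolding g_def by measurable
  have lim: "AE x in M. (\<lambda>k. F (K k) x) \<longlonglongrightarrow> g x"
    using conv by eventually_elim (simp add: g_def convergent_LIMSEQ_iff)
  have Fatou: "(\<integral>\<^sup>+ x. ennreal ((F n x - g x)\<^sup>2) \<partial>M) \<le> ennreal \<epsilon>"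
    if n: "\<And>m. m \<ge> N0 \<Longrightarrow> L2_sq \<Omega> (\<lambda>x. F n x - F m x) \<le> \<epsilon>" for n N0 \<epsilon>
  proof -
    have "(\<integral>\<^sup>+ x. ennreal ((F n x - g x)\<^sup>2) \<partial>M) = (\<integral>\<^sup>+ x. liminf (\<lambda>k. ennreal ((F n x - F (K k) x)\<^sup>2)) \<partial>M)"
    proof (rule nn_integral_cong_AE)
      show "AE x in M. ennreal ((F n x - g x)\<^sup>2) = liminf (\<lambda>k. ennreal ((F n x - F (K k) x)\<^sup>2))"
        using lim
      proof eventually_elim
        case (elim x)
        have "(\<lambda>k. ennreal ((F n x - F (K k) x)\<^sup>2)) \<longlonglongrightarrow> ennreal ((F n x - g x)\<^sup>2)"
          by (intro tendsto_ennrealI tendsto_intros elim)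
        then show ?case using lim_imp_Liminf trivial_limit_sequentially by metis
      qed
    qed
    also have "\<dots> \<le> liminf (\<lambda>k. \<integral>\<^sup>+ x. ennreal ((F n x - F (K k) x)\<^sup>2) \<partial>M)"
      by (rule nn_integral_liminf) measurable
    also have "\<dots> = liminf (\<lambda>k. ennreal (L2_sq \<Omega> (\<lambda>x. F n x - F (K k) x)))" by (simp add: ennsq)
    also have "\<dots> \<le> limsup (\<lambda>k. ennreal (L2_sq \<Omega> (\<lambda>x. F n x - F (K k) x)))"
      by (rule Liminf_le_Limsup) simp
    also have "\<dots> \<le> ennreal \<epsilon>"
    proof (rule Limsup_bounded)
      show "\<forall>\<^sub>F k in sequentially. ennreal (L2_sq \<Omega> (\<lambda>x. F n x - F (K k) x)) \<le> ennreal \<epsilon>"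
        using eventually_ge_at_top[of N0]
      proof eventually_elim
        case (elim k)
        then have "K k \<ge> N0" by (simp add: K_def)
        then show ?case by (intro ennreal_leI n)
      qed
    qed
    finally show ?thesis .
  qed
  have close: "(\<lambda>x. F n x - g x) \<in> L2 \<Omega> \<and> L2_sq \<Omega> (\<lambda>x. F n x - g x) \<le> \<epsilon>"
    if n: "\<And>m. m \<ge> N0 \<Longrightarrow> L2_sq \<Omega> (\<lambda>x. F n x - F m x) \<le> \<epsilon>" and e: "\<epsilon> \<ge> 0" for n N0 \<epsilon>
  proof -
    note b = Fatou[OF n]
    have fin: "(\<integral>\<^sup>+ x. ennreal ((F n x - g x)\<^sup>2) \<partial>M) < \<infinity>"
      using b ennreal_less_top[of \<epsilon>] unfolding infinity_ennreal_def by (metis order.strict_trans1)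
    have i: "integrable M (\<lambda>x. (F n x - g x)\<^sup>2)"
      by (rule integrableI_nonneg) (use fin in auto)
    then have l: "(\<lambda>x. F n x - g x) \<in> L2 \<Omega>" unfolding L2_def M_def[symmetric] by auto
    have "ennreal (L2_sq \<Omega> (\<lambda>x. F n x - g x)) = (\<integral>\<^sup>+ x. ennreal ((F n x - g x)\<^sup>2) \<partial>M)"
      unfolding L2_sq_def L2_inner_def power2_eq_square M_def[symmetric]
      by (rule nn_integral_eq_integral[symmetric]) (use i in \<open>auto simp: power2_eq_square\<close>)
    with b have "ennreal (L2_sq \<Omega> (\<lambda>x. F n x - g x)) \<le> ennreal \<epsilon>" by simp
    then show ?thesis using l e by simp
  qed
  have conv0: "\<exists>N0. \<forall>n\<ge>N0. (\<lambda>x. F n x - g x) \<in> L2 \<Omega> \<and> L2_sq \<Omega> (\<lambda>x. F n x - g x) \<le> \<epsilon>" if e: "\<epsilon> > 0" for \<epsilon>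
  proof -
    obtain N0 where N0: "\<And>m n. m \<ge> N0 \<Longrightarrow> n \<ge> N0 \<Longrightarrow> L2_sq \<Omega> (\<lambda>x. F m x - F n x) < \<epsilon>" using Cauchy[OF e] by blast
    have "(\<lambda>x. F n x - g x) \<in> L2 \<Omega> \<and> L2_sq \<Omega> (\<lambda>x. F n x - g x) \<le> \<epsilon>" if "n \<ge> N0" for n
      by (rule close[of N0]) (use N0[OF that] e in \<open>auto intro: less_imp_le\<close>)
    then show ?thesis by blast
  qed
  show thesis
  proof (rule that)
    obtain n where n: "(\<lambda>x. F n x - g x) \<in> L2 \<Omega>" using conv0[of 1] by auto
    show "g \<in> L2 \<Omega>" using L2_diff[OF F n, of n] by simp
    show "(\<lambda>n. L2_sq \<Omega> (\<lambda>x. F n x - g x)) \<longlonglongrightarrow> 0"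
    proof (rule LIMSEQ_I)
      fix r :: real assume "r > 0"
      then obtain N0 where N0: "\<And>n. n \<ge> N0 \<Longrightarrow> L2_sq \<Omega> (\<lambda>x. F n x - g x) \<le> r / 2" using conv0[of "r / 2"] by auto
      have "norm (L2_sq \<Omega> (\<lambda>x. F n x - g x) - 0) < r" if "n \<ge> N0" for n
        using N0[OF that] L2_sq_nonneg[of \<Omega> "\<lambda>x. F n x - g x"] \<open>r > 0\<close> by simp
      then show "\<exists>no. \<forall>n\<ge>no. norm (L2_sq \<Omega> (\<lambda>x. F n x - g x) - 0) < r" by blast
    qed
  qed
qed

lemma L2_sums_iff: "L2_sums \<Omega> f s \<longleftrightarrow> s \<in> L2 \<Omega> \<and> (\<forall>n. f n \<in> L2 \<Omega>) \<and> (\<lambda>N. L2_sq \<Omega> (\<lambda>x. (\<Sum>n<N. f n x) - s x)) \<longlonglongrightarrow> 0"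
proof -
  have "((\<lambda>N. sqrt (a N)) \<longlonglongrightarrow> 0) \<longleftrightarrow> (a \<longlonglongrightarrow> 0)" if "\<And>N. a N \<ge> (0::real)" for a
  proof
    assume "(\<lambda>N. sqrt (a N)) \<longlonglongrightarrow> 0"
    from tendsto_power[OF this, of 2] show "a \<longlonglongrightarrow> 0" using that by simp
  next
    assume "a \<longlonglongrightarrow> 0"
    from tendsto_real_sqrt[OF this] show "(\<lambda>N. sqrt (a N)) \<longlonglongrightarrow> 0" by simp
  qed
  from this[of "\<lambda>N. L2_sq \<Omega> (\<lambda>x. (\<Sum>n<N. f n x) - s x)"] show ?thesis
    unfolding L2_sums_def L2_norm_sq using L2_sq_nonneg by auto
qed

locale orthonormal_basis =
  fixes \<Omega> :: "'a::euclidean_space set" and e :: "nat \<Rightarrow> 'a \<Rightarrow> real"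
  assumes e_L2: "\<And>n. e n \<in> L2 \<Omega>"
    and orthonormal: "\<And>m n. L2_inner \<Omega> (e m) (e n) = (if m = n then 1 else 0)"
    and expansion: "\<And>f. f \<in> L2 \<Omega> \<Longrightarrow> L2_sums \<Omega> (\<lambda>n x. L2_inner \<Omega> f (e n) * e n x) f"
begin

text \<open>Fourier coefficients with respect to the basis \<open>e\<close>.\<close>

abbreviation cf :: "('a \<Rightarrow> real) \<Rightarrow> nat \<Rightarrow> real" where "cf f n \<equiv> L2_inner \<Omega> f (e n)"

lemma partial_L2: "(\<lambda>x. \<Sum>n<N. c n * e n x) \<in> L2 \<Omega>"
  by (intro L2_sum L2_scale e_L2)

lemma inner_partial: assumes "f \<in> L2 \<Omega>"
  shows "L2_inner \<Omega> (\<lambda>x. \<Sum>n<N. c n * e n x) f = (\<Sum>n<N. c n * cf f n)"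
  using assms by (subst L2_inner_sum(1)) (auto simp: L2_inner_scale L2_inner_commute[of \<Omega> f] intro: L2_scale e_L2)

lemma cf_partial: "cf (\<lambda>x. \<Sum>n<N. c n * e n x) m = (if m < N then c m else 0)"
  by (subst inner_partial[OF e_L2]) (simp add: orthonormal sum.delta if_distrib[of "\<lambda>x. _ * x"] cong: if_cong)

lemma L2_sq_partial: "L2_sq \<Omega> (\<lambda>x. \<Sum>n<N. c n * e n x) = (\<Sum>n<N. (c n)\<^sup>2)"
  unfolding L2_sq_def by (subst inner_partial[OF partial_L2]) (simp add: cf_partial power2_eq_square)

lemma L2_sums_coeff:
  assumes "L2_sums \<Omega> (\<lambda>n x. c n * e n x) s"
  shows "cf s m = c m"
proof -
  have "(\<lambda>N. cf (\<lambda>x. \<Sum>n<N. c n * e n x) m) \<longlonglongrightarrow> cf s m"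
    by (rule L2_inner_tendsto) (use assms in \<open>auto simp: L2_sums_iff intro: partial_L2 e_L2\<close>)
  moreover have "(\<lambda>N. cf (\<lambda>x. \<Sum>n<N. c n * e n x) m) \<longlonglongrightarrow> c m"
    by (rule tendsto_eventually) (auto simp: cf_partial eventually_sequentially intro!: exI[of _ "Suc m"])
  ultimately show ?thesis using LIMSEQ_unique by blast
qed

lemma Parseval:
  assumes "f \<in> L2 \<Omega>" "g \<in> L2 \<Omega>"
  shows "(\<lambda>n. cf f n * cf g n) sums L2_inner \<Omega> f g"
proof -
  have "(\<lambda>N. L2_inner \<Omega> (\<lambda>x. \<Sum>n<N. cf f n * e n x) g) \<longlonglongrightarrow> L2_inner \<Omega> f g"
    by (rule L2_inner_tendsto) (use expansion[OF assms(1)] assms in \<open>auto simp: L2_sums_iff intro: partial_L2\<close>)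
  then show ?thesis using assms by (simp add: inner_partial sums_def)
qed

lemma Parseval_sq:
  assumes "f \<in> L2 \<Omega>" shows "(\<lambda>n. (cf f n)\<^sup>2) sums L2_sq \<Omega> f"
  using Parseval[OF assms assms] by (simp add: power2_eq_square L2_sq_def)

lemma eq_ae_cf: assumes "f \<in> L2 \<Omega>" "g \<in> L2 \<Omega>" shows "eq_ae \<Omega> f g \<longleftrightarrow> (\<forall>n. cf f n = cf g n)"
proof
  assume "eq_ae \<Omega> f g"
  then show "\<forall>n. cf f n = cf g n" using eq_ae_inner assms e_L2 by blast
next
  assume "\<forall>n. cf f n = cf g n"
  then have "(\<lambda>n. 0) sums L2_sq \<Omega> (\<lambda>x. f x - g x)"
    using Parseval_sq[OF L2_diff[OF assms]] assms by (simp add: L2_inner_diff e_L2)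
  then have "L2_sq \<Omega> (\<lambda>x. f x - g x) = 0" using sums_unique2 sums_zero by blast
  then show "eq_ae \<Omega> f g" using eq_ae_iff[OF assms] by simp
qed

lemma Riesz_Fischer:
  assumes "summable (\<lambda>n. (c n)\<^sup>2)"
  obtains s where "L2_sums \<Omega> (\<lambda>n x. c n * e n x) s"
proof -
  define F where "F = (\<lambda>N x. \<Sum>n<N. c n * e n x)"
  have F: "F n \<in> L2 \<Omega>" for n unfolding F_def by (rule partial_L2)
  have d: "L2_sq \<Omega> (\<lambda>x. F m x - F n x) = (\<Sum>k=n..<m. (c k)\<^sup>2)" if "n \<le> m" for m n
  proof -
    have "(\<lambda>x. F m x - F n x) = (\<lambda>x. \<Sum>k<m. (if k < n then 0 else c k) * e k x)"
    proof
      fix x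
      have "F m x = F n x + (\<Sum>k=n..<m. c k * e k x)"
        unfolding F_def lessThan_atLeast0 using that by (simp add: sum.atLeastLessThan_concat)
      moreover have "(\<Sum>k<m. (if k < n then 0 else c k) * e k x) = (\<Sum>k=n..<m. c k * e k x)"
        by (rule sum.mono_neutral_cong_right) auto
      ultimately show "F m x - F n x = (\<Sum>k<m. (if k < n then 0 else c k) * e k x)" by simp
    qed
    then have "L2_sq \<Omega> (\<lambda>x. F m x - F n x) = (\<Sum>k<m. (if k < n then 0 else c k)\<^sup>2)" by (simp only: L2_sq_partial)
    also have "\<dots> = (\<Sum>k=n..<m. (c k)\<^sup>2)" by (rule sum.mono_neutral_cong_right) auto
    finally show ?thesis .
  qed
  have sym: "L2_sq \<Omega> (\<lambda>x. F m x - F n x) = L2_sq \<Omega> (\<lambda>x. F n x - F m x)" for m n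
    using L2_sq_diff[OF F F] by (simp add: L2_inner_commute)
  obtain s where "s \<in> L2 \<Omega>" "(\<lambda>n. L2_sq \<Omega> (\<lambda>x. F n x - s x)) \<longlonglongrightarrow> 0"
  proof (rule L2_complete[OF F])
    fix \<epsilon> :: real assume "\<epsilon> > 0"
    then obtain N where N: "\<And>m n. m \<ge> N \<Longrightarrow> norm (sum (\<lambda>n. (c n)\<^sup>2) {m..<n}) < \<epsilon>"
      using assms unfolding summable_Cauchy by blast
    have "L2_sq \<Omega> (\<lambda>x. F m x - F n x) < \<epsilon>" if "m \<ge> N" "n \<ge> N" for m n
    proof (cases "n \<le> m")
      case True
      then show ?thesis using d[OF True] N[OF that(2), of m] by simp
    next
      case False
      then show ?thesis using sym[of m n] d[of m n] N[OF that(1), of n] by simp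
    qed
    then show "\<exists>N. \<forall>m\<ge>N. \<forall>n\<ge>N. L2_sq \<Omega> (\<lambda>x. F m x - F n x) < \<epsilon>" by blast
  qed
  then have "L2_sums \<Omega> (\<lambda>n x. c n * e n x) s"
    unfolding L2_sums_iff F_def by (auto intro: L2_scale e_L2)
  then show thesis by (rule that)
qed

end

section \<open>Functions of time in weighted sequence spaces\<close>

text \<open>Sampling at finitely many points gives simple functions that converge pointwise. The function is controlled only inside the
interval, so the sample points avoid its ends.\<close>

lemma cont_into_strongly_measurable:
  assumes b: "b > 0" and I: "{0<..<b} \<subseteq> I" "I \<subseteq> {0..b}" and c: "cont_into {0<..<b} X N f" and N0: "N (\<lambda>x. 0) = 0"
  shows "strongly_measurable I X N f"
proof -
  have Iset: "I \<in> sets lebesgue"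
  proof -
    have "I = {0<..<b} \<union> (I \<inter> {0, b})"
    proof (intro equalityI subsetI)
      fix t assume "t \<in> I"
      moreover have "t \<in> {0..b}" using \<open>t \<in> I\<close> I by blast
      ultimately show "t \<in> {0<..<b} \<union> (I \<inter> {0, b})" by (auto simp: less_le)
    qed (use I in auto)
    moreover have "I \<inter> {0, b} \<in> sets borel" by (intro borel_closed finite_imp_closed) auto
    then have "I \<inter> {0, b} \<in> sets lebesgue" by simp
    ultimately show ?thesis by (metis fmeasurableD lmeasurable_interval(2) sets.Un)
  qed
  have ae: "AE t in lebesgue_on I. t \<in> {0<..<b}"
  proof -
    have "AE t in lebesgue. t \<noteq> 0" "AE t in lebesgue. t \<noteq> b" by (simp_all add: AE_iff_null)
    then have "AE t in lebesgue. t \<in> I \<longrightarrow> t \<in> {0<..<b}"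
      by eventually_elim (use I in \<open>auto simp: subset_iff less_eq_real_def\<close>)
    then show ?thesis using Iset by (subst AE_restrict_space_iff) (auto elim: eventually_mono)
  qed
  \<comment> \<open>For \<open>j \<le> k + 1\<close> the sample points are strictly between \<open>0\<close> and \<open>b\<close>; \<open>j k t\<close> may take the value \<open>k + 1\<close> at \<open>t = b\<close>.\<close>
  define q where "q = (\<lambda>k::nat. \<lambda>j::int. b * (2 * of_int j + 1) / (2 * real k + 4))"
  define j where "j = (\<lambda>k::nat. \<lambda>t. \<lfloor>t * (real k + 1) / b\<rfloor>)"
  have jr: "0 \<le> j k t" "j k t \<le> int k + 1" if "t \<in> I" for k t
  proof -
    have t: "0 \<le> t" "t \<le> b" using that I by auto
    show "0 \<le> j k t" using t b by (simp add: j_def)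
    have "t * (real k + 1) / b \<le> real k + 1" using t b mult_right_mono[of t b "real k + 1"] by (simp add: pos_divide_le_eq mult.commute)
    then have "j k t \<le> \<lfloor>real k + 1\<rfloor>" unfolding j_def by (rule floor_mono)
    then show "j k t \<le> int k + 1" by simp
  qed
  have qr: "q k i \<in> {0<..<b}" if "0 \<le> i" "i \<le> int k + 1" for k i
  proof -
    have "2 * real_of_int i + 1 < 2 * real k + 4" using that by linarith
    moreover have "0 < 2 * real_of_int i + 1" using that by linarith
    ultimately show ?thesis
      using b mult_strict_left_mono[of "2 * real_of_int i + 1" "2 * real k + 4" b] by (simp add: q_def pos_divide_less_eq)
  qed
  define s where "s = (\<lambda>k t. f (q k (j k t)))"
  have fin: "finite (s k ` I)" for k
  proof (rule finite_subset)
    show "s k ` I \<subseteq> (\<lambda>i. f (q k i)) ` {0..int k + 1}" using jr by (auto simp: s_def)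
  qed auto
  have sub: "s k ` I \<subseteq> X" for k
    using c qr jr by (auto simp: s_def cont_into_def)
  have meas: "{t \<in> I. s k t = y} \<in> sets lebesgue" for k y
  proof -
    have "j k \<in> measurable borel (count_space UNIV)" unfolding j_def by measurable
    then have "j k -` {i. f (q k i) = y} \<inter> space borel \<in> sets borel" by (rule measurable_sets) simp
    then have "j k -` {i. f (q k i) = y} \<in> sets lebesgue" by simp
    moreover have "{t \<in> I. s k t = y} = I \<inter> j k -` {i. f (q k i) = y}" by (auto simp: s_def)
    ultimately show ?thesis using Iset by auto
  qed
  have lim: "(\<lambda>k. N (\<lambda>x. s k t x - f t x)) \<longlonglongrightarrow> 0" if t: "t \<in> {0<..<b}" for t
  proof -
    have tI: "t \<in> I" using t I by auto
    have "(\<lambda>k. q k (j k t)) \<longlonglongrightarrow> t"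
    proof (rule Lim_null_comparison[THEN LIM_zero_cancel])
      show "\<forall>\<^sub>F k in sequentially. norm (q k (j k t) - t) \<le> (3 * b + 2 * t) / real (Suc k)"
      proof (rule always_eventually, rule allI)
        fix k
        have floor_bounds: "real_of_int (j k t) \<le> t * (real k + 1) / b" "t * (real k + 1) / b < real_of_int (j k t) + 1"
          unfolding j_def by linarith+
        then have "b * real_of_int (j k t) \<le> t * (real k + 1)" "t * (real k + 1) < b * real_of_int (j k t) + b"
          using b by (simp_all add: field_simps)
        then have "\<bar>b * (2 * of_int (j k t) + 1) - t * (2 * real k + 4)\<bar> \<le> 3 * b + 2 * t"
          using b t by (simp add: algebra_simps abs_le_iff)
        then have "\<bar>(b * (2 * of_int (j k t) + 1) - t * (2 * real k + 4)) / (2 * real k + 4)\<bar> \<le> (3 * b + 2 * t) / (2 * real k + 4)"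
          by (simp add: abs_divide divide_right_mono)
        moreover have "(3 * b + 2 * t) / (2 * real k + 4) \<le> (3 * b + 2 * t) / real (Suc k)"
          using b t by (intro divide_left_mono) auto
        moreover have "q k (j k t) - t = (b * (2 * of_int (j k t) + 1) - t * (2 * real k + 4)) / (2 * real k + 4)"
          by (simp add: q_def field_simps)
        ultimately show "norm (q k (j k t) - t) \<le> (3 * b + 2 * t) / real (Suc k)" by simp
      qed
      show "(\<lambda>k. (3 * b + 2 * t) / real (Suc k)) \<longlonglongrightarrow> 0"
        by (rule LIMSEQ_Suc[OF lim_const_over_n])
    qed
    then have "(\<lambda>k. (\<lambda>r. N (\<lambda>x. f r x - f t x)) (q k (j k t))) \<longlonglongrightarrow> (\<lambda>r. N (\<lambda>x. f r x - f t x)) t"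
    proof (rule continuous_within_tendsto_compose[rotated 2])
      show "continuous (at t within {0<..<b}) (\<lambda>r. N (\<lambda>x. f r x - f t x))"
        using c t N0 by (simp add: cont_into_def continuous_within)
      show "\<forall>\<^sub>F k in sequentially. q k (j k t) \<in> {0<..<b}" using qr jr[OF tI] by (intro always_eventually) blast
    qed
    then show ?thesis by (simp add: s_def N0)
  qed
  show ?thesis unfolding strongly_measurable_def
  proof (intro conjI exI[of _ s] allI)
    show "AE t in lebesgue_on I. f t \<in> X" using ae by eventually_elim (use c in \<open>auto simp: cont_into_def\<close>)
    show "AE t in lebesgue_on I. (\<lambda>k. N (\<lambda>x. s k t x - f t x)) \<longlonglongrightarrow> 0"
      using ae by eventually_elim (rule lim)
  qed (use fin sub meas in auto)
qed

text \<open>Dominated convergence for series (Tannery's theorem).\<close>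

lemma suminf_tendsto_0:
  fixes a :: "nat \<Rightarrow> 'c \<Rightarrow> real"
  assumes "\<And>n. ((\<lambda>s. a n s) \<longlongrightarrow> 0) F" "\<forall>\<^sub>F s in F. \<forall>n. \<bar>a n s\<bar> \<le> m n" "summable m"
  shows "((\<lambda>s. \<Sum>n. a n s) \<longlongrightarrow> 0) F"
proof (cases "F = bot")
  case False
  have "\<forall>\<^sub>F (n, s) in at_top \<times>\<^sub>F F. norm (a n s) \<le> m n"
    unfolding eventually_prod_filter
    by (rule exI[of _ "\<lambda>_. True"], rule exI[of _ "\<lambda>s. \<forall>n. \<bar>a n s\<bar> \<le> m n"]) (use assms(2) in auto)
  from tannerys_theorem[OF assms(1) this assms(3) False] show ?thesis by simp
qed simp

text \<open>A normed space of functions or functionals in which an element is controlled by its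
  coordinates, as in a weighted sequence space.\<close>

locale coord_space =
  fixes X :: "('b \<Rightarrow> real) set" and N :: "('b \<Rightarrow> real) \<Rightarrow> real"
    and \<kappa> :: "nat \<Rightarrow> ('b \<Rightarrow> real) \<Rightarrow> real" and \<omega> :: "nat \<Rightarrow> real"
  assumes weight_pos: "\<And>n. \<omega> n > 0"
    and zero_in: "(\<lambda>x. 0) \<in> X"
    and diff_in: "f \<in> X \<Longrightarrow> g \<in> X \<Longrightarrow> (\<lambda>x. f x - g x) \<in> X"
    and scale_in: "f \<in> X \<Longrightarrow> (\<lambda>x. c * f x) \<in> X"
    and coord_diff: "f \<in> X \<Longrightarrow> g \<in> X \<Longrightarrow> \<kappa> n (\<lambda>x. f x - g x) = \<kappa> n f - \<kappa> n g"
    and coord_scale: "f \<in> X \<Longrightarrow> \<kappa> n (\<lambda>x. c * f x) = c * \<kappa> n f"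
    and norm_sums: "f \<in> X \<Longrightarrow> (\<lambda>n. \<omega> n * (\<kappa> n f)\<^sup>2) sums (N f)\<^sup>2"
    and norm_nonneg: "f \<in> X \<Longrightarrow> N f \<ge> 0"
begin

lemma norm_eq: "f \<in> X \<Longrightarrow> N f = sqrt (\<Sum>n. \<omega> n * (\<kappa> n f)\<^sup>2)"
  using norm_sums[of f] norm_nonneg[of f] by (simp add: sums_iff real_sqrt_unique)

lemma coord_zero: "\<kappa> n (\<lambda>x. 0) = 0"
  using coord_scale[OF zero_in, of n 0] by simp

lemma norm_zero: "N (\<lambda>x. 0) = 0"
  by (simp add: norm_eq zero_in coord_zero)

lemma coord_bound: assumes "f \<in> X" shows "\<bar>\<kappa> n f\<bar> \<le> N f / sqrt (\<omega> n)"
proof -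
  have "(\<Sum>k\<in>{n}. \<omega> k * (\<kappa> k f)\<^sup>2) \<le> (N f)\<^sup>2"
    using norm_sums[OF assms] weight_pos
    by (intro sum_le_suminf[of "\<lambda>n. \<omega> n * (\<kappa> n f)\<^sup>2" "{n}", THEN order_trans]) (auto simp: sums_iff less_imp_le)
  then have "(\<kappa> n f)\<^sup>2 \<le> (N f)\<^sup>2 / \<omega> n" using weight_pos[of n] by (simp add: field_simps)
  then have "sqrt ((\<kappa> n f)\<^sup>2) \<le> sqrt ((N f)\<^sup>2 / \<omega> n)" by (rule real_sqrt_le_mono)
  then show ?thesis using norm_nonneg[OF assms] by (simp add: real_sqrt_divide)
qed

lemma norm_scale: assumes "f \<in> X" shows "N (\<lambda>x. c * f x) = \<bar>c\<bar> * N f"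
proof -
  have "(\<lambda>n. \<omega> n * (\<kappa> n (\<lambda>x. c * f x))\<^sup>2) sums (c\<^sup>2 * (N f)\<^sup>2)"
    using sums_mult[OF norm_sums[OF assms], of "c\<^sup>2"] by (simp add: coord_scale[OF assms] power_mult_distrib mult.left_commute)
  then have "(N (\<lambda>x. c * f x))\<^sup>2 = (\<bar>c\<bar> * N f)\<^sup>2"
    using norm_sums[OF scale_in[OF assms, of c]] sums_unique2 by (fastforce simp: power_mult_distrib)
  then show ?thesis using norm_nonneg[OF scale_in[OF assms, of c]] norm_nonneg[OF assms] by simp
qed

lemma norm_le:
  assumes "f \<in> X" "\<And>n. \<bar>\<kappa> n f\<bar> \<le> k * m n" "summable (\<lambda>n. \<omega> n * (m n)\<^sup>2)" "k \<ge> 0"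
  shows "N f \<le> k * sqrt (\<Sum>n. \<omega> n * (m n)\<^sup>2)"
proof -
  have "(\<Sum>n. \<omega> n * (\<kappa> n f)\<^sup>2) \<le> (\<Sum>n. k\<^sup>2 * (\<omega> n * (m n)\<^sup>2))"
  proof (rule suminf_le)
    fix n
    have "\<bar>\<kappa> n f\<bar>\<^sup>2 \<le> (k * m n)\<^sup>2" by (rule power_mono[OF assms(2)]) simp
    then show "\<omega> n * (\<kappa> n f)\<^sup>2 \<le> k\<^sup>2 * (\<omega> n * (m n)\<^sup>2)"
      using weight_pos[of n] by (simp add: power_mult_distrib mult_left_mono mult.left_commute[of "k\<^sup>2"])
  qed (use norm_sums[OF assms(1)] assms(3) in \<open>auto simp: sums_iff intro!: summable_mult\<close>)
  then have "sqrt (\<Sum>n. \<omega> n * (\<kappa> n f)\<^sup>2) \<le> sqrt (k\<^sup>2 * (\<Sum>n. \<omega> n * (m n)\<^sup>2))"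
    using suminf_mult[OF assms(3), of "k\<^sup>2"] by simp
  then show ?thesis using assms(4) by (simp add: norm_eq[OF assms(1)] real_sqrt_mult)
qed

lemma norm_tendsto_0:
  assumes "\<forall>\<^sub>F s in F. f s \<in> X" "\<And>n. ((\<lambda>s. \<kappa> n (f s)) \<longlongrightarrow> 0) F"
    and "\<forall>\<^sub>F s in F. \<forall>n. \<bar>\<kappa> n (f s)\<bar> \<le> m n" "summable (\<lambda>n. \<omega> n * (m n)\<^sup>2)"
  shows "((\<lambda>s. N (f s)) \<longlongrightarrow> 0) F"
proof -
  have "((\<lambda>s. \<Sum>n. \<omega> n * (\<kappa> n (f s))\<^sup>2) \<longlongrightarrow> 0) F"
  proof (rule suminf_tendsto_0[OF _ _ assms(4)])
    show "((\<lambda>s. \<omega> n * (\<kappa> n (f s))\<^sup>2) \<longlongrightarrow> 0) F" for n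
      using tendsto_mult[OF tendsto_const[of "\<omega> n"] tendsto_power[OF assms(2)[of n], of 2]] by simp
    show "\<forall>\<^sub>F s in F. \<forall>n. \<bar>\<omega> n * (\<kappa> n (f s))\<^sup>2\<bar> \<le> \<omega> n * (m n)\<^sup>2"
      using assms(3)
    proof eventually_elim
      case (elim s)
      show ?case
      proof
        fix n
        have "\<bar>\<kappa> n (f s)\<bar>\<^sup>2 \<le> (m n)\<^sup>2" by (rule power_mono) (use elim in auto)
        then show "\<bar>\<omega> n * (\<kappa> n (f s))\<^sup>2\<bar> \<le> \<omega> n * (m n)\<^sup>2"
          using weight_pos[of n] by (simp add: abs_mult mult_left_mono)
      qed
    qed
  qed
  from tendsto_real_sqrt[OF this] have "((\<lambda>s. sqrt (\<Sum>n. \<omega> n * (\<kappa> n (f s))\<^sup>2)) \<longlongrightarrow> 0) F" by simp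
  then show ?thesis
    by (rule Lim_transform_eventually) (use assms(1) in \<open>auto elim!: eventually_mono simp: norm_eq\<close>)
qed

lemma cont_intoI:
  assumes "\<And>t. t \<in> I \<Longrightarrow> f t \<in> X" "\<And>n. continuous_on I (\<lambda>t. \<kappa> n (f t))"
    and "\<And>t n. t \<in> I \<Longrightarrow> \<bar>\<kappa> n (f t)\<bar> \<le> K t * m n" "continuous_on I K" "summable (\<lambda>n. \<omega> n * (m n)\<^sup>2)" "\<And>n. m n \<ge> 0"
  shows "cont_into I X N f"
  unfolding cont_into_def
proof (intro ballI conjI)
  fix t assume t: "t \<in> I"
  show "f t \<in> X" using assms(1)[OF t] .
  have ev: "\<forall>\<^sub>F s in at t within I. s \<in> I" by (simp add: eventually_at_filter)
  have K: "\<forall>\<^sub>F s in at t within I. K s < K t + 1"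
    using assms(4) t by (intro order_tendstoD(2)[of K "K t"]) (auto simp: continuous_on_def)
  show "((\<lambda>s. N (\<lambda>x. f s x - f t x)) \<longlongrightarrow> 0) (at t within I)"
  proof (rule norm_tendsto_0[where m = "\<lambda>n. (2 * K t + 1) * m n"])
    show "\<forall>\<^sub>F s in at t within I. (\<lambda>x. f s x - f t x) \<in> X"
      using ev by eventually_elim (use t assms(1) diff_in in auto)
    show "((\<lambda>s. \<kappa> n (\<lambda>x. f s x - f t x)) \<longlongrightarrow> 0) (at t within I)" for n
    proof (rule Lim_transform_eventually)
      have "((\<lambda>s. \<kappa> n (f s)) \<longlongrightarrow> \<kappa> n (f t)) (at t within I)" using assms(2)[of n] t by (auto simp: continuous_on_def)
      then show "((\<lambda>s. \<kappa> n (f s) - \<kappa> n (f t)) \<longlongrightarrow> 0) (at t within I)" by (simp add: LIM_zero)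
      show "\<forall>\<^sub>F s in at t within I. \<kappa> n (f s) - \<kappa> n (f t) = \<kappa> n (\<lambda>x. f s x - f t x)"
        using ev by eventually_elim (use t assms(1) coord_diff in auto)
    qed
    show "\<forall>\<^sub>F s in at t within I. \<forall>n. \<bar>\<kappa> n (\<lambda>x. f s x - f t x)\<bar> \<le> (2 * K t + 1) * m n"
      using ev K
    proof eventually_elim
      case (elim s)
      show ?case
      proof
        fix n
        have "\<bar>\<kappa> n (f s) - \<kappa> n (f t)\<bar> \<le> K s * m n + K t * m n"
          using assms(3)[OF elim(1), of n] assms(3)[OF t, of n] by linarith
        also have "K s * m n \<le> (K t + 1) * m n" using elim assms(6) by (intro mult_right_mono) auto
        finally show "\<bar>\<kappa> n (\<lambda>x. f s x - f t x)\<bar> \<le> (2 * K t + 1) * m n"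
          using coord_diff[OF assms(1)[OF elim(1)] assms(1)[OF t], of n] by (simp add: algebra_simps)
      qed
    qed
    show "summable (\<lambda>n. \<omega> n * ((2 * K t + 1) * m n)\<^sup>2)"
      using summable_mult[OF assms(5), of "(2 * K t + 1)\<^sup>2"] by (simp add: power_mult_distrib mult_ac)
  qed
qed

text \<open>A common Lipschitz bound of the coefficients majorizes the difference quotients.\<close>

lemma has_time_derivI:
  assumes "\<And>s. s \<in> I \<Longrightarrow> f s \<in> X" "f' \<in> X" "t \<in> I"
    and "\<And>n. ((\<lambda>s. \<kappa> n (f s)) has_real_derivative \<kappa> n f') (at t within I)"
    and "\<And>s n. s \<in> I \<Longrightarrow> \<bar>\<kappa> n (f s) - \<kappa> n (f t)\<bar> \<le> m n * \<bar>s - t\<bar>" "\<And>n. \<bar>\<kappa> n f'\<bar> \<le> m n"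
    and "summable (\<lambda>n. \<omega> n * (m n)\<^sup>2)"
  shows "has_time_deriv N f f' t I"
  unfolding has_time_deriv_def
proof -
  have ev: "\<forall>\<^sub>F s in at t within I. s \<in> I \<and> s \<noteq> t" by (simp add: eventually_at_filter)
  have q: "(\<lambda>x. (f s x - f t x) / (s - t)) \<in> X"
    "\<kappa> n (\<lambda>x. (f s x - f t x) / (s - t)) = (\<kappa> n (f s) - \<kappa> n (f t)) / (s - t)" if "s \<in> I" for s n
    using scale_in[OF diff_in[OF assms(1)[OF that] assms(1)[OF assms(3)]], where c = "1 / (s - t)"]
      coord_scale[OF diff_in[OF assms(1)[OF that] assms(1)[OF assms(3)]], where n = n and c = "1 / (s - t)"]
      coord_diff[OF assms(1)[OF that] assms(1)[OF assms(3)], where n = n] by simp_all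
  show "((\<lambda>s. N (\<lambda>x. (f s x - f t x) / (s - t) - f' x)) \<longlongrightarrow> 0) (at t within I)"
  proof (rule norm_tendsto_0[where m = "\<lambda>n. 2 * m n"])
    show "\<forall>\<^sub>F s in at t within I. (\<lambda>x. (f s x - f t x) / (s - t) - f' x) \<in> X"
      using ev by eventually_elim (use q(1) diff_in assms(2) in auto)
    show "((\<lambda>s. \<kappa> n (\<lambda>x. (f s x - f t x) / (s - t) - f' x)) \<longlongrightarrow> 0) (at t within I)" for n
    proof (rule Lim_transform_eventually)
      show "((\<lambda>s. (\<kappa> n (f s) - \<kappa> n (f t)) / (s - t) - \<kappa> n f') \<longlongrightarrow> 0) (at t within I)"
        using assms(4)[of n] by (simp add: has_field_derivative_iff LIM_zero)
      show "\<forall>\<^sub>F s in at t within I. (\<kappa> n (f s) - \<kappa> n (f t)) / (s - t) - \<kappa> n f' = \<kappa> n (\<lambda>x. (f s x - f t x) / (s - t) - f' x)"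
        using ev by eventually_elim (use q coord_diff[OF _ assms(2)] in auto)
    qed
    show "\<forall>\<^sub>F s in at t within I. \<forall>n. \<bar>\<kappa> n (\<lambda>x. (f s x - f t x) / (s - t) - f' x)\<bar> \<le> 2 * m n"
      using ev
    proof eventually_elim
      case (elim s)
      show ?case
      proof
        fix n
        have h: "\<bar>(\<kappa> n (f s) - \<kappa> n (f t)) / (s - t)\<bar> \<le> m n"
          using assms(5)[of s n] elim by (simp add: abs_divide field_simps)
        have "\<kappa> n (\<lambda>x. (f s x - f t x) / (s - t) - f' x) = (\<kappa> n (f s) - \<kappa> n (f t)) / (s - t) - \<kappa> n f'"
          using q(2)[of s n] coord_diff[OF q(1)[of s] assms(2), where n = n] elim by simp
        then show "\<bar>\<kappa> n (\<lambda>x. (f s x - f t x) / (s - t) - f' x)\<bar> \<le> 2 * m n"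
          using assms(6)[of n] h by linarith
      qed
    qed
    show "summable (\<lambda>n. \<omega> n * (2 * m n)\<^sup>2)"
      using summable_mult[OF assms(7), of 4] by (simp add: power_mult_distrib mult_ac)
  qed
qed

lemma has_time_derivD:
  assumes "has_time_deriv N f f' t I" "\<And>s. s \<in> I \<Longrightarrow> f s \<in> X" "f' \<in> X" "t \<in> I"
  shows "((\<lambda>s. \<kappa> n (f s)) has_real_derivative \<kappa> n f') (at t within I)"
proof -
  have ev: "\<forall>\<^sub>F s in at t within I. s \<in> I" by (simp add: eventually_at_filter)
  have "((\<lambda>s. (\<kappa> n (f s) - \<kappa> n (f t)) / (s - t) - \<kappa> n f') \<longlongrightarrow> 0) (at t within I)"
  proof (rule Lim_null_comparison)
    show "\<forall>\<^sub>F s in at t within I. norm ((\<kappa> n (f s) - \<kappa> n (f t)) / (s - t) - \<kappa> n f') \<le> N (\<lambda>x. (f s x - f t x) / (s - t) - f' x) / sqrt (\<omega> n)"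
      using ev
    proof eventually_elim
      case (elim s)
      have d: "(\<lambda>x. f s x - f t x) \<in> X" using assms elim by (intro diff_in) auto
      have q: "(\<lambda>x. (f s x - f t x) / (s - t)) \<in> X"
        "\<kappa> n (\<lambda>x. (f s x - f t x) / (s - t)) = (\<kappa> n (f s) - \<kappa> n (f t)) / (s - t)"
        using scale_in[OF d, where c = "1 / (s - t)"] coord_scale[OF d, where n = n and c = "1 / (s - t)"]
          coord_diff[OF assms(2)[OF elim] assms(2)[OF assms(4)], where n = n] by simp_all
      show ?case using coord_bound[OF diff_in[OF q(1) assms(3)], of n] coord_diff[OF q(1) assms(3), where n = n] q(2) by simp
    qed
    show "((\<lambda>s. N (\<lambda>x. (f s x - f t x) / (s - t) - f' x) / sqrt (\<omega> n)) \<longlongrightarrow> 0) (at t within I)"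
      using assms(1) unfolding has_time_deriv_def by (rule tendsto_divide_zero)
  qed
  then show ?thesis by (simp add: has_field_derivative_iff LIM_zero_iff)
qed

lemma norm_measurable:
  assumes "\<And>t. t \<in> S \<Longrightarrow> f t \<in> X" "\<And>n. continuous_on S (\<lambda>t. \<kappa> n (f t))" "S \<in> sets lebesgue"
  shows "(\<lambda>t. N (f t)) \<in> borel_measurable (lebesgue_on S)"
proof -
  have [measurable]: "(\<lambda>t. \<kappa> n (f t)) \<in> borel_measurable (lebesgue_on S)" for n
    by (rule continuous_imp_measurable_on_sets_lebesgue[OF assms(2,3)])
  have "(\<lambda>t. sqrt (\<Sum>n. \<omega> n * (\<kappa> n (f t))\<^sup>2)) \<in> borel_measurable (lebesgue_on S)" by measurable
  then show ?thesis
    by (rule measurable_cong[THEN iffD1, rotated]) (use assms(1) norm_eq in auto)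
qed

text \<open>The number \<open>K t\<close> may be unbounded as \<open>t\<close> approaches the ends of the interval; all singularities at \<open>t = 0\<close> enter through it.\<close>

lemma bochner_integrableI:
  assumes b: "b > 0" and I: "I = {0<..<b} \<or> I = {0..b}"
    and f: "\<And>t. t \<in> {0<..<b} \<Longrightarrow> f t \<in> X" "\<And>n. continuous_on {0<..<b} (\<lambda>t. \<kappa> n (f t))"
    and K: "\<And>t n. t \<in> {0<..<b} \<Longrightarrow> \<bar>\<kappa> n (f t)\<bar> \<le> K t * m n" "\<And>t. t \<in> {0<..<b} \<Longrightarrow> K t \<ge> 0" "continuous_on {0<..<b} K"
    and m: "summable (\<lambda>n. \<omega> n * (m n)\<^sup>2)" "\<And>n. m n \<ge> 0"
  shows "integrable (lebesgue_on {0<..<b}) K \<Longrightarrow> bochner_integrable I X N f"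
    and "integrable (lebesgue_on {0<..<b}) (\<lambda>t. (K t)\<^sup>2) \<Longrightarrow> L2_into {0<..<b} X N f"
proof -
  have c: "cont_into {0<..<b} X N f" by (rule cont_intoI[OF f(1,2) K(1,3) m])
  have sm: "strongly_measurable J X N f" if "J = {0<..<b} \<or> J = {0..b}" for J
    by (rule cont_into_strongly_measurable[OF b _ _ c norm_zero]) (use that in auto)
  define B where "B = sqrt (\<Sum>n. \<omega> n * (m n)\<^sup>2)"
  have B: "B \<ge> 0" unfolding B_def using weight_pos by (intro real_sqrt_ge_zero suminf_nonneg m) (simp add: less_imp_le)
  have bd: "N (f t) \<le> K t * B" if "t \<in> {0<..<b}" for t
    unfolding B_def by (rule norm_le[OF f(1)[OF that] K(1)[OF that] m(1) K(2)[OF that]])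
  have meas: "(\<lambda>t. N (f t)) \<in> borel_measurable (lebesgue_on {0<..<b})"
    by (rule norm_measurable[OF f]) auto
  { assume i: "integrable (lebesgue_on {0<..<b}) K"
    have "integrable (lebesgue_on {0<..<b}) (\<lambda>t. N (f t))"
    proof (rule Bochner_Integration.integrable_bound[OF integrable_mult_left[OF i, of B] meas])
      show "AE t in lebesgue_on {0<..<b}. norm (N (f t)) \<le> norm (K t * B)"
        by (rule AE_I2) (use bd norm_nonneg f(1) B K(2) in \<open>auto simp: abs_mult\<close>)
    qed
    then have "(\<lambda>t. N (f t)) absolutely_integrable_on {0<..<b}"
      by (simp add: set_integrable_def integrable_restrict_space)
    then have "(\<lambda>t. N (f t)) absolutely_integrable_on I"
      using I by (auto simp: absolutely_integrable_on_Icc_iff_Ioo)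
    then have "integrable (lebesgue_on I) (\<lambda>t. N (f t))"
      by (rule absolutely_integrable_imp_integrable) (use I in auto)
    then show "bochner_integrable I X N f" using sm[OF I] by (simp add: bochner_integrable_def) }
  { assume i: "integrable (lebesgue_on {0<..<b}) (\<lambda>t. (K t)\<^sup>2)"
    have "integrable (lebesgue_on {0<..<b}) (\<lambda>t. (N (f t))\<^sup>2)"
    proof (rule Bochner_Integration.integrable_bound[OF integrable_mult_left[OF i, of "B\<^sup>2"]])
      show "(\<lambda>t. (N (f t))\<^sup>2) \<in> borel_measurable (lebesgue_on {0<..<b})" using meas by measurable
      show "AE t in lebesgue_on {0<..<b}. norm ((N (f t))\<^sup>2) \<le> norm ((K t)\<^sup>2 * B\<^sup>2)"
      proof (rule AE_I2)
        fix t assume "t \<in> space (lebesgue_on {0<..<b})"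
        then have t: "t \<in> {0<..<b}" by simp
        have "(N (f t))\<^sup>2 \<le> (K t * B)\<^sup>2" by (rule power_mono[OF bd[OF t] norm_nonneg[OF f(1)[OF t]]])
        then show "norm ((N (f t))\<^sup>2) \<le> norm ((K t)\<^sup>2 * B\<^sup>2)" by (simp add: power_mult_distrib)
      qed
    qed
    then show "L2_into {0<..<b} X N f" using sm by (simp add: L2_into_def) }
qed

text \<open>Coordinates are continuous linear functionals, so they carry approximating simple functions to approximating simple functions.\<close>

lemma coord_integrable:
  assumes "bochner_integrable I X N f" "I \<in> sets lebesgue"
  shows "integrable (lebesgue_on I) (\<lambda>t. \<kappa> n (f t))"
proof -
  have sm: "strongly_measurable I X N f" and i: "integrable (lebesgue_on I) (\<lambda>t. N (f t))"
    using assms(1) by (auto simp: bochner_integrable_def)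
  obtain s where s: "\<And>k. finite (s k ` I)" "\<And>k. s k ` I \<subseteq> X" "\<And>k y. {t \<in> I. s k t = y} \<in> sets lebesgue"
    "AE t in lebesgue_on I. (\<lambda>k. N (\<lambda>x. s k t x - f t x)) \<longlonglongrightarrow> 0"
    using sm unfolding strongly_measurable_def by blast
  have fX: "AE t in lebesgue_on I. f t \<in> X" using sm by (simp add: strongly_measurable_def)
  have [measurable]: "(\<lambda>t. indicator I t * \<kappa> n (s k t)) \<in> borel_measurable lebesgue" for k
  proof -
    have "(\<lambda>t. \<Sum>y\<in>s k ` I. \<kappa> n y * indicator {t \<in> I. s k t = y} t) \<in> borel_measurable lebesgue"
      by (intro borel_measurable_sum borel_measurable_times borel_measurable_const borel_measurable_indicator s)
    also have "(\<lambda>t. \<Sum>y\<in>s k ` I. \<kappa> n y * indicator {t \<in> I. s k t = y} t) = (\<lambda>t. indicator I t * \<kappa> n (s k t))"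
    proof
      fix t
      show "(\<Sum>y\<in>s k ` I. \<kappa> n y * indicator {t \<in> I. s k t = y} t) = indicator I t * \<kappa> n (s k t)"
      proof (cases "t \<in> I")
        case True
        have "(\<Sum>y\<in>s k ` I. \<kappa> n y * indicator {t \<in> I. s k t = y} t) = (\<Sum>y\<in>s k ` I. if s k t = y then \<kappa> n y else 0)"
          using True by (intro sum.cong) (auto simp: indicator_def)
        then show ?thesis using True s(1)[of k] by (simp add: sum.delta')
      qed simp
    qed
    finally show ?thesis .
  qed
  have "(\<lambda>t. lim (\<lambda>k. indicator I t * \<kappa> n (s k t))) \<in> borel_measurable lebesgue" by measurable
  moreover have "AE t in lebesgue. lim (\<lambda>k. indicator I t * \<kappa> n (s k t)) = indicator I t * \<kappa> n (f t)"
  proof -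
    have "AE t in lebesgue_on I. (\<lambda>k. \<kappa> n (s k t)) \<longlonglongrightarrow> \<kappa> n (f t)"
      using fX s(4) AE_space
    proof eventually_elim
      case (elim t)
      have sX: "s k t \<in> X" for k using elim(3) s(2)[of k] by auto
      have "(\<lambda>k. \<kappa> n (s k t) - \<kappa> n (f t)) \<longlonglongrightarrow> 0"
      proof (rule Lim_null_comparison)
        show "\<forall>\<^sub>F k in sequentially. norm (\<kappa> n (s k t) - \<kappa> n (f t)) \<le> N (\<lambda>x. s k t x - f t x) / sqrt (\<omega> n)"
          using coord_bound[OF diff_in[OF sX elim(1)], of n] coord_diff[OF sX elim(1), of n] by simp
        show "(\<lambda>k. N (\<lambda>x. s k t x - f t x) / sqrt (\<omega> n)) \<longlonglongrightarrow> 0" by (rule tendsto_divide_zero[OF elim(2)])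
      qed
      then show ?case by (simp add: LIM_zero_iff)
    qed
    then have "AE t in lebesgue. t \<in> I \<longrightarrow> (\<lambda>k. \<kappa> n (s k t)) \<longlonglongrightarrow> \<kappa> n (f t)"
      using assms(2) by (subst (asm) AE_restrict_space_iff) auto
    then show ?thesis
    proof eventually_elim
      case (elim t)
      then show ?case by (cases "t \<in> I") (auto simp: limI)
    qed
  qed
  ultimately have "(\<lambda>t. indicator I t * \<kappa> n (f t)) \<in> borel_measurable lebesgue" by (rule borel_measurable_AE)
  then have meas: "(\<lambda>t. \<kappa> n (f t)) \<in> borel_measurable (lebesgue_on I)"
    using assms(2) by (subst borel_measurable_restrict_space_iff) auto
  show ?thesis
  proof (rule Bochner_Integration.integrable_bound[OF integrable_divide[OF i, of "sqrt (\<omega> n)"] meas])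
    show "AE t in lebesgue_on I. norm (\<kappa> n (f t)) \<le> norm (N (f t) / sqrt (\<omega> n))"
      using fX by eventually_elim (use coord_bound[of _ n] norm_nonneg weight_pos[of n] in auto)
  qed
qed

end

text \<open>The functions whose coefficients are square summable with weights \<open>\<omega>\<close>. The space \<open>Y\<close> and its norm are given, not constructed, so that spaces
with another definition, like \<open>H\<^sup>1\<^sub>0\<close>, can be recognized as instances. The lower bound of the weights embeds \<open>Y\<close> into \<open>L\<^sup>2\<close>, hence \<open>L\<^sup>2\<close> into
the dual of \<open>Y\<close>.\<close>

locale hilbert_scale = orthonormal_basis \<Omega> e
  for \<Omega> :: "'a::euclidean_space set" and e :: "nat \<Rightarrow> 'a \<Rightarrow> real" +
  fixes Y :: "('a \<Rightarrow> real) set" and NY :: "('a \<Rightarrow> real) \<Rightarrow> real" and \<omega> :: "nat \<Rightarrow> real" and c0 :: real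
  assumes c0: "c0 > 0" "\<And>n. \<omega> n \<ge> c0"
    and Y_iff: "\<And>v. v \<in> Y \<longleftrightarrow> v \<in> L2 \<Omega> \<and> summable (\<lambda>n. \<omega> n * (cf v n)\<^sup>2)"
    and NY_eq: "\<And>v. v \<in> Y \<Longrightarrow> NY v = sqrt (\<Sum>n. \<omega> n * (cf v n)\<^sup>2)"
begin

lemma omega_pos: "\<omega> n > 0" using c0(1) c0(2)[of n] by linarith

lemma Y_L2: "v \<in> Y \<Longrightarrow> v \<in> L2 \<Omega>" by (simp add: Y_iff)

lemma weighted_sum_diff:
  assumes "\<And>n. w n \<ge> (0::real)" "summable (\<lambda>n. w n * (a n)\<^sup>2)" "summable (\<lambda>n. w n * (b n)\<^sup>2)"
  shows "summable (\<lambda>n. w n * (a n - b n)\<^sup>2)"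
proof (rule summable_comparison_test')
  show "summable (\<lambda>n. 2 * (w n * (a n)\<^sup>2) + 2 * (w n * (b n)\<^sup>2))" by (intro summable_add summable_mult assms)
  fix n
  have "(a n - b n)\<^sup>2 \<le> 2 * (a n)\<^sup>2 + 2 * (b n)\<^sup>2"
    using zero_le_power2[of "a n + b n"] by (simp add: power2_sum power2_diff)
  then have "w n * (a n - b n)\<^sup>2 \<le> w n * (2 * (a n)\<^sup>2 + 2 * (b n)\<^sup>2)" by (rule mult_left_mono[OF _ assms(1)])
  then show "norm (w n * (a n - b n)\<^sup>2) \<le> 2 * (w n * (a n)\<^sup>2) + 2 * (w n * (b n)\<^sup>2)"
    using assms(1)[of n] by (simp add: abs_mult algebra_simps)
qed

sublocale P: coord_space Y NY "\<lambda>n f. cf f n" \<omega>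
proof
  show "(\<lambda>x. 0) \<in> Y" by (simp add: Y_iff L2_zero L2_inner_def)
  fix f g c n assume f: "f \<in> Y"
  show "(\<lambda>x. c * f x) \<in> Y"
    using f summable_mult[of "\<lambda>n. \<omega> n * (cf f n)\<^sup>2" "c\<^sup>2"]
    by (simp add: Y_iff L2_scale L2_inner_scale power_mult_distrib mult.left_commute[of "c\<^sup>2"])
  show "cf (\<lambda>x. c * f x) n = c * cf f n" by (rule L2_inner_scale)
  have s: "summable (\<lambda>n. \<omega> n * (cf f n)\<^sup>2)" using f by (simp add: Y_iff)
  have nn: "0 \<le> (\<Sum>n. \<omega> n * (cf f n)\<^sup>2)" by (rule suminf_nonneg[OF s]) (use omega_pos in \<open>simp add: less_imp_le\<close>)
  then show "NY f \<ge> 0" using f by (simp add: NY_eq)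
  show "(\<lambda>n. \<omega> n * (cf f n)\<^sup>2) sums (NY f)\<^sup>2" using f s nn by (simp add: NY_eq summable_sums)
  assume g: "g \<in> Y"
  show "cf (\<lambda>x. f x - g x) n = cf f n - cf g n" using f g by (intro L2_inner_diff e_L2) (auto simp: Y_iff)
  show "(\<lambda>x. f x - g x) \<in> Y"
    using f g weighted_sum_diff[of \<omega> "cf f" "cf g"] omega_pos
    by (auto simp: Y_iff L2_diff L2_inner_diff e_L2 less_imp_le)
qed (rule omega_pos)

lemma Y_add: assumes "f \<in> Y" "g \<in> Y" shows "(\<lambda>x. f x + g x) \<in> Y"
  using P.diff_in[OF assms(1) P.scale_in[OF assms(2), of "-1"]] by simp

lemma partial_in_Y: "(\<lambda>x. \<Sum>n<M. c n * e n x) \<in> Y"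
  unfolding Y_iff
  by (auto simp: partial_L2 cf_partial intro!: summable_finite[of "{..<M}"] split: if_splits)

lemma e_in_Y: "e n \<in> Y"
  unfolding Y_iff by (auto simp: e_L2 orthonormal intro!: summable_finite[of "{n}"] split: if_splits)

lemma synthesis:
  assumes "summable (\<lambda>n. \<omega> n * (c n)\<^sup>2)"
  obtains f where "f \<in> Y" "\<And>n. cf f n = c n"
proof -
  have "summable (\<lambda>n. (c n)\<^sup>2)"
  proof (rule summable_comparison_test')
    show "summable (\<lambda>n. \<omega> n * (c n)\<^sup>2 / c0)" using assms by (rule summable_divide)
    show "norm ((c n)\<^sup>2) \<le> \<omega> n * (c n)\<^sup>2 / c0" for n
      using c0(1) mult_right_mono[OF c0(2), of "(c n)\<^sup>2" n] by (simp add: field_simps)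
  qed
  then obtain s where s: "L2_sums \<Omega> (\<lambda>n x. c n * e n x) s" by (rule Riesz_Fischer)
  then have "\<And>n. cf s n = c n" by (rule L2_sums_coeff)
  moreover have "s \<in> L2 \<Omega>" using s by (simp add: L2_sums_iff)
  ultimately show thesis using assms by (intro that[of s]) (auto simp: Y_iff)
qed

lemma pairing_bound:
  assumes "summable (\<lambda>n. 1 / \<omega> n * (c n)\<^sup>2)" "v \<in> Y"
  shows "summable (\<lambda>n. \<bar>c n * cf v n\<bar>)"
    and "\<bar>\<Sum>n. c n * cf v n\<bar> \<le> sqrt (\<Sum>n. 1 / \<omega> n * (c n)\<^sup>2) * NY v"
proof -
  have sv: "summable (\<lambda>n. \<omega> n * (cf v n)\<^sup>2)" using assms(2) by (simp add: Y_iff)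
  show 1: "summable (\<lambda>n. \<bar>c n * cf v n\<bar>)"
  proof (rule summable_comparison_test')
    show "summable (\<lambda>n. 1 / \<omega> n * (c n)\<^sup>2 + \<omega> n * (cf v n)\<^sup>2)" by (intro summable_add assms sv)
    fix n
    define r where "r = sqrt (\<omega> n)"
    have r: "r > 0" "r\<^sup>2 = \<omega> n" using omega_pos[of n] by (simp_all add: r_def)
    have "0 \<le> (\<bar>c n\<bar> / r - r * \<bar>cf v n\<bar>)\<^sup>2" by simp
    then have "2 * \<bar>c n * cf v n\<bar> \<le> (c n)\<^sup>2 / \<omega> n + \<omega> n * (cf v n)\<^sup>2"
      using r by (simp add: power2_diff power_divide power_mult_distrib abs_mult)
    then show "norm \<bar>c n * cf v n\<bar> \<le> 1 / \<omega> n * (c n)\<^sup>2 + \<omega> n * (cf v n)\<^sup>2" by simp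
  qed
  have "\<bar>\<Sum>n<M. c n * cf v n\<bar> \<le> sqrt (\<Sum>n. 1 / \<omega> n * (c n)\<^sup>2) * NY v" for M
  proof -
    have "(\<Sum>n<M. c n * cf v n) = (\<Sum>n<M. (c n / sqrt (\<omega> n)) * (sqrt (\<omega> n) * cf v n))"
      using omega_pos by (intro sum.cong refl) (simp add: less_imp_neq[symmetric])
    then have "(\<Sum>n<M. c n * cf v n)\<^sup>2 \<le> (\<Sum>n<M. (c n / sqrt (\<omega> n))\<^sup>2) * (\<Sum>n<M. (sqrt (\<omega> n) * cf v n)\<^sup>2)"
      by (simp only: Cauchy_Schwarz_ineq_sum)
    also have "(\<Sum>n<M. (c n / sqrt (\<omega> n))\<^sup>2) = (\<Sum>n<M. 1 / \<omega> n * (c n)\<^sup>2)"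
      using omega_pos by (intro sum.cong refl) (simp add: power_divide less_imp_le)
    also have "(\<Sum>n<M. (sqrt (\<omega> n) * cf v n)\<^sup>2) = (\<Sum>n<M. \<omega> n * (cf v n)\<^sup>2)"
      using omega_pos by (intro sum.cong refl) (simp add: power_mult_distrib less_imp_le)
    also have "(\<Sum>n<M. 1 / \<omega> n * (c n)\<^sup>2) * (\<Sum>n<M. \<omega> n * (cf v n)\<^sup>2) \<le> (\<Sum>n. 1 / \<omega> n * (c n)\<^sup>2) * (\<Sum>n. \<omega> n * (cf v n)\<^sup>2)"
      using omega_pos by (intro mult_mono sum_le_suminf assms sv sum_nonneg suminf_nonneg) (auto simp: less_imp_le)
    finally have "sqrt ((\<Sum>n<M. c n * cf v n)\<^sup>2) \<le> sqrt ((\<Sum>n. 1 / \<omega> n * (c n)\<^sup>2) * (\<Sum>n. \<omega> n * (cf v n)\<^sup>2))"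
      by (rule real_sqrt_le_mono)
    then show ?thesis using assms(2) by (simp add: NY_eq real_sqrt_mult)
  qed
  moreover have "(\<lambda>M. \<bar>\<Sum>n<M. c n * cf v n\<bar>) \<longlonglongrightarrow> \<bar>\<Sum>n. c n * cf v n\<bar>"
    using summable_LIMSEQ[OF summable_rabs_cancel[OF 1]] by (rule tendsto_rabs)
  ultimately show "\<bar>\<Sum>n. c n * cf v n\<bar> \<le> sqrt (\<Sum>n. 1 / \<omega> n * (c n)\<^sup>2) * NY v"
    by (intro LIMSEQ_le_const2) auto
qed

text \<open>The functional with prescribed values on the basis.\<close>

definition dual_series :: "(nat \<Rightarrow> real) \<Rightarrow> ('a \<Rightarrow> real) \<Rightarrow> real" where
  "dual_series c v = (\<Sum>n. c n * cf v n)"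

lemma dual_series_e: "dual_series c (e m) = c m"
proof -
  have "dual_series c (e m) = (\<Sum>n\<in>{m}. c n * cf (e m) n)"
    unfolding dual_series_def by (rule suminf_finite) (auto simp: orthonormal)
  then show ?thesis by (simp add: orthonormal)
qed

lemma dual_series_dual:
  assumes "summable (\<lambda>n. 1 / \<omega> n * (c n)\<^sup>2)"
  shows "dual_series c \<in> dual Y NY"
  unfolding dual_def
proof (intro CollectI conjI ballI allI)
  note s = summable_rabs_cancel[OF pairing_bound(1)[OF assms]]
  fix f assume f: "f \<in> Y"
  show "dual_series c (\<lambda>x. a * f x) = a * dual_series c f" for a
    unfolding dual_series_def using suminf_mult[OF s[OF f], of a] by (simp add: L2_inner_scale mult.left_commute)
  fix g assume g: "g \<in> Y"
  show "dual_series c (\<lambda>x. f x + g x) = dual_series c f + dual_series c g"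
    unfolding dual_series_def using suminf_add[OF s[OF f] s[OF g]] by (simp add: L2_inner_add f g Y_L2 e_L2 ring_distribs)
next
  show "\<exists>C. \<forall>f\<in>Y. \<bar>dual_series c f\<bar> \<le> C * NY f"
    using pairing_bound(2)[OF assms] unfolding dual_series_def by blast
qed

lemma dual_cong:
  assumes "\<And>v. v \<in> Y \<Longrightarrow> L v = L' v" "L \<in> dual Y NY"
  shows "L' \<in> dual Y NY"
  using assms Y_add P.scale_in unfolding dual_def by simp

lemma dual_linear:
  assumes "L \<in> dual Y NY"
  shows "f \<in> Y \<Longrightarrow> g \<in> Y \<Longrightarrow> L (\<lambda>x. f x + g x) = L f + L g" "f \<in> Y \<Longrightarrow> L (\<lambda>x. c * f x) = c * L f"
    "f \<in> Y \<Longrightarrow> g \<in> Y \<Longrightarrow> L (\<lambda>x. f x - g x) = L f - L g"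
proof -
  show a: "f \<in> Y \<Longrightarrow> g \<in> Y \<Longrightarrow> L (\<lambda>x. f x + g x) = L f + L g" for f g using assms by (auto simp: dual_def)
  show s: "f \<in> Y \<Longrightarrow> L (\<lambda>x. c * f x) = c * L f" for f c using assms by (auto simp: dual_def)
  show "L (\<lambda>x. f x - g x) = L f - L g" if "f \<in> Y" "g \<in> Y"
    using a[OF that(1) P.scale_in[OF that(2), of "-1"]] s[OF that(2), of "-1"] by simp
qed

lemma dual_partial:
  assumes "L \<in> dual Y NY" shows "L (\<lambda>x. \<Sum>n<M. c n * e n x) = (\<Sum>n<M. c n * L (e n))"
proof (induction M)
  case 0
  show ?case using dual_linear(2)[OF assms P.zero_in, of 0] by simp
next
  case (Suc M)
  then show ?case
    using dual_linear(1)[OF assms partial_in_Y[of c M] P.scale_in[OF e_in_Y[of M], of "c M"]] dual_linear(2)[OF assms e_in_Y[of M], of "c M"] by simp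
qed

lemma NY_partial: "NY (\<lambda>x. \<Sum>n<M. c n * e n x) = sqrt (\<Sum>n<M. \<omega> n * (c n)\<^sup>2)"
proof -
  have "(\<Sum>n. \<omega> n * (cf (\<lambda>x. \<Sum>n<M. c n * e n x) n)\<^sup>2) = (\<Sum>n<M. \<omega> n * (cf (\<lambda>x. \<Sum>n<M. c n * e n x) n)\<^sup>2)"
    by (rule suminf_finite) (auto simp: cf_partial)
  then show ?thesis by (simp add: NY_eq partial_in_Y cf_partial)
qed

text \<open>The extremal test function of Riesz' representation theorem, cut off after \<open>M\<close> terms.\<close>

lemma dual_test:
  "L \<in> dual Y NY \<Longrightarrow> L (\<lambda>x. \<Sum>n<M. (1 / \<omega> n * L (e n)) * e n x) = (\<Sum>n<M. 1 / \<omega> n * (L (e n))\<^sup>2)"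
  "NY (\<lambda>x. \<Sum>n<M. (1 / \<omega> n * L (e n)) * e n x) = sqrt (\<Sum>n<M. 1 / \<omega> n * (L (e n))\<^sup>2)"
proof -
  show "L (\<lambda>x. \<Sum>n<M. (1 / \<omega> n * L (e n)) * e n x) = (\<Sum>n<M. 1 / \<omega> n * (L (e n))\<^sup>2)" if "L \<in> dual Y NY"
    unfolding dual_partial[OF that] by (simp add: power2_eq_square)
  have "\<omega> n * (1 / \<omega> n * L (e n))\<^sup>2 = 1 / \<omega> n * (L (e n))\<^sup>2" for n
    using omega_pos[of n] by (simp add: power2_eq_square)
  then show "NY (\<lambda>x. \<Sum>n<M. (1 / \<omega> n * L (e n)) * e n x) = sqrt (\<Sum>n<M. 1 / \<omega> n * (L (e n))\<^sup>2)"
    unfolding NY_partial by simp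
qed

text \<open>Apply the functional to the extremal test functions.\<close>

lemma dual_summable:
  assumes "L \<in> dual Y NY" shows "summable (\<lambda>n. 1 / \<omega> n * (L (e n))\<^sup>2)"
proof -
  obtain C where C: "\<And>f. f \<in> Y \<Longrightarrow> \<bar>L f\<bar> \<le> C * NY f" using assms unfolding dual_def by blast
  show ?thesis
  proof (rule summableI_nonneg_bounded[where x = "C\<^sup>2"])
    show "0 \<le> 1 / \<omega> n * (L (e n))\<^sup>2" for n using omega_pos[of n] by simp
    fix M
    define A where "A = (\<Sum>n<M. 1 / \<omega> n * (L (e n))\<^sup>2)"
    have A: "A \<ge> 0" unfolding A_def using omega_pos by (intro sum_nonneg) (simp add: less_imp_le)
    have "\<bar>A\<bar> \<le> C * sqrt A"
      using C[OF partial_in_Y[of "\<lambda>n. 1 / \<omega> n * L (e n)" M]] dual_test(1)[OF assms, of M] dual_test(2)[of L M] by (simp add: A_def)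
    then have le: "sqrt A * sqrt A \<le> C * sqrt A" using A by simp
    show "(\<Sum>n<M. 1 / \<omega> n * (L (e n))\<^sup>2) \<le> C\<^sup>2"
    proof (cases "A = 0")
      case False
      then have "0 < sqrt A" using A by simp
      then have "sqrt A \<le> C" using le by (rule mult_right_le_imp_le[rotated])
      then have "(sqrt A)\<^sup>2 \<le> C\<^sup>2" using A by (intro power_mono) auto
      then show ?thesis using A by (simp add: A_def)
    qed (simp add: A_def)
  qed
qed

text \<open>The partial sums of the expansion converge in \<open>Y\<close>, not only in \<open>L\<^sup>2\<close>.\<close>

lemma dual_expand:
  assumes "L \<in> dual Y NY" "v \<in> Y" shows "L v = dual_series (\<lambda>n. L (e n)) v"
proof -
  obtain C where C: "\<And>f. f \<in> Y \<Longrightarrow> \<bar>L f\<bar> \<le> C * NY f" using assms unfolding dual_def by blast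
  define S where "S = (\<lambda>M x. \<Sum>n<M. cf v n * e n x)"
  have S: "S M \<in> Y" for M unfolding S_def by (rule partial_in_Y)
  have "(\<lambda>M. NY (\<lambda>x. v x - S M x)) \<longlonglongrightarrow> 0"
  proof (rule P.norm_tendsto_0[where m = "\<lambda>n. \<bar>cf v n\<bar>"])
    have c: "cf (\<lambda>x. v x - S M x) n = (if n < M then 0 else cf v n)" for M n
      using P.coord_diff[OF assms(2) S[of M], of n] by (simp add: S_def cf_partial)
    show "(\<lambda>M. cf (\<lambda>x. v x - S M x) n) \<longlonglongrightarrow> 0" for n
      by (rule tendsto_eventually) (auto simp: c eventually_sequentially intro!: exI[of _ "Suc n"])
    show "\<forall>\<^sub>F M in sequentially. \<forall>n. \<bar>cf (\<lambda>x. v x - S M x) n\<bar> \<le> \<bar>cf v n\<bar>" by (simp add: c)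
    show "\<forall>\<^sub>F M in sequentially. (\<lambda>x. v x - S M x) \<in> Y" using P.diff_in[OF assms(2) S] by simp
    show "summable (\<lambda>n. \<omega> n * \<bar>cf v n\<bar>\<^sup>2)" using assms(2) by (simp add: Y_iff)
  qed
  then have z: "(\<lambda>M. C * NY (\<lambda>x. v x - S M x)) \<longlonglongrightarrow> 0" by (rule tendsto_mult_right_zero)
  have "(\<lambda>M. L v - L (S M)) \<longlonglongrightarrow> 0"
    by (rule Lim_null_comparison[OF _ z]) (use C[OF P.diff_in[OF assms(2) S]] dual_linear(3)[OF assms(1,2) S] in simp)
  then have "(\<lambda>M. L v - (L v - L (S M))) \<longlonglongrightarrow> L v - 0" by (intro tendsto_intros)
  then have "(\<lambda>n. cf v n * L (e n)) sums L v"
    using dual_partial[OF assms(1)] by (simp add: sums_def S_def)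
  then show ?thesis by (simp add: dual_series_def sums_iff mult.commute)
qed

lemma dual_norm_eq:
  assumes L: "L \<in> dual Y NY" shows "dual_norm Y NY L = sqrt (\<Sum>n. 1 / \<omega> n * (L (e n))\<^sup>2)"
proof -
  note s = dual_summable[OF L]
  let ?B = "sqrt (\<Sum>n. 1 / \<omega> n * (L (e n))\<^sup>2)"
  have nn: "0 \<le> 1 / \<omega> n * (L (e n))\<^sup>2" for n using omega_pos[of n] by simp
  have B: "?B \<ge> 0" by (intro real_sqrt_ge_zero suminf_nonneg s nn)
  have le: "\<bar>L f\<bar> \<le> ?B" if "f \<in> {f \<in> Y. NY f \<le> 1}" for f
  proof -
    have "\<bar>L f\<bar> \<le> ?B * NY f"
      using pairing_bound(2)[OF s, of f] dual_expand[OF L, of f] that by (simp add: dual_series_def)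
    also have "\<dots> \<le> ?B * 1" by (rule mult_left_mono) (use that B in auto)
    finally show ?thesis by simp
  qed
  have bdd: "bdd_above ((\<lambda>f. \<bar>L f\<bar>) ` {f \<in> Y. NY f \<le> 1})" using le by (intro bdd_aboveI[of _ ?B]) auto
  have zero: "(\<lambda>x. 0) \<in> {f \<in> Y. NY f \<le> 1}" using P.zero_in P.norm_zero by simp
  have "dual_norm Y NY L \<le> ?B" unfolding dual_norm_def by (rule cSUP_least) (use zero le in auto)
  moreover have "sqrt (\<Sum>n<M. 1 / \<omega> n * (L (e n))\<^sup>2) \<le> dual_norm Y NY L" for M
  proof -
    define A where "A = (\<Sum>n<M. 1 / \<omega> n * (L (e n))\<^sup>2)"
    have A: "A \<ge> 0" unfolding A_def by (intro sum_nonneg nn)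
    define S where "S = (\<lambda>x. \<Sum>n<M. (1 / \<omega> n * L (e n)) * e n x)"
    have S: "S \<in> Y" "L S = A" "NY S = sqrt A"
      unfolding S_def A_def by (rule partial_in_Y dual_test(1)[OF L] dual_test(2))+
    show ?thesis
    proof (cases "A = 0")
      case True
      have "\<bar>L (\<lambda>x. 0)\<bar> \<le> dual_norm Y NY L" unfolding dual_norm_def by (rule cSUP_upper[OF zero bdd])
      then show ?thesis using True by (simp add: A_def)
    next
      case False
      have "NY (\<lambda>x. 1 / sqrt A * S x) = 1"
      proof -
        have "NY (\<lambda>x. 1 / sqrt A * S x) = \<bar>1 / sqrt A\<bar> * sqrt A"
          unfolding S(3)[symmetric] by (rule P.norm_scale[OF S(1)])
        then show ?thesis using A False by simp
      qed
      then have "\<bar>L (\<lambda>x. 1 / sqrt A * S x)\<bar> \<le> dual_norm Y NY L"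
        unfolding dual_norm_def by (intro cSUP_upper[OF _ bdd]) (use P.scale_in[OF S(1), of "1 / sqrt A"] in auto)
      moreover have "\<bar>L (\<lambda>x. 1 / sqrt A * S x)\<bar> = sqrt A"
        using dual_linear(2)[OF L S(1), of "1 / sqrt A"] S(2) A False by (simp add: real_div_sqrt)
      ultimately show ?thesis by (simp add: A_def)
    qed
  qed
  then have "?B \<le> dual_norm Y NY L"
    by (intro LIMSEQ_le_const2[OF tendsto_real_sqrt[OF summable_LIMSEQ[OF s]]]) auto
  ultimately show ?thesis by simp
qed

text \<open>Riesz' theorem in coordinates. It makes the criteria for continuity, differentiability and integrability available in the dual.\<close>

sublocale D: coord_space "dual Y NY" "dual_norm Y NY" "\<lambda>n L. L (e n)" "\<lambda>n. 1 / \<omega> n"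
proof
  show "1 / \<omega> n > 0" for n using omega_pos by simp
  show "(\<lambda>x. 0) \<in> dual Y NY" by (auto simp: dual_def intro!: exI[of _ 0])
  fix L L' :: "('a \<Rightarrow> real) \<Rightarrow> real" and c :: real and n assume L: "L \<in> dual Y NY"
  obtain C where C: "\<And>f. f \<in> Y \<Longrightarrow> \<bar>L f\<bar> \<le> C * NY f" using L unfolding dual_def by blast
  show "(\<lambda>x. c * L x) \<in> dual Y NY"
    unfolding dual_def
  proof (intro CollectI conjI ballI allI)
    show "\<exists>C. \<forall>f\<in>Y. \<bar>c * L f\<bar> \<le> C * NY f"
    proof (intro exI ballI)
      fix f assume "f \<in> Y"
      then have "\<bar>c\<bar> * \<bar>L f\<bar> \<le> \<bar>c\<bar> * (C * NY f)" using C by (intro mult_left_mono) auto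
      then show "\<bar>c * L f\<bar> \<le> (\<bar>c\<bar> * C) * NY f" by (simp add: abs_mult)
    qed
  qed (use dual_linear[OF L] in \<open>auto simp: algebra_simps\<close>)
  show "c * L (e n) = c * L (e n)" ..
  note s = dual_summable[OF L]
  have nn: "0 \<le> (\<Sum>n. 1 / \<omega> n * (L (e n))\<^sup>2)" by (rule suminf_nonneg[OF s]) (use omega_pos in \<open>simp add: less_imp_le\<close>)
  then show "dual_norm Y NY L \<ge> 0" by (simp add: dual_norm_eq[OF L])
  show "(\<lambda>n. 1 / \<omega> n * (L (e n))\<^sup>2) sums (dual_norm Y NY L)\<^sup>2" using s nn by (simp add: dual_norm_eq[OF L] summable_sums)
  assume L': "L' \<in> dual Y NY"
  obtain C' where C': "\<And>f. f \<in> Y \<Longrightarrow> \<bar>L' f\<bar> \<le> C' * NY f" using L' unfolding dual_def by blast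
  show "L (e n) - L' (e n) = L (e n) - L' (e n)" ..
  show "(\<lambda>x. L x - L' x) \<in> dual Y NY"
    unfolding dual_def
  proof (intro CollectI conjI ballI allI)
    show "\<exists>C. \<forall>f\<in>Y. \<bar>L f - L' f\<bar> \<le> C * NY f"
    proof (intro exI ballI)
      fix f assume "f \<in> Y"
      then show "\<bar>L f - L' f\<bar> \<le> (C + C') * NY f" using C[of f] C'[of f] by (simp add: ring_distribs)
    qed
  qed (use dual_linear[OF L] dual_linear[OF L'] in \<open>auto simp: algebra_simps\<close>)
qed

lemma dual_series_L2: assumes "f \<in> L2 \<Omega>" "v \<in> L2 \<Omega>" shows "L2_inner \<Omega> f v = dual_series (cf f) v"
  using Parseval[OF assms] by (simp add: dual_series_def sums_iff)

lemma L2_dual_summable: assumes "f \<in> L2 \<Omega>" shows "summable (\<lambda>n. 1 / \<omega> n * (cf f n)\<^sup>2)"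
proof (rule summable_comparison_test')
  show "summable (\<lambda>n. (cf f n)\<^sup>2 / c0)" using Parseval_sq[OF assms] by (intro summable_divide) (simp add: sums_iff)
  show "norm (1 / \<omega> n * (cf f n)\<^sup>2) \<le> (cf f n)\<^sup>2 / c0" for n
    using c0(1) c0(2)[of n] by (simp add: frac_le)
qed

lemma L2_dual: assumes "f \<in> L2 \<Omega>" shows "L2_inner \<Omega> f \<in> dual Y NY"
  by (rule dual_cong[OF _ dual_series_dual[OF L2_dual_summable[OF assms]]]) (simp add: dual_series_L2[OF assms] Y_L2)

text \<open>The Bochner integral of a functional valued function can be computed coefficient by coefficient.\<close>

lemma dual_series_integral:
  fixes b :: real and c :: "real \<Rightarrow> nat \<Rightarrow> real"
  assumes f: "\<And>n. continuous_on {0<..<b} (\<lambda>t. c t n)"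
    and K: "\<And>t n. t \<in> {0<..<b} \<Longrightarrow> \<bar>c t n\<bar> \<le> K t * m n" "integrable (lebesgue_on {0<..<b}) K" "\<And>t. t \<in> {0<..<b} \<Longrightarrow> K t \<ge> 0"
    and m: "summable (\<lambda>n. 1 / \<omega> n * (m n)\<^sup>2)" "\<And>n. m n \<ge> 0" and v: "v \<in> Y"
  shows "integrable (lebesgue_on {0<..<b}) (\<lambda>t. dual_series (c t) v)"
    and "(LINT t|lebesgue_on {0<..<b}. dual_series (c t) v) = dual_series (\<lambda>n. LINT t|lebesgue_on {0<..<b}. c t n) v"
proof -
  let ?M = "lebesgue_on {0<..<b}"
  have i: "integrable ?M (\<lambda>t. c t n)" for n
  proof (rule Bochner_Integration.integrable_bound[OF integrable_mult_left[OF K(2), of "m n"]])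
    show "(\<lambda>t. c t n) \<in> borel_measurable ?M"
      by (rule continuous_imp_measurable_on_sets_lebesgue[OF f]) auto
    show "AE t in ?M. norm (c t n) \<le> norm (K t * m n)"
      by (rule AE_I2) (use K m in \<open>auto simp: abs_mult\<close>)
  qed
  have i1: "integrable ?M (\<lambda>t. c t n * cf v n)" for n by (rule integrable_mult_left[OF i])
  have sm: "summable (\<lambda>n. \<bar>m n * cf v n\<bar>)" by (rule pairing_bound(1)[OF m(1) v])
  have ae: "AE t in ?M. summable (\<lambda>n. norm (c t n * cf v n))"
  proof (rule AE_I2)
    fix t assume "t \<in> space ?M"
    then have t: "t \<in> {0<..<b}" by simp
    show "summable (\<lambda>n. norm (c t n * cf v n))"
    proof (rule summable_comparison_test'[OF summable_mult[OF sm, of "K t"]])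
      fix n
      show "norm (norm (c t n * cf v n)) \<le> K t * \<bar>m n * cf v n\<bar>"
        using mult_right_mono[OF K(1)[OF t, of n], of "\<bar>cf v n\<bar>"] m(2)[of n] by (simp add: abs_mult mult.assoc)
    qed
  qed
  have s: "summable (\<lambda>n. LINT t|?M. norm (c t n * cf v n))"
  proof (rule summable_comparison_test'[OF summable_mult[OF sm, of "LINT t|?M. K t"]])
    fix n
    have "(LINT t|?M. norm (c t n * cf v n)) \<le> (LINT t|?M. K t * \<bar>m n * cf v n\<bar>)"
    proof (rule integral_mono)
      show "norm (c t n * cf v n) \<le> K t * \<bar>m n * cf v n\<bar>" if "t \<in> space ?M" for t
        using that mult_right_mono[OF K(1)[of t n], of "\<bar>cf v n\<bar>"] m(2)[of n] by (simp add: abs_mult mult.assoc)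
    qed (use i1 K(2) in auto)
    then show "norm (LINT t|?M. norm (c t n * cf v n)) \<le> (LINT t|?M. K t) * \<bar>m n * cf v n\<bar>" by simp
  qed
  show "integrable ?M (\<lambda>t. dual_series (c t) v)" unfolding dual_series_def by (rule integrable_suminf[OF i1 ae s])
  show "(LINT t|?M. dual_series (c t) v) = dual_series (\<lambda>n. LINT t|?M. c t n) v"
    unfolding dual_series_def integral_suminf[OF i1 ae s] by simp
qed

end

section \<open>Weak derivatives and Green's formula\<close>

lemma test_C_k: "\<phi> \<in> test_functions \<Omega> \<Longrightarrow> C_k k UNIV \<phi>"
  and test_compact: "\<phi> \<in> test_functions \<Omega> \<Longrightarrow> compact (closure {x. \<phi> x \<noteq> 0})"
  and test_support: "\<phi> \<in> test_functions \<Omega> \<Longrightarrow> closure {x. \<phi> x \<noteq> 0} \<subseteq> \<Omega>"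
  by (auto simp: test_functions_def)

lemma test_continuous: "\<phi> \<in> test_functions \<Omega> \<Longrightarrow> continuous_on UNIV \<phi>"
  using test_C_k[of \<phi> \<Omega> 0] by simp

lemma test_differentiable: "\<phi> \<in> test_functions \<Omega> \<Longrightarrow> \<phi> differentiable (at x)"
  using test_C_k[of \<phi> \<Omega> 1] by simp

lemma test_zero: "\<phi> \<in> test_functions \<Omega> \<Longrightarrow> x \<notin> \<Omega> \<Longrightarrow> \<phi> x = 0"
  using test_support[of \<phi> \<Omega>] closure_subset[of "{x. \<phi> x \<noteq> 0}"] by auto

lemma test_support_subset:
  assumes "\<phi> \<in> test_functions \<Omega>" "\<And>k. C_k k UNIV \<psi>" "{x. \<psi> x \<noteq> 0} \<subseteq> closure {x. \<phi> x \<noteq> 0}"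
  shows "\<psi> \<in> test_functions \<Omega>"
proof -
  have sub: "closure {x. \<psi> x \<noteq> 0} \<subseteq> closure {x. \<phi> x \<noteq> 0}" using assms(3) by (rule closure_minimal) simp
  moreover have "compact (closure {x. \<psi> x \<noteq> 0})"
    using compact_Int_closed[OF test_compact[OF assms(1)] closed_closure, of "{x. \<psi> x \<noteq> 0}"] sub by (simp add: inf.absorb2)
  ultimately show ?thesis using assms(2) test_support[OF assms(1)] by (auto simp: test_functions_def)
qed

lemma test_pderiv:
  assumes "\<phi> \<in> test_functions \<Omega>" "b \<in> Basis"
  shows "pderiv_dir b \<phi> \<in> test_functions \<Omega>"
proof (rule test_support_subset[OF assms(1)])
  show "C_k k UNIV (pderiv_dir b \<phi>)" for k using test_C_k[OF assms(1), of "Suc k"] assms(2) by simp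
  show "{x. pderiv_dir b \<phi> x \<noteq> 0} \<subseteq> closure {x. \<phi> x \<noteq> 0}"
  proof
    fix x assume "x \<in> {x. pderiv_dir b \<phi> x \<noteq> 0}"
    then have nz: "pderiv_dir b \<phi> x \<noteq> 0" by simp
    show "x \<in> closure {x. \<phi> x \<noteq> 0}"
    proof (rule ccontr)
      assume x: "x \<notin> closure {x. \<phi> x \<noteq> 0}"
      have "((\<lambda>_. 0) has_derivative (\<lambda>_. 0)) (at x)" by simp
      then have "(\<phi> has_derivative (\<lambda>_. 0)) (at x)"
        by (rule has_derivative_transform_within_open[of _ _ _ _ "- closure {x. \<phi> x \<noteq> 0}"])
          (use x closure_subset[of "{x. \<phi> x \<noteq> 0}"] in auto)
      then have "frechet_derivative \<phi> (at x) = (\<lambda>_. 0)" by (rule frechet_derivative_at[symmetric])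
      then show False using nz by (simp add: pderiv_dir_def)
    qed
  qed
qed

lemma pderiv_dir_lincomb:
  assumes "f differentiable (at x)" "g differentiable (at x)"
  shows "pderiv_dir b (\<lambda>x. c * f x + d * g x) x = c * pderiv_dir b f x + d * pderiv_dir b g x"
proof -
  have "((\<lambda>x. c * f x + d * g x) has_derivative (\<lambda>h. c * frechet_derivative f (at x) h + d * frechet_derivative g (at x) h)) (at x)"
    by (intro has_derivative_add has_derivative_mult_right) (use assms frechet_derivative_works in auto)
  from frechet_derivative_at[OF this] show ?thesis by (simp add: pderiv_dir_def flip: fun_eq_iff) metis
qed

lemma C_k_lincomb:
  assumes "C_k k UNIV f" "C_k k UNIV g" shows "C_k k UNIV (\<lambda>x. c * f x + d * g x)"
  using assms
proof (induction k arbitrary: f g)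
  case 0 then show ?case by (auto intro!: continuous_intros)
next
  case (Suc k)
  have "pderiv_dir b (\<lambda>x. c * f x + d * g x) = (\<lambda>x. c * pderiv_dir b f x + d * pderiv_dir b g x)" for b
    using Suc.prems by (intro ext pderiv_dir_lincomb) auto
  then show ?case using Suc by (auto intro!: differentiable_add differentiable_mult)
qed

lemma test_lincomb:
  assumes "\<phi> \<in> test_functions \<Omega>" "\<psi> \<in> test_functions \<Omega>"
  shows "(\<lambda>x. c * \<phi> x + d * \<psi> x) \<in> test_functions \<Omega>"
proof -
  define S where "S = closure {x. \<phi> x \<noteq> 0} \<union> closure {x. \<psi> x \<noteq> 0}"
  have S: "compact S" "S \<subseteq> \<Omega>" unfolding S_def using assms test_compact test_support by blast+
  have "{x. c * \<phi> x + d * \<psi> x \<noteq> 0} \<subseteq> S"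
  proof
    fix x assume "x \<in> {x. c * \<phi> x + d * \<psi> x \<noteq> 0}"
    then have "\<phi> x \<noteq> 0 \<or> \<psi> x \<noteq> 0" by auto
    then show "x \<in> S"
      unfolding S_def using closure_subset[of "{x. \<phi> x \<noteq> 0}"] closure_subset[of "{x. \<psi> x \<noteq> 0}"] by blast
  qed
  then have sub: "closure {x. c * \<phi> x + d * \<psi> x \<noteq> 0} \<subseteq> S" by (rule closure_minimal) (use S compact_imp_closed in blast)
  moreover have "compact (closure {x. c * \<phi> x + d * \<psi> x \<noteq> 0})"
    using compact_Int_closed[OF S(1) closed_closure, of "{x. c * \<phi> x + d * \<psi> x \<noteq> 0}"] sub by (simp add: inf.absorb2)
  moreover have "C_k k UNIV (\<lambda>x. c * \<phi> x + d * \<psi> x)" for k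
    by (rule C_k_lincomb[OF test_C_k[OF assms(1)] test_C_k[OF assms(2)]])
  ultimately show ?thesis using S(2) by (simp add: test_functions_def)
qed

lemma test_bounded:
  assumes "\<phi> \<in> test_functions \<Omega>" shows "\<exists>B\<ge>0. \<forall>x. \<bar>\<phi> x\<bar> \<le> B"
proof -
  have "bounded (\<phi> ` closure {x. \<phi> x \<noteq> 0})"
    by (intro compact_imp_bounded compact_continuous_image test_compact[OF assms] continuous_on_subset[OF test_continuous[OF assms]]) auto
  then obtain B where B: "\<And>x. x \<in> closure {x. \<phi> x \<noteq> 0} \<Longrightarrow> \<bar>\<phi> x\<bar> \<le> B" by (auto simp: bounded_iff)
  have "\<bar>\<phi> x\<bar> \<le> max 0 B" for x
    using B[of x] closure_subset[of "{x. \<phi> x \<noteq> 0}"] by (cases "\<phi> x = 0") auto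
  then show ?thesis by (intro exI[of _ "max 0 B"]) auto
qed

lemma bounded_continuous_L2:
  assumes "open \<Omega>" "bounded \<Omega>" "continuous_on UNIV f" "\<And>x. \<bar>f x\<bar> \<le> B"
  shows "f \<in> L2 \<Omega>"
proof -
  have lm: "\<Omega> \<in> lmeasurable" using assms(1,2) by (simp add: lmeasurable_open)
  then interpret finite_measure "lebesgue_on \<Omega>" by (rule finite_measure_lebesgue_on)
  have m [measurable]: "f \<in> borel_measurable (lebesgue_on \<Omega>)"
    by (rule continuous_imp_measurable_on_sets_lebesgue) (use assms lm fmeasurableD continuous_on_subset in blast)+
  have "integrable (lebesgue_on \<Omega>) (\<lambda>x. (f x)\<^sup>2)"
  proof (rule integrable_const_bound[where B = "B\<^sup>2"])
    show "AE x in lebesgue_on \<Omega>. norm ((f x)\<^sup>2) \<le> B\<^sup>2"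
      using power_mono[OF assms(4) abs_ge_zero, of _ 2] by simp
  qed measurable
  then show ?thesis using m by (simp add: L2_def)
qed

text \<open>The difference quotients integrate to zero by translation invariance, and they converge boundedly to the derivative. This avoids
Fubini's theorem in coordinates.\<close>

lemma integral_directional_derivative_zero:
  fixes F G :: "'a::euclidean_space \<Rightarrow> real"
  assumes deriv: "\<And>x. ((\<lambda>h. F (x + h *\<^sub>R b)) has_real_derivative G x) (at 0)"
    and cont: "continuous_on UNIV F" "continuous_on UNIV G"
    and supp: "\<And>x. norm x > R \<Longrightarrow> F x = 0" and b: "norm b = 1"
    and bd: "\<And>x. \<bar>F x\<bar> \<le> B" "\<And>x. \<bar>G x\<bar> \<le> B"
  shows "(LINT x|lborel. G x) = 0"
proof -
  define D where "D = (\<lambda>n::nat. \<lambda>x. (F (x + (1 / Suc n) *\<^sub>R b) - F x) / (1 / Suc n))"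
  have [measurable]: "F \<in> borel_measurable borel" "G \<in> borel_measurable borel"
    using cont by (auto intro: borel_measurable_continuous_onI)
  have ball: "integrable lborel (\<lambda>x::'a. B * indicator (cball 0 r) x)" for r
    by (intro integrable_mult_right integrable_real_indicator) (auto simp: emeasure_bounded_finite[unfolded infinity_ennreal_def])
  have Fint: "integrable lborel F"
  proof (rule Bochner_Integration.integrable_bound[OF ball[of R]])
    show "AE x in lborel. norm (F x) \<le> norm (B * indicator (cball 0 R) x)"
      using bd(1) supp by (auto simp: indicator_def intro: order_trans[OF _ abs_ge_self])
  qed measurable
  have shift: "(LINT x|lborel. F (x + v)) = (LINT x|lborel. F x)" "integrable lborel (\<lambda>x. F (x + v))" for v
  proof -
    have "(LINT x|lborel. F x) = (LINT x|distr lborel borel ((+) v). F x)" by (simp add: lborel_distr_plus)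
    also have "\<dots> = (LINT x|lborel. F (v + x))" by (rule integral_distr) measurable
    finally show "(LINT x|lborel. F (x + v)) = (LINT x|lborel. F x)" by (simp add: add.commute)
    have "integrable (distr lborel borel ((+) v)) F" using Fint by (simp add: lborel_distr_plus)
    then show "integrable lborel (\<lambda>x. F (x + v))" by (subst (asm) integrable_distr_eq) (auto simp: add.commute)
  qed
  have D0: "(LINT x|lborel. D n x) = 0" for n
    unfolding D_def using shift[of "(1 / Suc n) *\<^sub>R b"] Fint by simp
  have chain: "((\<lambda>h. F (x + h *\<^sub>R b)) has_real_derivative G (x + s *\<^sub>R b)) (at s)" for x s
  proof -
    have "((\<lambda>h. F ((x + s *\<^sub>R b) + (h - s) *\<^sub>R b)) has_real_derivative G (x + s *\<^sub>R b) * 1) (at s)"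
      by (rule DERIV_chain2[where f = "\<lambda>h. F ((x + s *\<^sub>R b) + h *\<^sub>R b)" and g = "\<lambda>h. h - s"])
        (use deriv[of "x + s *\<^sub>R b"] in \<open>auto intro!: derivative_eq_intros\<close>)
    then show ?thesis by (simp add: algebra_simps)
  qed
  have Dbd: "\<bar>D n x\<bar> \<le> B" for n x
  proof -
    have "(0::real) < 1 / Suc n" by simp
    from MVT2[OF this, of "\<lambda>h. F (x + h *\<^sub>R b)" "\<lambda>s. G (x + s *\<^sub>R b)"] chain
    obtain z where "F (x + (1 / Suc n) *\<^sub>R b) - F (x + 0 *\<^sub>R b) = (1 / Suc n - 0) * G (x + z *\<^sub>R b)" by blast
    then have "D n x = G (x + z *\<^sub>R b)" by (simp add: D_def)
    then show ?thesis using bd(2) by simp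
  qed
  have "(\<lambda>n. LINT x|lborel. D n x) \<longlonglongrightarrow> (LINT x|lborel. G x)"
  proof (rule integral_dominated_convergence[where w = "\<lambda>x::'a. B * indicator (cball 0 (R + 1)) x"])
    show "integrable lborel (\<lambda>x::'a. B * indicator (cball 0 (R + 1)) x)" by (rule ball)
    show "D n \<in> borel_measurable lborel" for n unfolding D_def by measurable
    show "G \<in> borel_measurable lborel" by measurable
    show "AE x in lborel. norm (D n x) \<le> B * indicator (cball 0 (R + 1)) x" for n
    proof (rule AE_I2)
      fix x
      show "norm (D n x) \<le> B * indicator (cball 0 (R + 1)) x"
      proof (cases "norm x \<le> R + 1")
        case False
        have "norm x \<le> norm (x + (1 / Suc n) *\<^sub>R b) + norm ((1 / Suc n) *\<^sub>R b)"
          using norm_triangle_ineq4[of "x + (1 / Suc n) *\<^sub>R b" "(1 / Suc n) *\<^sub>R b"] by simp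
        moreover have "norm ((1 / Suc n) *\<^sub>R b) \<le> 1" using b by simp
        ultimately have "norm (x + (1 / Suc n) *\<^sub>R b) > R" "norm x > R" using False by linarith+
        then show ?thesis using supp False by (simp add: D_def)
      qed (use Dbd in simp)
    qed
    show "AE x in lborel. (\<lambda>n. D n x) \<longlonglongrightarrow> G x"
    proof (rule AE_I2)
      fix x
      have "((\<lambda>h. (F (x + h *\<^sub>R b) - F (x + 0 *\<^sub>R b)) / (h - 0)) \<longlongrightarrow> G x) (at 0)"
        using deriv[of x] by (simp add: has_field_derivative_iff)
      moreover have "filterlim (\<lambda>n. 1 / real (Suc n)) (at 0) sequentially"
        unfolding filterlim_at using LIMSEQ_Suc[OF lim_const_over_n[of "1::real"]] by simp
      ultimately have "(\<lambda>n. (F (x + (1 / real (Suc n)) *\<^sub>R b) - F (x + 0 *\<^sub>R b)) / (1 / real (Suc n) - 0)) \<longlonglongrightarrow> G x"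
        by (rule filterlim_compose)
      then show "(\<lambda>n. D n x) \<longlonglongrightarrow> G x" by (simp add: D_def)
    qed
  qed
  then show ?thesis using D0 by (simp add: LIMSEQ_const_iff)
qed

locale bounded_domain =
  fixes \<Omega> :: "'a::euclidean_space set"
  assumes open_dom: "open \<Omega>" and bounded_dom: "bounded \<Omega>"
begin

lemma test_L2: assumes "\<phi> \<in> test_functions \<Omega>" shows "\<phi> \<in> L2 \<Omega>"
  using test_bounded[OF assms] bounded_continuous_L2[OF open_dom bounded_dom test_continuous[OF assms]] by blast

text \<open>The product vanishes outside a compact subset of the domain, so its derivative has integral zero over the whole space.\<close>

lemma integration_by_parts:
  assumes "\<phi> \<in> test_functions \<Omega>" "\<psi> \<in> test_functions \<Omega>" "b \<in> Basis"
  shows "L2_inner \<Omega> \<phi> (pderiv_dir b \<psi>) = - L2_inner \<Omega> (pderiv_dir b \<phi>) \<psi>"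
proof -
  note p = test_pderiv[OF assms(1,3)] test_pderiv[OF assms(2,3)]
  define G where "G = (\<lambda>x. \<phi> x * pderiv_dir b \<psi> x + pderiv_dir b \<phi> x * \<psi> x)"
  obtain B1 B2 B3 B4 where B: "\<And>x. \<bar>\<phi> x\<bar> \<le> B1" "\<And>x. \<bar>\<psi> x\<bar> \<le> B2" "\<And>x. \<bar>pderiv_dir b \<phi> x\<bar> \<le> B3" "\<And>x. \<bar>pderiv_dir b \<psi> x\<bar> \<le> B4"
    using test_bounded assms p by metis
  obtain R where R: "\<And>x. x \<in> \<Omega> \<Longrightarrow> norm x \<le> R" using bounded_dom by (auto simp: bounded_iff)
  have contG: "continuous_on UNIV G" unfolding G_def using assms p test_continuous by (intro continuous_intros) auto
  have "(LINT x|lborel. G x) = 0"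
  proof (rule integral_directional_derivative_zero[where F = "\<lambda>x. \<phi> x * \<psi> x" and b = b and R = R and B = "B1 * B2 + (B1 * B4 + B3 * B2)"])
    show "((\<lambda>h. \<phi> (x + h *\<^sub>R b) * \<psi> (x + h *\<^sub>R b)) has_real_derivative G x) (at 0)" for x
    proof -
      have d: "((\<lambda>h. f (x + h *\<^sub>R b)) has_real_derivative pderiv_dir b f x) (at 0)" if "f \<in> test_functions \<Omega>" for f
      proof -
        have fd: "(f has_derivative frechet_derivative f (at x)) (at (x + 0 *\<^sub>R b))"
          using test_differentiable[OF that, of x] by (simp add: frechet_derivative_works[symmetric])
        have "((\<lambda>h. x + h *\<^sub>R b) has_derivative (\<lambda>h. h *\<^sub>R b)) (at 0)" by (auto intro!: derivative_eq_intros)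
        from has_derivative_compose[OF this fd]
        have "((\<lambda>h. f (x + h *\<^sub>R b)) has_derivative (\<lambda>h. frechet_derivative f (at x) (h *\<^sub>R b))) (at 0)" .
        moreover have "frechet_derivative f (at x) (h *\<^sub>R b) = pderiv_dir b f x * h" for h
          using linear_scale[OF linear_frechet_derivative[OF test_differentiable[OF that]], of x h b] by (simp add: pderiv_dir_def)
        ultimately show ?thesis by (simp add: has_field_derivative_def)
      qed
      show ?thesis using DERIV_mult[OF d[OF assms(1)] d[OF assms(2)]] by (simp add: G_def algebra_simps)
    qed
    show "continuous_on UNIV (\<lambda>x. \<phi> x * \<psi> x)" using assms test_continuous by (intro continuous_intros) auto
    show "\<phi> x * \<psi> x = 0" if "norm x > R" for x using R[of x] that test_zero[OF assms(1), of x] by force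
    show "norm b = 1" using assms(3) by simp
    have nn: "B1 \<ge> 0" "B2 \<ge> 0" "B3 \<ge> 0" "B4 \<ge> 0" using B abs_ge_zero order_trans by blast+
    show "\<bar>\<phi> x * \<psi> x\<bar> \<le> B1 * B2 + (B1 * B4 + B3 * B2)" for x
      using mult_mono[OF B(1,2)] nn by (simp add: abs_mult add_increasing2)
    have "\<bar>G x\<bar> \<le> B1 * B4 + B3 * B2" for x
    proof -
      have "\<bar>G x\<bar> \<le> \<bar>\<phi> x\<bar> * \<bar>pderiv_dir b \<psi> x\<bar> + \<bar>pderiv_dir b \<phi> x\<bar> * \<bar>\<psi> x\<bar>"
        unfolding G_def by (metis abs_mult abs_triangle_ineq)
      also have "\<dots> \<le> B1 * B4 + B3 * B2" using B nn by (intro add_mono mult_mono) auto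
      finally show ?thesis .
    qed
    then show "\<bar>G x\<bar> \<le> B1 * B2 + (B1 * B4 + B3 * B2)" for x using nn by (simp add: add_increasing)
  qed (rule contG)
  moreover have "(LINT x|lebesgue_on \<Omega>. G x) = (LINT x|lborel. G x)"
  proof -
    have "\<Omega> \<in> sets lebesgue" using open_dom by simp
    then have "(LINT x|lebesgue_on \<Omega>. G x) = (LINT x|lebesgue. indicator \<Omega> x *\<^sub>R G x)"
      by (intro integral_restrict_space) simp
    also have "(\<lambda>x. indicator \<Omega> x *\<^sub>R G x) = G"
      using test_zero[OF assms(1)] test_zero[OF assms(2)] by (auto simp: G_def indicator_def intro!: ext)
    also have "(LINT x|lebesgue. G x) = (LINT x|lborel. G x)"
      by (rule integral_completion) (use contG in \<open>simp add: borel_measurable_continuous_onI\<close>)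
    finally show ?thesis .
  qed
  moreover have "(LINT x|lebesgue_on \<Omega>. G x) = L2_inner \<Omega> \<phi> (pderiv_dir b \<psi>) + L2_inner \<Omega> (pderiv_dir b \<phi>) \<psi>"
    unfolding G_def L2_inner_def using assms p by (intro Bochner_Integration.integral_add L2_mult_integrable test_L2)
  ultimately show ?thesis by simp
qed

lemma test_weak_pderiv: "\<phi> \<in> test_functions \<Omega> \<Longrightarrow> b \<in> Basis \<Longrightarrow> has_weak_pderiv \<Omega> b \<phi> (pderiv_dir b \<phi>)"
  using integration_by_parts by (simp add: has_weak_pderiv_def)

lemma sobolev_1_iff: "u \<in> sobolev 1 \<Omega> \<longleftrightarrow> u \<in> L2 \<Omega> \<and> (\<forall>b\<in>Basis. \<exists>g\<in>L2 \<Omega>. has_weak_pderiv \<Omega> b u g)"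
  by simp

lemma test_sobolev: "\<phi> \<in> test_functions \<Omega> \<Longrightarrow> \<phi> \<in> sobolev 1 \<Omega>"
  unfolding sobolev_1_iff using test_weak_pderiv test_L2 test_pderiv by blast

lemma weak_pderiv_lincomb:
  assumes "u \<in> L2 \<Omega>" "v \<in> L2 \<Omega>" "g \<in> L2 \<Omega>" "h \<in> L2 \<Omega>" "has_weak_pderiv \<Omega> b u g" "has_weak_pderiv \<Omega> b v h" "b \<in> Basis"
  shows "has_weak_pderiv \<Omega> b (\<lambda>x. c * u x + d * v x) (\<lambda>x. c * g x + d * h x)"
  unfolding has_weak_pderiv_def
proof
  fix \<phi> assume p: "\<phi> \<in> test_functions \<Omega>"
  have "L2_inner \<Omega> (\<lambda>x. c * u x + d * v x) (pderiv_dir b \<phi>) = c * L2_inner \<Omega> u (pderiv_dir b \<phi>) + d * L2_inner \<Omega> v (pderiv_dir b \<phi>)"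
    using assms p by (subst L2_inner_add(1)) (auto intro: L2_scale test_L2 test_pderiv simp: L2_inner_scale)
  moreover have "L2_inner \<Omega> (\<lambda>x. c * g x + d * h x) \<phi> = c * L2_inner \<Omega> g \<phi> + d * L2_inner \<Omega> h \<phi>"
    using assms p by (subst L2_inner_add(1)) (auto intro: L2_scale test_L2 simp: L2_inner_scale)
  ultimately show "L2_inner \<Omega> (\<lambda>x. c * u x + d * v x) (pderiv_dir b \<phi>) = - L2_inner \<Omega> (\<lambda>x. c * g x + d * h x) \<phi>"
    using assms(5,6) p by (simp add: has_weak_pderiv_def)
qed

lemma weak_pderiv_spec:
  assumes "u \<in> sobolev 1 \<Omega>" "b \<in> Basis"
  shows "weak_pderiv \<Omega> b u \<in> L2 \<Omega>" "has_weak_pderiv \<Omega> b u (weak_pderiv \<Omega> b u)"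
proof -
  have "\<exists>g. g \<in> L2 \<Omega> \<and> has_weak_pderiv \<Omega> b u g" using assms unfolding sobolev_1_iff by auto
  from someI_ex[OF this] show "weak_pderiv \<Omega> b u \<in> L2 \<Omega>" "has_weak_pderiv \<Omega> b u (weak_pderiv \<Omega> b u)"
    unfolding weak_pderiv_def by auto
qed

lemma sobolev_lincomb:
  assumes "u \<in> sobolev 1 \<Omega>" "v \<in> sobolev 1 \<Omega>" shows "(\<lambda>x. c * u x + d * v x) \<in> sobolev 1 \<Omega>"
  unfolding sobolev_1_iff
proof (intro conjI ballI)
  show "(\<lambda>x. c * u x + d * v x) \<in> L2 \<Omega>" using assms unfolding sobolev_1_iff by (intro L2_add L2_scale) auto
  fix b :: 'a assume b: "b \<in> Basis"
  show "\<exists>g\<in>L2 \<Omega>. has_weak_pderiv \<Omega> b (\<lambda>x. c * u x + d * v x) g"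
    using assms weak_pderiv_spec[OF assms(1) b] weak_pderiv_spec[OF assms(2) b] b unfolding sobolev_1_iff
    by (intro bexI[where x = "\<lambda>x. c * weak_pderiv \<Omega> b u x + d * weak_pderiv \<Omega> b v x"] weak_pderiv_lincomb) (auto intro!: L2_add L2_scale)
qed

lemma weak_pderiv_limit:
  assumes "\<And>n. u n \<in> L2 \<Omega>" "u' \<in> L2 \<Omega>" "(\<lambda>n. L2_sq \<Omega> (\<lambda>x. u n x - u' x)) \<longlonglongrightarrow> 0"
    and "\<And>n. g n \<in> L2 \<Omega>" "g' \<in> L2 \<Omega>" "(\<lambda>n. L2_sq \<Omega> (\<lambda>x. g n x - g' x)) \<longlonglongrightarrow> 0"
    and "\<And>n. has_weak_pderiv \<Omega> b (u n) (g n)" "b \<in> Basis"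
  shows "has_weak_pderiv \<Omega> b u' g'"
  unfolding has_weak_pderiv_def
proof
  fix \<phi> assume p: "\<phi> \<in> test_functions \<Omega>"
  have 1: "(\<lambda>n. L2_inner \<Omega> (u n) (pderiv_dir b \<phi>)) \<longlonglongrightarrow> L2_inner \<Omega> u' (pderiv_dir b \<phi>)"
    by (intro L2_inner_tendsto assms test_L2 test_pderiv p)
  have "(\<lambda>n. - L2_inner \<Omega> (g n) \<phi>) \<longlonglongrightarrow> - L2_inner \<Omega> g' \<phi>"
    by (intro tendsto_minus L2_inner_tendsto assms test_L2 p)
  then have "(\<lambda>n. L2_inner \<Omega> (u n) (pderiv_dir b \<phi>)) \<longlonglongrightarrow> - L2_inner \<Omega> g' \<phi>"
    using assms(7) p by (simp add: has_weak_pderiv_def)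
  with 1 show "L2_inner \<Omega> u' (pderiv_dir b \<phi>) = - L2_inner \<Omega> g' \<phi>" using LIMSEQ_unique by blast
qed

lemma laplace_test_L2: assumes "\<phi> \<in> test_functions \<Omega>" shows "(\<lambda>x. \<Sum>b\<in>Basis. pderiv_dir b (pderiv_dir b \<phi>) x) \<in> L2 \<Omega>"
  using assms by (intro L2_sum test_L2 test_pderiv)

lemma weak_laplacian_cong:
  assumes "has_weak_laplacian \<Omega> u f" "u \<in> L2 \<Omega>" "u' \<in> L2 \<Omega>" "f \<in> L2 \<Omega>" "f' \<in> L2 \<Omega>" "eq_ae \<Omega> u u'" "eq_ae \<Omega> f f'"
  shows "has_weak_laplacian \<Omega> u' f'"
  using assms(1) eq_ae_inner[OF assms(6,2,3) laplace_test_L2] eq_ae_inner[OF assms(7,4,5) test_L2]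
  by (simp add: has_weak_laplacian_def)

lemma weak_laplacian_lincomb:
  assumes "u \<in> L2 \<Omega>" "v \<in> L2 \<Omega>" "g \<in> L2 \<Omega>" "h \<in> L2 \<Omega>" "has_weak_laplacian \<Omega> u g" "has_weak_laplacian \<Omega> v h"
  shows "has_weak_laplacian \<Omega> (\<lambda>x. c * u x + d * v x) (\<lambda>x. c * g x + d * h x)"
  unfolding has_weak_laplacian_def
proof
  fix \<phi> assume p: "\<phi> \<in> test_functions \<Omega>"
  let ?l = "\<lambda>x. \<Sum>b\<in>Basis. pderiv_dir b (pderiv_dir b \<phi>) x"
  have "L2_inner \<Omega> (\<lambda>x. c * u x + d * v x) ?l = c * L2_inner \<Omega> u ?l + d * L2_inner \<Omega> v ?l"
    using assms p by (subst L2_inner_add(1)) (auto intro: L2_scale laplace_test_L2 simp: L2_inner_scale)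
  moreover have "L2_inner \<Omega> (\<lambda>x. c * g x + d * h x) \<phi> = c * L2_inner \<Omega> g \<phi> + d * L2_inner \<Omega> h \<phi>"
    using assms p by (subst L2_inner_add(1)) (auto intro: L2_scale test_L2 simp: L2_inner_scale)
  ultimately show "L2_inner \<Omega> (\<lambda>x. c * u x + d * v x) ?l = L2_inner \<Omega> (\<lambda>x. c * g x + d * h x) \<phi>"
    using assms(5,6) p by (simp add: has_weak_laplacian_def)
qed

lemma weak_laplacian_sum:
  assumes "\<And>i. i \<in> I \<Longrightarrow> u i \<in> L2 \<Omega>" "\<And>i. i \<in> I \<Longrightarrow> f i \<in> L2 \<Omega>" "\<And>i. i \<in> I \<Longrightarrow> has_weak_laplacian \<Omega> (u i) (f i)"
  shows "has_weak_laplacian \<Omega> (\<lambda>x. \<Sum>i\<in>I. u i x) (\<lambda>x. \<Sum>i\<in>I. f i x)"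
  unfolding has_weak_laplacian_def
proof
  fix \<phi> assume p: "\<phi> \<in> test_functions \<Omega>"
  show "L2_inner \<Omega> (\<lambda>x. \<Sum>i\<in>I. u i x) (\<lambda>x. \<Sum>b\<in>Basis. pderiv_dir b (pderiv_dir b \<phi>) x) = L2_inner \<Omega> (\<lambda>x. \<Sum>i\<in>I. f i x) \<phi>"
    using assms(3) p L2_inner_sum(1)[of I u, OF assms(1) laplace_test_L2[OF p]] L2_inner_sum(1)[of I f, OF assms(2) test_L2[OF p]]
    by (simp add: has_weak_laplacian_def)
qed

lemma sobolev_L2: "u \<in> sobolev k \<Omega> \<Longrightarrow> u \<in> L2 \<Omega>" by (cases k) auto

lemma sobolev_2_laplacian:
  assumes "\<And>b. b \<in> Basis \<Longrightarrow> g b \<in> sobolev 1 \<Omega>" "\<And>b. b \<in> Basis \<Longrightarrow> has_weak_pderiv \<Omega> b u (g b)" "u \<in> L2 \<Omega>"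
    and "\<And>b. b \<in> Basis \<Longrightarrow> h b \<in> L2 \<Omega>" "\<And>b. b \<in> Basis \<Longrightarrow> has_weak_pderiv \<Omega> b (g b) (h b)"
  shows "has_weak_laplacian \<Omega> u (\<lambda>x. \<Sum>b\<in>Basis. h b x)"
  unfolding has_weak_laplacian_def
proof
  fix \<phi> assume p: "\<phi> \<in> test_functions \<Omega>"
  have "L2_inner \<Omega> u (\<lambda>x. \<Sum>b\<in>Basis. pderiv_dir b (pderiv_dir b \<phi>) x) = (\<Sum>b\<in>Basis. L2_inner \<Omega> u (pderiv_dir b (pderiv_dir b \<phi>)))"
    using assms(3) p by (intro L2_inner_sum(2)) (auto intro: test_L2 test_pderiv)
  also have "\<dots> = (\<Sum>b\<in>Basis. L2_inner \<Omega> (h b) \<phi>)"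
    using assms(2,5) p test_pderiv[OF p] by (intro sum.cong refl) (simp add: has_weak_pderiv_def)
  also have "\<dots> = L2_inner \<Omega> (\<lambda>x. \<Sum>b\<in>Basis. h b x) \<phi>"
    using assms(4) p by (intro L2_inner_sum(1)[symmetric]) (auto intro: test_L2)
  finally show "L2_inner \<Omega> u (\<lambda>x. \<Sum>b\<in>Basis. pderiv_dir b (pderiv_dir b \<phi>) x) = L2_inner \<Omega> (\<lambda>x. \<Sum>b\<in>Basis. h b x) \<phi>" .
qed

lemma sobolev_laplacian_ex:
  assumes "u \<in> sobolev (Suc (Suc k)) \<Omega>"
  shows "\<exists>h :: 'a \<Rightarrow> 'a \<Rightarrow> real. (\<forall>b\<in>Basis. h b \<in> sobolev k \<Omega>) \<and> has_weak_laplacian \<Omega> u (\<lambda>x. \<Sum>b\<in>Basis. h b x)"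
proof -
  have "\<forall>b\<in>Basis. \<exists>g. g \<in> sobolev (Suc k) \<Omega> \<and> has_weak_pderiv \<Omega> b u g" and uL: "u \<in> L2 \<Omega>" using assms by auto
  then obtain g where g: "\<And>b. b \<in> Basis \<Longrightarrow> g b \<in> sobolev (Suc k) \<Omega>" "\<And>b. b \<in> Basis \<Longrightarrow> has_weak_pderiv \<Omega> b u (g b)" by metis
  have "\<forall>b\<in>Basis. \<exists>h. h \<in> sobolev k \<Omega> \<and> has_weak_pderiv \<Omega> b (g b) h" using g(1) by auto
  then obtain h where h: "\<And>b. b \<in> Basis \<Longrightarrow> h b \<in> sobolev k \<Omega>" "\<And>b. b \<in> Basis \<Longrightarrow> has_weak_pderiv \<Omega> b (g b) (h b)" by metis
  have "g b \<in> sobolev 1 \<Omega>" if "b \<in> Basis" for b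
    using g(1)[OF that] h[OF that] sobolev_L2 unfolding sobolev_1_iff by fastforce
  then have "has_weak_laplacian \<Omega> u (\<lambda>x. \<Sum>b\<in>Basis. h b x)"
    by (rule sobolev_2_laplacian) (use g(2) h(2) uL sobolev_L2[OF h(1)] in \<open>auto simp del: sobolev.simps\<close>)
  then show ?thesis using h(1) by blast
qed

lemma laplacian_spec:
  assumes "f \<in> L2 \<Omega>" "has_weak_laplacian \<Omega> u f"
  shows "laplacian \<Omega> u \<in> L2 \<Omega>" "has_weak_laplacian \<Omega> u (laplacian \<Omega> u)"
proof -
  have "\<exists>f. f \<in> L2 \<Omega> \<and> has_weak_laplacian \<Omega> u f" using assms by auto
  from someI_ex[OF this] show "laplacian \<Omega> u \<in> L2 \<Omega>" "has_weak_laplacian \<Omega> u (laplacian \<Omega> u)"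
    unfolding laplacian_def by auto
qed

lemma grad_inner_nonneg: "grad_inner \<Omega> u u \<ge> 0"
  unfolding grad_inner_def by (intro integral_nonneg_AE AE_I2 sum_nonneg) simp

end

text \<open>Density will be derived from that of the domain of \<open>A\<close>, so that no mollification is used.\<close>

locale dense_domain = bounded_domain +
  assumes dense: "\<And>f \<epsilon>. f \<in> L2 \<Omega> \<Longrightarrow> \<epsilon> > 0 \<Longrightarrow> \<exists>\<phi>\<in>test_functions \<Omega>. L2_sq \<Omega> (\<lambda>x. f x - \<phi> x) < \<epsilon>"
begin

text \<open>Approximate \<open>f\<close> itself by test functions.\<close>

lemma zero_of_test:
  assumes "f \<in> L2 \<Omega>" "\<And>\<phi>. \<phi> \<in> test_functions \<Omega> \<Longrightarrow> L2_inner \<Omega> f \<phi> = 0"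
  shows "L2_sq \<Omega> f = 0"
proof -
  have "L2_sq \<Omega> f \<le> \<epsilon>" if e: "\<epsilon> > 0" for \<epsilon>
  proof -
    obtain \<phi> where p: "\<phi> \<in> test_functions \<Omega>" "L2_sq \<Omega> (\<lambda>x. f x - \<phi> x) < \<epsilon>" using dense[OF assms(1) e] by blast
    have d: "(\<lambda>x. f x - \<phi> x) \<in> L2 \<Omega>" by (rule L2_diff[OF assms(1) test_L2[OF p(1)]])
    have "L2_inner \<Omega> f (\<lambda>x. f x - \<phi> x) = L2_sq \<Omega> f"
      using L2_inner_diff(2)[OF assms(1) test_L2[OF p(1)] assms(1)] assms(2)[OF p(1)] by (simp add: L2_sq_def)
    then have "(L2_sq \<Omega> f)\<^sup>2 \<le> L2_sq \<Omega> f * L2_sq \<Omega> (\<lambda>x. f x - \<phi> x)" using L2_Cauchy_Schwarz[OF assms(1) d] by simp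
    also have "\<dots> \<le> L2_sq \<Omega> f * \<epsilon>" using p(2) L2_sq_nonneg by (intro mult_left_mono) auto
    finally have le: "L2_sq \<Omega> f * L2_sq \<Omega> f \<le> L2_sq \<Omega> f * \<epsilon>" by (simp add: power2_eq_square)
    show ?thesis
    proof (cases "L2_sq \<Omega> f = 0")
      case False
      then have "L2_sq \<Omega> f > 0" using L2_sq_nonneg[of \<Omega> f] by simp
      then show ?thesis using le by simp
    qed (use e in simp)
  qed
  then have "L2_sq \<Omega> f \<le> 0" by (rule field_le_epsilon[of _ 0, simplified]) auto
  then show ?thesis using L2_sq_nonneg[of \<Omega> f] by simp
qed

lemma eq_ae_of_test:
  assumes "f \<in> L2 \<Omega>" "g \<in> L2 \<Omega>" "\<And>\<phi>. \<phi> \<in> test_functions \<Omega> \<Longrightarrow> L2_inner \<Omega> f \<phi> = L2_inner \<Omega> g \<phi>"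
  shows "eq_ae \<Omega> f g"
  unfolding eq_ae_iff[OF assms(1,2)]
proof (rule zero_of_test[OF L2_diff[OF assms(1,2)]])
  fix \<phi> assume "\<phi> \<in> test_functions \<Omega>"
  then show "L2_inner \<Omega> (\<lambda>x. f x - g x) \<phi> = 0"
    using L2_inner_diff(1)[OF assms(1,2) test_L2] assms(3) by simp
qed

lemma weak_pderiv_eq:
  assumes "g \<in> L2 \<Omega>" "has_weak_pderiv \<Omega> b u g" "u \<in> sobolev 1 \<Omega>" "b \<in> Basis"
  shows "eq_ae \<Omega> (weak_pderiv \<Omega> b u) g"
  by (rule eq_ae_of_test) (use assms weak_pderiv_spec[OF assms(3,4)] in \<open>auto simp: has_weak_pderiv_def\<close>)

text \<open>Uniqueness of the weak Laplacian makes the choice in its definition harmless.\<close>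

lemma laplacian_eq:
  assumes "f \<in> L2 \<Omega>" "has_weak_laplacian \<Omega> u f" shows "eq_ae \<Omega> (laplacian \<Omega> u) f"
  by (rule eq_ae_of_test) (use assms laplacian_spec[OF assms] in \<open>auto simp: has_weak_laplacian_def\<close>)

lemma grad_inner_eq:
  assumes "u \<in> sobolev 1 \<Omega>" "v \<in> sobolev 1 \<Omega>"
    and "\<And>b. b \<in> Basis \<Longrightarrow> g b \<in> L2 \<Omega>" "\<And>b. b \<in> Basis \<Longrightarrow> has_weak_pderiv \<Omega> b u (g b)"
    and "\<And>b. b \<in> Basis \<Longrightarrow> h b \<in> L2 \<Omega>" "\<And>b. b \<in> Basis \<Longrightarrow> has_weak_pderiv \<Omega> b v (h b)"
  shows "grad_inner \<Omega> u v = (\<Sum>b\<in>Basis. L2_inner \<Omega> (g b) (h b))"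
proof -
  have "grad_inner \<Omega> u v = (\<Sum>b\<in>Basis. L2_inner \<Omega> (weak_pderiv \<Omega> b u) (weak_pderiv \<Omega> b v))"
    unfolding grad_inner_def L2_inner_def
    using weak_pderiv_spec(1)[OF assms(1)] weak_pderiv_spec(1)[OF assms(2)]
    by (intro Bochner_Integration.integral_sum L2_mult_integrable) auto
  also have "\<dots> = (\<Sum>b\<in>Basis. L2_inner \<Omega> (g b) (h b))"
  proof (rule sum.cong[OF refl])
    fix b :: 'a assume b: "b \<in> Basis"
    note 1 = weak_pderiv_spec(1)[OF assms(1) b] and 2 = weak_pderiv_spec(1)[OF assms(2) b]
    have "L2_inner \<Omega> (weak_pderiv \<Omega> b u) (weak_pderiv \<Omega> b v) = L2_inner \<Omega> (g b) (weak_pderiv \<Omega> b v)"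
      by (rule eq_ae_inner[OF weak_pderiv_eq 1 _ 2]) (use assms b in auto)
    also have "\<dots> = L2_inner \<Omega> (h b) (g b)"
      unfolding L2_inner_commute[of \<Omega> "g b"] by (rule eq_ae_inner[OF weak_pderiv_eq 2]) (use assms b in auto)
    finally show "L2_inner \<Omega> (weak_pderiv \<Omega> b u) (weak_pderiv \<Omega> b v) = L2_inner \<Omega> (g b) (h b)"
      by (simp add: L2_inner_commute)
  qed
  finally show ?thesis .
qed

lemma grad_inner_commute: "grad_inner \<Omega> u v = grad_inner \<Omega> v u"
  by (simp add: grad_inner_def mult.commute)

lemma grad_inner_lincomb:
  assumes "u \<in> sobolev 1 \<Omega>" "v \<in> sobolev 1 \<Omega>" "z \<in> sobolev 1 \<Omega>"
  shows "grad_inner \<Omega> (\<lambda>x. c * u x + d * v x) z = c * grad_inner \<Omega> u z + d * grad_inner \<Omega> v z"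
proof -
  note s = weak_pderiv_spec
  have L: "u \<in> L2 \<Omega>" "v \<in> L2 \<Omega>" using assms unfolding sobolev_1_iff by auto
  have "grad_inner \<Omega> (\<lambda>x. c * u x + d * v x) z = (\<Sum>b\<in>Basis. L2_inner \<Omega> (\<lambda>x. c * weak_pderiv \<Omega> b u x + d * weak_pderiv \<Omega> b v x) (weak_pderiv \<Omega> b z))"
    by (rule grad_inner_eq) (use assms s L in \<open>auto intro!: sobolev_lincomb[unfolded One_nat_def] L2_add L2_scale weak_pderiv_lincomb simp: One_nat_def simp del: sobolev.simps\<close>)
  also have "\<dots> = (\<Sum>b\<in>Basis. c * L2_inner \<Omega> (weak_pderiv \<Omega> b u) (weak_pderiv \<Omega> b z) + d * L2_inner \<Omega> (weak_pderiv \<Omega> b v) (weak_pderiv \<Omega> b z))"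
  proof (rule sum.cong[OF refl])
    fix b :: 'a assume b: "b \<in> Basis"
    show "L2_inner \<Omega> (\<lambda>x. c * weak_pderiv \<Omega> b u x + d * weak_pderiv \<Omega> b v x) (weak_pderiv \<Omega> b z) = c * L2_inner \<Omega> (weak_pderiv \<Omega> b u) (weak_pderiv \<Omega> b z) + d * L2_inner \<Omega> (weak_pderiv \<Omega> b v) (weak_pderiv \<Omega> b z)"
      using s(1)[OF assms(1) b] s(1)[OF assms(2) b] s(1)[OF assms(3) b]
      by (subst L2_inner_add(1)) (auto intro: L2_scale simp: L2_inner_scale)
  qed
  also have "\<dots> = c * (\<Sum>b\<in>Basis. L2_inner \<Omega> (weak_pderiv \<Omega> b u) (weak_pderiv \<Omega> b z)) + d * (\<Sum>b\<in>Basis. L2_inner \<Omega> (weak_pderiv \<Omega> b v) (weak_pderiv \<Omega> b z))"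
    by (simp add: sum.distrib sum_distrib_left)
  also have "\<dots> = c * grad_inner \<Omega> u z + d * grad_inner \<Omega> v z"
    using grad_inner_eq[OF assms(1,3) s[OF assms(1)] s[OF assms(3)]] grad_inner_eq[OF assms(2,3) s[OF assms(2)] s[OF assms(3)]] by simp
  finally show ?thesis .
qed

lemma grad_inner_lincomb_right:
  assumes "u \<in> sobolev 1 \<Omega>" "v \<in> sobolev 1 \<Omega>" "z \<in> sobolev 1 \<Omega>"
  shows "grad_inner \<Omega> z (\<lambda>x. c * u x + d * v x) = c * grad_inner \<Omega> z u + d * grad_inner \<Omega> z v"
  using grad_inner_lincomb[OF assms, of c d] by (metis grad_inner_commute)

lemma grad_Cauchy_Schwarz:
  assumes "u \<in> sobolev 1 \<Omega>" "v \<in> sobolev 1 \<Omega>"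
  shows "(grad_inner \<Omega> u v)\<^sup>2 \<le> grad_inner \<Omega> u u * grad_inner \<Omega> v v"
proof (rule discriminant_bound[OF _ grad_inner_nonneg])
  fix t
  have s: "(\<lambda>x. 1 * u x + t * v x) \<in> sobolev 1 \<Omega>" by (rule sobolev_lincomb[OF assms])
  have "grad_inner \<Omega> (\<lambda>x. 1 * u x + t * v x) (\<lambda>x. 1 * u x + t * v x) = grad_inner \<Omega> u (\<lambda>x. 1 * u x + t * v x) + t * grad_inner \<Omega> v (\<lambda>x. 1 * u x + t * v x)"
    using grad_inner_lincomb[OF assms s, of 1 t] by simp
  also have "grad_inner \<Omega> u (\<lambda>x. 1 * u x + t * v x) = grad_inner \<Omega> u u + t * grad_inner \<Omega> u v"
    using grad_inner_lincomb_right[OF assms assms(1), of 1 t] by simp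
  also have "grad_inner \<Omega> v (\<lambda>x. 1 * u x + t * v x) = grad_inner \<Omega> u v + t * grad_inner \<Omega> v v"
    using grad_inner_lincomb_right[OF assms assms(2), of 1 t] grad_inner_commute[of v u] by simp
  finally show "0 \<le> grad_inner \<Omega> u u + 2 * t * grad_inner \<Omega> u v + t\<^sup>2 * grad_inner \<Omega> v v"
    using grad_inner_nonneg[of "\<lambda>x. 1 * u x + t * v x"] by (simp add: algebra_simps power2_eq_square)
qed

lemma H10_sobolev: "v \<in> H10 \<Omega> \<Longrightarrow> v \<in> sobolev 1 \<Omega>" by (simp add: H10_def)

lemma H10_L2: "v \<in> H10 \<Omega> \<Longrightarrow> v \<in> L2 \<Omega>" by (simp add: H10_def)

lemma H1_norm_sq: "(H1_norm \<Omega> u)\<^sup>2 = L2_sq \<Omega> u + grad_inner \<Omega> u u"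
  using L2_sq_nonneg[of \<Omega> u] grad_inner_nonneg[of u] by (simp add: H1_norm_def L2_sq_def)

lemma H10_approx:
  assumes "v \<in> H10 \<Omega>" "\<epsilon> > 0"
  obtains \<phi> where "\<phi> \<in> test_functions \<Omega>" "L2_sq \<Omega> (\<lambda>x. v x - \<phi> x) < \<epsilon>" "grad_inner \<Omega> (\<lambda>x. v x - \<phi> x) (\<lambda>x. v x - \<phi> x) < \<epsilon>"
proof -
  obtain \<phi> where p: "\<phi> \<in> test_functions \<Omega>" "H1_norm \<Omega> (\<lambda>x. v x - \<phi> x) < sqrt \<epsilon>"
    using assms(1) real_sqrt_gt_zero[OF assms(2)] unfolding H10_def by blast
  have "(H1_norm \<Omega> (\<lambda>x. v x - \<phi> x))\<^sup>2 < (sqrt \<epsilon>)\<^sup>2"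
    using p(2) by (intro power_strict_mono) (auto simp: H1_norm_def intro!: L2_sq_nonneg[unfolded L2_sq_def] grad_inner_nonneg add_nonneg_nonneg)
  then show thesis
    using assms(2) L2_sq_nonneg[of \<Omega> "\<lambda>x. v x - \<phi> x"] grad_inner_nonneg[of "\<lambda>x. v x - \<phi> x"]
    by (intro that[OF p(1)]) (simp_all add: H1_norm_sq)
qed

lemma Green_test:
  assumes "u \<in> sobolev 1 \<Omega>" "f \<in> L2 \<Omega>" "has_weak_laplacian \<Omega> u f" "\<phi> \<in> test_functions \<Omega>"
  shows "grad_inner \<Omega> u \<phi> = - L2_inner \<Omega> f \<phi>"
proof -
  note s = weak_pderiv_spec[OF assms(1)]
  have "grad_inner \<Omega> u \<phi> = (\<Sum>b\<in>Basis. L2_inner \<Omega> (weak_pderiv \<Omega> b u) (pderiv_dir b \<phi>))"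
    by (rule grad_inner_eq[OF assms(1) test_sobolev[OF assms(4)] s])
      (use assms(4) test_L2 test_pderiv test_weak_pderiv in auto)
  also have "\<dots> = - (\<Sum>b\<in>Basis. L2_inner \<Omega> u (pderiv_dir b (pderiv_dir b \<phi>)))"
    unfolding sum_negf[symmetric] using s(2) test_pderiv[OF assms(4)] by (intro sum.cong refl) (simp add: has_weak_pderiv_def)
  also have "(\<Sum>b\<in>Basis. L2_inner \<Omega> u (pderiv_dir b (pderiv_dir b \<phi>))) = L2_inner \<Omega> u (\<lambda>x. \<Sum>b\<in>Basis. pderiv_dir b (pderiv_dir b \<phi>) x)"
    using assms(1,4) unfolding sobolev_1_iff by (intro L2_inner_sum(2)[symmetric]) (auto intro: test_L2 test_pderiv)
  also have "\<dots> = L2_inner \<Omega> f \<phi>" using assms(3,4) by (simp add: has_weak_laplacian_def)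
  finally show ?thesis .
qed

text \<open>For test functions this is the definition of weak derivatives; both sides are continuous in the norm of \<open>H\<^sup>1\<close>.\<close>

lemma Green:
  assumes u: "u \<in> sobolev 1 \<Omega>" and f: "f \<in> L2 \<Omega>" "has_weak_laplacian \<Omega> u f" and v: "v \<in> H10 \<Omega>"
  shows "grad_inner \<Omega> u v = - L2_inner \<Omega> f v"
proof -
  define K where "K = grad_inner \<Omega> u u + L2_sq \<Omega> f + 1"
  have K: "K > 0" using grad_inner_nonneg[of u] L2_sq_nonneg[of \<Omega> f] by (simp add: K_def)
  have "(grad_inner \<Omega> u v + L2_inner \<Omega> f v)\<^sup>2 \<le> \<epsilon>" if e: "\<epsilon> > 0" for \<epsilon>
  proof -
    define d where "d = \<epsilon> / (4 * K)"
    have d: "d > 0" "K * d = \<epsilon> / 4" using e K by (simp_all add: d_def)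
    obtain \<phi> where p: "\<phi> \<in> test_functions \<Omega>" "L2_sq \<Omega> (\<lambda>x. v x - \<phi> x) < d" "grad_inner \<Omega> (\<lambda>x. v x - \<phi> x) (\<lambda>x. v x - \<phi> x) < d"
      by (rule H10_approx[OF v d(1)])
    note sv = H10_sobolev[OF v] and st = test_sobolev[OF p(1)]
    have sd: "(\<lambda>x. v x - \<phi> x) \<in> sobolev 1 \<Omega>" using sobolev_lincomb[OF sv st, of 1 "-1"] by simp
    have dL: "(\<lambda>x. v x - \<phi> x) \<in> L2 \<Omega>" using H10_L2[OF v] test_L2[OF p(1)] by (rule L2_diff)
    define A where "A = grad_inner \<Omega> u (\<lambda>x. v x - \<phi> x)"
    define B where "B = L2_inner \<Omega> f (\<lambda>x. v x - \<phi> x)"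
    have "A = grad_inner \<Omega> u v - grad_inner \<Omega> u \<phi>"
      unfolding A_def using grad_inner_lincomb_right[OF sv st u, of 1 "-1"] by simp
    moreover have "B = L2_inner \<Omega> f v - L2_inner \<Omega> f \<phi>"
      unfolding B_def by (rule L2_inner_diff(2)[OF H10_L2[OF v] test_L2[OF p(1)] f(1)])
    ultimately have eq: "grad_inner \<Omega> u v + L2_inner \<Omega> f v = A + B" using Green_test[OF u f p(1)] by simp
    have "A\<^sup>2 \<le> grad_inner \<Omega> u u * (d)"
      unfolding A_def using grad_Cauchy_Schwarz[OF u sd] mult_left_mono[OF less_imp_le[OF p(3)] grad_inner_nonneg[of u]] by linarith
    moreover have "B\<^sup>2 \<le> L2_sq \<Omega> f * (d)"
      unfolding B_def using L2_Cauchy_Schwarz[OF f(1) dL] mult_left_mono[OF less_imp_le[OF p(2)] L2_sq_nonneg[of \<Omega> f]] by linarith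
    moreover have "(A + B)\<^sup>2 \<le> 2 * A\<^sup>2 + 2 * B\<^sup>2"
      using zero_le_power2[of "A - B"] by (simp add: power2_sum power2_diff)
    ultimately have "(A + B)\<^sup>2 \<le> 2 * ((grad_inner \<Omega> u u + L2_sq \<Omega> f) * (d))" by (simp add: ring_distribs)
    also have "\<dots> \<le> 2 * (K * (d))" using d by (intro mult_left_mono mult_right_mono) (auto simp: K_def)
    also have "\<dots> \<le> \<epsilon>" using e d by simp
    finally show ?thesis unfolding eq .
  qed
  then have "(grad_inner \<Omega> u v + L2_inner \<Omega> f v)\<^sup>2 \<le> 0" by (rule field_le_epsilon[of _ 0, simplified]) auto
  then show ?thesis by simp
qed

text \<open>The number \<open>lam\<close> factors: with \<open>m = sqrt lam\<close>, the function \<open>z = \<Delta>e + m e\<close> satisfies \<open>\<Delta>z = m z\<close> and vanishes on the boundary.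
Since the Dirichlet Laplacian is nonpositive, \<open>z = 0\<close>.\<close>

lemma eigenfunction_laplacian:
  assumes e: "e \<in> dom_A \<Omega>" and eig: "eq_ae \<Omega> (bilaplacian \<Omega> e) (\<lambda>x. lam * e x)" and lam: "lam > 0"
  shows "has_weak_laplacian \<Omega> e (\<lambda>x. - sqrt lam * e x)"
proof -
  define m where "m = sqrt lam"
  have m: "m > 0" "m * m = lam" using lam by (simp_all add: m_def)
  define g where "g = laplacian \<Omega> e"
  have eH: "e \<in> H10 \<Omega>" and gH: "g \<in> H10 \<Omega>" and e4: "e \<in> sobolev (Suc (Suc 2)) \<Omega>"
    using e by (auto simp: dom_A_def g_def numeral_eq_Suc)
  note eL = H10_L2[OF eH] and gL = H10_L2[OF gH] and eS = H10_sobolev[OF eH] and gS = H10_sobolev[OF gH]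
  obtain h :: "'a \<Rightarrow> 'a \<Rightarrow> real" where h: "\<And>b. b \<in> Basis \<Longrightarrow> h b \<in> sobolev 2 \<Omega>" "has_weak_laplacian \<Omega> e (\<lambda>x. \<Sum>b\<in>Basis. h b x)"
    using sobolev_laplacian_ex[OF e4] by blast
  have hL: "(\<lambda>x. \<Sum>b\<in>Basis. h b x) \<in> L2 \<Omega>" using h(1) sobolev_L2 by (intro L2_sum) auto
  have eg: "has_weak_laplacian \<Omega> e g" unfolding g_def by (rule laplacian_spec(2)[OF hL h(2)])
  have "\<forall>b\<in>Basis. \<exists>k. k \<in> L2 \<Omega> \<and> has_weak_laplacian \<Omega> (h b) k"
  proof
    fix b :: 'a assume "b \<in> Basis"
    then have "h b \<in> sobolev (Suc (Suc 0)) \<Omega>" using h(1) by (simp add: numeral_2_eq_2)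
    then obtain k :: "'a \<Rightarrow> 'a \<Rightarrow> real" where "\<forall>c\<in>Basis. k c \<in> sobolev 0 \<Omega>" "has_weak_laplacian \<Omega> (h b) (\<lambda>x. \<Sum>c\<in>Basis. k c x)"
      using sobolev_laplacian_ex by blast
    then show "\<exists>k. k \<in> L2 \<Omega> \<and> has_weak_laplacian \<Omega> (h b) k" by (intro exI[of _ "\<lambda>x. \<Sum>c\<in>Basis. k c x"] conjI L2_sum) auto
  qed
  then obtain k where k: "\<And>b. b \<in> Basis \<Longrightarrow> k b \<in> L2 \<Omega>" "\<And>b. b \<in> Basis \<Longrightarrow> has_weak_laplacian \<Omega> (h b) (k b)" by metis
  have kL: "(\<lambda>x. \<Sum>b\<in>Basis. k b x) \<in> L2 \<Omega>" using k by (intro L2_sum) auto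
  have "has_weak_laplacian \<Omega> (\<lambda>x. \<Sum>b\<in>Basis. h b x) (\<lambda>x. \<Sum>b\<in>Basis. k b x)"
    by (rule weak_laplacian_sum) (use h(1) k sobolev_L2 in blast)+
  then have "has_weak_laplacian \<Omega> g (\<lambda>x. \<Sum>b\<in>Basis. k b x)"
    by (rule weak_laplacian_cong) (use hL gL kL laplacian_eq[OF hL h(2)] in \<open>auto simp: g_def eq_ae_refl intro: eq_ae_sym\<close>)
  from laplacian_spec[OF kL this] have "bilaplacian \<Omega> e \<in> L2 \<Omega>" "has_weak_laplacian \<Omega> g (bilaplacian \<Omega> e)"
    by (simp_all add: bilaplacian_def g_def)
  then have gg: "has_weak_laplacian \<Omega> g (\<lambda>x. lam * e x)"
    by (intro weak_laplacian_cong[OF _ gL gL _ _ eq_ae_refl eig] L2_scale eL)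
  define z where "z = (\<lambda>x. 1 * g x + m * e x)"
  have zS: "z \<in> sobolev 1 \<Omega>" unfolding z_def by (rule sobolev_lincomb[OF gS eS])
  have zL: "z \<in> L2 \<Omega>" unfolding z_def by (intro L2_add L2_scale gL eL)
  have "has_weak_laplacian \<Omega> z (\<lambda>x. 1 * (lam * e x) + m * g x)"
    unfolding z_def by (rule weak_laplacian_lincomb) (use gL eL gg eg in \<open>auto intro: L2_scale\<close>)
  moreover have "(\<lambda>x. 1 * (lam * e x) + m * g x) = (\<lambda>x. m * z x)"
    by (auto simp: z_def m(2)[symmetric] algebra_simps)
  ultimately have zlap: "has_weak_laplacian \<Omega> z (\<lambda>x. m * z x)" by simp
  note Gz = Green[OF zS L2_scale[OF zL] zlap]
  have "grad_inner \<Omega> z z = 1 * grad_inner \<Omega> g z + m * grad_inner \<Omega> e z"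
    using grad_inner_lincomb[OF gS eS zS, of 1 m] by (simp add: z_def)
  also have "\<dots> = - m * (L2_inner \<Omega> z g + m * L2_inner \<Omega> z e)"
    unfolding grad_inner_commute[of _ z] Gz[OF gH] Gz[OF eH] L2_inner_scale by (simp add: algebra_simps)
  \<comment> \<open>Hence \<open>|\<nabla>z|\<^sup>2 = - m |z|\<^sup>2\<close>, and both sides vanish.\<close>
  also have "L2_inner \<Omega> z g + m * L2_inner \<Omega> z e = L2_inner \<Omega> z z"
    using L2_inner_add(2)[OF gL L2_scale[OF eL, of m] zL] by (simp add: L2_inner_scale z_def)
  finally have "m * L2_sq \<Omega> z \<le> 0" using grad_inner_nonneg[of z] by (simp add: L2_sq_def)
  then have "L2_sq \<Omega> z = 0" using m L2_sq_nonneg[of \<Omega> z] by (simp add: mult_le_0_iff)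
  then have "eq_ae \<Omega> z (\<lambda>_. 0)" using L2_sq_zero_iff[OF zL] by simp
  then have "eq_ae \<Omega> g (\<lambda>x. - m * e x)"
    unfolding eq_ae_def by eventually_elim (simp add: z_def)
  then show ?thesis unfolding m_def[symmetric]
    by (rule weak_laplacian_cong[OF eg eL eL gL L2_scale[OF eL] eq_ae_refl])
qed

definition H1_sq :: "('a \<Rightarrow> real) \<Rightarrow> real" where "H1_sq u = L2_sq \<Omega> u + grad_inner \<Omega> u u"

lemma H1_norm_eq: "H1_norm \<Omega> u = sqrt (H1_sq u)" by (simp add: H1_norm_def H1_sq_def L2_sq_def)

lemma H1_sq_lincomb:
  assumes "u \<in> sobolev 1 \<Omega>" "v \<in> sobolev 1 \<Omega>"
  shows "H1_sq (\<lambda>x. c * u x + d * v x) \<le> 2 * c\<^sup>2 * H1_sq u + 2 * d\<^sup>2 * H1_sq v"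
proof -
  have L: "u \<in> L2 \<Omega>" "v \<in> L2 \<Omega>" using assms unfolding sobolev_1_iff by auto
  have ex: "grad_inner \<Omega> (\<lambda>x. c * u x + d * v x) (\<lambda>x. c * u x + d * v x) = c\<^sup>2 * grad_inner \<Omega> u u + 2 * (c * d * grad_inner \<Omega> u v) + d\<^sup>2 * grad_inner \<Omega> v v" for c d
    unfolding grad_inner_lincomb[OF assms sobolev_lincomb[OF assms]] grad_inner_lincomb_right[OF assms assms(1)] grad_inner_lincomb_right[OF assms assms(2)]
    by (simp add: grad_inner_commute[of v u] power2_eq_square algebra_simps)
  have "grad_inner \<Omega> (\<lambda>x. c * u x + d * v x) (\<lambda>x. c * u x + d * v x) \<le> 2 * c\<^sup>2 * grad_inner \<Omega> u u + 2 * d\<^sup>2 * grad_inner \<Omega> v v"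
    using ex[of c d] ex[of c "-d"] grad_inner_nonneg[of "\<lambda>x. c * u x + - d * v x"] by (simp add: algebra_simps)
  moreover have "L2_sq \<Omega> (\<lambda>x. c * u x + d * v x) \<le> 2 * c\<^sup>2 * L2_sq \<Omega> u + 2 * d\<^sup>2 * L2_sq \<Omega> v"
    using L2_sq_add_le[OF L2_scale[OF L(1), of c] L2_scale[OF L(2), of d]] by (simp add: L2_sq_scale)
  ultimately show ?thesis by (simp add: H1_sq_def algebra_simps)
qed

lemma H10_iff: "v \<in> H10 \<Omega> \<longleftrightarrow> v \<in> sobolev 1 \<Omega> \<and> (\<forall>\<epsilon>>0. \<exists>\<phi>\<in>test_functions \<Omega>. H1_sq (\<lambda>x. v x - \<phi> x) < \<epsilon>)"
proof (intro iffI conjI allI impI)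
  assume v: "v \<in> H10 \<Omega>"
  then show "v \<in> sobolev 1 \<Omega>" by (rule H10_sobolev)
  fix \<epsilon> :: real assume e: "\<epsilon> > 0"
  then have "sqrt \<epsilon> > 0" by simp
  then obtain \<phi> where "\<phi> \<in> test_functions \<Omega>" "H1_norm \<Omega> (\<lambda>x. v x - \<phi> x) < sqrt \<epsilon>" using v unfolding H10_def by blast
  then show "\<exists>\<phi>\<in>test_functions \<Omega>. H1_sq (\<lambda>x. v x - \<phi> x) < \<epsilon>" by (auto simp: H1_norm_eq)
next
  assume v: "v \<in> sobolev 1 \<Omega> \<and> (\<forall>\<epsilon>>0. \<exists>\<phi>\<in>test_functions \<Omega>. H1_sq (\<lambda>x. v x - \<phi> x) < \<epsilon>)"
  have "\<exists>\<phi>\<in>test_functions \<Omega>. H1_norm \<Omega> (\<lambda>x. v x - \<phi> x) < \<epsilon>" if e: "\<epsilon> > 0" for \<epsilon>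
  proof -
    obtain \<phi> where p: "\<phi> \<in> test_functions \<Omega>" "H1_sq (\<lambda>x. v x - \<phi> x) < \<epsilon>\<^sup>2" using v e by (metis zero_less_power)
    have "sqrt (H1_sq (\<lambda>x. v x - \<phi> x)) < sqrt (\<epsilon>\<^sup>2)" by (rule real_sqrt_less_mono[OF p(2)])
    then show ?thesis using p(1) e by (auto simp: H1_norm_eq)
  qed
  then show "v \<in> H10 \<Omega>" using v unfolding H10_def by blast
qed

lemma H10_closed:
  assumes v: "v \<in> sobolev 1 \<Omega>" and ap: "\<And>\<epsilon>. \<epsilon> > 0 \<Longrightarrow> \<exists>z\<in>H10 \<Omega>. H1_sq (\<lambda>x. v x - z x) < \<epsilon>"
  shows "v \<in> H10 \<Omega>"
  unfolding H10_iff
proof (intro conjI allI impI v)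
  fix \<epsilon> :: real assume "\<epsilon> > 0"
  then have e: "\<epsilon> / 4 > 0" by simp
  obtain z where z: "z \<in> H10 \<Omega>" "H1_sq (\<lambda>x. v x - z x) < \<epsilon> / 4" using ap[OF e] by blast
  obtain \<phi> where p: "\<phi> \<in> test_functions \<Omega>" "H1_sq (\<lambda>x. z x - \<phi> x) < \<epsilon> / 4" using z(1) e unfolding H10_iff by blast
  have s1: "(\<lambda>x. v x - z x) \<in> sobolev 1 \<Omega>" using sobolev_lincomb[OF v H10_sobolev[OF z(1)], of 1 "-1"] by simp
  have s2: "(\<lambda>x. z x - \<phi> x) \<in> sobolev 1 \<Omega>" using sobolev_lincomb[OF H10_sobolev[OF z(1)] test_sobolev[OF p(1)], of 1 "-1"] by simp
  have "H1_sq (\<lambda>x. v x - \<phi> x) < \<epsilon>"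
    using H1_sq_lincomb[OF s1 s2, of 1 1] z(2) p(2) by simp
  then show "\<exists>\<phi>\<in>test_functions \<Omega>. H1_sq (\<lambda>x. v x - \<phi> x) < \<epsilon>" using p(1) by blast
qed

lemma H10_lincomb:
  assumes "u \<in> H10 \<Omega>" "v \<in> H10 \<Omega>" shows "(\<lambda>x. c * u x + d * v x) \<in> H10 \<Omega>"
  unfolding H10_iff
proof (intro conjI allI impI)
  note su = H10_sobolev[OF assms(1)] and sv = H10_sobolev[OF assms(2)]
  show "(\<lambda>x. c * u x + d * v x) \<in> sobolev 1 \<Omega>" by (rule sobolev_lincomb[OF su sv])
  fix \<epsilon> :: real assume e: "\<epsilon> > 0"
  define K where "K = 2 * c\<^sup>2 + 2 * d\<^sup>2 + 1"
  have K: "K > 0" by (simp add: K_def add_nonneg_pos)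
  define r where "r = \<epsilon> / K"
  have r: "r > 0" "K * r = \<epsilon>" using e K by (simp_all add: r_def)
  obtain \<phi> where p: "\<phi> \<in> test_functions \<Omega>" "H1_sq (\<lambda>x. u x - \<phi> x) < r" using assms(1) r(1) unfolding H10_iff by blast
  obtain \<psi> where q: "\<psi> \<in> test_functions \<Omega>" "H1_sq (\<lambda>x. v x - \<psi> x) < r" using assms(2) r(1) unfolding H10_iff by blast
  have s1: "(\<lambda>x. u x - \<phi> x) \<in> sobolev 1 \<Omega>" using sobolev_lincomb[OF su test_sobolev[OF p(1)], of 1 "-1"] by simp
  have s2: "(\<lambda>x. v x - \<psi> x) \<in> sobolev 1 \<Omega>" using sobolev_lincomb[OF sv test_sobolev[OF q(1)], of 1 "-1"] by simp
  have "(\<lambda>x. c * u x + d * v x - (c * \<phi> x + d * \<psi> x)) = (\<lambda>x. c * (u x - \<phi> x) + d * (v x - \<psi> x))" by (simp add: algebra_simps)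
  then have "H1_sq (\<lambda>x. c * u x + d * v x - (c * \<phi> x + d * \<psi> x)) \<le> 2 * c\<^sup>2 * H1_sq (\<lambda>x. u x - \<phi> x) + 2 * d\<^sup>2 * H1_sq (\<lambda>x. v x - \<psi> x)"
    using H1_sq_lincomb[OF s1 s2, of c d] by simp
  also have "\<dots> \<le> 2 * c\<^sup>2 * r + 2 * d\<^sup>2 * r" using p(2) q(2) by (intro add_mono mult_left_mono) auto
  also have "\<dots> < \<epsilon>" using r by (simp add: K_def algebra_simps)
  finally show "\<exists>\<phi>\<in>test_functions \<Omega>. H1_sq (\<lambda>x. c * u x + d * v x - \<phi> x) < \<epsilon>"
    by (rule bexI[where x = "\<lambda>x. c * \<phi> x + d * \<psi> x"]) (rule test_lincomb[OF p(1) q(1)])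
qed

end

section \<open>The Sobolev space in terms of eigenfunctions\<close>

text \<open>The numbers \<open>lam n\<close> are eigenvalues of \<open>A = \<Delta>\<^sup>2\<close>; the corresponding ones of \<open>- \<Delta>\<close> are their square roots.\<close>

locale eigen_domain = dense_domain \<Omega> + orthonormal_basis \<Omega> e
  for \<Omega> :: "'a::euclidean_space set" and e :: "nat \<Rightarrow> 'a \<Rightarrow> real" +
  fixes lam :: "nat \<Rightarrow> real" and c1 :: real
  assumes e_H10: "\<And>n. e n \<in> H10 \<Omega>"
    and lam_ge: "c1 > 0" "\<And>n. lam n \<ge> c1"
    and e_laplacian: "\<And>n. has_weak_laplacian \<Omega> (e n) (\<lambda>x. - sqrt (lam n) * e n x)"
begin

lemma lam_pos: "lam n > 0" using lam_ge(1) lam_ge(2)[of n] by linarith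

lemma e_sobolev: "e n \<in> sobolev 1 \<Omega>" by (rule H10_sobolev[OF e_H10])

lemma grad_e: assumes "v \<in> H10 \<Omega>" shows "grad_inner \<Omega> (e n) v = sqrt (lam n) * cf v n"
  using Green[OF e_sobolev L2_scale[OF e_L2] e_laplacian assms, of n] L2_inner_scale(1)[of \<Omega> "- sqrt (lam n)" "e n" v] by (simp add: L2_inner_commute[of \<Omega> v])

lemma partial_H10: "(\<lambda>x. \<Sum>n<N. c n * e n x) \<in> H10 \<Omega>"
proof (induction N)
  case 0
  show ?case using H10_lincomb[OF e_H10 e_H10, of 0 0 0 0] by simp
next
  case (Suc N)
  then show ?case using H10_lincomb[OF Suc e_H10, of 1 "c N" N] by simp
qed

lemma partial_sobolev: "(\<lambda>x. \<Sum>n<N. c n * e n x) \<in> sobolev 1 \<Omega>"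
  by (rule H10_sobolev[OF partial_H10])

lemma grad_partial: assumes "v \<in> H10 \<Omega>"
  shows "grad_inner \<Omega> (\<lambda>x. \<Sum>n<N. c n * e n x) v = (\<Sum>n<N. c n * (sqrt (lam n) * cf v n))"
proof (induction N)
  case 0
  show ?case using grad_inner_lincomb[OF e_sobolev e_sobolev H10_sobolev[OF assms], of 0 0 0 0] by simp
next
  case (Suc N)
  then show ?case
    using grad_inner_lincomb[OF partial_sobolev e_sobolev H10_sobolev[OF assms], of 1 c N "c N" N] grad_e[OF assms] by simp
qed

lemma grad_partial_sq: "grad_inner \<Omega> (\<lambda>x. \<Sum>n<N. c n * e n x) (\<lambda>x. \<Sum>n<N. c n * e n x) = (\<Sum>n<N. sqrt (lam n) * (c n)\<^sup>2)"
  unfolding grad_partial[OF partial_H10] by (intro sum.cong refl) (simp add: cf_partial power2_eq_square)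

text \<open>Weak partial derivatives of the partial sums of an expansion.\<close>

definition pderiv_sum :: "(nat \<Rightarrow> real) \<Rightarrow> 'a \<Rightarrow> nat \<Rightarrow> 'a \<Rightarrow> real" where
  "pderiv_sum c b N x = (\<Sum>n<N. c n * weak_pderiv \<Omega> b (e n) x)"

lemma pderiv_sum_L2: "b \<in> Basis \<Longrightarrow> pderiv_sum c b N \<in> L2 \<Omega>"
  unfolding pderiv_sum_def[abs_def] by (intro L2_sum L2_scale weak_pderiv_spec e_sobolev)

lemma pderiv_sum_weak: assumes "b \<in> Basis" shows "has_weak_pderiv \<Omega> b (\<lambda>x. \<Sum>n<N. c n * e n x) (pderiv_sum c b N)"
proof (induction N)
  case 0
  show ?case by (simp add: has_weak_pderiv_def pderiv_sum_def[abs_def] L2_inner_def)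
next
  case (Suc N)
  show ?case
    using weak_pderiv_lincomb[OF partial_L2 e_L2 pderiv_sum_L2[OF assms] weak_pderiv_spec(1)[OF e_sobolev assms] Suc weak_pderiv_spec(2)[OF e_sobolev assms] assms, of 1 "c N"]
    by (simp add: pderiv_sum_def[abs_def])
qed

lemma pderiv_sum_sq: "(\<Sum>b\<in>Basis. L2_sq \<Omega> (pderiv_sum c b N)) = (\<Sum>n<N. sqrt (lam n) * (c n)\<^sup>2)"
  using grad_inner_eq[OF partial_sobolev partial_sobolev pderiv_sum_L2 pderiv_sum_weak pderiv_sum_L2 pderiv_sum_weak, of c N c N] grad_partial_sq[of c N] by (simp add: L2_sq_def)

text \<open>Bessel's inequality for the form \<open>grad_inner\<close>, in which the \<open>e n\<close> are orthogonal.\<close>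

lemma H10_summable:
  assumes v: "v \<in> H10 \<Omega>" shows "summable (\<lambda>n. sqrt (lam n) * (cf v n)\<^sup>2)"
proof (rule summableI_nonneg_bounded[where x = "grad_inner \<Omega> v v"])
  show "0 \<le> sqrt (lam n) * (cf v n)\<^sup>2" for n using lam_pos[of n] by simp
  fix N
  define S where "S = (\<lambda>x. \<Sum>n<N. cf v n * e n x)"
  have S: "S \<in> sobolev 1 \<Omega>" unfolding S_def by (rule partial_sobolev)
  note sv = H10_sobolev[OF v]
  have Sv: "grad_inner \<Omega> S v = (\<Sum>n<N. sqrt (lam n) * (cf v n)\<^sup>2)"
    unfolding S_def grad_partial[OF v] by (intro sum.cong refl) (simp add: power2_eq_square)
  have SS: "grad_inner \<Omega> S S = (\<Sum>n<N. sqrt (lam n) * (cf v n)\<^sup>2)" unfolding S_def by (rule grad_partial_sq)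
  have "grad_inner \<Omega> (\<lambda>x. 1 * v x + (-1) * S x) (\<lambda>x. 1 * v x + (-1) * S x) = grad_inner \<Omega> v v - 2 * grad_inner \<Omega> S v + grad_inner \<Omega> S S"
    unfolding grad_inner_lincomb[OF sv S sobolev_lincomb[OF sv S]] grad_inner_lincomb_right[OF sv S sv] grad_inner_lincomb_right[OF sv S S]
    by (simp add: grad_inner_commute[of v S])
  then show "(\<Sum>n<N. sqrt (lam n) * (cf v n)\<^sup>2) \<le> grad_inner \<Omega> v v"
    using grad_inner_nonneg[of "\<lambda>x. 1 * v x + (-1) * S x"] Sv SS by simp
qed

text \<open>By the orthogonality in the gradient form the gradients of the partial sums are a Cauchy sequence, and the limits are the weak derivatives because weak differentiation is closed.\<close>

lemma spectral_gradient:
  assumes vL: "v \<in> L2 \<Omega>" and s: "summable (\<lambda>n. sqrt (lam n) * (cf v n)\<^sup>2)"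
  obtains g where "\<And>b. b \<in> Basis \<Longrightarrow> g b \<in> L2 \<Omega>" "\<And>b. b \<in> Basis \<Longrightarrow> has_weak_pderiv \<Omega> b v (g b)"
    "\<And>b. b \<in> Basis \<Longrightarrow> (\<lambda>N. L2_sq \<Omega> (\<lambda>x. pderiv_sum (cf v) b N x - g b x)) \<longlonglongrightarrow> 0"
proof -
  let ?c = "cf v"
  have d: "L2_sq \<Omega> (\<lambda>x. pderiv_sum ?c b M x - pderiv_sum ?c b N x) \<le> (\<Sum>k=N..<M. sqrt (lam k) * (?c k)\<^sup>2)" if b: "b \<in> Basis" and le: "N \<le> M" for b :: 'a and M N
  proof -
    define c' where "c' = (\<lambda>k. if k < N then 0 else ?c k)"
    have "(\<lambda>x. pderiv_sum ?c b M x - pderiv_sum ?c b N x) = pderiv_sum c' b M"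
    proof
      fix x
      have "pderiv_sum ?c b M x = pderiv_sum ?c b N x + (\<Sum>k=N..<M. ?c k * weak_pderiv \<Omega> b (e k) x)"
        unfolding pderiv_sum_def lessThan_atLeast0 using le by (simp add: sum.atLeastLessThan_concat)
      moreover have "pderiv_sum c' b M x = (\<Sum>k=N..<M. ?c k * weak_pderiv \<Omega> b (e k) x)"
        unfolding pderiv_sum_def c'_def by (rule sum.mono_neutral_cong_right) auto
      ultimately show "pderiv_sum ?c b M x - pderiv_sum ?c b N x = pderiv_sum c' b M x" by simp
    qed
    then have "L2_sq \<Omega> (\<lambda>x. pderiv_sum ?c b M x - pderiv_sum ?c b N x) = (\<Sum>b\<in>{b}. L2_sq \<Omega> (pderiv_sum c' b M))" by simp
    also have "\<dots> \<le> (\<Sum>b\<in>Basis. L2_sq \<Omega> (pderiv_sum c' b M))" using b by (intro sum_mono2) (auto intro: L2_sq_nonneg)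
    also have "\<dots> = (\<Sum>n<M. sqrt (lam n) * (c' n)\<^sup>2)" by (rule pderiv_sum_sq)
    also have "\<dots> = (\<Sum>k=N..<M. sqrt (lam k) * (?c k)\<^sup>2)" unfolding c'_def by (rule sum.mono_neutral_cong_right) auto
    finally show ?thesis .
  qed
  have sym: "L2_sq \<Omega> (\<lambda>x. pderiv_sum ?c b m x - pderiv_sum ?c b n x) = L2_sq \<Omega> (\<lambda>x. pderiv_sum ?c b n x - pderiv_sum ?c b m x)" if "b \<in> Basis" for b :: 'a and m n
    using L2_sq_diff[OF pderiv_sum_L2[OF that] pderiv_sum_L2[OF that]] by (simp add: L2_inner_commute)
  have "\<exists>g. g \<in> L2 \<Omega> \<and> (\<lambda>N. L2_sq \<Omega> (\<lambda>x. pderiv_sum ?c b N x - g x)) \<longlonglongrightarrow> 0" if b: "b \<in> Basis" for b :: 'a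
  proof (rule L2_complete[OF pderiv_sum_L2[OF b, of ?c]])
    fix \<epsilon> :: real assume "\<epsilon> > 0"
    then obtain N where N: "\<And>m n. m \<ge> N \<Longrightarrow> norm (sum (\<lambda>n. sqrt (lam n) * (?c n)\<^sup>2) {m..<n}) < \<epsilon>"
      using s unfolding summable_Cauchy by blast
    have "L2_sq \<Omega> (\<lambda>x. pderiv_sum ?c b m x - pderiv_sum ?c b n x) < \<epsilon>" if "m \<ge> N" "n \<ge> N" for m n
    proof (cases "n \<le> m")
      case True
      show ?thesis using d[OF b True] N[OF that(2), of m] by simp
    next
      case False
      then have "m \<le> n" by simp
      then show ?thesis using sym[OF b, of m n] d[OF b \<open>m \<le> n\<close>] N[OF that(1), of n] by simp
    qed
    then show "\<exists>N. \<forall>m\<ge>N. \<forall>n\<ge>N. L2_sq \<Omega> (\<lambda>x. pderiv_sum ?c b m x - pderiv_sum ?c b n x) < \<epsilon>" by blast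
  next
    fix g assume "g \<in> L2 \<Omega>" "(\<lambda>n. L2_sq \<Omega> (\<lambda>x. pderiv_sum ?c b n x - g x)) \<longlonglongrightarrow> 0"
    then show ?thesis by blast
  qed
  then obtain g where g: "\<And>b. b \<in> Basis \<Longrightarrow> g b \<in> L2 \<Omega>" "\<And>b. b \<in> Basis \<Longrightarrow> (\<lambda>N. L2_sq \<Omega> (\<lambda>x. pderiv_sum ?c b N x - g b x)) \<longlonglongrightarrow> 0"
    by metis
  have conv: "(\<lambda>N. L2_sq \<Omega> (\<lambda>x. (\<Sum>n<N. ?c n * e n x) - v x)) \<longlonglongrightarrow> 0"
    using expansion[OF vL] by (simp add: L2_sums_iff)
  have "has_weak_pderiv \<Omega> b v (g b)" if b: "b \<in> Basis" for b
    by (rule weak_pderiv_limit[OF partial_L2 vL conv pderiv_sum_L2[OF b] g(1)[OF b] g(2)[OF b] pderiv_sum_weak[OF b] b])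
  then show thesis using g by (intro that[of g])
qed

text \<open>Bessel's inequality gives one direction. Conversely the partial sums, which belong to \<open>H\<^sup>1\<^sub>0\<close>, converge in the norm of \<open>H\<^sup>1\<close>.\<close>

lemma H10_spectral: "v \<in> H10 \<Omega> \<longleftrightarrow> v \<in> L2 \<Omega> \<and> summable (\<lambda>n. sqrt (lam n) * (cf v n)\<^sup>2)"
  and grad_inner_spectral: "u \<in> H10 \<Omega> \<Longrightarrow> v \<in> H10 \<Omega> \<Longrightarrow> (\<lambda>n. cf u n * (sqrt (lam n) * cf v n)) sums grad_inner \<Omega> u v"
proof -
  have main: "v \<in> H10 \<Omega>" if vL: "v \<in> L2 \<Omega>" and s: "summable (\<lambda>n. sqrt (lam n) * (cf v n)\<^sup>2)" for v
  proof (rule spectral_gradient[OF that])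
    fix g assume g: "\<And>b. b \<in> Basis \<Longrightarrow> g b \<in> L2 \<Omega>" "\<And>b. b \<in> Basis \<Longrightarrow> has_weak_pderiv \<Omega> b v (g b)"
      "\<And>b. b \<in> Basis \<Longrightarrow> (\<lambda>N. L2_sq \<Omega> (\<lambda>x. pderiv_sum (cf v) b N x - g b x)) \<longlonglongrightarrow> 0"
    have sv: "v \<in> sobolev 1 \<Omega>" unfolding sobolev_1_iff using vL g by blast
    define S where "S = (\<lambda>N x. \<Sum>n<N. cf v n * e n x)"
    have SH: "S N \<in> H10 \<Omega>" for N unfolding S_def by (rule partial_H10)
    have gr: "grad_inner \<Omega> (\<lambda>x. S N x - v x) (\<lambda>x. S N x - v x) = (\<Sum>b\<in>Basis. L2_sq \<Omega> (\<lambda>x. pderiv_sum (cf v) b N x - g b x))" for N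
    proof -
      have sd: "(\<lambda>x. S N x - v x) \<in> sobolev 1 \<Omega>" using sobolev_lincomb[OF H10_sobolev[OF SH[of N]] sv, of 1 "-1"] by simp
      have w: "has_weak_pderiv \<Omega> b (\<lambda>x. S N x - v x) (\<lambda>x. pderiv_sum (cf v) b N x - g b x)" if "b \<in> Basis" for b
        using weak_pderiv_lincomb[OF partial_L2[of "cf v" N] vL pderiv_sum_L2[OF that, of "cf v" N] g(1)[OF that] pderiv_sum_weak[OF that, of "cf v" N] g(2)[OF that] that, of 1 "-1"] by (simp add: S_def)
      show ?thesis unfolding L2_sq_def by (rule grad_inner_eq[OF sd sd _ w _ w]) (auto intro: L2_diff pderiv_sum_L2 g(1))
    qed
    have "(\<lambda>N. L2_sq \<Omega> (\<lambda>x. S N x - v x) + (\<Sum>b\<in>Basis. L2_sq \<Omega> (\<lambda>x. pderiv_sum (cf v) b N x - g b x))) \<longlonglongrightarrow> 0 + (\<Sum>b\<in>(Basis :: 'a set). 0)"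
      using expansion[OF vL] by (intro tendsto_add tendsto_sum g(3)) (simp_all add: L2_sums_iff S_def)
    then have lim: "(\<lambda>N. H1_sq (\<lambda>x. S N x - v x)) \<longlonglongrightarrow> 0" by (simp add: H1_sq_def gr)
    show "v \<in> H10 \<Omega>"
    proof (rule H10_closed[OF sv])
      fix \<epsilon> :: real assume "\<epsilon> > 0"
      then have "\<forall>\<^sub>F N in sequentially. H1_sq (\<lambda>x. S N x - v x) < \<epsilon> / 2" by (intro order_tendstoD(2)[OF lim]) simp
      then obtain N where N: "H1_sq (\<lambda>x. S N x - v x) < \<epsilon> / 2" by (auto simp: eventually_sequentially)
      have sd: "(\<lambda>x. S N x - v x) \<in> sobolev 1 \<Omega>" using sobolev_lincomb[OF H10_sobolev[OF SH[of N]] sv, of 1 "-1"] by simp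
      have "H1_sq (\<lambda>x. v x - S N x) < \<epsilon>" using H1_sq_lincomb[OF sd sd, of "-1" 0] N by simp
      then show "\<exists>z\<in>H10 \<Omega>. H1_sq (\<lambda>x. v x - z x) < \<epsilon>" using SH by blast
    qed
  qed
  show "v \<in> H10 \<Omega> \<longleftrightarrow> v \<in> L2 \<Omega> \<and> summable (\<lambda>n. sqrt (lam n) * (cf v n)\<^sup>2)"
    using main[of v] H10_L2[of v] H10_summable[of v] by iprover
  assume u: "u \<in> H10 \<Omega>" and v: "v \<in> H10 \<Omega>"
  show "(\<lambda>n. cf u n * (sqrt (lam n) * cf v n)) sums grad_inner \<Omega> u v"
  proof (rule spectral_gradient[OF H10_L2[OF u] H10_summable[OF u]])
    fix g assume g: "\<And>b. b \<in> Basis \<Longrightarrow> g b \<in> L2 \<Omega>" "\<And>b. b \<in> Basis \<Longrightarrow> has_weak_pderiv \<Omega> b u (g b)"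
      "\<And>b. b \<in> Basis \<Longrightarrow> (\<lambda>N. L2_sq \<Omega> (\<lambda>x. pderiv_sum (cf u) b N x - g b x)) \<longlonglongrightarrow> 0"
    note sv = H10_sobolev[OF v] and su = H10_sobolev[OF u]
    note wv = weak_pderiv_spec[OF sv]
    have "(\<lambda>N. \<Sum>b\<in>Basis. L2_inner \<Omega> (pderiv_sum (cf u) b N) (weak_pderiv \<Omega> b v)) \<longlonglongrightarrow> (\<Sum>b\<in>Basis. L2_inner \<Omega> (g b) (weak_pderiv \<Omega> b v))"
    proof (rule tendsto_sum)
      fix b :: 'a assume b: "b \<in> Basis"
      show "(\<lambda>N. L2_inner \<Omega> (pderiv_sum (cf u) b N) (weak_pderiv \<Omega> b v)) \<longlonglongrightarrow> L2_inner \<Omega> (g b) (weak_pderiv \<Omega> b v)"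
        by (rule L2_inner_tendsto[where f = "pderiv_sum (cf u) b", OF pderiv_sum_L2[OF b] g(1)[OF b] wv(1)[OF b] g(3)[OF b]])
    qed
    also have "(\<Sum>b\<in>Basis. L2_inner \<Omega> (g b) (weak_pderiv \<Omega> b v)) = grad_inner \<Omega> u v"
      by (rule grad_inner_eq[of u v g "\<lambda>b. weak_pderiv \<Omega> b v", OF su sv g(1,2) wv, symmetric])
    also have "(\<lambda>N. \<Sum>b\<in>Basis. L2_inner \<Omega> (pderiv_sum (cf u) b N) (weak_pderiv \<Omega> b v)) = (\<lambda>N. \<Sum>n<N. cf u n * (sqrt (lam n) * cf v n))"
    proof
      fix N
      have "grad_inner \<Omega> (\<lambda>x. \<Sum>n<N. cf u n * e n x) v = (\<Sum>b\<in>Basis. L2_inner \<Omega> (pderiv_sum (cf u) b N) (weak_pderiv \<Omega> b v))"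
        by (rule grad_inner_eq[of _ v "\<lambda>b. pderiv_sum (cf u) b N" "\<lambda>b. weak_pderiv \<Omega> b v", OF partial_sobolev sv pderiv_sum_L2 pderiv_sum_weak wv])
      then show "(\<Sum>b\<in>Basis. L2_inner \<Omega> (pderiv_sum (cf u) b N) (weak_pderiv \<Omega> b v)) = (\<Sum>n<N. cf u n * (sqrt (lam n) * cf v n))"
        by (simp add: grad_partial[OF v])
    qed
    finally show ?thesis by (simp add: sums_def)
  qed
qed

lemma H1_norm_spectral:
  assumes "v \<in> H10 \<Omega>" shows "H1_norm \<Omega> v = sqrt (\<Sum>n. (1 + sqrt (lam n)) * (cf v n)\<^sup>2)"
proof -
  have "(\<lambda>n. (cf v n)\<^sup>2 + cf v n * (sqrt (lam n) * cf v n)) sums (L2_sq \<Omega> v + grad_inner \<Omega> v v)"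
    by (intro sums_add Parseval_sq grad_inner_spectral assms H10_L2)
  moreover have "(\<lambda>n. (cf v n)\<^sup>2 + cf v n * (sqrt (lam n) * cf v n)) = (\<lambda>n. (1 + sqrt (lam n)) * (cf v n)\<^sup>2)"
    by (simp add: power2_eq_square algebra_simps)
  ultimately show ?thesis by (simp add: H1_norm_eq H1_sq_def sums_iff)
qed

end

section \<open>Uniqueness for the scalar fractional equation\<close>

lemma lebesgue_on_interval_lborel:
  fixes f :: "real \<Rightarrow> real"
  assumes "f \<in> borel_measurable borel"
  shows "integrable (lebesgue_on {a<..<b}) f \<longleftrightarrow> integrable lborel (\<lambda>x. indicator {a<..<b} x * f x)"
    and "(LINT x|lebesgue_on {a<..<b}. f x) = (LINT x|lborel. indicator {a<..<b} x * f x)"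
proof -
  have m: "(\<lambda>x. indicator {a<..<b} x * f x) \<in> borel_measurable lborel" using assms by simp
  show "integrable (lebesgue_on {a<..<b}) f \<longleftrightarrow> integrable lborel (\<lambda>x. indicator {a<..<b} x * f x)"
    using integrable_completion[OF m] by (simp add: integrable_restrict_space)
  show "(LINT x|lebesgue_on {a<..<b}. f x) = (LINT x|lborel. indicator {a<..<b} x * f x)"
    using integral_completion[OF m] by (simp add: integral_restrict_space)
qed

lemma shifted_beta_kernel:
  fixes \<alpha> \<sigma> t :: real
  assumes "1 < \<alpha>" "\<alpha> < 2" "\<sigma> < t"
  shows "integrable lborel (\<lambda>\<tau>. indicator {\<sigma><..<t} \<tau> * ((t - \<tau>) powr (\<alpha> - 2) * (\<tau> - \<sigma>) powr (1 - \<alpha>)))"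
    and "(LINT \<tau>|lborel. indicator {\<sigma><..<t} \<tau> * ((t - \<tau>) powr (\<alpha> - 2) * (\<tau> - \<sigma>) powr (1 - \<alpha>))) = Beta (\<alpha> - 1) (2 - \<alpha>)"
proof -
  define f where "f = (\<lambda>\<tau>. (t - \<sigma> - \<tau>) powr (\<alpha> - 2) * \<tau> powr (1 - \<alpha>))"
  define g where "g = (\<lambda>\<tau>. indicator {0<..<t - \<sigma>} \<tau> * f \<tau>)"
  have fm: "f \<in> borel_measurable borel" unfolding f_def by measurable
  have b: "integrable lborel g" "(LINT \<tau>|lborel. g \<tau>) = Beta (\<alpha> - 1) (2 - \<alpha>)"
    using beta_kernel_integral[of "\<alpha> - 1" "2 - \<alpha>" "t - \<sigma>"] lebesgue_on_interval_lborel[OF fm, of 0 "t - \<sigma>"] assms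
    by (simp_all add: f_def g_def)
  have eq: "(\<lambda>\<tau>. g (- \<sigma> + 1 * \<tau>)) = (\<lambda>\<tau>. indicator {\<sigma><..<t} \<tau> * ((t - \<tau>) powr (\<alpha> - 2) * (\<tau> - \<sigma>) powr (1 - \<alpha>)))"
    by (auto simp: g_def f_def indicator_def fun_eq_iff)
  show "integrable lborel (\<lambda>\<tau>. indicator {\<sigma><..<t} \<tau> * ((t - \<tau>) powr (\<alpha> - 2) * (\<tau> - \<sigma>) powr (1 - \<alpha>)))"
    using lborel_integrable_real_affine[OF b(1), of 1 "- \<sigma>"] unfolding eq by simp
  show "(LINT \<tau>|lborel. indicator {\<sigma><..<t} \<tau> * ((t - \<tau>) powr (\<alpha> - 2) * (\<tau> - \<sigma>) powr (1 - \<alpha>))) = Beta (\<alpha> - 1) (2 - \<alpha>)"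
    using lborel_integral_real_affine[of 1 g "- \<sigma>"] b(2) unfolding eq by simp
qed

text \<open>Fubini's theorem for the triangle \<open>0 < \<sigma> < \<tau> < t\<close>; the inner integral over \<open>\<tau>\<close> is a Beta integral that depends neither on \<open>\<sigma>\<close> nor on \<open>t\<close>.\<close>

lemma abel_inversion_borel:
  fixes \<alpha> t :: real and q :: "real \<Rightarrow> real"
  assumes a: "1 < \<alpha>" "\<alpha> < 2" and q: "integrable lborel q" and t: "t > 0"
  shows "(LINT \<tau>|lborel. indicator {0<..<t} \<tau> * ((t - \<tau>) powr (\<alpha> - 2) * (LINT \<sigma>|lborel. indicator {0<..<\<tau>} \<sigma> * ((\<tau> - \<sigma>) powr (1 - \<alpha>) * q \<sigma>))))
    = Beta (\<alpha> - 1) (2 - \<alpha>) * (LINT \<sigma>|lborel. indicator {0<..<t} \<sigma> * q \<sigma>)"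
proof -
  have qm [measurable]: "q \<in> borel_measurable borel" using q by (simp add: borel_measurable_integrable flip: measurable_lborel1)
  define k where "k = (\<lambda>\<sigma> \<tau> :: real. indicator {\<sigma><..<t} \<tau> * ((t - \<tau>) powr (\<alpha> - 2) * (\<tau> - \<sigma>) powr (1 - \<alpha>)))"
  define f where "f = (\<lambda>\<sigma> \<tau>. indicator {0<..<t} \<sigma> * q \<sigma> * k \<sigma> \<tau>)"
  have kn: "k \<sigma> \<tau> \<ge> 0" for \<sigma> \<tau> by (simp add: k_def)
  have km: "(\<lambda>p. k (fst p) (snd p)) \<in> borel_measurable (borel \<Otimes>\<^sub>M borel)"
    unfolding k_def indicator_def greaterThanLessThan_iff by measurable
  have fm: "case_prod f \<in> borel_measurable (lborel \<Otimes>\<^sub>M lborel)"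
    using km unfolding f_def case_prod_beta by measurable
  have ki: "integrable lborel (k \<sigma>)" "(LINT \<tau>|lborel. k \<sigma> \<tau>) = Beta (\<alpha> - 1) (2 - \<alpha>)" if "\<sigma> < t" for \<sigma>
    unfolding k_def by (rule shifted_beta_kernel[OF a that])+
  have fi: "integrable lborel (f \<sigma>)" for \<sigma>
  proof (cases "\<sigma> \<in> {0<..<t}")
    case True
    then show ?thesis unfolding f_def by (intro integrable_mult_right ki) auto
  qed (simp add: f_def)
  have fv: "(LINT \<tau>|lborel. f \<sigma> \<tau>) = Beta (\<alpha> - 1) (2 - \<alpha>) * (indicator {0<..<t} \<sigma> * q \<sigma>)" for \<sigma>
  proof (cases "\<sigma> \<in> {0<..<t}")
    case True
    then show ?thesis using ki(2)[of \<sigma>] by (simp add: f_def)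
  qed (simp add: f_def)
  have fn: "(LINT \<tau>|lborel. norm (f \<sigma> \<tau>)) = Beta (\<alpha> - 1) (2 - \<alpha>) * \<bar>indicator {0<..<t} \<sigma> * q \<sigma>\<bar>" for \<sigma>
  proof (cases "\<sigma> \<in> {0<..<t}")
    case True
    then show ?thesis using ki(2)[of \<sigma>] kn by (simp add: f_def abs_mult)
  qed (simp add: f_def)
  have qi: "integrable lborel (\<lambda>\<sigma>. indicator {0<..<t} \<sigma> * q \<sigma>)"
    by (rule Bochner_Integration.integrable_bound[OF q]) (auto simp: indicator_def)
  have int: "integrable (lborel \<Otimes>\<^sub>M lborel) (case_prod f)"
    by (rule lborel_pair.Fubini_integrable[OF fm]) (use fi qi in \<open>simp_all add: fn[unfolded real_norm_def] integrable_abs\<close>)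
  have "(LINT \<tau>|lborel. LINT \<sigma>|lborel. f \<sigma> \<tau>) = (LINT \<sigma>|lborel. LINT \<tau>|lborel. f \<sigma> \<tau>)"
    by (rule lborel_pair.Fubini_integral[OF int])
  also have "\<dots> = Beta (\<alpha> - 1) (2 - \<alpha>) * (LINT \<sigma>|lborel. indicator {0<..<t} \<sigma> * q \<sigma>)"
    unfolding fv by simp
  also have "(\<lambda>\<tau>. LINT \<sigma>|lborel. f \<sigma> \<tau>) = (\<lambda>\<tau>. indicator {0<..<t} \<tau> * ((t - \<tau>) powr (\<alpha> - 2) * (LINT \<sigma>|lborel. indicator {0<..<\<tau>} \<sigma> * ((\<tau> - \<sigma>) powr (1 - \<alpha>) * q \<sigma>))))"
  proof
    fix \<tau>
    have "(LINT \<sigma>|lborel. f \<sigma> \<tau>) = (LINT \<sigma>|lborel. (indicator {0<..<t} \<tau> * (t - \<tau>) powr (\<alpha> - 2)) * (indicator {0<..<\<tau>} \<sigma> * ((\<tau> - \<sigma>) powr (1 - \<alpha>) * q \<sigma>)))"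
      by (rule Bochner_Integration.integral_cong[OF refl]) (auto simp: f_def k_def indicator_def)
    then show "(LINT \<sigma>|lborel. f \<sigma> \<tau>) = indicator {0<..<t} \<tau> * ((t - \<tau>) powr (\<alpha> - 2) * (LINT \<sigma>|lborel. indicator {0<..<\<tau>} \<sigma> * ((\<tau> - \<sigma>) powr (1 - \<alpha>) * q \<sigma>)))"
      by (simp add: mult.assoc)
  qed
  finally show ?thesis .
qed

lemma abel_inversion:
  fixes q z :: "real \<Rightarrow> real"
  assumes a: "1 < \<alpha>" "\<alpha> < 2" and q: "integrable (lebesgue_on {0..T}) q" and t: "0 < t" "t \<le> T"
    and z: "continuous_on {0..T} z" and eq: "\<And>\<tau>. \<tau> \<in> {0<..<T} \<Longrightarrow> frac_integral (2 - \<alpha>) q \<tau> = z \<tau>"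
  shows "Gamma (2 - \<alpha>) * (LINT \<tau>|lebesgue_on {0<..<t}. (t - \<tau>) powr (\<alpha> - 2) * z \<tau>)
    = Beta (\<alpha> - 1) (2 - \<alpha>) * (LINT \<sigma>|lebesgue_on {0..t}. q \<sigma>)"
proof -
  have q0: "(\<lambda>x. indicator {0..T} x * q x) \<in> borel_measurable lebesgue" "integrable lebesgue (\<lambda>x. indicator {0..T} x * q x)"
    using q by (simp_all add: integrable_restrict_space borel_measurable_integrable)
  \<comment> \<open>Fubini's theorem is used for Borel measurable functions, so \<open>q\<close> is replaced by a Borel version.\<close>
  obtain p where p: "p \<in> borel_measurable lborel" "AE x in lborel. indicator {0..T} x * q x = p x"
    using completion_ex_borel_measurable_real[OF q0(1)] by blast
  have pl: "AE x in lebesgue. indicator {0..T} x * q x = p x" using AE_completion[OF p(2)] .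
  have pm [measurable]: "p \<in> borel_measurable borel" using p(1) by simp
  have pml: "p \<in> borel_measurable lebesgue" using p(1) by (rule measurable_completion)
  have "integrable lebesgue p"
    using integrable_cong_AE[THEN iffD1, OF q0(1) pml pl q0(2)] .
  then have pi: "integrable lborel p" using integrable_completion[OF p(1)] by simp
  have inner: "(LINT \<sigma>|lborel. indicator {0<..<\<tau>} \<sigma> * ((\<tau> - \<sigma>) powr (1 - \<alpha>) * p \<sigma>)) = Gamma (2 - \<alpha>) * z \<tau>" if "\<tau> \<in> {0<..<T}" for \<tau>
  proof -
    have m: "(\<lambda>\<sigma>. (\<tau> - \<sigma>) powr (1 - \<alpha>) * p \<sigma>) \<in> borel_measurable borel" by measurable
    have "(LINT \<sigma>|lborel. indicator {0<..<\<tau>} \<sigma> * ((\<tau> - \<sigma>) powr (1 - \<alpha>) * p \<sigma>)) = (LINT \<sigma>|lebesgue_on {0<..<\<tau>}. (\<tau> - \<sigma>) powr (1 - \<alpha>) * p \<sigma>)"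
      using lebesgue_on_interval_lborel(2)[OF m] by simp
    also have "\<dots> = (LINT \<sigma>|lebesgue_on {0<..<\<tau>}. (\<tau> - \<sigma>) powr (1 - \<alpha>) * q \<sigma>)"
    proof -
      have "(LINT \<sigma>|lebesgue. indicator {0<..<\<tau>} \<sigma> *\<^sub>R ((\<tau> - \<sigma>) powr (1 - \<alpha>) * p \<sigma>)) = (LINT \<sigma>|lebesgue. (indicator {0<..<\<tau>} \<sigma> * (\<tau> - \<sigma>) powr (1 - \<alpha>)) * (indicator {0..T} \<sigma> * q \<sigma>))"
      proof (rule integral_cong_AE)
        show "(\<lambda>\<sigma>. (indicator {0<..<\<tau>} \<sigma> * (\<tau> - \<sigma>) powr (1 - \<alpha>)) * (indicator {0..T} \<sigma> * q \<sigma>)) \<in> borel_measurable lebesgue"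
          by (rule borel_measurable_times[OF measurable_completion q0(1)]) simp
        show "(\<lambda>\<sigma>. indicator {0<..<\<tau>} \<sigma> *\<^sub>R ((\<tau> - \<sigma>) powr (1 - \<alpha>) * p \<sigma>)) \<in> borel_measurable lebesgue"
          by (rule measurable_completion) simp
        show "AE \<sigma> in lebesgue. indicator {0<..<\<tau>} \<sigma> *\<^sub>R ((\<tau> - \<sigma>) powr (1 - \<alpha>) * p \<sigma>) = (indicator {0<..<\<tau>} \<sigma> * (\<tau> - \<sigma>) powr (1 - \<alpha>)) * (indicator {0..T} \<sigma> * q \<sigma>)"
          using pl by eventually_elim simp
      qed
      also have "\<dots> = (LINT \<sigma>|lebesgue. indicator {0<..<\<tau>} \<sigma> *\<^sub>R ((\<tau> - \<sigma>) powr (1 - \<alpha>) * q \<sigma>))"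
        by (rule Bochner_Integration.integral_cong[OF refl]) (use that in \<open>auto simp: indicator_def\<close>)
      finally show ?thesis by (simp add: integral_restrict_space)
    qed
    also have "\<dots> = Gamma (2 - \<alpha>) * z \<tau>"
    proof -
      define G where "G = Gamma (2 - \<alpha>)"
      have "G > 0" unfolding G_def by (rule Gamma_real_pos) (use a in simp)
      then have G: "G = Gamma (2 - \<alpha>)" "G \<noteq> 0" by (simp_all add: G_def)
      have "1 / G * (LINT \<sigma>|lebesgue_on {0<..<\<tau>}. (\<tau> - \<sigma>) powr (1 - \<alpha>) * q \<sigma>) = z \<tau>"
        using eq[OF that] unfolding frac_integral_def G(1) by simp
      then show ?thesis unfolding G(1)[symmetric] using G(2) by (simp add: nonzero_divide_eq_eq mult.commute[of G])
    qed
    finally show ?thesis .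
  qed
  have "Gamma (2 - \<alpha>) * (LINT \<tau>|lebesgue_on {0<..<t}. (t - \<tau>) powr (\<alpha> - 2) * z \<tau>)
      = (LINT \<tau>|lebesgue_on {0<..<t}. (t - \<tau>) powr (\<alpha> - 2) * (LINT \<sigma>|lborel. indicator {0<..<\<tau>} \<sigma> * ((\<tau> - \<sigma>) powr (1 - \<alpha>) * p \<sigma>)))"
  proof -
    have "(LINT \<tau>|lebesgue_on {0<..<t}. (t - \<tau>) powr (\<alpha> - 2) * (LINT \<sigma>|lborel. indicator {0<..<\<tau>} \<sigma> * ((\<tau> - \<sigma>) powr (1 - \<alpha>) * p \<sigma>)))
      = (LINT \<tau>|lebesgue_on {0<..<t}. Gamma (2 - \<alpha>) * ((t - \<tau>) powr (\<alpha> - 2) * z \<tau>))"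
      by (rule Bochner_Integration.integral_cong[OF refl]) (use inner t in auto)
    then show ?thesis by simp
  qed
  also have "\<dots> = (LINT \<tau>|lborel. indicator {0<..<t} \<tau> * ((t - \<tau>) powr (\<alpha> - 2) * (LINT \<sigma>|lborel. indicator {0<..<\<tau>} \<sigma> * ((\<tau> - \<sigma>) powr (1 - \<alpha>) * p \<sigma>))))"
  proof (rule lebesgue_on_interval_lborel(2))
    have "(\<lambda>p'. indicator {0<..<fst p'} (snd p') * ((fst p' - snd p') powr (1 - \<alpha>) * p (snd p'))) \<in> borel_measurable (borel \<Otimes>\<^sub>M lborel)"
      unfolding indicator_def greaterThanLessThan_iff by measurable
    then have "(\<lambda>\<tau>. LINT \<sigma>|lborel. indicator {0<..<\<tau>} \<sigma> * ((\<tau> - \<sigma>) powr (1 - \<alpha>) * p \<sigma>)) \<in> borel_measurable borel"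
      by (intro lborel.borel_measurable_lebesgue_integral) (simp add: case_prod_beta)
    then show "(\<lambda>\<tau>. (t - \<tau>) powr (\<alpha> - 2) * (LINT \<sigma>|lborel. indicator {0<..<\<tau>} \<sigma> * ((\<tau> - \<sigma>) powr (1 - \<alpha>) * p \<sigma>))) \<in> borel_measurable borel"
      by measurable
  qed
  also have "\<dots> = Beta (\<alpha> - 1) (2 - \<alpha>) * (LINT \<sigma>|lborel. indicator {0<..<t} \<sigma> * p \<sigma>)"
    by (rule abel_inversion_borel[OF a pi t(1)])
  also have "(LINT \<sigma>|lborel. indicator {0<..<t} \<sigma> * p \<sigma>) = (LINT \<sigma>|lebesgue. indicator {0<..<t} \<sigma> * p \<sigma>)"
    by (rule integral_completion[symmetric]) simp
  also have "\<dots> = (LINT \<sigma>|lebesgue. indicator {0..t} \<sigma> *\<^sub>R q \<sigma>)"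
  proof (rule integral_cong_AE)
    have "(\<lambda>\<sigma>. indicator {0..t} \<sigma> * (indicator {0..T} \<sigma> * q \<sigma>)) \<in> borel_measurable lebesgue"
      by (rule borel_measurable_times[OF borel_measurable_indicator q0(1)]) simp
    also have "(\<lambda>\<sigma>. indicator {0..t} \<sigma> * (indicator {0..T} \<sigma> * q \<sigma>)) = (\<lambda>\<sigma>. indicator {0..t} \<sigma> *\<^sub>R q \<sigma>)"
      using t by (auto simp: indicator_def fun_eq_iff)
    finally show "(\<lambda>\<sigma>. indicator {0..t} \<sigma> *\<^sub>R q \<sigma>) \<in> borel_measurable lebesgue" .
    show "(\<lambda>\<sigma>. indicator {0<..<t} \<sigma> * p \<sigma>) \<in> borel_measurable lebesgue" by (rule measurable_completion) simp
    have "AE \<sigma> in lebesgue. \<sigma> \<noteq> 0" "AE \<sigma> in lebesgue. \<sigma> \<noteq> t" by (simp_all add: AE_iff_null)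
    then show "AE \<sigma> in lebesgue. indicator {0<..<t} \<sigma> * p \<sigma> = indicator {0..t} \<sigma> *\<^sub>R q \<sigma>"
      using pl by eventually_elim (use t in \<open>auto simp: indicator_def split: if_splits\<close>)
  qed
  also have "\<dots> = (LINT \<sigma>|lebesgue_on {0..t}. q \<sigma>)" by (simp add: integral_restrict_space)
  finally show ?thesis .
qed

text \<open>Abel's inversion recovers \<open>z'\<close> from the equation as a fractional integral of order \<open>\<alpha> - 1\<close> of \<open>z\<close>. Let \<open>m\<close> be the maximum of \<open>e\<^sup>-\<^sup>\<kappa>\<^sup>t |z t|\<close>. The bound
\<open>|z t| \<le> m e\<^sup>\<kappa>\<^sup>t\<close> yields one for \<open>z'\<close>, and its integration gains the factor \<open>1 / \<kappa>\<close>; for large \<open>\<kappa>\<close> this forces \<open>m = 0\<close>.\<close>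

lemma fractional_ode_zero:
  fixes z z' q :: "real \<Rightarrow> real"
  assumes a: "1 < \<alpha>" "\<alpha> < 2" and T: "T > 0"
    and z: "\<And>t. t \<in> {0..T} \<Longrightarrow> (z has_real_derivative z' t) (at t within {0..T})"
    and z': "\<And>t. t \<in> {0..T} \<Longrightarrow> z' t = (LINT \<tau>|lebesgue_on {0..t}. q \<tau>)"
    and q: "integrable (lebesgue_on {0..T}) q"
    and eq: "\<And>t. t \<in> {0<..<T} \<Longrightarrow> frac_integral (2 - \<alpha>) q t = - lam * z t"
    and z0: "z 0 = 0" and t: "t \<in> {0..T}"
  shows "z t = 0"
proof -
  define G where "G = Gamma (2 - \<alpha>)"
  define Bt where "Bt = Beta (\<alpha> - 1) (2 - \<alpha>)"
  have G: "G > 0" unfolding G_def by (rule Gamma_real_pos) (use a in simp)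
  have Bt: "Bt > 0" unfolding Bt_def Beta_def using a by (intro divide_pos_pos mult_pos_pos Gamma_real_pos) auto
  define c where "c = T powr (\<alpha> - 1) * Beta (\<alpha> - 1) 1"
  have B1: "Beta (\<alpha> - 1) 1 > 0" unfolding Beta_def using a by (intro divide_pos_pos mult_pos_pos Gamma_real_pos) auto
  then have c: "c \<ge> 0" by (simp add: c_def)
  define K where "K = G * (\<bar>lam\<bar> * c) / Bt"
  have K: "K \<ge> 0" using G Bt c by (simp add: K_def)
  \<comment> \<open>Integration divides the bound \<open>K\<close> of the Volterra operator by \<open>\<kappa>\<close>, and \<open>K / \<kappa> < 1\<close>.\<close>
  define \<kappa> where "\<kappa> = 2 * K + 1"
  have kp: "\<kappa> > 0" using K by (simp add: \<kappa>_def)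
  have contz: "continuous_on {0..T} z" using z by (meson DERIV_continuous continuous_on_eq_continuous_within)
  have "\<exists>s\<in>{0..T}. \<forall>r\<in>{0..T}. exp (- \<kappa> * r) * \<bar>z r\<bar> \<le> exp (- \<kappa> * s) * \<bar>z s\<bar>"
    by (rule continuous_attains_sup) (use T contz in \<open>auto intro!: continuous_intros\<close>)
  then obtain s where s: "s \<in> {0..T}" "\<And>r. r \<in> {0..T} \<Longrightarrow> exp (- \<kappa> * r) * \<bar>z r\<bar> \<le> exp (- \<kappa> * s) * \<bar>z s\<bar>" by blast
  define m where "m = exp (- \<kappa> * s) * \<bar>z s\<bar>"
  have m: "m \<ge> 0" by (simp add: m_def)
  have zm: "\<bar>z r\<bar> \<le> m * exp (\<kappa> * r)" if "r \<in> {0..T}" for r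
  proof -
    have "exp (\<kappa> * r) * (exp (- \<kappa> * r) * \<bar>z r\<bar>) \<le> exp (\<kappa> * r) * m"
      using s(2)[OF that] by (intro mult_left_mono) (auto simp: m_def)
    moreover have "exp (\<kappa> * r) * exp (- \<kappa> * r) = 1" by (simp flip: exp_add)
    ultimately show ?thesis by (simp only: mult.assoc[symmetric]) (simp add: mult.commute)
  qed
  have zd: "\<bar>z' r\<bar> \<le> K * m * exp (\<kappa> * r)" if r: "r \<in> {0..T}" for r
  proof (cases "r = 0")
    case True
    have "z' 0 = (LINT \<tau>|lebesgue_on {0..0}. q \<tau>)" using z'[of 0] T by simp
    also have "\<dots> = (LINT \<tau>|lebesgue. indicator {0..0} \<tau> *\<^sub>R q \<tau>)" by (simp add: integral_restrict_space)
    also have "\<dots> = 0"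
    proof (rule integral_eq_zero_AE)
      have "AE \<tau> in lebesgue. \<tau> \<noteq> (0::real)" by (simp add: AE_iff_null)
      then show "AE \<tau> in lebesgue. indicator {0..0} \<tau> *\<^sub>R q \<tau> = 0" by eventually_elim simp
    qed
    finally show ?thesis using True K m by simp
  next
    case False
    then have r0: "0 < r" "r \<le> T" using r by auto
    define k where "k = (\<lambda>\<tau>. (r - \<tau>) powr (\<alpha> - 2))"
    have kint: "integrable (lebesgue_on {0<..<r}) k" and kval: "(LINT \<tau>|lebesgue_on {0<..<r}. k \<tau>) = r powr (\<alpha> - 1) * Beta (\<alpha> - 1) 1"
    proof -
      have e: "\<tau> \<in> space (lebesgue_on {0<..<r}) \<Longrightarrow> (r - \<tau>) powr (\<alpha> - 1 - 1) * \<tau> powr (1 - 1) = k \<tau>" for \<tau>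
        by (simp add: k_def)
      show "integrable (lebesgue_on {0<..<r}) k"
        using beta_kernel_integral(1)[of "\<alpha> - 1" 1 r] a r0 by (subst (asm) Bochner_Integration.integrable_cong[OF refl e]) auto
      show "(LINT \<tau>|lebesgue_on {0<..<r}. k \<tau>) = r powr (\<alpha> - 1) * Beta (\<alpha> - 1) 1"
        using beta_kernel_integral(2)[of "\<alpha> - 1" 1 r] a r0 by (subst (asm) Bochner_Integration.integral_cong[OF refl e]) auto
    qed
    have zc: "continuous_on {0..T} (\<lambda>t. - lam * z t)" using contz by (intro continuous_intros)
    have inv: "Bt * z' r = G * (LINT \<tau>|lebesgue_on {0<..<r}. k \<tau> * (- lam * z \<tau>))"
      using abel_inversion[OF a q r0 zc eq] z'[OF r] by (simp add: G_def Bt_def k_def)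
    have "\<bar>LINT \<tau>|lebesgue_on {0<..<r}. k \<tau> * (- lam * z \<tau>)\<bar> \<le> (LINT \<tau>|lebesgue_on {0<..<r}. k \<tau> * (\<bar>lam\<bar> * (m * exp (\<kappa> * r))))"
    proof -
      have b: "\<bar>k \<tau> * (- lam * z \<tau>)\<bar> \<le> k \<tau> * (\<bar>lam\<bar> * (m * exp (\<kappa> * r)))" if "\<tau> \<in> {0<..<r}" for \<tau>
      proof -
        have "\<bar>z \<tau>\<bar> \<le> m * exp (\<kappa> * \<tau>)" using zm[of \<tau>] that r0 by auto
        also have "\<dots> \<le> m * exp (\<kappa> * r)" using m kp that by (intro mult_left_mono) auto
        finally have "k \<tau> * (\<bar>lam\<bar> * \<bar>z \<tau>\<bar>) \<le> k \<tau> * (\<bar>lam\<bar> * (m * exp (\<kappa> * r)))"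
          by (intro mult_left_mono) (auto simp: k_def)
        then show ?thesis by (simp add: abs_mult k_def)
      qed
      have "\<bar>LINT \<tau>|lebesgue_on {0<..<r}. k \<tau> * (- lam * z \<tau>)\<bar> \<le> (LINT \<tau>|lebesgue_on {0<..<r}. \<bar>k \<tau> * (- lam * z \<tau>)\<bar>)"
        by (rule integral_abs_bound)
      also have "\<dots> \<le> (LINT \<tau>|lebesgue_on {0<..<r}. k \<tau> * (\<bar>lam\<bar> * (m * exp (\<kappa> * r))))"
        by (rule integral_mono'[OF integrable_mult_left[OF kint]]) (use b m in \<open>auto simp: k_def\<close>)
      finally show ?thesis .
    qed
    also have "\<dots> = (r powr (\<alpha> - 1) * Beta (\<alpha> - 1) 1) * (\<bar>lam\<bar> * (m * exp (\<kappa> * r)))" using kval by simp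
    also have "\<dots> \<le> c * (\<bar>lam\<bar> * (m * exp (\<kappa> * r)))"
      unfolding c_def using r0 a m B1 by (intro mult_right_mono powr_mono2) auto
    finally have "G * \<bar>LINT \<tau>|lebesgue_on {0<..<r}. k \<tau> * (- lam * z \<tau>)\<bar> \<le> G * (c * (\<bar>lam\<bar> * (m * exp (\<kappa> * r))))"
      using G by (intro mult_left_mono) auto
    moreover have "Bt * \<bar>z' r\<bar> = G * \<bar>LINT \<tau>|lebesgue_on {0<..<r}. k \<tau> * (- lam * z \<tau>)\<bar>"
      using arg_cong[OF inv, of abs] G Bt by (simp add: abs_mult)
    ultimately have "Bt * \<bar>z' r\<bar> \<le> Bt * (K * m * exp (\<kappa> * r))" using Bt by (simp add: K_def mult_ac)
    then show ?thesis using Bt by simp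
  qed
  have "\<bar>z s\<bar> \<le> K * m / \<kappa> * (exp (\<kappa> * s) - 1)"
  proof -
    have s0: "0 \<le> s" "{0..s} \<subseteq> {0..T}" using s(1) by auto
    have 1: "(z' has_integral (z s - z 0)) {0..s}"
      by (rule fundamental_theorem_of_calculus[OF s0(1)])
        (use DERIV_subset[OF z s0(2)] s0(2) in \<open>auto simp: has_real_derivative_iff_has_vector_derivative[symmetric] subset_iff\<close>)
    have 2: "((\<lambda>r. K * m * exp (\<kappa> * r)) has_integral (K * m / \<kappa> * exp (\<kappa> * s) - K * m / \<kappa> * exp (\<kappa> * 0))) {0..s}"
      by (rule fundamental_theorem_of_calculus[OF s0(1)])
        (use kp in \<open>auto intro!: derivative_eq_intros simp: has_real_derivative_iff_has_vector_derivative[symmetric]\<close>)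
    have "norm (integral {0..s} z') \<le> integral {0..s} (\<lambda>r. K * m * exp (\<kappa> * r))"
      by (rule Henstock_Kurzweil_Integration.integral_norm_bound_integral) (use 1 2 zd s0 in auto)
    then show ?thesis using integral_unique[OF 1] integral_unique[OF 2] z0 by (simp add: algebra_simps)
  qed
  also have "\<dots> \<le> K * m / \<kappa> * exp (\<kappa> * s)" using K m kp by (intro mult_left_mono) auto
  finally have "m \<le> exp (- \<kappa> * s) * (K * m / \<kappa> * exp (\<kappa> * s))" unfolding m_def by (intro mult_left_mono) auto
  also have "\<dots> = K / \<kappa> * m" by (simp add: exp_minus)
  finally have "m * \<kappa> \<le> K * m" using kp by (simp add: field_simps)
  then have "m * (K + 1) \<le> 0" by (simp add: \<kappa>_def algebra_simps)
  then have "m = 0" using m K by (simp add: mult_le_0_iff)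
  then show ?thesis using zm[OF t] by simp
qed

section \<open>Spectral data of the Dirichlet Laplacian\<close>

lemma bounded_below_of_at_top:
  fixes lam :: "nat \<Rightarrow> real"
  assumes "filterlim lam at_top sequentially" "\<And>n. lam n > 0"
  shows "\<exists>c>0. \<forall>n. lam n \<ge> c"
proof -
  obtain N where N: "\<And>n. n \<ge> N \<Longrightarrow> lam n \<ge> 1"
    using assms(1) unfolding filterlim_at_top eventually_sequentially by blast
  define c where "c = Min (insert 1 (lam ` {..<N}))"
  have "c > 0" unfolding c_def using assms(2) by (subst Min_gr_iff) auto
  moreover have "lam n \<ge> c" for n
  proof (cases "n < N")
    case True
    then show ?thesis unfolding c_def by (intro Min_le) auto
  next
    case False
    have "c \<le> 1" unfolding c_def by (intro Min_le) auto
    then show ?thesis using N[of n] False by simp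
  qed
  ultimately show ?thesis by blast
qed

text \<open>Test functions are dense in \<open>L\<^sup>2\<close> because the domain of the self-adjoint operator is dense and contained in \<open>H\<^sup>1\<^sub>0\<close>. Eigenvalues are
positive since the operator is, and bounded away from zero since they tend to infinity.\<close>

lemma eigen_domain_of_hypotheses:
  fixes \<Omega> :: "'a::euclidean_space set"
  assumes "open \<Omega>" "bounded \<Omega>" and psa: "positive_selfadjoint \<Omega> (dom_A \<Omega>) (bilaplacian \<Omega>)"
    and es: "eigensystem \<Omega> (dom_A \<Omega>) (bilaplacian \<Omega>) lam e"
  shows "\<exists>c1. eigen_domain \<Omega> e lam c1"
proof -
  interpret bounded_domain \<Omega> by unfold_locales (use assms in auto)
  have dom: "u \<in> dom_A \<Omega> \<Longrightarrow> u \<in> H10 \<Omega> \<and> u \<in> L2 \<Omega>" for u by (auto simp: dom_A_def H10_def)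
  interpret dense_domain \<Omega>
  proof
    fix f and \<epsilon> :: real assume f: "f \<in> L2 \<Omega>" and e: "\<epsilon> > 0"
    define d where "d = sqrt (\<epsilon> / 4)"
    have d: "d > 0" "d\<^sup>2 = \<epsilon> / 4" using e by (simp_all add: d_def)
    obtain u where u: "u \<in> dom_A \<Omega>" "L2_norm \<Omega> (\<lambda>x. f x - u x) < d"
      using psa f d(1) unfolding positive_selfadjoint_def by blast
    obtain \<phi> where p: "\<phi> \<in> test_functions \<Omega>" "H1_norm \<Omega> (\<lambda>x. u x - \<phi> x) < d"
      using dom[OF u(1)] d(1) unfolding H10_def by blast
    have "sqrt (L2_sq \<Omega> (\<lambda>x. f x - u x)) < d" using u(2) by (simp add: L2_norm_sq)
    then have "(sqrt (L2_sq \<Omega> (\<lambda>x. f x - u x)))\<^sup>2 < d\<^sup>2" by (intro power_strict_mono) (auto simp: L2_sq_nonneg)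
    then have 1: "L2_sq \<Omega> (\<lambda>x. f x - u x) < \<epsilon> / 4" using d(2) by (simp add: L2_sq_nonneg)
    have "(H1_norm \<Omega> (\<lambda>x. u x - \<phi> x))\<^sup>2 < d\<^sup>2"
      using p(2) by (intro power_strict_mono) (auto simp: H1_norm_def intro!: L2_sq_nonneg[unfolded L2_sq_def] grad_inner_nonneg add_nonneg_nonneg)
    then have 2: "L2_sq \<Omega> (\<lambda>x. u x - \<phi> x) < \<epsilon> / 4"
      using d(2) L2_sq_nonneg[of \<Omega> "\<lambda>x. u x - \<phi> x"] grad_inner_nonneg[of "\<lambda>x. u x - \<phi> x"] by (simp add: H1_norm_def L2_sq_def)
    have uL: "u \<in> L2 \<Omega>" using dom[OF u(1)] by simp
    have "L2_sq \<Omega> (\<lambda>x. (f x - u x) + (u x - \<phi> x)) < \<epsilon>"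
      using L2_sq_add_le[OF L2_diff[OF f uL] L2_diff[OF uL test_L2[OF p(1)]]] 1 2 by linarith
    then show "\<exists>\<phi>\<in>test_functions \<Omega>. L2_sq \<Omega> (\<lambda>x. f x - \<phi> x) < \<epsilon>" using p(1) by (intro bexI[of _ \<phi>]) simp_all
  qed
  have en: "e n \<in> dom_A \<Omega>" "eq_ae \<Omega> (bilaplacian \<Omega> (e n)) (\<lambda>x. lam n * e n x)" for n
    using es by (auto simp: eigensystem_def)
  note eL = dom[OF en(1), THEN conjunct2]
  interpret orthonormal_basis \<Omega> e
    by unfold_locales (use es eL in \<open>auto simp: eigensystem_def\<close>)
  have lam: "lam n > 0" for n
  proof -
    have AL: "bilaplacian \<Omega> (e n) \<in> L2 \<Omega>" using psa en(1) by (auto simp: positive_selfadjoint_def)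
    have "L2_sq \<Omega> (e n) = 1" using orthonormal[of n n] by (simp add: L2_sq_def)
    then have "\<not> eq_ae \<Omega> (e n) (\<lambda>_. 0)" using L2_sq_zero_iff[OF eL, of n] by simp
    then have "L2_inner \<Omega> (bilaplacian \<Omega> (e n)) (e n) > 0" using psa en(1) by (auto simp: positive_selfadjoint_def)
    also have "L2_inner \<Omega> (bilaplacian \<Omega> (e n)) (e n) = L2_inner \<Omega> (\<lambda>x. lam n * e n x) (e n)"
      by (rule eq_ae_inner[OF en(2) AL L2_scale[OF eL] eL])
    also have "\<dots> = lam n" using orthonormal[of n n] by (simp add: L2_inner_scale)
    finally show ?thesis .
  qed
  obtain c1 where c1: "c1 > 0" "\<And>n. lam n \<ge> c1"
    using bounded_below_of_at_top[of lam] es lam by (auto simp: eigensystem_def)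
  have "eigen_domain \<Omega> e lam c1"
    by unfold_locales (use c1 dom[OF en(1)] eigenfunction_laplacian[OF en lam] in auto)
  then show ?thesis by blast
qed

section \<open>Function spaces as weighted sequence spaces\<close>

lemma (in hilbert_scale) Y_memI:
  assumes "f \<in> L2 \<Omega>" "\<And>n. \<bar>cf f n\<bar> \<le> k * m n" "summable (\<lambda>n. \<omega> n * (m n)\<^sup>2)"
  shows "f \<in> Y"
proof -
  have "summable (\<lambda>n. \<omega> n * (cf f n)\<^sup>2)"
  proof (rule summable_comparison_test'[OF summable_mult[OF assms(3), of "k\<^sup>2"]])
    fix n
    have "(cf f n)\<^sup>2 \<le> (k * m n)\<^sup>2" using power_mono[OF assms(2)[of n] abs_ge_zero, of 2] by simp
    then have "\<omega> n * (cf f n)\<^sup>2 \<le> \<omega> n * (k * m n)\<^sup>2" using omega_pos[of n] by (intro mult_left_mono) auto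
    then show "norm (\<omega> n * (cf f n)\<^sup>2) \<le> k\<^sup>2 * (\<omega> n * (m n)\<^sup>2)"
      using omega_pos[of n] by (simp add: abs_mult power_mult_distrib mult_ac)
  qed
  then show ?thesis using assms(1) by (simp add: Y_iff)
qed

lemma summable_weighted_bound:
  fixes c m w :: "nat \<Rightarrow> real"
  assumes "\<And>n. \<bar>c n\<bar> \<le> k * m n" "summable (\<lambda>n. w n * (m n)\<^sup>2)" "\<And>n. w n \<ge> 0"
  shows "summable (\<lambda>n. w n * (c n)\<^sup>2)"
proof (rule summable_comparison_test'[OF summable_mult[OF assms(2), of "k\<^sup>2"]])
  fix n
  have "(c n)\<^sup>2 \<le> (k * m n)\<^sup>2" using power_mono[OF assms(1)[of n] abs_ge_zero, of 2] by simp
  then have "w n * (c n)\<^sup>2 \<le> w n * (k * m n)\<^sup>2" by (rule mult_left_mono[OF _ assms(3)])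
  then show "norm (w n * (c n)\<^sup>2) \<le> k\<^sup>2 * (w n * (m n)\<^sup>2)"
    using assms(3)[of n] by (simp add: abs_mult power_mult_distrib mult_ac)
qed

lemma powr_integrable_near_0:
  assumes "e > (-1::real)" "b > 0" shows "integrable (lebesgue_on {0<..<b}) (\<lambda>t. t powr e)"
proof -
  have eq: "t \<in> space (lebesgue_on {0<..<b}) \<Longrightarrow> (b - t) powr (1 - 1) * t powr (e + 1 - 1) = t powr e" for t by simp
  show ?thesis using beta_kernel_integral(1)[of 1 "e + 1" b] assms
    by (subst (asm) Bochner_Integration.integrable_cong[OF refl eq]) auto
qed

lemma LINT_Icc_Ioo:
  fixes h :: "real \<Rightarrow> real"
  assumes "integrable (lebesgue_on {0<..<t}) h"
  shows "integrable (lebesgue_on {0..t}) h" "(LINT x|lebesgue_on {0..t}. h x) = (LINT x|lebesgue_on {0<..<t}. h x)"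
proof -
  have "h absolutely_integrable_on {0<..<t}" using assms by (simp add: set_integrable_def integrable_restrict_space)
  then have "h absolutely_integrable_on {0..t}" by (simp add: absolutely_integrable_on_Icc_iff_Ioo)
  then show i2: "integrable (lebesgue_on {0..t}) h" by (rule absolutely_integrable_imp_integrable) simp
  show "(LINT x|lebesgue_on {0..t}. h x) = (LINT x|lebesgue_on {0<..<t}. h x)"
    by (subst (1 2) lebesgue_integral_eq_integral) (use assms i2 in \<open>auto simp: integral_open_interval_real\<close>)
qed

lemma LINT_point: "(LINT x|lebesgue_on {0..0}. h x) = (0::real)" for h :: "real \<Rightarrow> real"
proof -
  have "(LINT x|lebesgue_on {0..0}. h x) = (LINT x|lebesgue. indicator {0..0} x *\<^sub>R h x)" by (simp add: integral_restrict_space)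
  also have "\<dots> = 0"
  proof (rule integral_eq_zero_AE)
    have "AE x in lebesgue. x \<noteq> (0::real)" by (simp add: AE_iff_null)
    then show "AE x in lebesgue. indicator {0..0} x *\<^sub>R h x = 0" by eventually_elim simp
  qed
  finally show ?thesis .
qed

context eigen_domain
begin

text \<open>The summand \<open>1\<close> of the weight stands for the \<open>L\<^sup>2\<close> part of the norm, \<open>sqrt (lam n)\<close> for the gradient.\<close>

sublocale H: hilbert_scale \<Omega> e "H10 \<Omega>" "H1_norm \<Omega>" "\<lambda>n. 1 + sqrt (lam n)" 1
proof
  show "1 \<le> 1 + sqrt (lam n)" for n using lam_pos[of n] by simp
  show "v \<in> H10 \<Omega> \<longleftrightarrow> v \<in> L2 \<Omega> \<and> summable (\<lambda>n. (1 + sqrt (lam n)) * (cf v n)\<^sup>2)" for v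
  proof
    assume "v \<in> H10 \<Omega>"
    then have v: "v \<in> L2 \<Omega>" "summable (\<lambda>n. sqrt (lam n) * (cf v n)\<^sup>2)" using H10_spectral by auto
    have "summable (\<lambda>n. (cf v n)\<^sup>2 + sqrt (lam n) * (cf v n)\<^sup>2)"
      using Parseval_sq[OF v(1)] v(2) by (intro summable_add) (auto simp: sums_iff)
    then show "v \<in> L2 \<Omega> \<and> summable (\<lambda>n. (1 + sqrt (lam n)) * (cf v n)\<^sup>2)" using v by (simp add: ring_distribs)
  next
    assume v: "v \<in> L2 \<Omega> \<and> summable (\<lambda>n. (1 + sqrt (lam n)) * (cf v n)\<^sup>2)"
    have "summable (\<lambda>n. sqrt (lam n) * (cf v n)\<^sup>2)"
      by (rule summable_comparison_test'[of "\<lambda>n. (1 + sqrt (lam n)) * (cf v n)\<^sup>2"])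
        (use v lam_pos in \<open>auto simp: abs_mult less_imp_le intro!: mult_right_mono\<close>)
    then show "v \<in> H10 \<Omega>" using v H10_spectral by blast
  qed
qed (auto intro: H1_norm_spectral)

lemma frac_power_spec:
  assumes "summable (\<lambda>n. (lam n powr \<theta> * cf u n)\<^sup>2)"
  shows "frac_power \<Omega> lam e \<theta> u \<in> L2 \<Omega>" "cf (frac_power \<Omega> lam e \<theta> u) n = lam n powr \<theta> * cf u n"
proof -
  have "\<exists>v. L2_sums \<Omega> (\<lambda>n x. lam n powr \<theta> * cf u n * e n x) v"
    using Riesz_Fischer[OF assms] by blast
  then have s: "L2_sums \<Omega> (\<lambda>n x. lam n powr \<theta> * cf u n * e n x) (frac_power \<Omega> lam e \<theta> u)"
    unfolding frac_power_def by (rule someI_ex)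
  then show "frac_power \<Omega> lam e \<theta> u \<in> L2 \<Omega>" by (simp add: L2_sums_iff)
  show "cf (frac_power \<Omega> lam e \<theta> u) n = lam n powr \<theta> * cf u n" by (rule L2_sums_coeff[OF s])
qed

text \<open>The space \<open>D(A\<^sup>3\<^sup>/\<^sup>4)\<close>, whose dual is the space in which \<open>u\<close> is differentiable at \<open>0\<close>.\<close>

sublocale Q: hilbert_scale \<Omega> e "dom_frac \<Omega> lam e (3/4)" "frac_norm \<Omega> lam e (3/4)" "\<lambda>n. lam n powr (3/2)" "c1 powr (3/2)"
proof
  show "0 < c1 powr (3/2)" using lam_ge by simp
  show "c1 powr (3/2) \<le> lam n powr (3/2)" for n using lam_ge by (intro powr_mono2) auto
  show Y: "v \<in> dom_frac \<Omega> lam e (3/4) \<longleftrightarrow> v \<in> L2 \<Omega> \<and> summable (\<lambda>n. lam n powr (3/2) * (cf v n)\<^sup>2)" for v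
    by (simp add: dom_frac_def)
  fix v assume "v \<in> dom_frac \<Omega> lam e (3/4)"
  then have v: "v \<in> L2 \<Omega>" "summable (\<lambda>n. lam n powr (3/2) * (cf v n)\<^sup>2)" using Y by auto
  have eq: "(lam n powr (3/4) * cf v n)\<^sup>2 = lam n powr (3/2) * (cf v n)\<^sup>2" for n
    by (simp add: power_mult_distrib power2_eq_square flip: powr_add)
  have s: "summable (\<lambda>n. (lam n powr (3/4) * cf v n)\<^sup>2)" unfolding eq by (rule v(2))
  have "(\<lambda>n. (cf (frac_power \<Omega> lam e (3/4) v) n)\<^sup>2) sums L2_sq \<Omega> (frac_power \<Omega> lam e (3/4) v)"
    by (rule Parseval_sq[OF frac_power_spec(1)[OF s]])
  then have "(\<lambda>n. lam n powr (3/2) * (cf v n)\<^sup>2) sums L2_sq \<Omega> (frac_power \<Omega> lam e (3/4) v)"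
    unfolding frac_power_spec(2)[OF s] eq .
  then show "frac_norm \<Omega> lam e (3/4) v = sqrt (\<Sum>n. lam n powr (3/2) * (cf v n)\<^sup>2)"
    by (simp add: frac_norm_def L2_norm_sq sums_iff)
qed

sublocale L: hilbert_scale \<Omega> e "L2 \<Omega>" "L2_norm \<Omega>" "\<lambda>_. 1" 1
proof
  show "v \<in> L2 \<Omega> \<longleftrightarrow> v \<in> L2 \<Omega> \<and> summable (\<lambda>n. 1 * (cf v n)\<^sup>2)" for v
    using Parseval_sq[of v] by (auto simp: sums_iff)
  show "L2_norm \<Omega> v = sqrt (\<Sum>n. 1 * (cf v n)\<^sup>2)" if "v \<in> L2 \<Omega>" for v
    using Parseval_sq[OF that] by (simp add: L2_norm_sq sums_iff)
qed auto

text \<open>Here \<open>w = A\<^sup>-\<^sup>1\<^sup>/\<^sup>2 u\<close>, that is \<open>\<Delta> w = - u\<close>.\<close>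

lemma laplacian_inverse:
  assumes u: "u \<in> L2 \<Omega>" and w: "w \<in> L2 \<Omega>" and c: "\<And>n. cf w n = cf u n / sqrt (lam n)"
  shows "laplacian \<Omega> w \<in> L2 \<Omega>" "cf (laplacian \<Omega> w) n = - cf u n"
proof -
  have uL: "(\<lambda>x. - 1 * u x) \<in> L2 \<Omega>" by (rule L2_scale[OF u])
  have wl: "has_weak_laplacian \<Omega> w (\<lambda>x. - 1 * u x)"
    unfolding has_weak_laplacian_def
  proof
    fix \<phi> assume p: "\<phi> \<in> test_functions \<Omega>"
    let ?l = "\<lambda>x. \<Sum>b\<in>Basis. pderiv_dir b (pderiv_dir b \<phi>) x"
    have "cf ?l n = - sqrt (lam n) * cf \<phi> n" for n
    proof -
      have "cf ?l n = L2_inner \<Omega> (e n) ?l" by (rule L2_inner_commute)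
      also have "\<dots> = L2_inner \<Omega> (\<lambda>x. - sqrt (lam n) * e n x) \<phi>" using e_laplacian[of n] p by (simp add: has_weak_laplacian_def)
      also have "\<dots> = - sqrt (lam n) * cf \<phi> n" unfolding L2_inner_scale(1) L2_inner_commute[of \<Omega> \<phi>] ..
      finally show ?thesis .
    qed
    then have "cf w n * cf ?l n = - 1 * (cf u n * cf \<phi> n)" for n
      using lam_pos[of n] c[of n] by simp
    then have "(\<lambda>n. - 1 * (cf u n * cf \<phi> n)) sums L2_inner \<Omega> w ?l"
      using Parseval[OF w laplace_test_L2[OF p]] by simp
    moreover have "(\<lambda>n. - 1 * (cf u n * cf \<phi> n)) sums (- 1 * L2_inner \<Omega> u \<phi>)"
      by (rule sums_mult[OF Parseval[OF u test_L2[OF p]]])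
    ultimately show "L2_inner \<Omega> w ?l = L2_inner \<Omega> (\<lambda>x. - 1 * u x) \<phi>"
      unfolding L2_inner_scale(1) using sums_unique2 by blast
  qed
  show l: "laplacian \<Omega> w \<in> L2 \<Omega>" by (rule laplacian_spec(1)[OF uL wl])
  have "cf (laplacian \<Omega> w) n = cf (\<lambda>x. - 1 * u x) n"
    by (rule eq_ae_inner[OF laplacian_eq[OF uL wl] l uL e_L2])
  then show "cf (laplacian \<Omega> w) n = - cf u n" by (simp only: L2_inner_scale(1))
qed

lemma grad_laplacian_inverse:
  assumes u: "u \<in> H10 \<Omega>" and w: "w \<in> L2 \<Omega>" and c: "\<And>n. cf w n = cf u n / sqrt (lam n)" and v: "v \<in> H10 \<Omega>"
  shows "(\<lambda>n. - sqrt (lam n) * cf u n * cf v n) sums grad_inner \<Omega> (laplacian \<Omega> w) v"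
proof -
  note l = laplacian_inverse[OF H10_L2[OF u] w c]
  have "laplacian \<Omega> w \<in> H10 \<Omega>" using l H10_spectral u by simp
  from grad_inner_spectral[OF this v] show ?thesis by (simp add: l(2) mult_ac)
qed

lemma dual_series_diff_scale:
  assumes "summable (\<lambda>n. \<bar>c n * cf v n\<bar>)"
  shows "H.dual_series (\<lambda>n. k * c n) v = k * H.dual_series c v"
    and "summable (\<lambda>n. \<bar>d n * cf v n\<bar>) \<Longrightarrow> H.dual_series (\<lambda>n. c n - d n) v = H.dual_series c v - H.dual_series d v"
proof -
  note s = summable_rabs_cancel
  show "H.dual_series (\<lambda>n. k * c n) v = k * H.dual_series c v"
    unfolding H.dual_series_def using suminf_mult[OF s[OF assms], of k] by (simp add: mult.assoc)
  show "H.dual_series (\<lambda>n. c n - d n) v = H.dual_series c v - H.dual_series d v" if "summable (\<lambda>n. \<bar>d n * cf v n\<bar>)"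
    unfolding H.dual_series_def using suminf_diff[OF s[OF assms] s[OF that]] by (simp add: ring_distribs)
qed

end

section \<open>Coefficients of the solution and their bounds\<close>

locale wave_problem = eigen_domain \<Omega> e lam c1
  for \<Omega> :: "'a::euclidean_space set" and e lam c1 +
  fixes \<alpha> T :: real and u0 :: "'a \<Rightarrow> real" and u1 :: "('a \<Rightarrow> real) \<Rightarrow> real"
  assumes alpha: "1 < \<alpha>" "\<alpha> < 2" and T: "T > 0" and u0: "u0 \<in> H10 \<Omega>" and u1: "u1 \<in> Hm1 \<Omega>"
begin

text \<open>One majorant for all estimates. That \<open>u0\<close> is in \<open>H\<^sup>1\<^sub>0\<close> and \<open>u1\<close> in \<open>H\<^sup>-\<^sup>1\<close> says exactly that the squares of \<open>mode_size n\<close> are summable with the weights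
\<open>1 / sqrt (lam n)\<close>.\<close>

definition mode_size :: "nat \<Rightarrow> real" where "mode_size n = sqrt (lam n) * \<bar>cf u0 n\<bar> + \<bar>u1 (e n)\<bar>"

text \<open>The coefficients of \<open>u\<close>, of \<open>w\<^sub>t\<close> and of \<open>w\<^sub>t\<^sub>t\<close>, where \<open>w = A\<^sup>-\<^sup>1\<^sup>/\<^sup>2 u\<close> has the coefficients \<open>u_mode n t / sqrt (lam n)\<close>.\<close>

definition u_mode :: "nat \<Rightarrow> real \<Rightarrow> real" where
  "u_mode n t = cf u0 n * mittag_leffler \<alpha> 1 (- lam n * t powr \<alpha>) + u1 (e n) * t * mittag_leffler \<alpha> 2 (- lam n * t powr \<alpha>)"
definition wt_mode :: "nat \<Rightarrow> real \<Rightarrow> real" where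
  "wt_mode n t = - sqrt (lam n) * cf u0 n * ml_kernel \<alpha> (lam n) \<alpha> t + u1 (e n) / sqrt (lam n) * mittag_leffler \<alpha> 1 (- lam n * t powr \<alpha>)"
definition wtt_mode :: "nat \<Rightarrow> real \<Rightarrow> real" where
  "wtt_mode n t = - sqrt (lam n) * (cf u0 n * ml_kernel \<alpha> (lam n) (\<alpha> - 1) t + u1 (e n) * ml_kernel \<alpha> (lam n) \<alpha> t)"

lemma sqrt_lam: "sqrt (lam n) > 0" "sqrt (lam n) * sqrt (lam n) = lam n" "(sqrt (lam n))\<^sup>2 = lam n"
  using lam_pos[of n] by auto

lemma mode_size_nonneg: "mode_size n \<ge> 0" using sqrt_lam(1)[of n] by (simp add: mode_size_def)

lemma u1_dual: "u1 \<in> dual (H10 \<Omega>) (H1_norm \<Omega>)" using u1 by (simp add: Hm1_def)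

lemma mode_size_summable: "summable (\<lambda>n. 1 / sqrt (lam n) * (mode_size n)\<^sup>2)"
proof -
  define K where "K = 1 + 1 / sqrt c1"
  have sb: "summable (\<lambda>n. K * (1 / (1 + sqrt (lam n)) * (u1 (e n))\<^sup>2))" by (intro summable_mult H.dual_summable u1_dual)
  have sa: "summable (\<lambda>n. sqrt (lam n) * (cf u0 n)\<^sup>2)" using u0 H10_spectral by simp
  show ?thesis
  proof (rule summable_comparison_test'[OF summable_add[OF summable_mult[OF sa, of 2] summable_mult[OF sb, of 2]]])
    fix n
    define l where "l = sqrt (lam n)"
    have l: "l > 0" "l \<ge> sqrt c1" using sqrt_lam(1)[of n] lam_ge(2)[of n] by (simp_all add: l_def)
    have "1 / l \<le> 1 / sqrt c1" using l lam_ge(1) by (intro divide_left_mono) auto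
    then have "(1 + l) / l \<le> K" using l by (simp add: K_def add_divide_distrib)
    then have k: "1 / l \<le> K * (1 / (1 + l))" using l by (simp add: field_simps)
    define x where "x = l * \<bar>cf u0 n\<bar>"
    define y where "y = \<bar>u1 (e n)\<bar>"
    have "(mode_size n)\<^sup>2 = (x + y)\<^sup>2" by (simp add: mode_size_def l_def x_def y_def)
    also have "\<dots> \<le> 2 * x\<^sup>2 + 2 * y\<^sup>2" using zero_le_power2[of "x - y"] by (simp add: power2_sum power2_diff)
    finally have "1 / l * (mode_size n)\<^sup>2 \<le> 1 / l * (2 * x\<^sup>2 + 2 * y\<^sup>2)" using l by (intro mult_left_mono) auto
    also have "\<dots> = 2 * (x\<^sup>2 / l) + 2 * (1 / l * y\<^sup>2)" by (simp add: ring_distribs)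
    also have "x\<^sup>2 / l = l * (cf u0 n)\<^sup>2" using l by (simp add: x_def power2_eq_square)
    also have "2 * (l * (cf u0 n)\<^sup>2) + 2 * (1 / l * y\<^sup>2) \<le> 2 * (l * (cf u0 n)\<^sup>2) + 2 * (K * (1 / (1 + l)) * y\<^sup>2)"
      by (intro add_mono mult_left_mono mult_right_mono k) auto
    finally show "norm (1 / sqrt (lam n) * (mode_size n)\<^sup>2) \<le> 2 * (sqrt (lam n) * (cf u0 n)\<^sup>2) + 2 * (K * (1 / (1 + sqrt (lam n)) * (u1 (e n))\<^sup>2))"
      using l by (simp add: l_def[symmetric] y_def mult.assoc)
  qed
qed

lemma mode_size_summable_weight:
  assumes "\<And>n. w n \<ge> 0" "\<And>n. w n \<le> k / sqrt (lam n)" shows "summable (\<lambda>n. w n * (mode_size n)\<^sup>2)"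
proof (rule summable_comparison_test'[OF summable_mult[OF mode_size_summable, of k]])
  fix n
  have "w n * (mode_size n)\<^sup>2 \<le> k / sqrt (lam n) * (mode_size n)\<^sup>2" by (intro mult_right_mono assms) auto
  then show "norm (w n * (mode_size n)\<^sup>2) \<le> k * (1 / sqrt (lam n) * (mode_size n)\<^sup>2)" using assms(1)[of n] by (simp add: abs_mult)
qed

text \<open>The majorant in the norms of \<open>H\<^sup>1\<^sub>0\<close> and, below, of \<open>H\<^sup>-\<^sup>1\<close>, \<open>L\<^sup>2\<close>, \<open>D(A\<^sup>3\<^sup>/\<^sup>4)\<close> and the dual of \<open>D(A\<^sup>3\<^sup>/\<^sup>4)\<close>, each time with the power of the eigenvalue that
makes the weighted sum comparable to that of \<open>mode_size\<close>.\<close>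

lemma summable_H: "summable (\<lambda>n. (1 + sqrt (lam n)) * (mode_size n / sqrt (lam n))\<^sup>2)"
proof -
  have "summable (\<lambda>n. (1 + sqrt (lam n)) / lam n * (mode_size n)\<^sup>2)"
  proof (rule mode_size_summable_weight)
    show "0 \<le> (1 + sqrt (lam n)) / lam n" for n using lam_pos[of n] by simp
    show "(1 + sqrt (lam n)) / lam n \<le> (1 + 1 / sqrt c1) / sqrt (lam n)" for n
    proof -
      have "1 / sqrt (lam n) \<le> 1 / sqrt c1" using lam_ge lam_pos[of n] by (intro divide_left_mono) auto
      then have "(1 / sqrt (lam n) + 1) / sqrt (lam n) \<le> (1 + 1 / sqrt c1) / sqrt (lam n)"
        using sqrt_lam(1)[of n] by (intro divide_right_mono) auto
      moreover have "(1 / sqrt (lam n) + 1) / sqrt (lam n) = (1 + sqrt (lam n)) / lam n"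
        using sqrt_lam[of n] lam_pos[of n] by (simp add: field_simps)
      ultimately show ?thesis by simp
    qed
  qed
  then show ?thesis using sqrt_lam(3) by (simp add: power_divide)
qed

lemma summable_D: "summable (\<lambda>n. 1 / (1 + sqrt (lam n)) * (mode_size n)\<^sup>2)"
  by (rule mode_size_summable_weight[of _ 1]) (use sqrt_lam(1) lam_pos in \<open>auto simp: less_imp_le intro!: divide_left_mono mult_pos_pos add_pos_pos\<close>)

lemma summable_L: "summable (\<lambda>n. 1 * (mode_size n / lam n powr (1/4))\<^sup>2)"
proof -
  have "(lam n powr (1/4))\<^sup>2 = sqrt (lam n)" for n
    using lam_pos[of n] by (simp add: power2_eq_square powr_half_sqrt flip: powr_add)
  then show ?thesis using mode_size_summable by (simp add: power_divide)
qed

lemma powr_32: "lam n powr (3/2) = lam n * sqrt (lam n)"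
proof -
  have "lam n powr (3/2) = lam n powr (1 + 1/2)" by simp
  also have "\<dots> = lam n * sqrt (lam n)" using lam_pos[of n] by (simp only: powr_add) (simp add: powr_half_sqrt)
  finally show ?thesis .
qed

lemma summable_Q: "summable (\<lambda>n. lam n powr (3/2) * (mode_size n / lam n)\<^sup>2)"
proof -
  have "lam n powr (3/2) * (mode_size n / lam n)\<^sup>2 = 1 / sqrt (lam n) * (mode_size n)\<^sup>2" for n
  proof -
    define l where "l = sqrt (lam n)"
    have l: "l > 0" "lam n = l * l" using sqrt_lam[of n] by (simp_all add: l_def)
    have p: "lam n powr (3/2) = l * l * l" using l(2) by (simp only: powr_32 l_def)
    show ?thesis unfolding p unfolding l_def[symmetric] unfolding l(2) using l(1) by (simp add: power2_eq_square)
  qed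
  then show ?thesis using mode_size_summable by simp
qed

lemma summable_R: "summable (\<lambda>n. 1 / lam n powr (3/2) * (sqrt (lam n) * mode_size n)\<^sup>2)"
proof -
  have "1 / lam n powr (3/2) * (sqrt (lam n) * mode_size n)\<^sup>2 = 1 / sqrt (lam n) * (mode_size n)\<^sup>2" for n
    unfolding powr_32 using sqrt_lam(3)[of n] lam_pos[of n] by (simp add: power_mult_distrib)
  then show ?thesis using mode_size_summable by simp
qed

lemma ml_kernel_bounds:
  "\<exists>C\<ge>1. \<forall>\<beta>\<in>{1, 2, \<alpha>, \<alpha> - 1}. \<forall>\<gamma>\<in>{0..1}. \<forall>n. \<forall>t>0. lam n powr \<gamma> * \<bar>ml_kernel \<alpha> (lam n) \<beta> t\<bar> \<le> C * t powr (\<beta> - 1 - \<alpha> * \<gamma>)"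
proof -
  have "\<forall>\<beta>\<in>{1, 2, \<alpha>, \<alpha> - 1}. \<exists>C>0. \<forall>\<gamma>\<in>{0..1}. \<forall>lam>0. \<forall>t>0. lam powr \<gamma> * \<bar>ml_kernel \<alpha> lam \<beta> t\<bar> \<le> C * t powr (\<beta> - 1 - \<alpha> * \<gamma>)"
    by (intro ballI ml_kernel_bound) (use alpha in auto)
  then obtain C where C: "\<And>\<beta>. \<beta> \<in> {1, 2, \<alpha>, \<alpha> - 1} \<Longrightarrow> C \<beta> > 0"
    "\<And>\<beta> \<gamma> l t. \<beta> \<in> {1, 2, \<alpha>, \<alpha> - 1} \<Longrightarrow> \<gamma> \<in> {0..1} \<Longrightarrow> l > 0 \<Longrightarrow> t > 0 \<Longrightarrow> l powr \<gamma> * \<bar>ml_kernel \<alpha> l \<beta> t\<bar> \<le> C \<beta> * t powr (\<beta> - 1 - \<alpha> * \<gamma>)"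
    by metis
  define D where "D = 1 + C 1 + C 2 + C \<alpha> + C (\<alpha> - 1)"
  have pos: "C 1 > 0" "C 2 > 0" "C \<alpha> > 0" "C (\<alpha> - 1) > 0" using C(1) by auto
  have le: "C \<beta> \<le> D" if "\<beta> \<in> {1, 2, \<alpha>, \<alpha> - 1}" for \<beta> using that pos by (auto simp: D_def)
  have "l powr \<gamma> * \<bar>ml_kernel \<alpha> l \<beta> t\<bar> \<le> D * t powr (\<beta> - 1 - \<alpha> * \<gamma>)"
    if "\<beta> \<in> {1, 2, \<alpha>, \<alpha> - 1}" "\<gamma> \<in> {0..1}" "l > 0" "t > 0" for \<beta> \<gamma> l t
  proof -
    note C(2)[OF that]
    also have "C \<beta> * t powr (\<beta> - 1 - \<alpha> * \<gamma>) \<le> D * t powr (\<beta> - 1 - \<alpha> * \<gamma>)"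
      by (rule mult_right_mono[OF le[OF that(1)]]) simp
    finally show ?thesis .
  qed
  note D = this
  show ?thesis
  proof (intro exI[of _ D] conjI ballI allI impI)
    show "D \<ge> 1" using pos by (simp add: D_def)
  qed (rule D, assumption+, rule lam_pos, assumption)
qed

definition ml_const :: real where
  "ml_const = (SOME C. C \<ge> 1 \<and> (\<forall>\<beta>\<in>{1, 2, \<alpha>, \<alpha> - 1}. \<forall>\<gamma>\<in>{0..1}. \<forall>n. \<forall>t>0. lam n powr \<gamma> * \<bar>ml_kernel \<alpha> (lam n) \<beta> t\<bar> \<le> C * t powr (\<beta> - 1 - \<alpha> * \<gamma>)))"

lemma ml_const: "ml_const \<ge> 1" "\<beta> \<in> {1, 2, \<alpha>, \<alpha> - 1} \<Longrightarrow> \<gamma> \<in> {0..1} \<Longrightarrow> t > 0 \<Longrightarrow> lam n powr \<gamma> * \<bar>ml_kernel \<alpha> (lam n) \<beta> t\<bar> \<le> ml_const * t powr (\<beta> - 1 - \<alpha> * \<gamma>)"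
proof -
  have "ml_const \<ge> 1 \<and> (\<forall>\<beta>\<in>{1, 2, \<alpha>, \<alpha> - 1}. \<forall>\<gamma>\<in>{0..1}. \<forall>n. \<forall>t>0. lam n powr \<gamma> * \<bar>ml_kernel \<alpha> (lam n) \<beta> t\<bar> \<le> ml_const * t powr (\<beta> - 1 - \<alpha> * \<gamma>))"
    unfolding ml_const_def by (rule someI_ex) (use ml_kernel_bounds in blast)
  then show "ml_const \<ge> 1" "\<beta> \<in> {1, 2, \<alpha>, \<alpha> - 1} \<Longrightarrow> \<gamma> \<in> {0..1} \<Longrightarrow> t > 0 \<Longrightarrow> lam n powr \<gamma> * \<bar>ml_kernel \<alpha> (lam n) \<beta> t\<bar> \<le> ml_const * t powr (\<beta> - 1 - \<alpha> * \<gamma>)" by blast+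
qed

text \<open>The instances \<open>\<gamma> = 0, 1/4, 1/2, 3/4\<close> of the kernel bound that the norms involved call for.\<close>

lemma basic_bounds:
  assumes "t > 0"
  shows "\<bar>ml_kernel \<alpha> (lam n) 1 t\<bar> \<le> ml_const"
    and "sqrt (lam n) * \<bar>ml_kernel \<alpha> (lam n) 2 t\<bar> \<le> ml_const * t powr (1 - \<alpha> / 2)"
    and "lam n powr (1/4) * \<bar>ml_kernel \<alpha> (lam n) 1 t\<bar> \<le> ml_const * t powr (- \<alpha> / 4)"
    and "lam n powr (3/4) * \<bar>ml_kernel \<alpha> (lam n) 2 t\<bar> \<le> ml_const * t powr (1 - 3 * \<alpha> / 4)"
    and "\<bar>ml_kernel \<alpha> (lam n) \<alpha> t\<bar> \<le> ml_const * t powr (\<alpha> - 1)"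
    and "sqrt (lam n) * \<bar>ml_kernel \<alpha> (lam n) \<alpha> t\<bar> \<le> ml_const * t powr (\<alpha> / 2 - 1)"
    and "\<bar>ml_kernel \<alpha> (lam n) (\<alpha> - 1) t\<bar> \<le> ml_const * t powr (\<alpha> - 2)"
proof -
  have p: "lam n powr 0 = 1" "lam n powr (1/2) = sqrt (lam n)" using lam_pos[of n] by (simp_all add: powr_half_sqrt)
  show "\<bar>ml_kernel \<alpha> (lam n) 1 t\<bar> \<le> ml_const" using ml_const(2)[of 1 0 t n] p assms by simp
  show "sqrt (lam n) * \<bar>ml_kernel \<alpha> (lam n) 2 t\<bar> \<le> ml_const * t powr (1 - \<alpha> / 2)" using ml_const(2)[of 2 "1/2" t n] p assms by simp
  show "lam n powr (1/4) * \<bar>ml_kernel \<alpha> (lam n) 1 t\<bar> \<le> ml_const * t powr (- \<alpha> / 4)" using ml_const(2)[of 1 "1/4" t n] assms by simp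
  show "lam n powr (3/4) * \<bar>ml_kernel \<alpha> (lam n) 2 t\<bar> \<le> ml_const * t powr (1 - 3 * \<alpha> / 4)" using ml_const(2)[of 2 "3/4" t n] assms by (simp add: mult.commute)
  show "\<bar>ml_kernel \<alpha> (lam n) \<alpha> t\<bar> \<le> ml_const * t powr (\<alpha> - 1)" using ml_const(2)[of \<alpha> 0 t n] p assms by simp
  have h: "\<alpha> - 1 - \<alpha> * (1/2) = \<alpha> / 2 - 1" by simp
  show "sqrt (lam n) * \<bar>ml_kernel \<alpha> (lam n) \<alpha> t\<bar> \<le> ml_const * t powr (\<alpha> / 2 - 1)" using ml_const(2)[of \<alpha> "1/2" t n, unfolded h p(2)] assms by simp
  show "\<bar>ml_kernel \<alpha> (lam n) (\<alpha> - 1) t\<bar> \<le> ml_const * t powr (\<alpha> - 2)" using ml_const(2)[of "\<alpha> - 1" 0 t n] p assms by simp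
qed

lemma u_mode_0: "u_mode n 0 = cf u0 n" and wt_mode_0: "wt_mode n 0 = u1 (e n) / sqrt (lam n)"
  using alpha mittag_leffler_0[of 1 \<alpha>] by (simp_all add: u_mode_def wt_mode_def ml_kernel_def)

lemma u_mode_ml_kernel: "t > 0 \<Longrightarrow> u_mode n t = cf u0 n * ml_kernel \<alpha> (lam n) 1 t + u1 (e n) * ml_kernel \<alpha> (lam n) 2 t"
  by (simp add: u_mode_def ml_kernel_1 ml_kernel_2 mult.assoc)

lemma wt_mode_ml_kernel: "t > 0 \<Longrightarrow> wt_mode n t = - sqrt (lam n) * cf u0 n * ml_kernel \<alpha> (lam n) \<alpha> t + u1 (e n) / sqrt (lam n) * ml_kernel \<alpha> (lam n) 1 t"
  by (simp add: wt_mode_def ml_kernel_1)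

lemma combine_bound:
  fixes p q x y x' y' K :: real
  assumes "\<bar>x\<bar> \<le> K * x'" "\<bar>y\<bar> \<le> K * y'" shows "\<bar>x + y\<bar> \<le> K * (x' + y')"
  using assms by (simp add: ring_distribs)

lemma mode_size_div_sqrt: "mode_size n / sqrt (lam n) = \<bar>cf u0 n\<bar> + \<bar>u1 (e n)\<bar> / sqrt (lam n)"
  using sqrt_lam(1)[of n] by (simp add: mode_size_def add_divide_distrib)

lemma u_mode_bound: "\<exists>K\<ge>0. \<forall>n. \<forall>t\<in>{0..T}. \<bar>u_mode n t\<bar> \<le> K * (mode_size n / sqrt (lam n))"
proof (intro exI conjI allI ballI)
  let ?K = "ml_const * (1 + T powr (1 - \<alpha> / 2))"
  show "?K \<ge> 0" using ml_const(1) by simp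
  fix n t assume t: "t \<in> {0..T}"
  have C: "ml_const \<le> ?K" "ml_const * T powr (1 - \<alpha> / 2) \<le> ?K" "1 \<le> ?K" using ml_const(1) by (simp_all add: ring_distribs add_increasing2)
  show "\<bar>u_mode n t\<bar> \<le> ?K * (mode_size n / sqrt (lam n))"
  proof (cases "t = 0")
    case True
    have "\<bar>cf u0 n\<bar> + 0 \<le> 1 * (\<bar>cf u0 n\<bar> + \<bar>u1 (e n)\<bar> / sqrt (lam n))" using sqrt_lam(1)[of n] by simp
    also have "\<dots> \<le> ?K * (\<bar>cf u0 n\<bar> + \<bar>u1 (e n)\<bar> / sqrt (lam n))" using C sqrt_lam(1)[of n] by (intro mult_right_mono) auto
    finally show ?thesis using True by (simp add: u_mode_0 mode_size_div_sqrt)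
  next
    case False
    then have t0: "t > 0" using t by simp
    have "\<bar>cf u0 n * ml_kernel \<alpha> (lam n) 1 t + u1 (e n) * ml_kernel \<alpha> (lam n) 2 t\<bar> \<le> ?K * (\<bar>cf u0 n\<bar> + \<bar>u1 (e n)\<bar> / sqrt (lam n))"
    proof (rule combine_bound)
      have "\<bar>ml_kernel \<alpha> (lam n) 1 t\<bar> \<le> ?K" using basic_bounds(1)[OF t0, of n] C by linarith
      then show "\<bar>cf u0 n * ml_kernel \<alpha> (lam n) 1 t\<bar> \<le> ?K * \<bar>cf u0 n\<bar>"
        unfolding abs_mult mult.commute[of ?K] by (rule mult_left_mono) simp
      have "t powr (1 - \<alpha> / 2) \<le> T powr (1 - \<alpha> / 2)" using t t0 alpha by (intro powr_mono2) auto
      then have "ml_const * t powr (1 - \<alpha> / 2) \<le> ml_const * T powr (1 - \<alpha> / 2)" using ml_const(1) by (intro mult_left_mono) auto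
      then have "sqrt (lam n) * \<bar>ml_kernel \<alpha> (lam n) 2 t\<bar> \<le> ?K" using basic_bounds(2)[OF t0, of n] C by linarith
      then have "\<bar>ml_kernel \<alpha> (lam n) 2 t\<bar> \<le> ?K / sqrt (lam n)" using sqrt_lam(1)[of n] by (simp add: pos_le_divide_eq mult.commute)
      then have "\<bar>u1 (e n)\<bar> * \<bar>ml_kernel \<alpha> (lam n) 2 t\<bar> \<le> \<bar>u1 (e n)\<bar> * (?K / sqrt (lam n))" by (rule mult_left_mono) simp
      then show "\<bar>u1 (e n) * ml_kernel \<alpha> (lam n) 2 t\<bar> \<le> ?K * (\<bar>u1 (e n)\<bar> / sqrt (lam n))" by (simp add: abs_mult mult.commute)
    qed
    then show ?thesis using u_mode_ml_kernel[OF t0] by (simp add: mode_size_div_sqrt)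
  qed
qed

lemma wt_mode_bound: "\<exists>K\<ge>0. \<forall>n. \<forall>t\<in>{0..T}. \<bar>wt_mode n t\<bar> \<le> K * mode_size n"
proof (intro exI conjI allI ballI)
  let ?K = "ml_const * (T powr (\<alpha> - 1) + 1 / sqrt c1)"
  have c1: "1 / sqrt c1 > 0" using lam_ge by simp
  show "?K \<ge> 0" using ml_const(1) c1 by simp
  fix n t assume t: "t \<in> {0..T}"
  have C: "ml_const * T powr (\<alpha> - 1) \<le> ?K" "ml_const * (1 / sqrt c1) \<le> ?K" using ml_const(1) c1 by (simp_all add: ring_distribs)
  have r: "1 / sqrt (lam n) \<le> 1 / sqrt c1" using lam_ge lam_pos[of n] by (intro divide_left_mono) auto
  have ml: "\<bar>mittag_leffler \<alpha> 1 (- lam n * t powr \<alpha>)\<bar> \<le> ml_const"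
  proof (cases "t = 0")
    case True
    then show ?thesis using alpha ml_const(1) mittag_leffler_0[of 1 \<alpha>] by simp
  next
    case False
    then show ?thesis using basic_bounds(1)[of t n] ml_kernel_1[of t \<alpha> "lam n"] t by simp
  qed
  have mf: "\<bar>ml_kernel \<alpha> (lam n) \<alpha> t\<bar> \<le> ml_const * T powr (\<alpha> - 1)"
  proof (cases "t = 0")
    case True
    then show ?thesis using ml_const(1) by (simp add: ml_kernel_def)
  next
    case False
    then have t0: "t > 0" using t by simp
    have "t powr (\<alpha> - 1) \<le> T powr (\<alpha> - 1)" using t t0 alpha by (intro powr_mono2) auto
    then have "ml_const * t powr (\<alpha> - 1) \<le> ml_const * T powr (\<alpha> - 1)" using ml_const(1) by (intro mult_left_mono) auto
    then show ?thesis using basic_bounds(5)[OF t0, of n] by linarith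
  qed
  show "\<bar>wt_mode n t\<bar> \<le> ?K * mode_size n"
    unfolding wt_mode_def mode_size_def
  proof (rule combine_bound)
    have "sqrt (lam n) * \<bar>cf u0 n\<bar> * \<bar>ml_kernel \<alpha> (lam n) \<alpha> t\<bar> \<le> sqrt (lam n) * \<bar>cf u0 n\<bar> * ?K"
      using mf C(1) sqrt_lam(1)[of n] by (intro mult_left_mono) auto
    then show "\<bar>- sqrt (lam n) * cf u0 n * ml_kernel \<alpha> (lam n) \<alpha> t\<bar> \<le> ?K * (sqrt (lam n) * \<bar>cf u0 n\<bar>)"
      using sqrt_lam(1)[of n] by (simp add: abs_mult mult.commute)
    have "1 / sqrt (lam n) * \<bar>mittag_leffler \<alpha> 1 (- lam n * t powr \<alpha>)\<bar> \<le> 1 / sqrt c1 * ml_const"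
      using r ml c1 by (intro mult_mono) auto
    then have "1 / sqrt (lam n) * \<bar>mittag_leffler \<alpha> 1 (- lam n * t powr \<alpha>)\<bar> \<le> ?K" using C(2) by (simp add: mult.commute)
    then have "\<bar>u1 (e n)\<bar> * (1 / sqrt (lam n) * \<bar>mittag_leffler \<alpha> 1 (- lam n * t powr \<alpha>)\<bar>) \<le> \<bar>u1 (e n)\<bar> * ?K"
      by (rule mult_left_mono) simp
    then show "\<bar>u1 (e n) / sqrt (lam n) * mittag_leffler \<alpha> 1 (- lam n * t powr \<alpha>)\<bar> \<le> ?K * \<bar>u1 (e n)\<bar>"
      using sqrt_lam(1)[of n] by (simp add: abs_mult mult.commute)
  qed
qed

text \<open>In \<open>H\<^sup>1\<^sub>0\<close> the derivative \<open>w\<^sub>t\<close> is only square integrable in time: the exponent \<open>\<alpha>/2 - 1\<close> is negative but greater than \<open>-1/2\<close>.\<close>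

lemma wt_mode_bound_H1:
  assumes "t \<in> {0<..<T}" shows "\<bar>wt_mode n t\<bar> \<le> (ml_const * (t powr (\<alpha> / 2 - 1) + 1)) * (mode_size n / sqrt (lam n))"
proof -
  let ?K = "ml_const * (t powr (\<alpha> / 2 - 1) + 1)"
  have t0: "t > 0" using assms by simp
  have C: "ml_const * t powr (\<alpha> / 2 - 1) \<le> ?K" "ml_const \<le> ?K" using ml_const(1) by (simp_all add: ring_distribs)
  show ?thesis unfolding wt_mode_ml_kernel[OF t0] mode_size_div_sqrt
  proof (rule combine_bound)
    have "\<bar>cf u0 n\<bar> * (sqrt (lam n) * \<bar>ml_kernel \<alpha> (lam n) \<alpha> t\<bar>) \<le> \<bar>cf u0 n\<bar> * ?K"
      using basic_bounds(6)[OF t0, of n] C(1) by (intro mult_left_mono) auto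
    then show "\<bar>- sqrt (lam n) * cf u0 n * ml_kernel \<alpha> (lam n) \<alpha> t\<bar> \<le> ?K * \<bar>cf u0 n\<bar>"
      using sqrt_lam(1)[of n] by (simp add: abs_mult mult_ac)
    have "\<bar>u1 (e n)\<bar> / sqrt (lam n) * \<bar>ml_kernel \<alpha> (lam n) 1 t\<bar> \<le> \<bar>u1 (e n)\<bar> / sqrt (lam n) * ?K"
      using basic_bounds(1)[OF t0, of n] C(2) sqrt_lam(1)[of n] by (intro mult_left_mono) auto
    then show "\<bar>u1 (e n) / sqrt (lam n) * ml_kernel \<alpha> (lam n) 1 t\<bar> \<le> ?K * (\<bar>u1 (e n)\<bar> / sqrt (lam n))"
      using sqrt_lam(1)[of n] by (simp add: abs_mult mult.commute)
  qed
qed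

text \<open>The function bounded here is the coefficient of the Caputo derivative of \<open>w\<close>, and the two exponents are greater than \<open>-1/2\<close>.\<close>

lemma u_mode_bound_L2:
  assumes "t \<in> {0<..<T}" 
  shows "\<bar>- sqrt (lam n) * u_mode n t\<bar> \<le> (ml_const * (t powr (- \<alpha> / 4) + t powr (1 - 3 * \<alpha> / 4))) * (mode_size n / lam n powr (1/4))"
proof -
  let ?K = "ml_const * (t powr (- \<alpha> / 4) + t powr (1 - 3 * \<alpha> / 4))"
  have t0: "t > 0" using assms by simp
  have C: "ml_const * t powr (- \<alpha> / 4) \<le> ?K" "ml_const * t powr (1 - 3 * \<alpha> / 4) \<le> ?K" using ml_const(1) by (simp_all add: ring_distribs)
  define r where "r = lam n powr (1/4)"
  have r: "r > 0" using lam_pos[of n] by (simp add: r_def)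
  have r3: "lam n powr (3/4) = sqrt (lam n) * r"
  proof -
    have "lam n powr (3/4) = lam n powr (1/2 + 1/4)" by simp
    also have "\<dots> = sqrt (lam n) * r" using lam_pos[of n] by (simp only: powr_add) (simp add: powr_half_sqrt r_def)
    finally show ?thesis .
  qed
  have eq: "- sqrt (lam n) * u_mode n t = - sqrt (lam n) * cf u0 n * ml_kernel \<alpha> (lam n) 1 t + - sqrt (lam n) * u1 (e n) * ml_kernel \<alpha> (lam n) 2 t"
    unfolding u_mode_ml_kernel[OF t0] by (simp add: algebra_simps)
  have md: "mode_size n / r = sqrt (lam n) * \<bar>cf u0 n\<bar> / r + \<bar>u1 (e n)\<bar> / r" by (simp add: mode_size_def add_divide_distrib)
  show ?thesis unfolding eq r_def[symmetric] md
  proof (rule combine_bound)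
    have "r * \<bar>ml_kernel \<alpha> (lam n) 1 t\<bar> \<le> ?K" using basic_bounds(3)[OF t0, of n] C(1) by (simp add: r_def)
    then have "sqrt (lam n) * \<bar>cf u0 n\<bar> / r * (r * \<bar>ml_kernel \<alpha> (lam n) 1 t\<bar>) \<le> sqrt (lam n) * \<bar>cf u0 n\<bar> / r * ?K"
      using sqrt_lam(1)[of n] r by (intro mult_left_mono) auto
    then show "\<bar>- sqrt (lam n) * cf u0 n * ml_kernel \<alpha> (lam n) 1 t\<bar> \<le> ?K * (sqrt (lam n) * \<bar>cf u0 n\<bar> / r)"
      using sqrt_lam(1)[of n] r by (simp add: abs_mult mult.commute)
    have "sqrt (lam n) * r * \<bar>ml_kernel \<alpha> (lam n) 2 t\<bar> \<le> ?K" using basic_bounds(4)[OF t0, of n] C(2) unfolding r3 by linarith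
    then have "\<bar>u1 (e n)\<bar> / r * (sqrt (lam n) * r * \<bar>ml_kernel \<alpha> (lam n) 2 t\<bar>) \<le> \<bar>u1 (e n)\<bar> / r * ?K"
      using r by (intro mult_left_mono) auto
    then show "\<bar>- sqrt (lam n) * u1 (e n) * ml_kernel \<alpha> (lam n) 2 t\<bar> \<le> ?K * (\<bar>u1 (e n)\<bar> / r)"
      using sqrt_lam(1)[of n] r by (simp add: abs_mult mult_ac)
  qed
qed

lemma wtt_mode_bound:
  assumes "t > 0" shows "\<bar>wtt_mode n t\<bar> \<le> (ml_const * (t powr (\<alpha> - 2) + t powr (\<alpha> / 2 - 1))) * mode_size n"
proof -
  let ?K = "ml_const * (t powr (\<alpha> - 2) + t powr (\<alpha> / 2 - 1))"
  have C: "ml_const * t powr (\<alpha> - 2) \<le> ?K" "ml_const * t powr (\<alpha> / 2 - 1) \<le> ?K" using ml_const(1) by (simp_all add: ring_distribs)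
  have eq: "wtt_mode n t = - sqrt (lam n) * cf u0 n * ml_kernel \<alpha> (lam n) (\<alpha> - 1) t + - sqrt (lam n) * u1 (e n) * ml_kernel \<alpha> (lam n) \<alpha> t"
    by (simp add: wtt_mode_def algebra_simps)
  show ?thesis unfolding eq mode_size_def
  proof (rule combine_bound)
    have "sqrt (lam n) * \<bar>cf u0 n\<bar> * \<bar>ml_kernel \<alpha> (lam n) (\<alpha> - 1) t\<bar> \<le> sqrt (lam n) * \<bar>cf u0 n\<bar> * ?K"
      using basic_bounds(7)[OF assms, of n] C(1) sqrt_lam(1)[of n] by (intro mult_left_mono) auto
    then show "\<bar>- sqrt (lam n) * cf u0 n * ml_kernel \<alpha> (lam n) (\<alpha> - 1) t\<bar> \<le> ?K * (sqrt (lam n) * \<bar>cf u0 n\<bar>)"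
      using sqrt_lam(1)[of n] by (simp add: abs_mult mult.commute)
    have "\<bar>u1 (e n)\<bar> * (sqrt (lam n) * \<bar>ml_kernel \<alpha> (lam n) \<alpha> t\<bar>) \<le> \<bar>u1 (e n)\<bar> * ?K"
      using basic_bounds(6)[OF assms, of n] C(2) by (intro mult_left_mono) auto
    then show "\<bar>- sqrt (lam n) * u1 (e n) * ml_kernel \<alpha> (lam n) \<alpha> t\<bar> \<le> ?K * \<bar>u1 (e n)\<bar>"
      using sqrt_lam(1)[of n] by (simp add: abs_mult mult_ac)
  qed
qed

lemma u_mode_continuous: "continuous_on {0..T} (u_mode n)"
  unfolding u_mode_def[abs_def] using alpha
  by (intro continuous_intros continuous_on_subset[OF ml_kernel_continuous(3)[of \<alpha>]]) auto

lemma wt_mode_continuous: "continuous_on {0..T} (wt_mode n)"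
  unfolding wt_mode_def[abs_def] using alpha
  by (intro continuous_intros continuous_on_subset[OF ml_kernel_continuous(3)[of \<alpha>]] continuous_on_subset[OF ml_kernel_continuous(2)[of \<alpha> \<alpha>]]) auto

lemma wtt_mode_continuous: "continuous_on {0<..} (wtt_mode n)"
  unfolding wtt_mode_def[abs_def] using alpha by (intro continuous_intros ml_kernel_continuous(1)) auto

lemma u_mode_deriv: assumes "t \<in> {0..T}" shows "(u_mode n has_real_derivative sqrt (lam n) * wt_mode n t) (at t within {0..T})"
proof -
  note d = ml_kernel_derivs[OF alpha assms, of "lam n"]
  have "((\<lambda>t. cf u0 n * mittag_leffler \<alpha> 1 (- lam n * t powr \<alpha>) + u1 (e n) * (t * mittag_leffler \<alpha> 2 (- lam n * t powr \<alpha>)))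
     has_real_derivative (cf u0 n * (- lam n * ml_kernel \<alpha> (lam n) \<alpha> t) + u1 (e n) * mittag_leffler \<alpha> 1 (- lam n * t powr \<alpha>))) (at t within {0..T})"
    by (intro DERIV_add DERIV_cmult d)
  moreover have "cf u0 n * (- lam n * ml_kernel \<alpha> (lam n) \<alpha> t) + u1 (e n) * mittag_leffler \<alpha> 1 (- lam n * t powr \<alpha>) = sqrt (lam n) * wt_mode n t"
  proof -
    define l where "l = sqrt (lam n)"
    define X where "X = ml_kernel \<alpha> (lam n) \<alpha> t"
    define Y where "Y = mittag_leffler \<alpha> 1 (- lam n * t powr \<alpha>)"
    have l: "l > 0" "lam n = l * l" using sqrt_lam[of n] by (simp_all add: l_def)
    have "cf u0 n * (- (l * l) * X) + u1 (e n) * Y = l * (- l * cf u0 n * X + u1 (e n) / l * Y)" using l(1) by (simp add: field_simps)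
    then show ?thesis unfolding wt_mode_def l_def[symmetric] X_def[symmetric] Y_def[symmetric] l(2)[symmetric] .
  qed
  ultimately show ?thesis by (simp add: u_mode_def[abs_def] mult.assoc)
qed

text \<open>The function \<open>wtt_mode n\<close> has an integrable singularity at \<open>0\<close>, and \<open>wt_mode n\<close> is one of its indefinite integrals.\<close>

lemma wt_mode_integral:
  assumes "t > 0" shows "(LINT \<tau>|lebesgue_on {0<..<t}. wtt_mode n \<tau>) = wt_mode n t - wt_mode n 0"
proof -
  note i = ml_kernel_integral[OF alpha(1), where t = t and lam = "lam n"]
  have i1: "integrable (lebesgue_on {0..t}) (ml_kernel \<alpha> (lam n) (\<alpha> - 1))" "(LINT \<tau>|lebesgue_on {0..t}. ml_kernel \<alpha> (lam n) (\<alpha> - 1) \<tau>) = ml_kernel \<alpha> (lam n) \<alpha> t"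
    using i[of "\<alpha> - 1"] alpha assms by simp_all
  have i2: "integrable (lebesgue_on {0..t}) (ml_kernel \<alpha> (lam n) \<alpha>)" "(LINT \<tau>|lebesgue_on {0..t}. ml_kernel \<alpha> (lam n) \<alpha> \<tau>) = ml_kernel \<alpha> (lam n) (\<alpha> + 1) t"
    using i[of \<alpha>] alpha assms by simp_all
  have Wi: "integrable (lebesgue_on {0..t}) (wtt_mode n)" unfolding wtt_mode_def[abs_def] by (intro integrable_mult_right Bochner_Integration.integrable_add i1 i2)
  have "(LINT \<tau>|lebesgue_on {0..t}. wtt_mode n \<tau>) = - sqrt (lam n) * (cf u0 n * ml_kernel \<alpha> (lam n) \<alpha> t + u1 (e n) * ml_kernel \<alpha> (lam n) (\<alpha> + 1) t)"
    unfolding wtt_mode_def using i1 i2 by simp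
  moreover have "ml_kernel \<alpha> (lam n) 1 t = 1 - lam n * ml_kernel \<alpha> (lam n) (\<alpha> + 1) t"
    using mittag_leffler_recurrence[OF alpha(1), of 1 "- lam n * t powr \<alpha>"] assms by (simp add: ml_kernel_def)
  moreover have "(LINT \<tau>|lebesgue_on {0..t}. wtt_mode n \<tau>) = (LINT \<tau>|lebesgue_on {0<..<t}. wtt_mode n \<tau>)"
  proof -
    have "(wtt_mode n) absolutely_integrable_on {0..t}" using Wi by (simp add: set_integrable_def integrable_restrict_space)
    then have "(wtt_mode n) absolutely_integrable_on {0<..<t}" by (simp add: absolutely_integrable_on_Icc_iff_Ioo)
    then have "integrable (lebesgue_on {0<..<t}) (wtt_mode n)" by (rule absolutely_integrable_imp_integrable) simp
    then show ?thesis by (rule LINT_Icc_Ioo(2))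
  qed
  moreover have "- sqrt (lam n) * (cf u0 n * x + u1 (e n) * y) = (- sqrt (lam n) * cf u0 n * x + u1 (e n) / sqrt (lam n) * (1 - lam n * y)) - u1 (e n) / sqrt (lam n)" for x y
  proof -
    define l where "l = sqrt (lam n)"
    have l: "l > 0" "lam n = l * l" using sqrt_lam[of n] by (simp_all add: l_def)
    show ?thesis unfolding l_def[symmetric] l(2) using l(1) by (simp add: field_simps)
  qed
  ultimately show ?thesis by (simp only: wt_mode_ml_kernel[OF assms] wt_mode_0)
qed

text \<open>The scalar fractional equation, as the Caputo derivative of \<open>w\<^sub>n\<close> is the fractional integral of \<open>w\<^sub>n''\<close>.\<close>

lemma wtt_mode_frac_integral:
  assumes "t > 0" 
  shows "frac_integral (2 - \<alpha>) (wtt_mode n) t = - sqrt (lam n) * u_mode n t"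
proof -
  define k where "k = (\<lambda>\<tau>. (t - \<tau>) powr (2 - \<alpha> - 1))"
  have k: "(t - \<tau>) powr (2 - \<alpha> - 1) = k \<tau>" for \<tau> by (simp only: k_def)
  have eq: "k \<tau> * wtt_mode n \<tau> = (- sqrt (lam n) * cf u0 n) * (k \<tau> * ml_kernel \<alpha> (lam n) (\<alpha> - 1) \<tau>) + (- sqrt (lam n) * u1 (e n)) * (k \<tau> * ml_kernel \<alpha> (lam n) \<alpha> \<tau>)" for \<tau>
    by (simp add: wtt_mode_def algebra_simps)
  have p: "\<alpha> - 1 > 0" "\<alpha> > 0" "2 - \<alpha> > 0" using alpha by auto
  have i1: "integrable (lebesgue_on {0<..<t}) (\<lambda>\<tau>. k \<tau> * ml_kernel \<alpha> (lam n) (\<alpha> - 1) \<tau>)" "frac_integral (2 - \<alpha>) (ml_kernel \<alpha> (lam n) (\<alpha> - 1)) t = ml_kernel \<alpha> (lam n) 1 t"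
    using ml_kernel_frac_integral[OF alpha(1) p(1) p(3) assms, of "lam n"] unfolding k by simp_all
  have i2: "integrable (lebesgue_on {0<..<t}) (\<lambda>\<tau>. k \<tau> * ml_kernel \<alpha> (lam n) \<alpha> \<tau>)" "frac_integral (2 - \<alpha>) (ml_kernel \<alpha> (lam n) \<alpha>) t = ml_kernel \<alpha> (lam n) 2 t"
    using ml_kernel_frac_integral[OF alpha(1) p(2) p(3) assms, of "lam n"] unfolding k by simp_all
  have "frac_integral (2 - \<alpha>) (wtt_mode n) t = 1 / Gamma (2 - \<alpha>) * (LINT \<tau>|lebesgue_on {0<..<t}. (- sqrt (lam n) * cf u0 n) * (k \<tau> * ml_kernel \<alpha> (lam n) (\<alpha> - 1) \<tau>) + (- sqrt (lam n) * u1 (e n)) * (k \<tau> * ml_kernel \<alpha> (lam n) \<alpha> \<tau>))"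
    unfolding frac_integral_def k eq ..
  also have "(LINT \<tau>|lebesgue_on {0<..<t}. (- sqrt (lam n) * cf u0 n) * (k \<tau> * ml_kernel \<alpha> (lam n) (\<alpha> - 1) \<tau>) + (- sqrt (lam n) * u1 (e n)) * (k \<tau> * ml_kernel \<alpha> (lam n) \<alpha> \<tau>))
     = (- sqrt (lam n) * cf u0 n) * (LINT \<tau>|lebesgue_on {0<..<t}. k \<tau> * ml_kernel \<alpha> (lam n) (\<alpha> - 1) \<tau>) + (- sqrt (lam n) * u1 (e n)) * (LINT \<tau>|lebesgue_on {0<..<t}. k \<tau> * ml_kernel \<alpha> (lam n) \<alpha> \<tau>)"
    using i1(1) i2(1) by simp
  also have "1 / Gamma (2 - \<alpha>) * \<dots> = (- sqrt (lam n) * cf u0 n) * frac_integral (2 - \<alpha>) (ml_kernel \<alpha> (lam n) (\<alpha> - 1)) t + (- sqrt (lam n) * u1 (e n)) * frac_integral (2 - \<alpha>) (ml_kernel \<alpha> (lam n) \<alpha>) t"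
    unfolding frac_integral_def k by (simp add: ring_distribs)
  finally show ?thesis unfolding i1(2) i2(2) u_mode_ml_kernel[OF assms] by (simp add: algebra_simps)
qed

end

section \<open>Existence of the solution\<close>

lemma L2_into_mono:
  assumes "L2_into I X N f" "X \<subseteq> X'" shows "L2_into I X' N f"
proof -
  have "strongly_measurable I X' N f" if s: "strongly_measurable I X N f"
  proof -
    have ae: "AE t in lebesgue_on I. f t \<in> X" using s by (simp add: strongly_measurable_def)
    have "AE t in lebesgue_on I. f t \<in> X'" using ae by eventually_elim (use assms(2) in blast)
    then show ?thesis using s assms(2) unfolding strongly_measurable_def by (meson order_trans)
  qed
  then show ?thesis using assms(1) by (simp add: L2_into_def)
qed

lemma powr_add_square_integrable:
  fixes a c b C :: real
  assumes "a > - 1/2" "c > - 1/2" "b > 0"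
  shows "integrable (lebesgue_on {0<..<b}) (\<lambda>t. (C * (t powr a + t powr c))\<^sup>2)"
proof -
  have "integrable (lebesgue_on {0<..<b}) (\<lambda>t. C\<^sup>2 * (t powr (2 * a) + 2 * t powr (a + c) + t powr (2 * c)))"
    by (intro integrable_mult_right Bochner_Integration.integrable_add powr_integrable_near_0) (use assms in auto)
  moreover have "C\<^sup>2 * (t powr (2 * a) + 2 * t powr (a + c) + t powr (2 * c)) = (C * (t powr a + t powr c))\<^sup>2" for t
  proof -
    have "t powr (2 * a) = (t powr a)\<^sup>2" "t powr (2 * c) = (t powr c)\<^sup>2" "t powr (a + c) = t powr a * t powr c"
      by (simp_all add: power2_eq_square flip: powr_add)
    then show ?thesis by (simp add: power_mult_distrib power2_sum)
  qed
  ultimately show ?thesis by simp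
qed

context eigen_domain
begin

lemma inverse_sqrt_spec:
  assumes "u \<in> L2 \<Omega>"
  shows "frac_power \<Omega> lam e (-1/2) u \<in> L2 \<Omega>" "cf (frac_power \<Omega> lam e (-1/2) u) n = cf u n / sqrt (lam n)"
proof -
  have p: "lam n powr (-1/2) = 1 / sqrt (lam n)" for n
    using lam_pos[of n] powr_minus_divide[of "lam n" "1/2"] by (simp add: powr_half_sqrt)
  have b: "\<bar>lam n powr (-1/2) * cf u n\<bar> \<le> 1 / sqrt c1 * \<bar>cf u n\<bar>" for n
  proof -
    have "1 / sqrt (lam n) \<le> 1 / sqrt c1" using lam_ge lam_pos[of n] by (intro divide_left_mono) auto
    then have "1 / sqrt (lam n) * \<bar>cf u n\<bar> \<le> 1 / sqrt c1 * \<bar>cf u n\<bar>" by (rule mult_right_mono) simp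
    then show ?thesis unfolding p abs_mult using lam_pos[of n] by simp
  qed
  have "summable (\<lambda>n. 1 * \<bar>cf u n\<bar>\<^sup>2)" using Parseval_sq[OF assms] by (simp add: sums_iff)
  from summable_weighted_bound[OF b this] have s: "summable (\<lambda>n. (lam n powr (-1/2) * cf u n)\<^sup>2)" by simp
  show "frac_power \<Omega> lam e (-1/2) u \<in> L2 \<Omega>" by (rule frac_power_spec(1)[OF s])
  show "cf (frac_power \<Omega> lam e (-1/2) u) n = cf u n / sqrt (lam n)"
    unfolding frac_power_spec(2)[OF s] p by simp
qed

lemma dom_frac_H10: "dom_frac \<Omega> lam e (3/4) \<subseteq> H10 \<Omega>"
proof
  fix v assume "v \<in> dom_frac \<Omega> lam e (3/4)"
  then have v: "v \<in> L2 \<Omega>" "summable (\<lambda>n. lam n powr (3/2) * (cf v n)\<^sup>2)" using Q.Y_iff by auto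
  define k where "k = 1 / c1 powr (3/2) + 1 / c1"
  have "summable (\<lambda>n. (1 + sqrt (lam n)) * (cf v n)\<^sup>2)"
  proof (rule summable_comparison_test'[OF summable_mult[OF v(2), of k]])
    fix n
    have "1 + sqrt (lam n) \<le> k * lam n powr (3/2)"
    proof -
      have "c1 powr (3/2) \<le> lam n powr (3/2)" by (rule Q.c0(2))
      then have 1: "1 \<le> 1 / c1 powr (3/2) * lam n powr (3/2)" using lam_ge(1) by (simp add: field_simps)
      have "lam n powr (3/2) = lam n * sqrt (lam n)"
        using lam_pos[of n] powr_add[of "lam n" 1 "1/2"] by (simp add: powr_half_sqrt)
      moreover have "c1 * sqrt (lam n) \<le> lam n * sqrt (lam n)" using lam_ge lam_pos[of n] by (intro mult_right_mono) auto
      ultimately have "sqrt (lam n) \<le> 1 / c1 * lam n powr (3/2)" using lam_ge(1) by (simp add: field_simps)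
      with 1 show ?thesis by (simp add: k_def ring_distribs)
    qed
    then have "(1 + sqrt (lam n)) * (cf v n)\<^sup>2 \<le> k * lam n powr (3/2) * (cf v n)\<^sup>2" by (rule mult_right_mono) simp
    then show "norm ((1 + sqrt (lam n)) * (cf v n)\<^sup>2) \<le> k * (lam n powr (3/2) * (cf v n)\<^sup>2)"
      using lam_pos[of n] by (simp add: abs_mult mult.assoc)
  qed
  then show "v \<in> H10 \<Omega>" using v by (simp add: H.Y_iff)
qed

end

context wave_problem
begin

lemma u_mode_lipschitz: "\<exists>K\<ge>0. \<forall>n. (\<forall>t\<in>{0..T}. \<bar>wt_mode n t\<bar> \<le> K * mode_size n) \<and>
  (\<forall>s\<in>{0..T}. \<forall>t\<in>{0..T}. \<bar>u_mode n s - u_mode n t\<bar> \<le> sqrt (lam n) * (K * mode_size n) * \<bar>s - t\<bar>)"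
proof -
  obtain K where K: "K \<ge> 0" "\<And>n t. t \<in> {0..T} \<Longrightarrow> \<bar>wt_mode n t\<bar> \<le> K * mode_size n" using wt_mode_bound by blast
  have "\<bar>u_mode n s - u_mode n t\<bar> \<le> sqrt (lam n) * (K * mode_size n) * \<bar>s - t\<bar>" if "s \<in> {0..T}" "t \<in> {0..T}" for n s t
  proof -
    have "norm (u_mode n s - u_mode n t) \<le> sqrt (lam n) * (K * mode_size n) * norm (s - t)"
    proof (rule field_differentiable_bound[of "{0..T}" "u_mode n" "\<lambda>t. sqrt (lam n) * wt_mode n t"])
      show "(u_mode n has_field_derivative sqrt (lam n) * wt_mode n z) (at z within {0..T})" if "z \<in> {0..T}" for z by (rule u_mode_deriv[OF that])
      show "norm (sqrt (lam n) * wt_mode n z) \<le> sqrt (lam n) * (K * mode_size n)" if "z \<in> {0..T}" for z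
        using K(2)[OF that, of n] sqrt_lam(1)[of n] by (simp add: abs_mult)
    qed (use that in auto)
    then show ?thesis by simp
  qed
  then show ?thesis using K by blast
qed

lemma wt_mode_dual_summable: assumes "t \<in> {0..T}" shows "summable (\<lambda>n. 1 / (1 + sqrt (lam n)) * (wt_mode n t)\<^sup>2)"
proof -
  obtain K where K: "\<And>n. \<bar>wt_mode n t\<bar> \<le> K * mode_size n" using wt_mode_bound assms by blast
  show ?thesis by (rule summable_weighted_bound[OF K summable_D]) (use sqrt_lam(1) in \<open>simp add: less_imp_le add_pos_pos\<close>)
qed

lemma wtt_mode_dual_summable: assumes "t > 0" shows "summable (\<lambda>n. 1 / (1 + sqrt (lam n)) * (wtt_mode n t)\<^sup>2)"
  by (rule summable_weighted_bound[OF wtt_mode_bound[OF assms] summable_D]) (use sqrt_lam(1) in \<open>simp add: less_imp_le add_pos_pos\<close>)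

lemma solution_series_iff:
  "solution_series \<Omega> lam e \<alpha> T u0 u1 u \<longleftrightarrow> (\<forall>t\<in>{0..T}. u t \<in> L2 \<Omega> \<and> (\<forall>n. cf (u t) n = u_mode n t))"
proof -
  have "L2_sums \<Omega> (\<lambda>n x. u_mode n t * e n x) f \<longleftrightarrow> f \<in> L2 \<Omega> \<and> (\<forall>n. cf f n = u_mode n t)" for f t
  proof
    assume s: "L2_sums \<Omega> (\<lambda>n x. u_mode n t * e n x) f"
    then show "f \<in> L2 \<Omega> \<and> (\<forall>n. cf f n = u_mode n t)" using L2_sums_coeff[OF s] by (simp add: L2_sums_iff)
  next
    assume "f \<in> L2 \<Omega> \<and> (\<forall>n. cf f n = u_mode n t)"
    then show "L2_sums \<Omega> (\<lambda>n x. u_mode n t * e n x) f" using expansion[of f] by simp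
  qed
  then show ?thesis unfolding solution_series_def u_mode_def by simp
qed

lemma solution_series_exists: "\<exists>u. solution_series \<Omega> lam e \<alpha> T u0 u1 u"
proof -
  have "\<forall>t\<in>{0..T}. \<exists>f. f \<in> L2 \<Omega> \<and> (\<forall>n. cf f n = u_mode n t)"
  proof
    fix t assume t: "t \<in> {0..T}"
    obtain K where K: "\<And>n. \<bar>u_mode n t\<bar> \<le> K * (mode_size n / sqrt (lam n))" using u_mode_bound t by blast
    have "summable (\<lambda>n. (1 + sqrt (lam n)) * (u_mode n t)\<^sup>2)"
      by (rule summable_weighted_bound[OF K summable_H]) (use sqrt_lam(1) in \<open>simp add: less_imp_le add_pos_pos\<close>)
    then obtain f where "f \<in> H10 \<Omega>" "\<And>n. cf f n = u_mode n t" by (rule H.synthesis) blast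
    then show "\<exists>f. f \<in> L2 \<Omega> \<and> (\<forall>n. cf f n = u_mode n t)" using H10_L2 by blast
  qed
  then obtain u where "\<forall>t\<in>{0..T}. u t \<in> L2 \<Omega> \<and> (\<forall>n. cf (u t) n = u_mode n t)" by (rule bchoice[THEN exE])
  then show ?thesis using solution_series_iff by blast
qed

text \<open>The fractional integral of \<open>w\<^sub>t\<^sub>t\<close> exists in \<open>H\<^sup>-\<^sup>1\<close>: the singularities of the kernel at \<open>t\<close> and of \<open>w\<^sub>t\<^sub>t\<close> at \<open>0\<close> are those of Beta integrals.
Computed coefficientwise it is the functional given by the function \<open>g\<close>.\<close>

lemma wtt_mode_kernel_dual_series:
  assumes t: "0 < t" and v: "v \<in> H10 \<Omega>"
  shows "bochner_integrable {0<..<t} (dual (H10 \<Omega>) (H1_norm \<Omega>)) (dual_norm (H10 \<Omega>) (H1_norm \<Omega>))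
           (\<lambda>\<tau> v. (t - \<tau>) powr (1 - \<alpha>) * H.dual_series (\<lambda>n. wtt_mode n \<tau>) v)"
    and "g \<in> L2 \<Omega> \<Longrightarrow> (\<And>n. cf g n = - sqrt (lam n) * u_mode n t) \<Longrightarrow>
           L2_inner \<Omega> g v = frac_integral (2 - \<alpha>) (\<lambda>\<tau>. H.dual_series (\<lambda>n. wtt_mode n \<tau>) v) t"
proof -
  define k where "k = (\<lambda>\<tau>. (t - \<tau>) powr (1 - \<alpha>))"
  define K where "K = (\<lambda>\<tau>. k \<tau> * (ml_const * (\<tau> powr (\<alpha> - 2) + \<tau> powr (\<alpha> / 2 - 1))))"
  have Kint: "integrable (lebesgue_on {0<..<t}) K"
  proof -
    have "integrable (lebesgue_on {0<..<t}) (\<lambda>\<tau>. ml_const * ((t - \<tau>) powr (2 - \<alpha> - 1) * \<tau> powr (\<alpha> - 1 - 1) + (t - \<tau>) powr (2 - \<alpha> - 1) * \<tau> powr (\<alpha> / 2 - 1)))"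
      by (intro integrable_mult_right Bochner_Integration.integrable_add beta_kernel_integral) (use alpha t in auto)
    then show ?thesis by (simp add: K_def k_def algebra_simps)
  qed
  have Kc: "continuous_on {0<..<t} K" unfolding K_def k_def by (intro continuous_intros) auto
  have kc: "continuous_on {0<..<t} k" unfolding k_def by (intro continuous_intros) auto
  have Wc: "continuous_on {0<..<t} (\<lambda>\<tau>. k \<tau> * wtt_mode n \<tau>)" for n
    by (intro continuous_intros kc continuous_on_subset[OF wtt_mode_continuous]) auto
  have Kpos: "K \<tau> \<ge> 0" for \<tau> using ml_const(1) by (simp add: K_def k_def)
  have Kb: "\<bar>k \<tau> * wtt_mode n \<tau>\<bar> \<le> K \<tau> * mode_size n" if "\<tau> \<in> {0<..<t}" for \<tau> n
  proof -
    have "k \<tau> * \<bar>wtt_mode n \<tau>\<bar> \<le> k \<tau> * ((ml_const * (\<tau> powr (\<alpha> - 2) + \<tau> powr (\<alpha> / 2 - 1))) * mode_size n)"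
      using that by (intro mult_left_mono wtt_mode_bound) (auto simp: k_def)
    then show ?thesis by (simp add: K_def abs_mult k_def mult.assoc)
  qed
  show "bochner_integrable {0<..<t} (dual (H10 \<Omega>) (H1_norm \<Omega>)) (dual_norm (H10 \<Omega>) (H1_norm \<Omega>))
           (\<lambda>\<tau> v. (t - \<tau>) powr (1 - \<alpha>) * H.dual_series (\<lambda>n. wtt_mode n \<tau>) v)"
    unfolding k_def[THEN fun_cong, symmetric]
  proof (rule H.D.bochner_integrableI(1)[where b = t and K = K and m = mode_size])
    show "(\<lambda>v. k \<tau> * H.dual_series (\<lambda>n. wtt_mode n \<tau>) v) \<in> dual (H10 \<Omega>) (H1_norm \<Omega>)" if "\<tau> \<in> {0<..<t}" for \<tau>
      by (intro H.D.scale_in H.dual_series_dual wtt_mode_dual_summable) (use that in auto)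
    show "continuous_on {0<..<t} (\<lambda>\<tau>. k \<tau> * H.dual_series (\<lambda>n. wtt_mode n \<tau>) (e n))" for n unfolding H.dual_series_e by (rule Wc)
    show "\<bar>k \<tau> * H.dual_series (\<lambda>n. wtt_mode n \<tau>) (e n)\<bar> \<le> K \<tau> * mode_size n" if "\<tau> \<in> {0<..<t}" for \<tau> n unfolding H.dual_series_e by (rule Kb[OF that])
  qed (use t Kpos Kc Kint summable_D mode_size_nonneg in auto)
  assume g: "g \<in> L2 \<Omega>" "\<And>n. cf g n = - sqrt (lam n) * u_mode n t"
  have G: "Gamma (2 - \<alpha>) > 0" using alpha by (intro Gamma_real_pos) simp
  have ke: "(t - \<tau>) powr (2 - \<alpha> - 1) = k \<tau>" for \<tau> by (simp add: k_def)
  have "(LINT \<tau>|lebesgue_on {0<..<t}. k \<tau> * H.dual_series (\<lambda>n. wtt_mode n \<tau>) v) = (LINT \<tau>|lebesgue_on {0<..<t}. H.dual_series (\<lambda>n. k \<tau> * wtt_mode n \<tau>) v)"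
  proof (rule Bochner_Integration.integral_cong[OF refl])
    fix \<tau> assume "\<tau> \<in> space (lebesgue_on {0<..<t})"
    then have "\<tau> > 0" by simp
    from dual_series_diff_scale(1)[OF H.pairing_bound(1)[OF wtt_mode_dual_summable[OF this] v], of "k \<tau>"]
    show "k \<tau> * H.dual_series (\<lambda>n. wtt_mode n \<tau>) v = H.dual_series (\<lambda>n. k \<tau> * wtt_mode n \<tau>) v" by simp
  qed
  also have "\<dots> = H.dual_series (\<lambda>n. LINT \<tau>|lebesgue_on {0<..<t}. k \<tau> * wtt_mode n \<tau>) v"
    by (rule H.dual_series_integral(2)[OF Wc Kb Kint Kpos summable_D mode_size_nonneg v])
  also have "(\<lambda>n. LINT \<tau>|lebesgue_on {0<..<t}. k \<tau> * wtt_mode n \<tau>) = (\<lambda>n. Gamma (2 - \<alpha>) * cf g n)"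
  proof
    fix n
    show "(LINT \<tau>|lebesgue_on {0<..<t}. k \<tau> * wtt_mode n \<tau>) = Gamma (2 - \<alpha>) * cf g n"
      using wtt_mode_frac_integral[OF t, of n] G unfolding frac_integral_def ke g(2) by (simp add: field_simps)
  qed
  also have "H.dual_series (\<lambda>n. Gamma (2 - \<alpha>) * cf g n) v = Gamma (2 - \<alpha>) * H.dual_series (cf g) v"
    by (rule dual_series_diff_scale(1)[OF H.pairing_bound(1)[OF H.L2_dual_summable[OF g(1)] v]])
  also have "H.dual_series (cf g) v = L2_inner \<Omega> g v" by (rule H.dual_series_L2[symmetric, OF g(1) H10_L2[OF v]])
  finally show "L2_inner \<Omega> g v = frac_integral (2 - \<alpha>) (\<lambda>\<tau>. H.dual_series (\<lambda>n. wtt_mode n \<tau>) v) t"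
    unfolding frac_integral_def ke using G by simp
qed

lemma wtt_mode_dual_series_integral:
  assumes t: "t \<in> {0..T}" and v: "v \<in> H10 \<Omega>"
  shows "H.dual_series (\<lambda>n. wt_mode n t) v = H.dual_series (\<lambda>n. wt_mode n 0) v + (LINT \<tau>|lebesgue_on {0..t}. H.dual_series (\<lambda>n. wtt_mode n \<tau>) v)"
proof (cases "t = 0")
  case True
  then show ?thesis by (simp only: LINT_point)
next
  case False
  then have t0: "t > 0" using t by simp
  define K where "K = (\<lambda>\<tau>. ml_const * (\<tau> powr (\<alpha> - 2) + \<tau> powr (\<alpha> / 2 - 1)))"
  have Kint: "integrable (lebesgue_on {0<..<t}) K" unfolding K_def
    by (intro integrable_mult_right Bochner_Integration.integrable_add powr_integrable_near_0) (use alpha t0 in auto)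
  have Kpos: "K \<tau> \<ge> 0" for \<tau> using ml_const(1) by (simp add: K_def)
  have Wc: "continuous_on {0<..<t} (\<lambda>\<tau>. wtt_mode n \<tau>)" for n by (rule continuous_on_subset[OF wtt_mode_continuous]) auto
  have Wb: "\<bar>wtt_mode n \<tau>\<bar> \<le> K \<tau> * mode_size n" if "\<tau> \<in> {0<..<t}" for \<tau> n unfolding K_def by (rule wtt_mode_bound) (use that in simp)
  note i = H.dual_series_integral[of t "\<lambda>\<tau> n. wtt_mode n \<tau>", OF Wc Wb Kint Kpos summable_D mode_size_nonneg v]
  have "(LINT \<tau>|lebesgue_on {0..t}. H.dual_series (\<lambda>n. wtt_mode n \<tau>) v) = (LINT \<tau>|lebesgue_on {0<..<t}. H.dual_series (\<lambda>n. wtt_mode n \<tau>) v)"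
    by (rule LINT_Icc_Ioo(2)[OF i(1)])
  also have "\<dots> = H.dual_series (\<lambda>n. LINT \<tau>|lebesgue_on {0<..<t}. wtt_mode n \<tau>) v" by (rule i(2))
  also have "\<dots> = H.dual_series (\<lambda>n. wt_mode n t - wt_mode n 0) v" by (simp only: wt_mode_integral[OF t0])
  also have "\<dots> = H.dual_series (\<lambda>n. wt_mode n t) v - H.dual_series (\<lambda>n. wt_mode n 0) v"
    by (intro dual_series_diff_scale(2) H.pairing_bound(1) wt_mode_dual_summable v) (use t T in auto)
  finally show ?thesis by simp
qed

text \<open>Each clause is a coefficientwise statement with a majorant: \<open>u\<close> and \<open>w\<close> are bounded in their spaces, \<open>w\<close> is Lipschitz continuous into \<open>H\<^sup>-\<^sup>1\<close>, and \<open>w\<^sub>t\<close> and the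
Caputo derivative gain regularity for \<open>t > 0\<close> at the price of a square integrable singularity at \<open>0\<close>.\<close>

lemma solution_series_H1_solution:
  assumes S: "solution_series \<Omega> lam e \<alpha> T u0 u1 u"
  shows "H1_solution \<Omega> lam e \<alpha> T u"
proof -
  have u: "u t \<in> L2 \<Omega>" "cf (u t) n = u_mode n t" if "t \<in> {0..T}" for t n using S that by (auto simp: solution_series_iff)
  obtain KU where KU: "\<And>t n. t \<in> {0..T} \<Longrightarrow> \<bar>u_mode n t\<bar> \<le> KU * (mode_size n / sqrt (lam n))" using u_mode_bound by blast
  obtain K where K: "K \<ge> 0" "\<And>t n. t \<in> {0..T} \<Longrightarrow> \<bar>wt_mode n t\<bar> \<le> K * mode_size n"
    "\<And>s t n. s \<in> {0..T} \<Longrightarrow> t \<in> {0..T} \<Longrightarrow> \<bar>u_mode n s - u_mode n t\<bar> \<le> sqrt (lam n) * (K * mode_size n) * \<bar>s - t\<bar>"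
    using u_mode_lipschitz by blast
  have md: "mode_size n / sqrt (lam n) \<ge> 0" for n using mode_size_nonneg[of n] sqrt_lam(1)[of n] by simp
  define w where "w = (\<lambda>t. frac_power \<Omega> lam e (-1/2) (u t))"
  have w: "w t \<in> L2 \<Omega>" "cf (w t) n = u_mode n t / sqrt (lam n)" if "t \<in> {0..T}" for t n
    using inverse_sqrt_spec[OF u(1)[OF that]] u(2)[OF that] by (simp_all add: w_def)
  have uH: "u t \<in> H10 \<Omega>" if "t \<in> {0..T}" for t
  proof (rule H.Y_memI[OF u(1)[OF that] _ summable_H])
    show "\<bar>cf (u t) n\<bar> \<le> KU * (mode_size n / sqrt (lam n))" for n unfolding u(2)[OF that] by (rule KU[OF that])
  qed
  have 1: "cont_into {0..T} (H10 \<Omega>) (H1_norm \<Omega>) u"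
  proof (rule H.P.cont_intoI[OF uH _ _ continuous_on_const summable_H md])
    show "continuous_on {0..T} (\<lambda>t. cf (u t) n)" for n using u_mode_continuous by (subst continuous_on_cong[OF refl u(2)]) auto
    show "\<bar>cf (u t) n\<bar> \<le> KU * (mode_size n / sqrt (lam n))" if "t \<in> {0..T}" for t n unfolding u(2)[OF that] by (rule KU[OF that])
  qed
  have wc: "continuous_on {0..T} (\<lambda>t. cf (w t) n)" for n
    using u_mode_continuous sqrt_lam(1)[of n] by (subst continuous_on_cong[OF refl w(2)]) (auto intro!: continuous_intros)
  have wb: "\<bar>cf (w t) n\<bar> \<le> KU * (mode_size n / lam n)" if "t \<in> {0..T}" for t n
  proof -
    have "\<bar>cf (w t) n\<bar> = \<bar>u_mode n t\<bar> / sqrt (lam n)" unfolding w(2)[OF that] using sqrt_lam(1)[of n] by simp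
    also have "\<dots> \<le> KU * (mode_size n / sqrt (lam n)) / sqrt (lam n)" using KU[OF that] sqrt_lam(1)[of n] by (intro divide_right_mono) auto
    finally show ?thesis using sqrt_lam(2)[of n] by simp
  qed
  have 2: "cont_into {0..T} (dom_frac \<Omega> lam e (3/4)) (frac_norm \<Omega> lam e (3/4)) w"
  proof (rule Q.P.cont_intoI[OF _ wc wb continuous_on_const summable_Q])
    show "w t \<in> dom_frac \<Omega> lam e (3/4)" if "t \<in> {0..T}" for t by (rule Q.Y_memI[OF w(1)[OF that] wb[OF that] summable_Q])
    show "mode_size n / lam n \<ge> 0" for n using mode_size_nonneg[of n] lam_pos[of n] by simp
  qed
  define wt where "wt = (\<lambda>t. H.dual_series (\<lambda>n. wt_mode n t))"
  have wtD: "wt t \<in> dual (H10 \<Omega>) (H1_norm \<Omega>)" if "t \<in> {0..T}" for t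
    unfolding wt_def by (rule H.dual_series_dual[OF wt_mode_dual_summable[OF that]])
  have wt_e: "wt t (e n) = wt_mode n t" for t n unfolding wt_def by (rule H.dual_series_e)
  have 3: "has_time_deriv (Hm1_norm \<Omega>) (\<lambda>s. L2_inner \<Omega> (w s)) (wt t) t {0..T}" if t: "t \<in> {0..T}" for t
    unfolding Hm1_norm_def
  proof (rule H.D.has_time_derivI[where m = "\<lambda>n. K * mode_size n"])
    show "L2_inner \<Omega> (w s) \<in> dual (H10 \<Omega>) (H1_norm \<Omega>)" if "s \<in> {0..T}" for s by (rule H.L2_dual[OF w(1)[OF that]])
    show "((\<lambda>s. cf (w s) n) has_real_derivative wt t (e n)) (at t within {0..T})" for n
    proof (rule has_field_derivative_transform_within[where d = 1])
      show "((\<lambda>s. u_mode n s / sqrt (lam n)) has_real_derivative wt t (e n)) (at t within {0..T})"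
        using DERIV_cdivide[OF u_mode_deriv[OF t, of n], of "sqrt (lam n)"] sqrt_lam(1)[of n] by (simp add: wt_e)
    qed (use t w(2) in auto)
    show "\<bar>cf (w s) n - cf (w t) n\<bar> \<le> K * mode_size n * \<bar>s - t\<bar>" if s: "s \<in> {0..T}" for s n
    proof -
      have "cf (w s) n - cf (w t) n = (u_mode n s - u_mode n t) / sqrt (lam n)" using w(2) s t by (simp add: diff_divide_distrib)
      then have "\<bar>cf (w s) n - cf (w t) n\<bar> = \<bar>u_mode n s - u_mode n t\<bar> / sqrt (lam n)" using sqrt_lam(1)[of n] by simp
      also have "\<dots> \<le> sqrt (lam n) * (K * mode_size n) * \<bar>s - t\<bar> / sqrt (lam n)"
        using K(3)[OF s t] sqrt_lam(1)[of n] by (intro divide_right_mono) auto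
      finally show ?thesis using sqrt_lam(1)[of n] by simp
    qed
    show "\<bar>wt t (e n)\<bar> \<le> K * mode_size n" for n unfolding wt_e by (rule K(2)[OF t])
    show "summable (\<lambda>n. 1 / (1 + sqrt (lam n)) * (K * mode_size n)\<^sup>2)"
      by (rule summable_weighted_bound[OF _ summable_D, where k = K])
        (use K(1) mode_size_nonneg sqrt_lam(1) in \<open>auto simp: less_imp_le add_pos_pos\<close>)
  qed (use wtD t in auto)
  have 4: "cont_into {0..T} (Hm1 \<Omega>) (Hm1_norm \<Omega>) wt"
    unfolding Hm1_def Hm1_norm_def
    by (rule H.D.cont_intoI[OF wtD _ _ continuous_on_const[of _ K] summable_D mode_size_nonneg]) (use wt_mode_continuous K(2) in \<open>auto simp: wt_e\<close>)
  have "\<forall>t\<in>{0<..<T}. \<exists>f. f \<in> H10 \<Omega> \<and> (\<forall>n. cf f n = wt_mode n t)"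
  proof
    fix t assume t: "t \<in> {0<..<T}"
    have "summable (\<lambda>n. (1 + sqrt (lam n)) * (wt_mode n t)\<^sup>2)"
      by (rule summable_weighted_bound[OF wt_mode_bound_H1[OF t] summable_H]) (use sqrt_lam(1) in \<open>simp add: less_imp_le add_pos_pos\<close>)
    then show "\<exists>f. f \<in> H10 \<Omega> \<and> (\<forall>n. cf f n = wt_mode n t)" by (rule H.synthesis) blast
  qed
  then obtain p where p: "\<And>t. t \<in> {0<..<T} \<Longrightarrow> p t \<in> H10 \<Omega>" "\<And>t n. t \<in> {0<..<T} \<Longrightarrow> cf (p t) n = wt_mode n t" by metis
  have "L2_into {0<..<T} (H10 \<Omega>) (H1_norm \<Omega>) p"
  proof (rule H.P.bochner_integrableI(2)[where K = "\<lambda>t. ml_const * (t powr (\<alpha> / 2 - 1) + t powr 0)" and I = "{0<..<T}"])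
    show "continuous_on {0<..<T} (\<lambda>t. cf (p t) n)" for n
      by (subst continuous_on_cong[OF refl p(2)]) (auto intro: continuous_on_subset[OF wt_mode_continuous])
    show "\<bar>cf (p t) n\<bar> \<le> ml_const * (t powr (\<alpha> / 2 - 1) + t powr 0) * (mode_size n / sqrt (lam n))" if "t \<in> {0<..<T}" for t n
      using wt_mode_bound_H1[OF that] that p(2)[OF that] by simp
    show "continuous_on {0<..<T} (\<lambda>t. ml_const * (t powr (\<alpha> / 2 - 1) + t powr 0))" by (intro continuous_intros) auto
    show "integrable (lebesgue_on {0<..<T}) (\<lambda>t. (ml_const * (t powr (\<alpha> / 2 - 1) + t powr 0))\<^sup>2)"
      by (rule powr_add_square_integrable) (use alpha T in auto)
    show "0 \<le> ml_const * (t powr (\<alpha> / 2 - 1) + t powr 0)" for t using ml_const(1) by (intro mult_nonneg_nonneg add_nonneg_nonneg) auto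
  qed (use p(1) T md summable_H in auto)
  then have 5: "L2_into {0<..<T} (sobolev 1 \<Omega>) (H1_norm \<Omega>) p" by (rule L2_into_mono) (auto simp: H10_def)
  have 6: "wt t v = L2_inner \<Omega> (p t) v" if t: "t \<in> {0<..<T}" and v: "v \<in> H10 \<Omega>" for t v
  proof -
    have "cf (p t) = (\<lambda>n. wt_mode n t)" using p(2)[OF t] by (rule ext)
    then show ?thesis using H.dual_series_L2[OF H10_L2[OF p(1)[OF t]] H10_L2[OF v]] by (simp add: wt_def)
  qed
  have "\<forall>t\<in>{0<..<T}. \<exists>f. f \<in> L2 \<Omega> \<and> (\<forall>n. cf f n = - sqrt (lam n) * u_mode n t)"
  proof
    fix t assume t: "t \<in> {0<..<T}"
    have "summable (\<lambda>n. 1 * (- sqrt (lam n) * u_mode n t)\<^sup>2)"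
      by (rule summable_weighted_bound[OF u_mode_bound_L2[OF t] summable_L]) simp
    then show "\<exists>f. f \<in> L2 \<Omega> \<and> (\<forall>n. cf f n = - sqrt (lam n) * u_mode n t)" by (rule L.synthesis) blast
  qed
  then obtain g where g: "\<And>t. t \<in> {0<..<T} \<Longrightarrow> g t \<in> L2 \<Omega>" "\<And>t n. t \<in> {0<..<T} \<Longrightarrow> cf (g t) n = - sqrt (lam n) * u_mode n t" by metis
  have 7: "L2_into {0<..<T} (L2 \<Omega>) (L2_norm \<Omega>) g"
  proof (rule L.P.bochner_integrableI(2)[where K = "\<lambda>t. ml_const * (t powr (- \<alpha> / 4) + t powr (1 - 3 * \<alpha> / 4))" and I = "{0<..<T}"
        and m = "\<lambda>n. mode_size n / lam n powr (1/4)"])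
    show "continuous_on {0<..<T} (\<lambda>t. cf (g t) n)" for n
      by (subst continuous_on_cong[OF refl g(2)]) (auto intro!: continuous_intros continuous_on_subset[OF u_mode_continuous])
    show "\<bar>cf (g t) n\<bar> \<le> ml_const * (t powr (- \<alpha> / 4) + t powr (1 - 3 * \<alpha> / 4)) * (mode_size n / lam n powr (1/4))" if "t \<in> {0<..<T}" for t n
      unfolding g(2)[OF that] by (rule u_mode_bound_L2[OF that])
    show "continuous_on {0<..<T} (\<lambda>t. ml_const * (t powr (- \<alpha> / 4) + t powr (1 - 3 * \<alpha> / 4)))" by (intro continuous_intros) auto
    show "integrable (lebesgue_on {0<..<T}) (\<lambda>t. (ml_const * (t powr (- \<alpha> / 4) + t powr (1 - 3 * \<alpha> / 4)))\<^sup>2)"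
      by (rule powr_add_square_integrable) (use alpha T in auto)
    show "0 \<le> ml_const * (t powr (- \<alpha> / 4) + t powr (1 - 3 * \<alpha> / 4))" for t using ml_const(1) by (intro mult_nonneg_nonneg add_nonneg_nonneg) auto
    show "0 \<le> mode_size n / lam n powr (1/4)" for n using mode_size_nonneg[of n] by simp
  qed (use g(1) T summable_L in auto)
  have 8: "has_caputo_deriv (H10 \<Omega>) (H1_norm \<Omega>) T \<alpha> (\<lambda>t. L2_inner \<Omega> (w t)) (\<lambda>t. L2_inner \<Omega> (g t))"
    unfolding has_caputo_deriv_def
  proof (rule conjI[rotated], rule exI[of _ wt], rule exI[of _ "\<lambda>\<tau>. H.dual_series (\<lambda>n. wtt_mode n \<tau>)"], intro conjI ballI)
    show "\<forall>t\<in>{0..T}. L2_inner \<Omega> (w t) \<in> dual (H10 \<Omega>) (H1_norm \<Omega>)" by (intro ballI H.L2_dual w(1))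
    show "has_time_deriv (dual_norm (H10 \<Omega>) (H1_norm \<Omega>)) (\<lambda>t. L2_inner \<Omega> (w t)) (wt t) t {0..T}" if "t \<in> {0..T}" for t
      using 3[OF that] by (simp add: Hm1_norm_def)
    show "bochner_integrable {0..T} (dual (H10 \<Omega>) (H1_norm \<Omega>)) (dual_norm (H10 \<Omega>) (H1_norm \<Omega>)) (\<lambda>\<tau>. H.dual_series (\<lambda>n. wtt_mode n \<tau>))"
    proof (rule H.D.bochner_integrableI(1)[where b = T and K = "\<lambda>\<tau>. ml_const * (\<tau> powr (\<alpha> - 2) + \<tau> powr (\<alpha> / 2 - 1))" and m = mode_size])
      show "H.dual_series (\<lambda>n. wtt_mode n t) \<in> dual (H10 \<Omega>) (H1_norm \<Omega>)" if "t \<in> {0<..<T}" for t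
        by (rule H.dual_series_dual[OF wtt_mode_dual_summable]) (use that in simp)
      show "continuous_on {0<..<T} (\<lambda>t. H.dual_series (\<lambda>n. wtt_mode n t) (e n))" for n
        unfolding H.dual_series_e by (rule continuous_on_subset[OF wtt_mode_continuous]) auto
      show "\<bar>H.dual_series (\<lambda>n. wtt_mode n t) (e n)\<bar> \<le> ml_const * (t powr (\<alpha> - 2) + t powr (\<alpha> / 2 - 1)) * mode_size n" if "t \<in> {0<..<T}" for t n
        unfolding H.dual_series_e by (rule wtt_mode_bound) (use that in simp)
      show "continuous_on {0<..<T} (\<lambda>\<tau>. ml_const * (\<tau> powr (\<alpha> - 2) + \<tau> powr (\<alpha> / 2 - 1)))" by (intro continuous_intros) auto
      show "integrable (lebesgue_on {0<..<T}) (\<lambda>\<tau>. ml_const * (\<tau> powr (\<alpha> - 2) + \<tau> powr (\<alpha> / 2 - 1)))"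
        by (intro integrable_mult_right Bochner_Integration.integrable_add powr_integrable_near_0) (use alpha T in auto)
      show "0 \<le> ml_const * (t powr (\<alpha> - 2) + t powr (\<alpha> / 2 - 1))" for t using ml_const(1) by (intro mult_nonneg_nonneg add_nonneg_nonneg) auto
    qed (use T mode_size_nonneg summable_D in auto)
    show "wt t v = wt 0 v + (LINT \<tau>|lebesgue_on {0..t}. H.dual_series (\<lambda>n. wtt_mode n \<tau>) v)" if "t \<in> {0..T}" "v \<in> H10 \<Omega>" for t v
      unfolding wt_def by (rule wtt_mode_dual_series_integral[OF that])
    show "bochner_integrable {0<..<t} (dual (H10 \<Omega>) (H1_norm \<Omega>)) (dual_norm (H10 \<Omega>) (H1_norm \<Omega>))
           (\<lambda>\<tau> v. (t - \<tau>) powr (1 - \<alpha>) * H.dual_series (\<lambda>n. wtt_mode n \<tau>) v)" if "t \<in> {0<..<T}" for t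
      by (rule wtt_mode_kernel_dual_series(1)[OF _ H.e_in_Y]) (use that in simp)
    show "L2_inner \<Omega> (g t) v = frac_integral (2 - \<alpha>) (\<lambda>\<tau>. H.dual_series (\<lambda>n. wtt_mode n \<tau>) v) t" if "t \<in> {0<..<T}" "v \<in> H10 \<Omega>" for t v
      by (rule wtt_mode_kernel_dual_series(2)[OF _ that(2) g(1)[OF that(1)] g(2)[OF that(1)]]) (use that in simp)
  qed (use wtD in auto)
  have 9: "L2_inner \<Omega> (g t) v - grad_inner \<Omega> (laplacian \<Omega> (w t)) v = 0" if t: "t \<in> {0<..<T}" and v: "v \<in> H10 \<Omega>" for t v
  proof -
    have t': "t \<in> {0..T}" using t by simp
    have "(\<lambda>n. - sqrt (lam n) * cf (u t) n * cf v n) sums grad_inner \<Omega> (laplacian \<Omega> (w t)) v"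
      by (rule grad_laplacian_inverse[OF uH[OF t'] w(1)[OF t'] _ v]) (simp add: w(2)[OF t'] u(2)[OF t'])
    moreover have "(\<lambda>n. - sqrt (lam n) * cf (u t) n * cf v n) sums L2_inner \<Omega> (g t) v"
      using Parseval[OF g(1)[OF t] H10_L2[OF v]] by (simp add: g(2)[OF t] u(2)[OF t'])
    ultimately show ?thesis using sums_unique2 by fastforce
  qed
  have ae: "AE t in lebesgue_on {0<..<T}. \<forall>v\<in>H10 \<Omega>. wt t v = L2_inner \<Omega> (p t) v" by (rule AE_I2) (use 6 in auto)
  have P: "\<exists>p. L2_into {0<..<T} (sobolev 1 \<Omega>) (H1_norm \<Omega>) p \<and>
      (AE t in lebesgue_on {0<..<T}. \<forall>v\<in>H10 \<Omega>. wt t v = L2_inner \<Omega> (p t) v)"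
    using 5 ae by blast
  have G: "\<exists>g. has_caputo_deriv (H10 \<Omega>) (H1_norm \<Omega>) T \<alpha> (\<lambda>t. L2_inner \<Omega> (w t)) (\<lambda>t. L2_inner \<Omega> (g t)) \<and>
      (\<forall>t\<in>{0<..<T}. g t \<in> L2 \<Omega>) \<and> L2_into {0<..<T} (L2 \<Omega>) (L2_norm \<Omega>) g \<and>
      (\<forall>v\<in>H10 \<Omega>. \<forall>t\<in>{0<..<T}. L2_inner \<Omega> (g t) v - grad_inner \<Omega> (laplacian \<Omega> (w t)) v = 0)"
    using 7 8 9 g(1) by (intro exI[of _ g]) blast
  show ?thesis
    unfolding H1_solution_def Let_def w_def[THEN fun_cong, symmetric] using 1 2 3 4 P G by blast
qed

text \<open>Since \<open>D(A\<^sup>3\<^sup>/\<^sup>4)\<close> is contained in \<open>H\<^sup>1\<^sub>0\<close>, functionals on \<open>H\<^sup>1\<^sub>0\<close> restrict.\<close>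

lemma u1_dual_dom_frac: "u1 \<in> dual (dom_frac \<Omega> lam e (3/4)) (frac_norm \<Omega> lam e (3/4))"
proof (rule Q.dual_cong)
  have b: "\<bar>u1 (e n)\<bar> \<le> 1 / sqrt c1 * (sqrt (lam n) * mode_size n)" for n
  proof -
    have "sqrt c1 * \<bar>u1 (e n)\<bar> \<le> sqrt (lam n) * mode_size n"
      using lam_ge lam_pos[of n] by (intro mult_mono) (auto simp: mode_size_def)
    then show ?thesis using lam_ge(1) by (simp add: field_simps)
  qed
  show "Q.dual_series (\<lambda>n. u1 (e n)) \<in> dual (dom_frac \<Omega> lam e (3/4)) (frac_norm \<Omega> lam e (3/4))"
    by (rule Q.dual_series_dual[OF summable_weighted_bound[OF b summable_R]]) simp
  show "Q.dual_series (\<lambda>n. u1 (e n)) v = u1 v" if "v \<in> dom_frac \<Omega> lam e (3/4)" for v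
    using H.dual_expand[OF u1_dual] that dom_frac_H10 by auto
qed

lemma solution_series_initial_conditions:
  assumes S: "solution_series \<Omega> lam e \<alpha> T u0 u1 u"
  shows "initial_conditions \<Omega> lam e T u0 u1 u"
proof -
  have u: "u t \<in> L2 \<Omega>" "cf (u t) n = u_mode n t" if "t \<in> {0..T}" for t n using S that by (auto simp: solution_series_iff)
  have t0: "0 \<in> {0..T}" using T by simp
  obtain K where K: "K \<ge> 0" "\<And>t n. t \<in> {0..T} \<Longrightarrow> \<bar>wt_mode n t\<bar> \<le> K * mode_size n"
    "\<And>s t n. s \<in> {0..T} \<Longrightarrow> t \<in> {0..T} \<Longrightarrow> \<bar>u_mode n s - u_mode n t\<bar> \<le> sqrt (lam n) * (K * mode_size n) * \<bar>s - t\<bar>"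
    using u_mode_lipschitz by blast
  have u1wt_mode: "u1 (e n) = sqrt (lam n) * wt_mode n 0" for n using sqrt_lam(1)[of n] by (simp add: wt_mode_0)
  have u1b: "\<bar>u1 (e n)\<bar> \<le> K * (sqrt (lam n) * mode_size n)" for n
    using K(2)[OF t0, of n] sqrt_lam(1)[of n] unfolding u1wt_mode by (simp add: abs_mult)
  show ?thesis unfolding initial_conditions_def
  proof
    show "eq_ae \<Omega> (u 0) u0" using eq_ae_cf[OF u(1)[OF t0] H10_L2[OF u0]] u(2)[OF t0] u_mode_0 by simp
    show "has_time_deriv (dual_norm (dom_frac \<Omega> lam e (3/4)) (frac_norm \<Omega> lam e (3/4))) (\<lambda>t. L2_inner \<Omega> (u t)) u1 0 {0..T}"
    proof (rule Q.D.has_time_derivI[where m = "\<lambda>n. K * (sqrt (lam n) * mode_size n)"])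
      show "L2_inner \<Omega> (u s) \<in> dual (dom_frac \<Omega> lam e (3/4)) (frac_norm \<Omega> lam e (3/4))" if "s \<in> {0..T}" for s
        by (rule Q.L2_dual[OF u(1)[OF that]])
      show "((\<lambda>s. cf (u s) n) has_real_derivative u1 (e n)) (at 0 within {0..T})" for n
      proof (rule has_field_derivative_transform_within[where d = 1])
        show "(u_mode n has_real_derivative u1 (e n)) (at 0 within {0..T})" using u_mode_deriv[OF t0, of n] by (simp add: u1wt_mode)
      qed (use t0 u(2) in auto)
      show "\<bar>cf (u s) n - cf (u 0) n\<bar> \<le> K * (sqrt (lam n) * mode_size n) * \<bar>s - 0\<bar>" if "s \<in> {0..T}" for s n
        using K(3)[OF that t0, of n] u(2)[OF that] u(2)[OF t0] by (simp add: mult_ac)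
      show "summable (\<lambda>n. 1 / lam n powr (3/2) * (K * (sqrt (lam n) * mode_size n))\<^sup>2)"
        by (rule summable_weighted_bound[OF _ summable_R, where k = K])
          (use K(1) mode_size_nonneg lam_pos in \<open>auto simp: less_imp_le abs_mult\<close>)
    qed (use u1b t0 u1_dual_dom_frac in auto)
  qed
qed

section \<open>Uniqueness of the solution\<close>

text \<open>For an arbitrary solution, all clauses of the definition are tested with \<open>v = e n\<close>. The value of \<open>w\<^sub>n'\<close> at \<open>0\<close> comes from the second initial condition
because derivatives are unique.\<close>

lemma solution_modes:
  assumes sol: "H1_solution \<Omega> lam e \<alpha> T v" and ic: "initial_conditions \<Omega> lam e T u0 u1 v"
  obtains y' q where "\<And>t. t \<in> {0..T} \<Longrightarrow> ((\<lambda>t. cf (v t) n / sqrt (lam n)) has_real_derivative y' t) (at t within {0..T})"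
    "integrable (lebesgue_on {0..T}) q"
    "\<And>t. t \<in> {0..T} \<Longrightarrow> y' t = u1 (e n) / sqrt (lam n) + (LINT \<tau>|lebesgue_on {0..t}. q \<tau>)"
    "\<And>t. t \<in> {0<..<T} \<Longrightarrow> integrable (lebesgue_on {0<..<t}) (\<lambda>\<tau>. (t - \<tau>) powr (1 - \<alpha>) * q \<tau>)"
    "\<And>t. t \<in> {0<..<T} \<Longrightarrow> frac_integral (2 - \<alpha>) q t = - lam n * (cf (v t) n / sqrt (lam n))"
    "cf (v 0) n = cf u0 n"
proof -
  let ?D = "dual (H10 \<Omega>) (H1_norm \<Omega>)" and ?DN = "dual_norm (H10 \<Omega>) (H1_norm \<Omega>)"
  define w where "w = (\<lambda>t. frac_power \<Omega> lam e (-1/2) (v t))"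
  have t0: "0 \<in> {0..T}" using T by simp
  have vH: "v t \<in> H10 \<Omega>" if "t \<in> {0..T}" for t using sol that by (auto simp: H1_solution_def cont_into_def)
  have vL: "v t \<in> L2 \<Omega>" if "t \<in> {0..T}" for t by (rule H10_L2[OF vH[OF that]])
  have w: "w t \<in> L2 \<Omega>" "cf (w t) n = cf (v t) n / sqrt (lam n)" if "t \<in> {0..T}" for t n
    unfolding w_def by (rule inverse_sqrt_spec[OF vL[OF that]])+
  obtain g where gc: "has_caputo_deriv (H10 \<Omega>) (H1_norm \<Omega>) T \<alpha> (\<lambda>t. L2_inner \<Omega> (w t)) (\<lambda>t. L2_inner \<Omega> (g t))"
    and ge: "\<And>v t. v \<in> H10 \<Omega> \<Longrightarrow> t \<in> {0<..<T} \<Longrightarrow> L2_inner \<Omega> (g t) v - grad_inner \<Omega> (laplacian \<Omega> (w t)) v = 0"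
    using sol unfolding H1_solution_def Let_def w_def by blast
  obtain f' f'' where f: "\<And>t. t \<in> {0..T} \<Longrightarrow> f' t \<in> ?D"
      "\<And>t. t \<in> {0..T} \<Longrightarrow> has_time_deriv ?DN (\<lambda>t. L2_inner \<Omega> (w t)) (f' t) t {0..T}"
      "bochner_integrable {0..T} ?D ?DN f''"
      "\<And>t v. t \<in> {0..T} \<Longrightarrow> v \<in> H10 \<Omega> \<Longrightarrow> f' t v = f' 0 v + (LINT \<tau>|lebesgue_on {0..t}. f'' \<tau> v)"
      "\<And>t. t \<in> {0<..<T} \<Longrightarrow> bochner_integrable {0<..<t} ?D ?DN (\<lambda>\<tau> v. (t - \<tau>) powr (1 - \<alpha>) * f'' \<tau> v)"
      "\<And>t v. t \<in> {0<..<T} \<Longrightarrow> v \<in> H10 \<Omega> \<Longrightarrow> L2_inner \<Omega> (g t) v = frac_integral (2 - \<alpha>) (\<lambda>\<tau>. f'' \<tau> v) t"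
    using gc unfolding has_caputo_deriv_def by blast
  have d: "((\<lambda>t. cf (v t) n / sqrt (lam n)) has_real_derivative f' t (e n)) (at t within {0..T})" if t: "t \<in> {0..T}" for t
  proof (rule has_field_derivative_transform_within[where d = 1])
    show "((\<lambda>t. cf (w t) n) has_real_derivative f' t (e n)) (at t within {0..T})"
      by (rule H.D.has_time_derivD[OF f(2)[OF t] H.L2_dual[OF w(1)] f(1)[OF t] t])
  qed (use t w(2) in auto)
  have 0: "f' 0 (e n) = u1 (e n) / sqrt (lam n)"
  proof -
    have h: "has_time_deriv (dual_norm (dom_frac \<Omega> lam e (3/4)) (frac_norm \<Omega> lam e (3/4))) (\<lambda>t. L2_inner \<Omega> (v t)) u1 0 {0..T}"
      using ic by (simp add: initial_conditions_def)
    have "((\<lambda>t. cf (v t) n) has_real_derivative u1 (e n)) (at 0 within {0..T})"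
      by (rule Q.D.has_time_derivD[where f = "\<lambda>t. L2_inner \<Omega> (v t)", OF h Q.L2_dual[OF vL] u1_dual_dom_frac t0])
    from DERIV_cdivide[OF this, of "sqrt (lam n)"]
    have "((\<lambda>t. cf (v t) n / sqrt (lam n)) has_real_derivative u1 (e n) / sqrt (lam n)) (at 0 within {0..T})" .
    moreover have "at 0 within {0..T} \<noteq> bot" using T by (simp add: trivial_limit_within islimpt_Icc)
    ultimately show ?thesis using d[OF t0] has_field_derivative_unique by blast
  qed
  show thesis
  proof (rule that[OF d])
    show "integrable (lebesgue_on {0..T}) (\<lambda>\<tau>. f'' \<tau> (e n))" by (rule H.D.coord_integrable[OF f(3)]) simp
    show "f' t (e n) = u1 (e n) / sqrt (lam n) + (LINT \<tau>|lebesgue_on {0..t}. f'' \<tau> (e n))" if "t \<in> {0..T}" for t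
      using f(4)[OF that e_H10, of n] 0 by simp
    show "integrable (lebesgue_on {0<..<t}) (\<lambda>\<tau>. (t - \<tau>) powr (1 - \<alpha>) * f'' \<tau> (e n))" if "t \<in> {0<..<T}" for t
      by (rule H.D.coord_integrable[OF f(5)[OF that]]) simp
    show "frac_integral (2 - \<alpha>) (\<lambda>\<tau>. f'' \<tau> (e n)) t = - lam n * (cf (v t) n / sqrt (lam n))" if t: "t \<in> {0<..<T}" for t
    proof -
      have t': "t \<in> {0..T}" using t by simp
      have "(\<lambda>k. - sqrt (lam k) * cf (v t) k * cf (e n) k) sums grad_inner \<Omega> (laplacian \<Omega> (w t)) (e n)"
        by (rule grad_laplacian_inverse[OF vH[OF t'] w(1)[OF t'] w(2)[OF t'] e_H10])
      moreover have "(\<lambda>k. - sqrt (lam k) * cf (v t) k * cf (e n) k) = (\<lambda>k. if k = n then - sqrt (lam k) * cf (v t) k else 0)"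
        by (auto simp: orthonormal)
      ultimately have "(\<lambda>k. if k = n then - sqrt (lam k) * cf (v t) k else 0) sums grad_inner \<Omega> (laplacian \<Omega> (w t)) (e n)" by simp
      from sums_unique2[OF this sums_single] have "grad_inner \<Omega> (laplacian \<Omega> (w t)) (e n) = - sqrt (lam n) * cf (v t) n" .
      moreover have "- lam n * (cf (v t) n / sqrt (lam n)) = - sqrt (lam n) * cf (v t) n"
        using sqrt_lam(1)[of n] sqrt_lam(2)[of n, symmetric] by (simp add: field_simps)
      ultimately show ?thesis using f(6)[OF t e_H10] ge[OF e_H10 t] by simp
    qed
    show "cf (v 0) n = cf u0 n" using ic eq_ae_cf[OF vL[OF t0] H10_L2[OF u0]] by (simp add: initial_conditions_def)
  qed
qed

lemma solution_unique:
  assumes v: "H1_solution \<Omega> lam e \<alpha> T v" "initial_conditions \<Omega> lam e T u0 u1 v"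
    and u: "H1_solution \<Omega> lam e \<alpha> T u" "initial_conditions \<Omega> lam e T u0 u1 u" and t: "t \<in> {0..T}"
  shows "eq_ae \<Omega> (v t) (u t)"
proof -
  have "cf (v t) n = cf (u t) n" for n
  proof -
    obtain y1 q1 where 1: "\<And>t. t \<in> {0..T} \<Longrightarrow> ((\<lambda>t. cf (v t) n / sqrt (lam n)) has_real_derivative y1 t) (at t within {0..T})"
      "integrable (lebesgue_on {0..T}) q1"
      "\<And>t. t \<in> {0..T} \<Longrightarrow> y1 t = u1 (e n) / sqrt (lam n) + (LINT \<tau>|lebesgue_on {0..t}. q1 \<tau>)"
      "\<And>t. t \<in> {0<..<T} \<Longrightarrow> integrable (lebesgue_on {0<..<t}) (\<lambda>\<tau>. (t - \<tau>) powr (1 - \<alpha>) * q1 \<tau>)"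
      "\<And>t. t \<in> {0<..<T} \<Longrightarrow> frac_integral (2 - \<alpha>) q1 t = - lam n * (cf (v t) n / sqrt (lam n))" "cf (v 0) n = cf u0 n"
      by (rule solution_modes[OF v, of n]) blast
    obtain y2 q2 where 2: "\<And>t. t \<in> {0..T} \<Longrightarrow> ((\<lambda>t. cf (u t) n / sqrt (lam n)) has_real_derivative y2 t) (at t within {0..T})"
      "integrable (lebesgue_on {0..T}) q2"
      "\<And>t. t \<in> {0..T} \<Longrightarrow> y2 t = u1 (e n) / sqrt (lam n) + (LINT \<tau>|lebesgue_on {0..t}. q2 \<tau>)"
      "\<And>t. t \<in> {0<..<T} \<Longrightarrow> integrable (lebesgue_on {0<..<t}) (\<lambda>\<tau>. (t - \<tau>) powr (1 - \<alpha>) * q2 \<tau>)"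
      "\<And>t. t \<in> {0<..<T} \<Longrightarrow> frac_integral (2 - \<alpha>) q2 t = - lam n * (cf (u t) n / sqrt (lam n))" "cf (u 0) n = cf u0 n"
      by (rule solution_modes[OF u, of n]) blast
    have "cf (v t) n / sqrt (lam n) - cf (u t) n / sqrt (lam n) = 0"
    proof (rule fractional_ode_zero[where \<alpha> = \<alpha> and T = T and z' = "\<lambda>t. y1 t - y2 t" and q = "\<lambda>\<tau>. q1 \<tau> - q2 \<tau>" and lam = "lam n"
          and z = "\<lambda>t. cf (v t) n / sqrt (lam n) - cf (u t) n / sqrt (lam n)"])
      show "((\<lambda>t. cf (v t) n / sqrt (lam n) - cf (u t) n / sqrt (lam n)) has_real_derivative y1 t - y2 t) (at t within {0..T})"
        if "t \<in> {0..T}" for t by (intro DERIV_diff 1(1) 2(1) that)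
      show "y1 t - y2 t = (LINT \<tau>|lebesgue_on {0..t}. q1 \<tau> - q2 \<tau>)" if t: "t \<in> {0..T}" for t
      proof -
        have "integrable (lebesgue_on {0..t}) q1" "integrable (lebesgue_on {0..t}) q2"
          using t by (auto intro: integrable_subinterval[OF 1(2)] integrable_subinterval[OF 2(2)])
        then show ?thesis using 1(3)[OF t] 2(3)[OF t] by simp
      qed
      show "frac_integral (2 - \<alpha>) (\<lambda>\<tau>. q1 \<tau> - q2 \<tau>) t = - lam n * (cf (v t) n / sqrt (lam n) - cf (u t) n / sqrt (lam n))"
        if t: "t \<in> {0<..<T}" for t
      proof -
        have "(LINT \<tau>|lebesgue_on {0<..<t}. (t - \<tau>) powr (2 - \<alpha> - 1) * (q1 \<tau> - q2 \<tau>))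
            = (LINT \<tau>|lebesgue_on {0<..<t}. (t - \<tau>) powr (1 - \<alpha>) * q1 \<tau> - (t - \<tau>) powr (1 - \<alpha>) * q2 \<tau>)"
          by (simp add: right_diff_distrib)
        also have "\<dots> = (LINT \<tau>|lebesgue_on {0<..<t}. (t - \<tau>) powr (1 - \<alpha>) * q1 \<tau>) - (LINT \<tau>|lebesgue_on {0<..<t}. (t - \<tau>) powr (1 - \<alpha>) * q2 \<tau>)"
          by (rule Bochner_Integration.integral_diff[OF 1(4)[OF t] 2(4)[OF t]])
        finally have "frac_integral (2 - \<alpha>) (\<lambda>\<tau>. q1 \<tau> - q2 \<tau>) t = frac_integral (2 - \<alpha>) q1 t - frac_integral (2 - \<alpha>) q2 t"
          by (simp add: frac_integral_def right_diff_distrib)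
        then show ?thesis unfolding 1(5)[OF t] 2(5)[OF t] by (simp add: right_diff_distrib)
      qed
    qed (use alpha T t 1 2 in auto)
    then show ?thesis using sqrt_lam(1)[of n] by simp
  qed
  moreover have "v t \<in> L2 \<Omega>" "u t \<in> L2 \<Omega>" using u(1) v(1) t H10_L2 by (auto simp: H1_solution_def cont_into_def)
  ultimately show ?thesis by (simp add: eq_ae_cf)
qed

end

theorem theorem1p1:
  fixes \<Omega> :: "'a::euclidean_space set"
    and lam :: "nat \<Rightarrow> real" and e :: "nat \<Rightarrow> 'a \<Rightarrow> real"
    and \<alpha> T :: real
    and u0 :: "'a \<Rightarrow> real" and u1 :: "('a \<Rightarrow> real) \<Rightarrow> real"
  assumes "open \<Omega>" and "bounded \<Omega>" and "C_k_boundary 4 \<Omega>"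
    and "positive_selfadjoint \<Omega> (dom_A \<Omega>) (bilaplacian \<Omega>)"
    and "eigensystem \<Omega> (dom_A \<Omega>) (bilaplacian \<Omega>) lam e"
    and "1 < \<alpha>" and "\<alpha> < 2" and "0 < T"
    and "u0 \<in> H10 \<Omega>" and "u1 \<in> Hm1 \<Omega>"
  shows "(\<exists>u. solution_series \<Omega> lam e \<alpha> T u0 u1 u) \<and>
    (\<forall>u. solution_series \<Omega> lam e \<alpha> T u0 u1 u \<longrightarrow>
       H1_solution \<Omega> lam e \<alpha> T u \<and> initial_conditions \<Omega> lam e T u0 u1 u \<and>
       (\<forall>v. H1_solution \<Omega> lam e \<alpha> T v \<and> initial_conditions \<Omega> lam e T u0 u1 v \<longrightarrow>
          (\<forall>t\<in>{0..T}. eq_ae \<Omega> (v t) (u t))))"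
proof -
  obtain c1 where "eigen_domain \<Omega> e lam c1"
    using eigen_domain_of_hypotheses assms(1,2,4,5) by blast
  then interpret wave_problem \<Omega> e lam c1 \<alpha> T u0 u1
    by (intro wave_problem.intro wave_problem_axioms.intro) (use assms in auto)
  show ?thesis
    using solution_series_exists solution_series_H1_solution solution_series_initial_conditions solution_unique by blast
qed

end
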